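(* Let $R$ be a Gorenstein local ring and let $M$ be a $2$-periodic $R$-module. Assume $M$ is generically free and $[M]=0$ in $\overline{G}(R)_{\mathbb{Q}}$. If $M\otimes_R M^{\ast}$ is torsion-free, then $M$ is free.
   Context: All rings are commutative Noetherian local rings, and all modules are finitely generated. $M^{\ast}=\operatorname{Hom}_R(M,R)$. $M$ is generically free if $M_{\mathfrak{p}}$ is a free $R_{\mathfrak{p}}$-module for all $\mathfrak{p}\in\operatorname{Ass}(R)$. $\Omega^n_R M$ denotes the $n$th syzygy in a minimal free resolution of $M$. $M$ is $n$-periodic if $M\oplus F\cong\Omega^n_R M\oplus G$ for some (finitely generated) free $R$-modules $F$ and $G$. $G(R)$ is the Grothendieck group of the category of (finitely generated) $R$-modules: the free abelian group on isomorphism classes $[X]$ of $R$-modules modulo the relations $[X]-[X']-[X'']$ for all short exact sequences $0\to X'\to X\to X''\to 0$. $\overline{G}(R)_{\mathbb{Q}}=(G(R)/\mathbb{Z}\cdot[R])\otimes_{\mathbb{Z}}\mathbb{Q}$, and $[X]$ also denotes the class of $X$ in it. A module $X$ is torsion-free if every non zero-divisor of $R$ is a non zero-divisor on $X$. *)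

theory Defs
  imports
    "HOL-Algebra.Module"
    "HOL-Algebra.IntRing"
    "HOL-Algebra.Ring_Divisibility"
    "HOL-Algebra.Free_Abelian_Groups"
begin

text \<open>
  Modules are the records of \<^theory>\<open>HOL-Algebra.Module\<close>, whose inherited fields
  \<open>mult\<close> and \<open>one\<close> carry no meaning for a module; they are left \<open>undefined\<close> below.

  Quantification over ``all'' modules over a ring with elements of type \<open>'a\<close> is rendered by
  quantification over the following type of records. Every finitely generated module is isomorphic
  to a quotient of some \<open>R\<^sup>n\<close>, whose elements are cosets, i.e. sets of functions
  \<open>nat \<Rightarrow> 'a\<close>; so every finitely generated module has an isomorphic copy in this type.
\<close>

type_synonym 'a umodule = "('a, (nat \<Rightarrow> 'a) set) module"


section \<open>Homomorphisms, submodules, finite generation\<close>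

definition mod_hom ::
    "('a, 'm) ring_scheme \<Rightarrow> ('a, 'b, 'n) module_scheme \<Rightarrow> ('a, 'c, 'k) module_scheme \<Rightarrow> ('b \<Rightarrow> 'c) set"
  where "mod_hom R M N =
    {f \<in> hom (add_monoid M) (add_monoid N).
       \<forall>a\<in>carrier R. \<forall>x\<in>carrier M. f (a \<odot>\<^bsub>M\<^esub> x) = a \<odot>\<^bsub>N\<^esub> f x}"

definition mod_iso ::
    "('a, 'm) ring_scheme \<Rightarrow> ('a, 'b, 'n) module_scheme \<Rightarrow> ('a, 'c, 'k) module_scheme \<Rightarrow> bool"
  where "mod_iso R M N \<longleftrightarrow> (\<exists>f\<in>mod_hom R M N. bij_betw f (carrier M) (carrier N))"

definition mod_span ::
    "('a, 'm) ring_scheme \<Rightarrow> ('a, 'b, 'n) module_scheme \<Rightarrow> 'b set \<Rightarrow> 'b set"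
  where "mod_span R M A = \<Inter>{H. submodule H R M \<and> A \<subseteq> H}"

definition fg_module :: "('a, 'm) ring_scheme \<Rightarrow> ('a, 'b, 'n) module_scheme \<Rightarrow> bool"
  where "fg_module R M \<longleftrightarrow>
    module R M \<and> (\<exists>A. finite A \<and> A \<subseteq> carrier M \<and> mod_span R M A = carrier M)"

definition ideal_smult ::
    "('a, 'm) ring_scheme \<Rightarrow> 'a set \<Rightarrow> ('a, 'b, 'n) module_scheme \<Rightarrow> 'b set"
  where "ideal_smult R I M = mod_span R M {a \<odot>\<^bsub>M\<^esub> x | a x. a \<in> I \<and> x \<in> carrier M}"


section \<open>Constructions of modules\<close>

definition self_module :: "('a, 'm) ring_scheme \<Rightarrow> ('a, 'a) module"
  where "self_module R =
    \<lparr>carrier = carrier R, monoid.mult = monoid.mult R, one = \<one>\<^bsub>R\<^esub>,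
     ring.zero = \<zero>\<^bsub>R\<^esub>, add = add R, smult = monoid.mult R\<rparr>"

text \<open>The free module on a set \<open>X\<close>: finitely supported functions \<open>X \<rightarrow> R\<close>.\<close>

definition free_on :: "('a, 'm) ring_scheme \<Rightarrow> 'x set \<Rightarrow> ('a, 'x \<Rightarrow> 'a) module"
  where "free_on R X =
    \<lparr>carrier = {f \<in> X \<rightarrow>\<^sub>E carrier R. finite {x \<in> X. f x \<noteq> \<zero>\<^bsub>R\<^esub>}},
     monoid.mult = undefined, one = undefined,
     ring.zero = (\<lambda>x\<in>X. \<zero>\<^bsub>R\<^esub>),
     add = (\<lambda>f g. \<lambda>x\<in>X. f x \<oplus>\<^bsub>R\<^esub> g x),
     smult = (\<lambda>a f. \<lambda>x\<in>X. a \<otimes>\<^bsub>R\<^esub> f x)\<rparr>"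

definition basis_elt :: "('a, 'm) ring_scheme \<Rightarrow> 'x set \<Rightarrow> 'x \<Rightarrow> ('x \<Rightarrow> 'a)"
  where "basis_elt R X x = (\<lambda>y\<in>X. if y = x then \<one>\<^bsub>R\<^esub> else \<zero>\<^bsub>R\<^esub>)"

abbreviation rpow :: "('a, 'm) ring_scheme \<Rightarrow> nat \<Rightarrow> ('a, nat \<Rightarrow> 'a) module"
  where "rpow R n \<equiv> free_on R {..<n}"

text \<open>Only used for finitely generated modules, for which a basis is finite.\<close>

definition free_module :: "('a, 'm) ring_scheme \<Rightarrow> ('a, 'b, 'n) module_scheme \<Rightarrow> bool"
  where "free_module R M \<longleftrightarrow> (\<exists>n. mod_iso R (rpow R n) M)"

definition direct_sum ::
    "('a, 'b, 'n) module_scheme \<Rightarrow> ('a, 'c, 'k) module_scheme \<Rightarrow> ('a, 'b \<times> 'c) module"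
  where "direct_sum M N =
    \<lparr>carrier = carrier M \<times> carrier N, monoid.mult = undefined, one = undefined,
     ring.zero = (\<zero>\<^bsub>M\<^esub>, \<zero>\<^bsub>N\<^esub>),
     add = (\<lambda>(x, y) (x', y'). (x \<oplus>\<^bsub>M\<^esub> x', y \<oplus>\<^bsub>N\<^esub> y')),
     smult = (\<lambda>a (x, y). (a \<odot>\<^bsub>M\<^esub> x, a \<odot>\<^bsub>N\<^esub> y))\<rparr>"

definition quot_module ::
    "('a, 'b, 'n) module_scheme \<Rightarrow> 'b set \<Rightarrow> ('a, 'b set) module"
  where "quot_module M N =
    \<lparr>carrier = a_rcosets\<^bsub>M\<^esub> N, monoid.mult = undefined, one = undefined,
     ring.zero = N,
     add = (\<lambda>X Y. X <+>\<^bsub>M\<^esub> Y),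
     smult = (\<lambda>a X. \<Union>x\<in>X. N +>\<^bsub>M\<^esub> (a \<odot>\<^bsub>M\<^esub> x))\<rparr>"

text \<open>Homomorphisms are made extensional, so that equality in \<open>Hom(M, N)\<close> is equality on \<open>M\<close>.\<close>

definition hom_module ::
    "('a, 'm) ring_scheme \<Rightarrow> ('a, 'b, 'n) module_scheme \<Rightarrow> ('a, 'c, 'k) module_scheme
      \<Rightarrow> ('a, 'b \<Rightarrow> 'c) module"
  where "hom_module R M N =
    \<lparr>carrier = mod_hom R M N \<inter> extensional (carrier M),
     monoid.mult = undefined, one = undefined,
     ring.zero = (\<lambda>x\<in>carrier M. \<zero>\<^bsub>N\<^esub>),
     add = (\<lambda>f g. \<lambda>x\<in>carrier M. f x \<oplus>\<^bsub>N\<^esub> g x),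
     smult = (\<lambda>a f. \<lambda>x\<in>carrier M. a \<odot>\<^bsub>N\<^esub> f x)\<rparr>"

definition dual_module ::
    "('a, 'm) ring_scheme \<Rightarrow> ('a, 'b, 'n) module_scheme \<Rightarrow> ('a, 'b \<Rightarrow> 'a) module"
  where "dual_module R M = hom_module R M (self_module R)"

definition tensor_rels ::
    "('a, 'm) ring_scheme \<Rightarrow> ('a, 'b, 'n) module_scheme \<Rightarrow> ('a, 'c, 'k) module_scheme
      \<Rightarrow> ('b \<times> 'c \<Rightarrow> 'a) set"
  where "tensor_rels R M N =
    (let F = free_on R (carrier M \<times> carrier N);
         e = (\<lambda>x y. basis_elt R (carrier M \<times> carrier N) (x, y))
     in {e (x \<oplus>\<^bsub>M\<^esub> x') y \<ominus>\<^bsub>F\<^esub> (e x y \<oplus>\<^bsub>F\<^esub> e x' y) | x x' y.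
           x \<in> carrier M \<and> x' \<in> carrier M \<and> y \<in> carrier N}
      \<union> {e x (y \<oplus>\<^bsub>N\<^esub> y') \<ominus>\<^bsub>F\<^esub> (e x y \<oplus>\<^bsub>F\<^esub> e x y') | x y y'.
           x \<in> carrier M \<and> y \<in> carrier N \<and> y' \<in> carrier N}
      \<union> {e (a \<odot>\<^bsub>M\<^esub> x) y \<ominus>\<^bsub>F\<^esub> a \<odot>\<^bsub>F\<^esub> e x y | a x y.
           a \<in> carrier R \<and> x \<in> carrier M \<and> y \<in> carrier N}
      \<union> {e x (a \<odot>\<^bsub>N\<^esub> y) \<ominus>\<^bsub>F\<^esub> a \<odot>\<^bsub>F\<^esub> e x y | a x y.
           a \<in> carrier R \<and> x \<in> carrier M \<and> y \<in> carrier N})"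

definition tensor_sub ::
    "('a, 'm) ring_scheme \<Rightarrow> ('a, 'b, 'n) module_scheme \<Rightarrow> ('a, 'c, 'k) module_scheme
      \<Rightarrow> ('b \<times> 'c \<Rightarrow> 'a) set"
  where "tensor_sub R M N =
    mod_span R (free_on R (carrier M \<times> carrier N)) (tensor_rels R M N)"

definition tensor ::
    "('a, 'm) ring_scheme \<Rightarrow> ('a, 'b, 'n) module_scheme \<Rightarrow> ('a, 'c, 'k) module_scheme
      \<Rightarrow> ('a, ('b \<times> 'c \<Rightarrow> 'a) set) module"
  where "tensor R M N =
    quot_module (free_on R (carrier M \<times> carrier N)) (tensor_sub R M N)"

definition pure_tensor ::
    "('a, 'm) ring_scheme \<Rightarrow> ('a, 'b, 'n) module_scheme \<Rightarrow> ('a, 'c, 'k) module_scheme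
      \<Rightarrow> 'b \<Rightarrow> 'c \<Rightarrow> ('b \<times> 'c \<Rightarrow> 'a) set"
  where "pure_tensor R M N x y =
    tensor_sub R M N +>\<^bsub>free_on R (carrier M \<times> carrier N)\<^esub>
      basis_elt R (carrier M \<times> carrier N) (x, y)"

definition torsion_free :: "('a, 'm) ring_scheme \<Rightarrow> ('a, 'b, 'n) module_scheme \<Rightarrow> bool"
  where "torsion_free R M \<longleftrightarrow>
    (\<forall>a\<in>carrier R. (\<forall>b\<in>carrier R. a \<otimes>\<^bsub>R\<^esub> b = \<zero>\<^bsub>R\<^esub> \<longrightarrow> b = \<zero>\<^bsub>R\<^esub>) \<longrightarrow>
       (\<forall>x\<in>carrier M. a \<odot>\<^bsub>M\<^esub> x = \<zero>\<^bsub>M\<^esub> \<longrightarrow> x = \<zero>\<^bsub>M\<^esub>))"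


section \<open>Localization and generic freeness\<close>

text \<open>The fraction \<open>x / s\<close>, as the set of all pairs representing it.\<close>

definition fraction ::
    "('a, 'm) ring_scheme \<Rightarrow> 'a set \<Rightarrow> ('a, 'b, 'n) module_scheme \<Rightarrow> 'b \<Rightarrow> 'a \<Rightarrow> ('b \<times> 'a) set"
  where "fraction R S M x s =
    {(y, t). y \<in> carrier M \<and> t \<in> S \<and>
       (\<exists>u\<in>S. u \<odot>\<^bsub>M\<^esub> (t \<odot>\<^bsub>M\<^esub> x) = u \<odot>\<^bsub>M\<^esub> (s \<odot>\<^bsub>M\<^esub> y))}"

text \<open>
  In the two unions all members are the same fraction, since the operations do not depend on the
  chosen representatives.
\<close>

definition loc_module ::
    "('a, 'm) ring_scheme \<Rightarrow> 'a set \<Rightarrow> ('a, 'b, 'n) module_scheme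
      \<Rightarrow> (('a \<times> 'a) set, ('b \<times> 'a) set) module"
  where "loc_module R S M =
    \<lparr>carrier = {fraction R S M x s | x s. x \<in> carrier M \<and> s \<in> S},
     monoid.mult = undefined, one = undefined,
     ring.zero = fraction R S M \<zero>\<^bsub>M\<^esub> \<one>\<^bsub>R\<^esub>,
     add = (\<lambda>X Y. \<Union>(x, s)\<in>X. \<Union>(y, t)\<in>Y.
              fraction R S M (t \<odot>\<^bsub>M\<^esub> x \<oplus>\<^bsub>M\<^esub> s \<odot>\<^bsub>M\<^esub> y) (s \<otimes>\<^bsub>R\<^esub> t)),
     smult = (\<lambda>A X. \<Union>(a, s)\<in>A. \<Union>(x, t)\<in>X. fraction R S M (a \<odot>\<^bsub>M\<^esub> x) (s \<otimes>\<^bsub>R\<^esub> t))\<rparr>"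

definition loc_ring :: "('a, 'm) ring_scheme \<Rightarrow> 'a set \<Rightarrow> ('a \<times> 'a) set ring"
  where "loc_ring R S =
    (let L = loc_module R S (self_module R)
     in \<lparr>carrier = carrier L, monoid.mult = smult L, one = fraction R S (self_module R) \<one>\<^bsub>R\<^esub> \<one>\<^bsub>R\<^esub>,
         ring.zero = ring.zero L, add = add L\<rparr>)"

definition Ass :: "('a, 'm) ring_scheme \<Rightarrow> ('a, 'b, 'n) module_scheme \<Rightarrow> 'a set set"
  where "Ass R M =
    {p. primeideal p R \<and> (\<exists>x\<in>carrier M. p = {a \<in> carrier R. a \<odot>\<^bsub>M\<^esub> x = \<zero>\<^bsub>M\<^esub>})}"

definition generically_free :: "('a, 'm) ring_scheme \<Rightarrow> ('a, 'b, 'n) module_scheme \<Rightarrow> bool"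
  where "generically_free R M \<longleftrightarrow>
    (\<forall>p\<in>Ass R (self_module R).
       free_module (loc_ring R (carrier R - p)) (loc_module R (carrier R - p) M))"


section \<open>Gorenstein local rings\<close>

definition noetherian_local_ring :: "('a, 'm) ring_scheme \<Rightarrow> bool"
  where "noetherian_local_ring R \<longleftrightarrow> cring R \<and> noetherian_ring R \<and> (\<exists>!m. maximalideal m R)"

definition max_ideal :: "('a, 'm) ring_scheme \<Rightarrow> 'a set"
  where "max_ideal R = (THE m. maximalideal m R)"

text \<open>
  Test modules \<open>A\<close>, \<open>B\<close> range over the type \<open>'a umodule\<close>. As this contains copies of
  \<open>R\<close> and its ideals, Baer's criterion shows that extension for modules of arbitrary type follows.
\<close>

definition injective_module :: "('a, 'm) ring_scheme \<Rightarrow> ('a, 'b, 'n) module_scheme \<Rightarrow> bool"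
  where "injective_module R E \<longleftrightarrow> module R E \<and>
    (\<forall>(A :: 'a umodule) (B :: 'a umodule). module R A \<longrightarrow> module R B \<longrightarrow>
       (\<forall>i\<in>mod_hom R A B. \<forall>g\<in>mod_hom R A E. inj_on i (carrier A) \<longrightarrow>
          (\<exists>h\<in>mod_hom R B E. \<forall>x\<in>carrier A. h (i x) = g x)))"

definition injective_resolution ::
    "('a, 'm) ring_scheme \<Rightarrow> ('a, 'b, 'n) module_scheme \<Rightarrow> (nat \<Rightarrow> ('a, 'c, 'k) module_scheme)
      \<Rightarrow> ('b \<Rightarrow> 'c) \<Rightarrow> (nat \<Rightarrow> 'c \<Rightarrow> 'c) \<Rightarrow> bool"
  where "injective_resolution R N E \<eta> d \<longleftrightarrow>
    (\<forall>i. injective_module R (E i)) \<and>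
    \<eta> \<in> mod_hom R N (E 0) \<and> inj_on \<eta> (carrier N) \<and>
    (\<forall>i. d i \<in> mod_hom R (E i) (E (Suc i))) \<and>
    \<eta> ` carrier N = a_kernel (E 0) (E 1) (d 0) \<and>
    (\<forall>i. d i ` carrier (E i) = a_kernel (E (Suc i)) (E (Suc (Suc i))) (d (Suc i)))"

text \<open>
  The terms of the resolution are taken in \<open>'a umodule\<close>. This is no restriction for a finitely
  generated module \<open>N\<close> over a nonzero ring: with \<open>\<kappa> = max(|R|, \<aleph>\<^sub>0)\<close>, the module
  \<open>N\<close> and each successive cokernel embed in injective modules \<open>Hom\<^sub>\<int>(R, D)\<close> with
  \<open>D\<close> divisible, which can be chosen of cardinality at most \<open>2\<^sup>\<kappa>\<close>, and the type
  \<open>(nat \<Rightarrow> 'a) set\<close> has at least that many elements.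
\<close>

definition finite_injdim :: "('a, 'm) ring_scheme \<Rightarrow> ('a, 'b, 'n) module_scheme \<Rightarrow> bool"
  where "finite_injdim R N \<longleftrightarrow>
    (\<exists>(E :: nat \<Rightarrow> 'a umodule) \<eta> d. injective_resolution R N E \<eta> d \<and>
       (\<exists>n. \<forall>i>n. carrier (E i) = {\<zero>\<^bsub>E i\<^esub>}))"

definition gorenstein_local_ring :: "('a, 'm) ring_scheme \<Rightarrow> bool"
  where "gorenstein_local_ring R \<longleftrightarrow>
    noetherian_local_ring R \<and> finite_injdim R (self_module R)"


section \<open>Syzygies and periodic modules\<close>

text \<open>\<open>\<dots> \<rightarrow> R\<^bsup>b 2\<^esup> \<rightarrow> R\<^bsup>b 1\<^esup> \<rightarrow> R\<^bsup>b 0\<^esup> \<rightarrow> M \<rightarrow> 0\<close>,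
  with \<open>d i\<close> the map from \<open>R\<^bsup>b (i+1)\<^esup>\<close> to \<open>R\<^bsup>b i\<^esup>\<close>.\<close>

definition minimal_free_resolution ::
    "('a, 'm) ring_scheme \<Rightarrow> ('a, 'b, 'n) module_scheme \<Rightarrow> (nat \<Rightarrow> nat)
      \<Rightarrow> ((nat \<Rightarrow> 'a) \<Rightarrow> 'b) \<Rightarrow> (nat \<Rightarrow> (nat \<Rightarrow> 'a) \<Rightarrow> (nat \<Rightarrow> 'a)) \<Rightarrow> bool"
  where "minimal_free_resolution R M b \<epsilon> d \<longleftrightarrow>
    \<epsilon> \<in> mod_hom R (rpow R (b 0)) M \<and>
    \<epsilon> ` carrier (rpow R (b 0)) = carrier M \<and>
    (\<forall>i. d i \<in> mod_hom R (rpow R (b (Suc i))) (rpow R (b i))) \<and>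
    d 0 ` carrier (rpow R (b 1)) = a_kernel (rpow R (b 0)) M \<epsilon> \<and>
    (\<forall>i. d (Suc i) ` carrier (rpow R (b (Suc (Suc i)))) =
           a_kernel (rpow R (b (Suc i))) (rpow R (b i)) (d i)) \<and>
    (\<forall>i. d i ` carrier (rpow R (b (Suc i))) \<subseteq> ideal_smult R (max_ideal R) (rpow R (b i)))"

text \<open>\<open>\<Omega>\<^sup>n M\<close>, for \<open>n \<ge> 1\<close>, computed from a resolution as above.\<close>

definition syzygy ::
    "('a, 'm) ring_scheme \<Rightarrow> (nat \<Rightarrow> nat) \<Rightarrow> (nat \<Rightarrow> (nat \<Rightarrow> 'a) \<Rightarrow> (nat \<Rightarrow> 'a)) \<Rightarrow> nat
      \<Rightarrow> ('a, nat \<Rightarrow> 'a) module"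
  where "syzygy R b d n =
    (rpow R (b (n - 1)))\<lparr>carrier := d (n - 1) ` carrier (rpow R (b n))\<rparr>"

text \<open>
  Minimal free resolutions exist and are unique up to isomorphism over a Noetherian local ring, so
  it does not matter which one is used.
\<close>

definition periodic_module ::
    "('a, 'm) ring_scheme \<Rightarrow> nat \<Rightarrow> ('a, 'b, 'n) module_scheme \<Rightarrow> bool"
  where "periodic_module R n M \<longleftrightarrow> n \<ge> 1 \<and>
    (\<exists>b \<epsilon> d. minimal_free_resolution R M b \<epsilon> d \<and>
       (\<exists>r s. mod_iso R (direct_sum M (rpow R r)) (direct_sum (syzygy R b d n) (rpow R s))))"


section \<open>The Grothendieck group\<close>

text \<open>
  The isomorphism class of a module \<open>X\<close> of any type, represented by the copies of \<open>X\<close> in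
  \<open>'a umodule\<close>.
\<close>

definition iso_class ::
    "('a, 'm) ring_scheme \<Rightarrow> ('a, 'b, 'n) module_scheme \<Rightarrow> 'a umodule set"
  where "iso_class R X = {Y. fg_module R Y \<and> mod_iso R X Y}"

definition iso_classes :: "('a, 'm) ring_scheme \<Rightarrow> 'a umodule set set"
  where "iso_classes R = {iso_class R X | X :: 'a umodule. fg_module R X}"

definition short_exact ::
    "('a, 'm) ring_scheme \<Rightarrow> ('a, 'b, 'n) module_scheme \<Rightarrow> ('a, 'c, 'k) module_scheme
      \<Rightarrow> ('a, 'd, 'l) module_scheme \<Rightarrow> bool"
  where "short_exact R X' X X'' \<longleftrightarrow>
    (\<exists>i\<in>mod_hom R X' X. \<exists>p\<in>mod_hom R X X''.
       inj_on i (carrier X') \<and> i ` carrier X' = a_kernel X X'' p \<and>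
       p ` carrier X = carrier X'')"

definition groth_rels :: "('a, 'm) ring_scheme \<Rightarrow> ('a umodule set \<Rightarrow>\<^sub>0 int) set"
  where "groth_rels R =
    generate (free_Abelian_group (iso_classes R))
      {frag_of (iso_class R X) - frag_of (iso_class R X') - frag_of (iso_class R X'')
        | (X :: 'a umodule) (X' :: 'a umodule) (X'' :: 'a umodule).
        fg_module R X \<and> fg_module R X' \<and> fg_module R X'' \<and> short_exact R X' X X''}"

definition groth_group :: "('a, 'm) ring_scheme \<Rightarrow> ('a umodule set \<Rightarrow>\<^sub>0 int) set monoid"
  where "groth_group R = free_Abelian_group (iso_classes R) Mod groth_rels R"

definition groth_class ::
    "('a, 'm) ring_scheme \<Rightarrow> ('a, 'b, 'n) module_scheme \<Rightarrow> ('a umodule set \<Rightarrow>\<^sub>0 int) set"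
  where "groth_class R X =
    groth_rels R #>\<^bsub>free_Abelian_group (iso_classes R)\<^esub> frag_of (iso_class R X)"

definition reduced_groth_sub ::
    "('a, 'm) ring_scheme \<Rightarrow> ('a umodule set \<Rightarrow>\<^sub>0 int) set set"
  where "reduced_groth_sub R = generate (groth_group R) {groth_class R (self_module R)}"

definition reduced_groth_group ::
    "('a, 'm) ring_scheme \<Rightarrow> ('a umodule set \<Rightarrow>\<^sub>0 int) set set monoid"
  where "reduced_groth_group R = groth_group R Mod reduced_groth_sub R"

definition reduced_groth_class ::
    "('a, 'm) ring_scheme \<Rightarrow> ('a, 'b, 'n) module_scheme \<Rightarrow> ('a umodule set \<Rightarrow>\<^sub>0 int) set set"
  where "reduced_groth_class R X =
    reduced_groth_sub R #>\<^bsub>groth_group R\<^esub> groth_class R X"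

text \<open>A (multiplicatively written) abelian group as a module over \<open>\<int>\<close>.\<close>

definition int_module :: "('g, 'n) monoid_scheme \<Rightarrow> (int, 'g) module"
  where "int_module G =
    \<lparr>carrier = carrier G, monoid.mult = undefined, one = undefined,
     ring.zero = \<one>\<^bsub>G\<^esub>, add = monoid.mult G, smult = (\<lambda>k x. x [^]\<^bsub>G\<^esub> k)\<rparr>"

definition rat_module :: "(int, rat) module"
  where "rat_module =
    \<lparr>carrier = UNIV, monoid.mult = undefined, one = undefined,
     ring.zero = 0, add = (+), smult = (\<lambda>k q. of_int k * q)\<rparr>"

definition reduced_groth_Q ::
    "('a, 'm) ring_scheme
      \<Rightarrow> (int, (('a umodule set \<Rightarrow>\<^sub>0 int) set set \<times> rat \<Rightarrow> int) set) module"
  where "reduced_groth_Q R = tensor \<Z> (int_module (reduced_groth_group R)) rat_module"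

definition reduced_groth_Q_class ::
    "('a, 'm) ring_scheme \<Rightarrow> ('a, 'b, 'n) module_scheme
      \<Rightarrow> (('a umodule set \<Rightarrow>\<^sub>0 int) set set \<times> rat \<Rightarrow> int) set"
  where "reduced_groth_Q_class R X =
    pure_tensor \<Z> (int_module (reduced_groth_group R)) rat_module (reduced_groth_class R X) 1"

end

theory Submission
  imports Defs
begin

text \<open>
  Write \<open>0\<close> and \<open>1\<close> for degrees modulo two. A two-periodic module \<open>M\<close> has a presentation by an exact
  complex of free modules with two alternating maps \<open>A : R\<^sup>n \<rightarrow> R\<^sup>m\<close> and \<open>B : R\<^sup>m \<rightarrow> R\<^sup>n\<close>, in which both
  the cokernel and the kernel of \<open>A\<close> are \<open>M \<oplus> R\<^sup>r\<close> (\<open>periodic_presentation_exists\<close>). The homomorphisms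
  from this complex to a module \<open>X\<close> have two cohomology modules \<open>H\<^sub>0(X)\<close> and \<open>H\<^sub>1(X)\<close>; they are the stable
  cohomology of \<open>M\<close>. The surjection \<open>q : R\<^sup>m \<rightarrow> M\<close> is a cocycle, and its class in \<open>H\<^sub>0(M)\<close> vanishes exactly
  if \<open>q = gB\<close> for some \<open>g\<close>. Then \<open>M\<close> is a direct summand of \<open>R\<^sup>n\<close>, its minimal presentation splits, and
  by Nakayama \<open>M\<close> is free (\<open>free_if_minimal_presentation_splits\<close>). So it suffices to show that the ideal
  \<open>I\<close> of all \<open>a\<close> that kill the class of \<open>q\<close> is the unit ideal.

  Three facts are combined. First, \<open>H\<^sub>0\<close> and \<open>H\<^sub>1\<close> vanish for injective coefficients, and there are only
  two degrees, so they vanish for every module with a finite injective resolution; as \<open>R\<close> is Gorenstein,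
  \<open>H\<^sub>0(R) = H\<^sub>1(R) = 0\<close> (\<open>finite_injdim_hvanish\<close>).

  Second, \<open>H\<^sub>1(M) = 0\<close> (\<open>cocycle_is_coboundary\<close>). A cocycle \<open>g : R\<^sup>n \<rightarrow> M\<close> gives the element
  \<open>\<Sum> g(e\<^sub>i) \<otimes> e\<^sub>i\<^sup>*j\<close> of \<open>M \<otimes> M\<^sup>*\<close>, where \<open>j : M \<rightarrow> R\<^sup>n\<close> is the inclusion of \<open>M\<close> into the kernel of \<open>A\<close>.
  It maps to \<open>gj = 0\<close> in \<open>Hom(M, M)\<close>, and since \<open>M\<close> is generically free it is torsion, hence zero. As
  \<open>H\<^sub>0(R) = H\<^sub>1(R) = 0\<close>, extending functionals along \<open>B\<close> gives a well-defined map from \<open>M \<otimes> M\<^sup>*\<close> to cochains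
  modulo coboundaries, which recovers the class of \<open>g\<close>.

  Third, let \<open>I\<close> be a proper ideal and \<open>p\<close> a minimal prime over it. For \<open>a \<in> I\<close> multiplication by \<open>a\<close> on
  the complex is null-homotopic (\<open>homotopy_from_factorization\<close>), so \<open>I\<close> kills \<open>H\<^sub>0(X)\<close> and \<open>H\<^sub>1(X)\<close>, and
  for finitely generated \<open>X\<close> these have finite length at \<open>p\<close>. The difference of the two lengths is
  additive on short exact sequences by the exact hexagon (\<open>htheta_additive\<close>), like the Herbrand quotient
  of a cyclic group, and it vanishes for \<open>R\<close>. So it defines a homomorphism from the reduced Grothendieck
  group to \<open>\<int>\<close>, which kills the torsion class \<open>[M]\<close> (\<open>vanishes_on_zero_class\<close>). As \<open>H\<^sub>1(M) = 0\<close>, the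
  length of \<open>H\<^sub>0(M)\<close> at \<open>p\<close> is zero too; thus some \<open>a \<notin> p\<close> kills the class of \<open>q\<close>, which contradicts
  \<open>I \<subseteq> p\<close>.

  Lengths at \<open>p\<close> are taken without localizing: they count the steps of a chain of submodules that
  remain strict at \<open>p\<close>.
\<close>

section \<open>Homomorphisms and submodules\<close>

lemma mod_homI:
  assumes "\<And>x. x \<in> carrier M \<Longrightarrow> f x \<in> carrier N"
    and "\<And>x y. x \<in> carrier M \<Longrightarrow> y \<in> carrier M \<Longrightarrow> f (x \<oplus>\<^bsub>M\<^esub> y) = f x \<oplus>\<^bsub>N\<^esub> f y"
    and "\<And>a x. a \<in> carrier R \<Longrightarrow> x \<in> carrier M \<Longrightarrow> f (a \<odot>\<^bsub>M\<^esub> x) = a \<odot>\<^bsub>N\<^esub> f x"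
  shows "f \<in> mod_hom R M N"
  using assms unfolding mod_hom_def hom_def by auto

lemma mod_hom_closed: "f \<in> mod_hom R M N \<Longrightarrow> x \<in> carrier M \<Longrightarrow> f x \<in> carrier N"
  unfolding mod_hom_def hom_def by auto

lemma mod_hom_add:
  "f \<in> mod_hom R M N \<Longrightarrow> x \<in> carrier M \<Longrightarrow> y \<in> carrier M \<Longrightarrow> f (x \<oplus>\<^bsub>M\<^esub> y) = f x \<oplus>\<^bsub>N\<^esub> f y"
  unfolding mod_hom_def hom_def by auto

lemma mod_hom_smult:
  "f \<in> mod_hom R M N \<Longrightarrow> a \<in> carrier R \<Longrightarrow> x \<in> carrier M \<Longrightarrow> f (a \<odot>\<^bsub>M\<^esub> x) = a \<odot>\<^bsub>N\<^esub> f x"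
  unfolding mod_hom_def by auto

lemma mod_hom_zero:
  assumes "module R M" "module R N" "f \<in> mod_hom R M N"
  shows "f \<zero>\<^bsub>M\<^esub> = \<zero>\<^bsub>N\<^esub>"
proof -
  interpret M: module R M by fact
  interpret N: module R N by fact
  have "f (\<zero>\<^bsub>R\<^esub> \<odot>\<^bsub>M\<^esub> \<zero>\<^bsub>M\<^esub>) = \<zero>\<^bsub>R\<^esub> \<odot>\<^bsub>N\<^esub> f \<zero>\<^bsub>M\<^esub>"
    using assms(3) by (rule mod_hom_smult) auto
  then show ?thesis using mod_hom_closed[OF assms(3)] by simp
qed

lemma mod_hom_neg:
  assumes "module R M" "module R N" "f \<in> mod_hom R M N" "x \<in> carrier M"
  shows "f (\<ominus>\<^bsub>M\<^esub> x) = \<ominus>\<^bsub>N\<^esub> f x"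
proof -
  interpret M: module R M by fact
  interpret N: module R N by fact
  have "f ((\<ominus>\<^bsub>R\<^esub> \<one>\<^bsub>R\<^esub>) \<odot>\<^bsub>M\<^esub> x) = (\<ominus>\<^bsub>R\<^esub> \<one>\<^bsub>R\<^esub>) \<odot>\<^bsub>N\<^esub> f x"
    using assms by (intro mod_hom_smult) auto
  then show ?thesis using mod_hom_closed[OF assms(3)] assms(4)
    by (simp add: M.smult_l_minus N.smult_l_minus)
qed

lemma mod_hom_diff:
  assumes "module R M" "module R N" "f \<in> mod_hom R M N" "x \<in> carrier M" "y \<in> carrier M"
  shows "f (x \<ominus>\<^bsub>M\<^esub> y) = f x \<ominus>\<^bsub>N\<^esub> f y"
proof -
  interpret M: module R M by fact
  show ?thesis unfolding a_minus_def
    using assms by (simp add: mod_hom_add mod_hom_neg)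
qed

lemma mod_hom_finsum:
  assumes "module R M" "module R N" "f \<in> mod_hom R M N" "finite T" "x \<in> T \<rightarrow> carrier M"
  shows "f (finsum M x T) = (\<Oplus>\<^bsub>N\<^esub>t\<in>T. f (x t))"
proof -
  interpret M: module R M by fact
  interpret N: module R N by fact
  show ?thesis using assms(4,5)
  proof (induction rule: finite_induct)
    case empty then show ?case using mod_hom_zero[OF assms(1-3)] by simp
  next
    case (insert t T)
    then have "f (finsum M x (insert t T)) = f (x t \<oplus>\<^bsub>M\<^esub> finsum M x T)"
      by (subst M.finsum_insert) auto
    also have "\<dots> = f (x t) \<oplus>\<^bsub>N\<^esub> f (finsum M x T)"
      using insert by (intro mod_hom_add[OF assms(3)]) auto
    also have "\<dots> = (\<Oplus>\<^bsub>N\<^esub>t\<in>insert t T. f (x t))"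
      using insert mod_hom_closed[OF assms(3)] by (subst N.finsum_insert) (auto simp: Pi_iff)
    finally show ?case .
  qed
qed

lemma mod_hom_id: "(\<lambda>x. x) \<in> mod_hom R M M"
  by (rule mod_homI) simp_all

lemma mod_hom_comp:
  "f \<in> mod_hom R M N \<Longrightarrow> g \<in> mod_hom R N P \<Longrightarrow> (\<lambda>x. g (f x)) \<in> mod_hom R M P"
  by (rule mod_homI) (auto simp: mod_hom_closed mod_hom_add mod_hom_smult)

lemma mod_hom_cong:
  assumes "module R M" "f \<in> mod_hom R M N" "\<And>x. x \<in> carrier M \<Longrightarrow> g x = f x"
  shows "g \<in> mod_hom R M N"
proof -
  interpret M: module R M by fact
  show ?thesis using assms(2,3)
    by (intro mod_homI) (auto simp: mod_hom_closed mod_hom_add mod_hom_smult)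
qed

lemma mod_hom_zero_fun: "module R N \<Longrightarrow> (\<lambda>x. \<zero>\<^bsub>N\<^esub>) \<in> mod_hom R M N"
proof -
  assume "module R N"
  then interpret N: module R N .
  show ?thesis by (rule mod_homI) auto
qed

lemma mod_hom_plus:
  assumes "module R N" "f \<in> mod_hom R M N" "g \<in> mod_hom R M N"
  shows "(\<lambda>x. f x \<oplus>\<^bsub>N\<^esub> g x) \<in> mod_hom R M N"
proof -
  interpret N: module R N by fact
  show ?thesis using assms(2,3)
    by (intro mod_homI)
      (simp_all add: mod_hom_closed mod_hom_add mod_hom_smult N.smult_r_distr N.M.add.m_ac)
qed

lemma mod_hom_scale:
  assumes "module R N" "f \<in> mod_hom R M N" "a \<in> carrier R"
  shows "(\<lambda>x. a \<odot>\<^bsub>N\<^esub> f x) \<in> mod_hom R M N"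
proof -
  interpret N: module R N by fact
  show ?thesis using assms(2,3)
    by (intro mod_homI)
      (auto simp: mod_hom_closed mod_hom_add mod_hom_smult N.smult_r_distr N.R.m_comm
        simp flip: N.smult_assoc1)
qed

lemma mod_hom_minus:
  assumes "module R M" "module R N" "f \<in> mod_hom R M N" "g \<in> mod_hom R M N"
  shows "(\<lambda>x. f x \<ominus>\<^bsub>N\<^esub> g x) \<in> mod_hom R M N"
proof -
  interpret N: module R N by fact
  have "(\<lambda>x. f x \<oplus>\<^bsub>N\<^esub> (\<ominus>\<^bsub>R\<^esub> \<one>\<^bsub>R\<^esub>) \<odot>\<^bsub>N\<^esub> g x) \<in> mod_hom R M N"
    by (intro mod_hom_plus mod_hom_scale assms) auto
  then show ?thesis
  proof (rule mod_hom_cong[OF assms(1)])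
    fix x assume "x \<in> carrier M"
    then show "f x \<ominus>\<^bsub>N\<^esub> g x = f x \<oplus>\<^bsub>N\<^esub> (\<ominus>\<^bsub>R\<^esub> \<one>\<^bsub>R\<^esub>) \<odot>\<^bsub>N\<^esub> g x"
      using mod_hom_closed[OF assms(4)] by (simp add: N.smult_l_minus a_minus_def)
  qed
qed

lemma (in module) submodule_iff:
  "submodule H R M \<longleftrightarrow> H \<subseteq> carrier M \<and> \<zero>\<^bsub>M\<^esub> \<in> H \<and> (\<forall>x\<in>H. \<forall>y\<in>H. x \<oplus>\<^bsub>M\<^esub> y \<in> H) \<and>
     (\<forall>a\<in>carrier R. \<forall>x\<in>H. a \<odot>\<^bsub>M\<^esub> x \<in> H)"
proof
  assume H: "submodule H R M"
  obtain x where "x \<in> H" using submoduleE(2)[OF H] by auto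
  then have "\<zero> \<odot>\<^bsub>M\<^esub> x \<in> H" using submoduleE(4)[OF H] by auto
  then have "\<zero>\<^bsub>M\<^esub> \<in> H" using \<open>x \<in> H\<close> submoduleE(1)[OF H] by auto
  then show "H \<subseteq> carrier M \<and> \<zero>\<^bsub>M\<^esub> \<in> H \<and> (\<forall>x\<in>H. \<forall>y\<in>H. x \<oplus>\<^bsub>M\<^esub> y \<in> H) \<and>
     (\<forall>a\<in>carrier R. \<forall>x\<in>H. a \<odot>\<^bsub>M\<^esub> x \<in> H)"
    using submoduleE[OF H] by blast
next
  assume H: "H \<subseteq> carrier M \<and> \<zero>\<^bsub>M\<^esub> \<in> H \<and> (\<forall>x\<in>H. \<forall>y\<in>H. x \<oplus>\<^bsub>M\<^esub> y \<in> H) \<and>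
     (\<forall>a\<in>carrier R. \<forall>x\<in>H. a \<odot>\<^bsub>M\<^esub> x \<in> H)"
  have "\<ominus>\<^bsub>M\<^esub> x \<in> H" if "x \<in> H" for x
  proof -
    have "(\<ominus> \<one>) \<odot>\<^bsub>M\<^esub> x \<in> H" using H that by simp
    moreover have "x \<in> carrier M" using H that by auto
    ultimately show ?thesis using smult_l_minus[of \<one> x] by simp
  qed
  then show "submodule H R M" using H by (intro submoduleI) auto
qed

lemma (in module) submodule_diff:
  assumes "submodule H R M" "x \<in> H" "y \<in> H"
  shows "x \<ominus>\<^bsub>M\<^esub> y \<in> H"
  unfolding a_minus_def using assms submoduleE(3,5) by blast

lemma (in module) submodule_finsum:
  assumes "submodule H R M" "finite T" "x \<in> T \<rightarrow> H"
  shows "finsum M x T \<in> H"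
  using assms(2,3)
proof (induction rule: finite_induct)
  case empty then show ?case using assms(1) by (simp add: submodule_iff)
next
  case (insert t T)
  then show ?case using assms(1) submoduleE(1)[OF assms(1)]
    by (subst finsum_insert) (auto simp: submodule_iff)
qed

lemma (in module) mod_span_submodule:
  assumes "A \<subseteq> carrier M"
  shows "submodule (mod_span R M A) R M" "A \<subseteq> mod_span R M A"
proof -
  have "mod_span R M A \<subseteq> carrier M"
    unfolding mod_span_def using assms carrier_is_submodule by auto
  then show "submodule (mod_span R M A) R M"
    unfolding submodule_iff by (auto simp: mod_span_def submodule_iff)
  show "A \<subseteq> mod_span R M A" unfolding mod_span_def by auto
qed

lemma mod_span_least: "submodule H R M \<Longrightarrow> A \<subseteq> H \<Longrightarrow> mod_span R M A \<subseteq> H"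
  unfolding mod_span_def by auto

lemma submodule_hom_vimage:
  assumes "module R M" "module R N" "f \<in> mod_hom R M N" "submodule K R N"
  shows "submodule {x \<in> carrier M. f x \<in> K} R M"
proof -
  interpret M: module R M by fact
  interpret N: module R N by fact
  show ?thesis using assms mod_hom_zero[OF assms(1-3)]
    unfolding M.submodule_iff N.submodule_iff
    by (auto simp: mod_hom_add mod_hom_smult)
qed

lemma submodule_hom_image:
  assumes "module R M" "module R N" "f \<in> mod_hom R M N" "submodule K R M"
  shows "submodule (f ` K) R N"
proof -
  interpret M: module R M by fact
  interpret N: module R N by fact
  have K: "K \<subseteq> carrier M" "\<zero>\<^bsub>M\<^esub> \<in> K" "\<And>x y. x \<in> K \<Longrightarrow> y \<in> K \<Longrightarrow> x \<oplus>\<^bsub>M\<^esub> y \<in> K"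
    "\<And>a x. a \<in> carrier R \<Longrightarrow> x \<in> K \<Longrightarrow> a \<odot>\<^bsub>M\<^esub> x \<in> K"
    using assms(4) unfolding M.submodule_iff by auto
  show ?thesis unfolding N.submodule_iff
  proof (intro conjI ballI)
    show "f ` K \<subseteq> carrier N" using K assms(3) by (auto intro: mod_hom_closed)
    show "\<zero>\<^bsub>N\<^esub> \<in> f ` K" using mod_hom_zero[OF assms(1-3)] K(2) by force
    fix x y assume "x \<in> f ` K" "y \<in> f ` K"
    then obtain u v where uv: "u \<in> K" "x = f u" "v \<in> K" "y = f v" by auto
    then have uvc: "u \<in> carrier M" "v \<in> carrier M" using K(1) by auto
    have "x \<oplus>\<^bsub>N\<^esub> y = f (u \<oplus>\<^bsub>M\<^esub> v)"
      by (simp add: uv(2,4) mod_hom_add[OF assms(3) uvc])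
    then show "x \<oplus>\<^bsub>N\<^esub> y \<in> f ` K" using uv K by auto
  next
    fix a x assume a: "a \<in> carrier R" and "x \<in> f ` K"
    then obtain u where u: "u \<in> K" "x = f u" by auto
    then have "a \<odot>\<^bsub>N\<^esub> x = f (a \<odot>\<^bsub>M\<^esub> u)" using mod_hom_smult[OF assms(3) a] K(1) by auto
    then show "a \<odot>\<^bsub>N\<^esub> x \<in> f ` K" using u a K by auto
  qed
qed

lemma a_kernel_iff: "x \<in> a_kernel M N f \<longleftrightarrow> x \<in> carrier M \<and> f x = \<zero>\<^bsub>N\<^esub>"
  by (simp add: a_kernel_def kernel_def)

lemma self_module_simps [simp]:
  "carrier (self_module R) = carrier R" "\<zero>\<^bsub>self_module R\<^esub> = \<zero>\<^bsub>R\<^esub>"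
  "x \<oplus>\<^bsub>self_module R\<^esub> y = x \<oplus>\<^bsub>R\<^esub> y" "a \<odot>\<^bsub>self_module R\<^esub> x = a \<otimes>\<^bsub>R\<^esub> x"
  by (simp_all add: self_module_def)

lemma self_module_module: "cring R \<Longrightarrow> module R (self_module R)"
proof -
  assume "cring R"
  then interpret cring R .
  show ?thesis
    by (rule moduleI)
       (auto intro!: abelian_groupI cring_axioms simp: a_ac m_assoc l_distr r_distr intro: l_neg)
qed


section \<open>Free modules\<close>

lemma free_on_simps:
  "\<zero>\<^bsub>free_on R S\<^esub> = (\<lambda>x\<in>S. \<zero>\<^bsub>R\<^esub>)"
  "u \<oplus>\<^bsub>free_on R S\<^esub> v = (\<lambda>x\<in>S. u x \<oplus>\<^bsub>R\<^esub> v x)"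
  "a \<odot>\<^bsub>free_on R S\<^esub> v = (\<lambda>x\<in>S. a \<otimes>\<^bsub>R\<^esub> v x)"
  by (simp_all add: free_on_def)

lemma free_on_carrier_iff:
  "v \<in> carrier (free_on R S) \<longleftrightarrow>
    v \<in> extensional S \<and> (\<forall>x\<in>S. v x \<in> carrier R) \<and> finite {x \<in> S. v x \<noteq> \<zero>\<^bsub>R\<^esub>}"
  by (auto simp: free_on_def PiE_def Pi_def)

lemma rpow_carrier_iff:
  "v \<in> carrier (rpow R n) \<longleftrightarrow> v \<in> extensional {..<n} \<and> (\<forall>i<n. v i \<in> carrier R)"
  by (auto simp: free_on_carrier_iff)

lemma free_on_module:
  fixes R (structure)
  assumes "cring R" shows "module R (free_on R S)"
proof -
  interpret cring R by fact
  let ?F = "free_on R S"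
  have add_closed: "u \<oplus>\<^bsub>?F\<^esub> v \<in> carrier ?F" if "u \<in> carrier ?F" "v \<in> carrier ?F" for u v
  proof -
    have "{x \<in> S. u x \<oplus> v x \<noteq> \<zero>} \<subseteq> {x \<in> S. u x \<noteq> \<zero>} \<union> {x \<in> S. v x \<noteq> \<zero>}"
      by auto
    then have "finite {x \<in> S. u x \<oplus> v x \<noteq> \<zero>}"
      using that by (auto simp: free_on_carrier_iff intro: finite_subset)
    then have "finite {x \<in> S. (u \<oplus>\<^bsub>?F\<^esub> v) x \<noteq> \<zero>}"
      by (rule rev_finite_subset) (auto simp: free_on_simps)
    then show ?thesis using that by (auto simp: free_on_carrier_iff free_on_simps)
  qed
  have smult_closed: "a \<odot>\<^bsub>?F\<^esub> v \<in> carrier ?F" if "a \<in> carrier R" "v \<in> carrier ?F" for a v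
  proof -
    have "finite {x \<in> S. v x \<noteq> \<zero>}" using that by (auto simp: free_on_carrier_iff)
    then have "finite {x \<in> S. (a \<odot>\<^bsub>?F\<^esub> v) x \<noteq> \<zero>}"
      by (rule rev_finite_subset) (use that in \<open>auto simp: free_on_simps\<close>)
    then show ?thesis using that by (auto simp: free_on_carrier_iff free_on_simps)
  qed
  have "abelian_group ?F"
  proof (rule abelian_groupI)
    fix u assume u: "u \<in> carrier ?F"
    have "(\<ominus> \<one>) \<odot>\<^bsub>?F\<^esub> u \<oplus>\<^bsub>?F\<^esub> u = \<zero>\<^bsub>?F\<^esub>"
      using u by (auto simp: free_on_carrier_iff free_on_simps l_minus l_neg)
    then show "\<exists>v\<in>carrier ?F. v \<oplus>\<^bsub>?F\<^esub> u = \<zero>\<^bsub>?F\<^esub>"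
      using smult_closed[of "\<ominus> \<one>" u] u by blast
  next
    fix u assume u: "u \<in> carrier ?F"
    then show "\<zero>\<^bsub>?F\<^esub> \<oplus>\<^bsub>?F\<^esub> u = u"
      by (auto simp: free_on_carrier_iff free_on_simps extensional_def fun_eq_iff)
  qed (use add_closed in \<open>auto simp: free_on_simps free_on_carrier_iff a_ac\<close>)
  then show ?thesis
  proof (rule moduleI[OF cring_axioms])
    fix u assume u: "u \<in> carrier ?F"
    then show "\<one> \<odot>\<^bsub>?F\<^esub> u = u"
      by (auto simp: free_on_carrier_iff free_on_simps extensional_def fun_eq_iff)
  qed (use smult_closed in \<open>auto simp: free_on_simps free_on_carrier_iff l_distr r_distr m_assoc\<close>)
qed

lemma basis_elt_closed:
  fixes R (structure)
  assumes "cring R" "s \<in> S" shows "basis_elt R S s \<in> carrier (free_on R S)"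
proof -
  interpret cring R by fact
  have "{x \<in> S. basis_elt R S s x \<noteq> \<zero>} \<subseteq> {s}" by (auto simp: basis_elt_def)
  then have "finite {x \<in> S. basis_elt R S s x \<noteq> \<zero>}" using finite_subset by blast
  then show ?thesis by (auto simp: free_on_carrier_iff basis_elt_def)
qed

lemma free_on_induct [consumes 2, case_names zero step]:
  fixes R (structure)
  assumes "cring R" "v \<in> carrier (free_on R S)"
    and zero: "Q \<zero>\<^bsub>free_on R S\<^esub>"
    and step: "\<And>v a s. v \<in> carrier (free_on R S) \<Longrightarrow> a \<in> carrier R \<Longrightarrow> s \<in> S \<Longrightarrow> Q v \<Longrightarrow>
       Q (v \<oplus>\<^bsub>free_on R S\<^esub> a \<odot>\<^bsub>free_on R S\<^esub> basis_elt R S s)"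
  shows "Q v"
proof -
  interpret cring R by fact
  interpret F: module R "free_on R S" using free_on_module[OF assms(1)] .
  have "\<forall>v. v \<in> carrier (free_on R S) \<and> {x \<in> S. v x \<noteq> \<zero>} \<subseteq> T \<longrightarrow> Q v"
    if "finite T" "T \<subseteq> S" for T
    using that
  proof (induction rule: finite_induct)
    case empty
    have "v = \<zero>\<^bsub>free_on R S\<^esub>" if "v \<in> carrier (free_on R S)" "{x \<in> S. v x \<noteq> \<zero>} \<subseteq> {}" for v
      using that by (auto simp: free_on_simps free_on_carrier_iff extensional_def fun_eq_iff)
    then show ?case using zero by auto
  next
    case (insert s T)
    show ?case
    proof (intro allI impI, elim conjE)
      fix v assume v: "v \<in> carrier (free_on R S)" and vs: "{x \<in> S. v x \<noteq> \<zero>} \<subseteq> insert s T"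
      define w where "w = v \<oplus>\<^bsub>free_on R S\<^esub> (\<ominus> (v s)) \<odot>\<^bsub>free_on R S\<^esub> basis_elt R S s"
      have s: "s \<in> S" using insert by auto
      have vc: "v x \<in> carrier R" if "x \<in> S" for x using v that by (auto simp: free_on_carrier_iff)
      have w: "w \<in> carrier (free_on R S)"
        unfolding w_def using v vc[OF s] basis_elt_closed[OF assms(1) s] by auto
      have wx: "w x = (if x = s then \<zero> else v x)" if "x \<in> S" for x
        using that s vc by (auto simp: w_def free_on_simps basis_elt_def r_neg)
      have "{x \<in> S. w x \<noteq> \<zero>} \<subseteq> T" using vs wx by (auto split: if_splits)
      then have "Q w" using insert w by auto
      from step[OF w vc[OF s] s this]
      have "Q (w \<oplus>\<^bsub>free_on R S\<^esub> v s \<odot>\<^bsub>free_on R S\<^esub> basis_elt R S s)" .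
      moreover have "w \<oplus>\<^bsub>free_on R S\<^esub> v s \<odot>\<^bsub>free_on R S\<^esub> basis_elt R S s = v"
        using vc[OF s] v basis_elt_closed[OF assms(1) s]
        by (simp add: w_def F.smult_l_minus F.M.a_assoc F.M.l_neg)
      ultimately show "Q v" by simp
    qed
  qed
  from this[of "{x \<in> S. v x \<noteq> \<zero>}"] assms(2) show ?thesis
    by (auto simp: free_on_carrier_iff)
qed

lemma free_on_hom_eqI:
  assumes "module R Y" "f \<in> mod_hom R (free_on R S) Y" "g \<in> mod_hom R (free_on R S) Y"
    and "\<And>s. s \<in> S \<Longrightarrow> f (basis_elt R S s) = g (basis_elt R S s)"
    and v: "v \<in> carrier (free_on R S)"
  shows "f v = g v"
proof -
  interpret Y: module R Y by fact
  interpret F: module R "free_on R S" using free_on_module Y.R.cring_axioms .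
  from Y.R.cring_axioms v show ?thesis
  proof (induction rule: free_on_induct)
    case zero
    then show ?case
      using mod_hom_zero[OF F.module_axioms Y.module_axioms assms(2)]
        mod_hom_zero[OF F.module_axioms Y.module_axioms assms(3)] by simp
  next
    case (step v a s)
    let ?e = "basis_elt R S s"
    have e: "?e \<in> carrier (free_on R S)" using basis_elt_closed[OF Y.R.cring_axioms step(3)] .
    have *: "h (v \<oplus>\<^bsub>free_on R S\<^esub> a \<odot>\<^bsub>free_on R S\<^esub> ?e) = h v \<oplus>\<^bsub>Y\<^esub> a \<odot>\<^bsub>Y\<^esub> h ?e"
      if "h \<in> mod_hom R (free_on R S) Y" for h
      using mod_hom_add[OF that step(1) F.smult_closed[OF step(2) e]] mod_hom_smult[OF that step(2) e]
      by simp
    show ?case using *[OF assms(2)] *[OF assms(3)] step(4) assms(4)[OF step(3)] by simp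
  qed
qed

text \<open>The homomorphism that takes the basis element of \<open>s\<close> to \<open>y s\<close>.\<close>

definition free_lift ::
    "('a, 'm) ring_scheme \<Rightarrow> 'x set \<Rightarrow> ('a, 'b, 'n) module_scheme \<Rightarrow> ('x \<Rightarrow> 'b) \<Rightarrow> ('x \<Rightarrow> 'a) \<Rightarrow> 'b"
  where "free_lift R S Y y v = (\<Oplus>\<^bsub>Y\<^esub>s\<in>{s \<in> S. v s \<noteq> \<zero>\<^bsub>R\<^esub>}. v s \<odot>\<^bsub>Y\<^esub> y s)"

lemma free_lift_eq:
  assumes "module R Y" "y \<in> S \<rightarrow> carrier Y" "v \<in> S \<rightarrow> carrier R"
    and T: "finite T" "T \<subseteq> S" "{s \<in> S. v s \<noteq> \<zero>\<^bsub>R\<^esub>} \<subseteq> T"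
  shows "free_lift R S Y y v = (\<Oplus>\<^bsub>Y\<^esub>s\<in>T. v s \<odot>\<^bsub>Y\<^esub> y s)"
proof -
  interpret Y: module R Y by fact
  have yc: "s \<in> S \<Longrightarrow> y s \<in> carrier Y" "s \<in> S \<Longrightarrow> v s \<in> carrier R" for s using assms by auto
  show ?thesis unfolding free_lift_def
    using T yc by (intro Y.M.add.finprod_mono_neutral_cong_left) (auto simp: subset_iff)
qed

lemma free_lift_hom:
  assumes "module R Y" "y \<in> S \<rightarrow> carrier Y"
  shows "free_lift R S Y y \<in> mod_hom R (free_on R S) Y"
proof -
  interpret Y: module R Y by fact
  have yc: "s \<in> S \<Longrightarrow> y s \<in> carrier Y" for s using assms by auto
  have F: "v \<in> S \<rightarrow> carrier R" "finite {s \<in> S. v s \<noteq> \<zero>\<^bsub>R\<^esub>}" if "v \<in> carrier (free_on R S)" for v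
    using that by (auto simp: free_on_carrier_iff)
  interpret F: module R "free_on R S" using free_on_module Y.R.cring_axioms .
  show ?thesis
  proof (rule mod_homI)
    fix v assume v: "v \<in> carrier (free_on R S)"
    show "free_lift R S Y y v \<in> carrier Y"
      unfolding free_lift_def using F[OF v] yc by (intro Y.M.finsum_closed) auto
  next
    fix u v assume u: "u \<in> carrier (free_on R S)" and v: "v \<in> carrier (free_on R S)"
    let ?T = "{s \<in> S. u s \<noteq> \<zero>\<^bsub>R\<^esub>} \<union> {s \<in> S. v s \<noteq> \<zero>\<^bsub>R\<^esub>}"
    have uc: "s \<in> S \<Longrightarrow> u s \<in> carrier R" "s \<in> S \<Longrightarrow> v s \<in> carrier R" for s using F u v by auto
    have T: "finite ?T" using F u v by auto
    have "free_lift R S Y y (u \<oplus>\<^bsub>free_on R S\<^esub> v) = (\<Oplus>\<^bsub>Y\<^esub>s\<in>?T. (u \<oplus>\<^bsub>free_on R S\<^esub> v) s \<odot>\<^bsub>Y\<^esub> y s)"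
      using T F[OF F.M.add.m_closed[OF u v]] assms
      by (intro free_lift_eq) (auto simp: free_on_simps)
    also have "\<dots> = (\<Oplus>\<^bsub>Y\<^esub>s\<in>?T. u s \<odot>\<^bsub>Y\<^esub> y s \<oplus>\<^bsub>Y\<^esub> v s \<odot>\<^bsub>Y\<^esub> y s)"
      using uc yc by (intro Y.M.finsum_cong') (auto simp: free_on_simps Y.smult_l_distr)
    also have "\<dots> = (\<Oplus>\<^bsub>Y\<^esub>s\<in>?T. u s \<odot>\<^bsub>Y\<^esub> y s) \<oplus>\<^bsub>Y\<^esub> (\<Oplus>\<^bsub>Y\<^esub>s\<in>?T. v s \<odot>\<^bsub>Y\<^esub> y s)"
      using uc yc by (intro Y.M.finsum_addf) auto
    also have "\<dots> = free_lift R S Y y u \<oplus>\<^bsub>Y\<^esub> free_lift R S Y y v"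
      using T F u v assms by (simp add: free_lift_eq[of R Y y S _ ?T])
    finally show "free_lift R S Y y (u \<oplus>\<^bsub>free_on R S\<^esub> v) = \<dots>" .
  next
    fix a v assume a: "a \<in> carrier R" and v: "v \<in> carrier (free_on R S)"
    let ?T = "{s \<in> S. v s \<noteq> \<zero>\<^bsub>R\<^esub>}"
    have vc: "s \<in> S \<Longrightarrow> v s \<in> carrier R" for s using F v by auto
    have T: "finite ?T" using F v by auto
    have "free_lift R S Y y (a \<odot>\<^bsub>free_on R S\<^esub> v) = (\<Oplus>\<^bsub>Y\<^esub>s\<in>?T. (a \<odot>\<^bsub>free_on R S\<^esub> v) s \<odot>\<^bsub>Y\<^esub> y s)"
      using T F[OF F.smult_closed[OF a v]] assms a
      by (intro free_lift_eq) (auto simp: free_on_simps)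
    also have "\<dots> = (\<Oplus>\<^bsub>Y\<^esub>s\<in>?T. a \<odot>\<^bsub>Y\<^esub> (v s \<odot>\<^bsub>Y\<^esub> y s))"
      using vc yc a by (intro Y.M.finsum_cong') (auto simp: free_on_simps Y.smult_assoc1)
    also have "\<dots> = a \<odot>\<^bsub>Y\<^esub> free_lift R S Y y v"
      unfolding free_lift_def using T vc yc a by (subst Y.finsum_smult_ldistr) auto
    finally show "free_lift R S Y y (a \<odot>\<^bsub>free_on R S\<^esub> v) = \<dots>" .
  qed
qed

lemma free_lift_basis:
  assumes "module R Y" "y \<in> S \<rightarrow> carrier Y" "s \<in> S"
  shows "free_lift R S Y y (basis_elt R S s) = y s"
proof -
  interpret Y: module R Y by fact
  have y: "y s \<in> carrier Y" using assms by auto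
  have "free_lift R S Y y (basis_elt R S s) = (\<Oplus>\<^bsub>Y\<^esub>t\<in>{s}. basis_elt R S s t \<odot>\<^bsub>Y\<^esub> y t)"
    using assms by (intro free_lift_eq) (auto simp: basis_elt_def)
  also have "\<dots> = y s" using y assms(3) by (simp add: Y.M.finsum_insert basis_elt_def)
  finally show ?thesis .
qed

lemma rpow_lift_eq:
  assumes "module R Y" "y \<in> {..<n} \<rightarrow> carrier Y" "v \<in> carrier (rpow R n)"
  shows "free_lift R {..<n} Y y v = (\<Oplus>\<^bsub>Y\<^esub>i\<in>{..<n}. v i \<odot>\<^bsub>Y\<^esub> y i)"
  using assms by (intro free_lift_eq) (auto simp: rpow_carrier_iff)

lemma rpow_hom_eq_sum:
  assumes "module R Y" "f \<in> mod_hom R (rpow R n) Y" "v \<in> carrier (rpow R n)"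
  shows "f v = (\<Oplus>\<^bsub>Y\<^esub>i\<in>{..<n}. v i \<odot>\<^bsub>Y\<^esub> f (basis_elt R {..<n} i))"
proof -
  interpret Y: module R Y by fact
  let ?y = "\<lambda>i. f (basis_elt R {..<n} i)"
  have y: "?y \<in> {..<n} \<rightarrow> carrier Y"
    by (intro Pi_I mod_hom_closed[OF assms(2)] basis_elt_closed[OF Y.R.cring_axioms])
  have "f v = free_lift R {..<n} Y ?y v"
    using assms(1,2) free_lift_hom[OF assms(1) y] _ assms(3)
  proof (rule free_on_hom_eqI)
    fix s assume "s \<in> {..<n}"
    then show "f (basis_elt R {..<n} s) = free_lift R {..<n} Y ?y (basis_elt R {..<n} s)"
      using free_lift_basis[OF assms(1) y] by simp
  qed
  then show ?thesis using rpow_lift_eq[OF assms(1) y assms(3)] by simp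
qed

lemma coordinate_hom:
  "cring R \<Longrightarrow> s \<in> S \<Longrightarrow> (\<lambda>v. v s) \<in> mod_hom R (free_on R S) (self_module R)"
  by (rule mod_homI) (auto simp: free_on_simps free_on_carrier_iff)

lemma free_on_projective:
  assumes "module R X" "module R Y" "p \<in> mod_hom R X Y" "f \<in> mod_hom R (free_on R S) Y"
    and sub: "\<And>v. v \<in> carrier (free_on R S) \<Longrightarrow> f v \<in> p ` carrier X"
  obtains g where "g \<in> mod_hom R (free_on R S) X" "\<And>v. v \<in> carrier (free_on R S) \<Longrightarrow> p (g v) = f v"
proof -
  interpret X: module R X by fact
  have "\<forall>s\<in>S. \<exists>x\<in>carrier X. p x = f (basis_elt R S s)"
  proof
    fix s assume "s \<in> S"
    then have "f (basis_elt R S s) \<in> p ` carrier X" by (intro sub basis_elt_closed[OF X.R.cring_axioms])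
    then show "\<exists>x\<in>carrier X. p x = f (basis_elt R S s)" by auto
  qed
  then obtain x where x: "\<And>s. s \<in> S \<Longrightarrow> x s \<in> carrier X \<and> p (x s) = f (basis_elt R S s)" by metis
  then have xc: "x \<in> S \<rightarrow> carrier X" by auto
  have g: "free_lift R S X x \<in> mod_hom R (free_on R S) X" by (rule free_lift_hom[OF assms(1) xc])
  show ?thesis
  proof (rule that[OF g])
    show "p (free_lift R S X x v) = f v" if "v \<in> carrier (free_on R S)" for v
      using assms(2) mod_hom_comp[OF g assms(3)] assms(4) _ that
      by (rule free_on_hom_eqI) (use x free_lift_basis[OF assms(1) xc] in auto)
  qed
qed

section \<open>Noetherian modules\<close>

definition noeth_module :: "('a, 'm) ring_scheme \<Rightarrow> ('a, 'b, 'n) module_scheme \<Rightarrow> bool"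
  where "noeth_module R Y \<longleftrightarrow> module R Y \<and>
    (\<forall>S. S \<noteq> {} \<and> (\<forall>K\<in>S. submodule K R Y) \<longrightarrow> (\<exists>K\<in>S. \<forall>L\<in>S. K \<subseteq> L \<longrightarrow> L = K))"

lemma noeth_moduleD:
  assumes "noeth_module R Y" "K0 \<in> S" "\<And>K. K \<in> S \<Longrightarrow> submodule K R Y"
  obtains K where "K \<in> S" "\<forall>L\<in>S. K \<subseteq> L \<longrightarrow> L = K"
  using assms unfolding noeth_module_def by (metis empty_iff)

lemma noeth_moduleI:
  assumes "module R Y"
    and "\<And>S. S \<noteq> {} \<Longrightarrow> \<forall>K\<in>S. submodule K R Y \<Longrightarrow> \<exists>K\<in>S. \<forall>L\<in>S. K \<subseteq> L \<longrightarrow> L = K"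
  shows "noeth_module R Y"
  using assms unfolding noeth_module_def by blast

lemma ideal_iff_submodule:
  assumes "cring R" shows "ideal I R \<longleftrightarrow> submodule I R (self_module R)"
proof -
  interpret cring R by fact
  interpret S: module R "self_module R" using self_module_module[OF assms] .
  show ?thesis
  proof
    assume "ideal I R"
    then interpret ideal I R .
    show "submodule I R (self_module R)"
      unfolding S.submodule_iff by (auto simp: a_subset I_l_closed a_closed)
  next
    assume I: "submodule I R (self_module R)"
    have "additive_subgroup I R"
    proof (rule additive_subgroupI, rule add.subgroupI)
      show "I \<subseteq> carrier R" "I \<noteq> {}" using I unfolding S.submodule_iff by auto
      fix a b assume "a \<in> I" "b \<in> I"
      then show "a \<oplus>\<^bsub>R\<^esub> b \<in> I" using I unfolding S.submodule_iff by auto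
    next
      fix a assume a: "a \<in> I"
      then have "a \<in> carrier R" "(\<ominus>\<^bsub>R\<^esub> \<one>\<^bsub>R\<^esub>) \<otimes>\<^bsub>R\<^esub> a \<in> I" using I unfolding S.submodule_iff by auto
      then show "\<ominus>\<^bsub>R\<^esub> a \<in> I" by (simp add: l_minus)
    qed
    then show "ideal I R"
    proof (intro idealI ring_axioms)
      fix a x assume "a \<in> I" "x \<in> carrier R"
      then show "x \<otimes>\<^bsub>R\<^esub> a \<in> I" "a \<otimes>\<^bsub>R\<^esub> x \<in> I"
        using I m_comm[of a x] unfolding S.submodule_iff by auto
    qed (auto simp: additive_subgroup_def)
  qed
qed

lemma noeth_self_module:
  assumes "cring R" "noetherian_ring R" shows "noeth_module R (self_module R)"
proof -
  interpret noetherian_ring R by fact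
  show ?thesis
proof (rule noeth_moduleI)
    show "module R (self_module R)" using self_module_module[OF assms(1)] .
    fix S assume S: "S \<noteq> {}" "\<forall>K\<in>S. submodule K R (self_module R)"
    have "\<Union>C \<in> S" if "C \<noteq> {}" "subset.chain S C" for C
    proof -
      have "subset.chain {I. ideal I R} C"
        using that S(2) unfolding pred_on.chain_def by (auto simp: ideal_iff_submodule[OF assms(1)])
      then have "\<Union>C \<in> C" using ideal_chain_is_trivial that(1) by blast
      then show ?thesis using that(2) unfolding pred_on.chain_def by blast
    qed
    then show "\<exists>K\<in>S. \<forall>L\<in>S. K \<subseteq> L \<longrightarrow> L = K"
      using subset_Zorn_nonempty[OF S(1)] by blast
  qed
qed

lemma (in module) submodule_Int:
  "submodule H R M \<Longrightarrow> submodule K R M \<Longrightarrow> submodule (H \<inter> K) R M"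
  unfolding submodule_iff by auto

text \<open>If \<open>L \<subseteq> L'\<close> have the same intersection with the kernel of \<open>h\<close> and the same image under \<open>h\<close>,
  they are equal. So one maximizes the image first and the intersection second.\<close>

lemma noeth_extension:
  assumes Y: "module R Y" and Z: "noeth_module R Z" and h: "h \<in> mod_hom R Y Z"
    and K: "noeth_module R (Y\<lparr>carrier := {y \<in> carrier Y. h y = \<zero>\<^bsub>Z\<^esub>}\<rparr>)"
  shows "noeth_module R Y"
proof (rule noeth_moduleI)
  have Zm: "module R Z" using Z unfolding noeth_module_def by blast
  interpret Y: module R Y by fact
  interpret Z: module R Z by fact
  let ?K = "{y \<in> carrier Y. h y = \<zero>\<^bsub>Z\<^esub>}"
  have Km: "module R (Y\<lparr>carrier := ?K\<rparr>)" using K unfolding noeth_module_def by blast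
  interpret Km: module R "Y\<lparr>carrier := ?K\<rparr>" by fact
  fix S assume S: "S \<noteq> {}" "\<forall>L\<in>S. submodule L R Y"
  from S(1) obtain L0 where "L0 \<in> S" by auto
  then have mem: "h ` L0 \<in> (`) h ` S" by (rule imageI)
  have im: "submodule W R Z" if "W \<in> (`) h ` S" for W
    using that S(2) submodule_hom_image[OF Y Zm h] by auto
  obtain W where W: "W \<in> (`) h ` S"
    "\<forall>W'\<in>(`) h ` S. W \<subseteq> W' \<longrightarrow> W' = W"
    by (rule noeth_moduleD[OF Z mem im])
  let ?S' = "{L \<inter> ?K | L. L \<in> S \<and> h ` L = W}"
  have sub: "submodule N R (Y\<lparr>carrier := ?K\<rparr>)" if "N \<in> ?S'" for N
  proof -
    have "submodule ?K R Y"
      using submodule_hom_vimage[OF Y Zm h, of "{\<zero>\<^bsub>Z\<^esub>}"] by (simp add: Z.submodule_iff)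
    then have "submodule N R Y" "N \<subseteq> ?K" using that S(2) Y.submodule_Int by auto
    then show ?thesis unfolding Km.submodule_iff Y.submodule_iff by auto
  qed
  obtain N0 where mem': "N0 \<in> ?S'" using W(1) by auto
  obtain N where N: "N \<in> ?S'" "\<forall>N'\<in>?S'. N \<subseteq> N' \<longrightarrow> N' = N"
    by (rule noeth_moduleD[OF K mem' sub])
  from N(1) obtain L where L: "L \<in> S" "h ` L = W" "N = L \<inter> ?K" by blast
  show "\<exists>K\<in>S. \<forall>L\<in>S. K \<subseteq> L \<longrightarrow> L = K"
  proof (intro bexI[OF _ L(1)] ballI impI)
    fix L' assume L': "L' \<in> S" "L \<subseteq> L'"
    have "h ` L' = W" by (rule W(2)[rule_format]) (use L(2) L' in auto)
    then have "L' \<inter> ?K \<in> ?S'" using L'(1) by auto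
    from N(2)[rule_format, OF this] have eq: "L' \<inter> ?K = L \<inter> ?K" using L(3) L'(2) by auto
    have sL: "submodule L R Y" "submodule L' R Y" using S(2) L L' by auto
    show "L' = L"
    proof
      show "L' \<subseteq> L"
      proof
        fix x assume x: "x \<in> L'"
        then obtain y where y: "y \<in> L" "h y = h x" using \<open>h ` L' = W\<close> L(2) by (metis imageE imageI)
        have c: "x \<in> carrier Y" "y \<in> carrier Y" using x y sL Y.submoduleE(1) by auto
        have "x \<ominus>\<^bsub>Y\<^esub> y \<in> L'" using x y L'(2) by (intro Y.submodule_diff[OF sL(2)]) auto
        moreover have "h (x \<ominus>\<^bsub>Y\<^esub> y) = \<zero>\<^bsub>Z\<^esub>"
          using mod_hom_diff[OF Y Zm h c] y(2) mod_hom_closed[OF h c(1)]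
          by (simp add: a_minus_def Z.M.r_neg)
        ultimately have "x \<ominus>\<^bsub>Y\<^esub> y \<in> L" using eq c by auto
        then have "(x \<ominus>\<^bsub>Y\<^esub> y) \<oplus>\<^bsub>Y\<^esub> y \<in> L" by (rule Y.submoduleE(5)[OF sL(1) _ y(1)])
        then show "x \<in> L" using c by (simp add: a_minus_def Y.M.a_assoc Y.M.l_neg)
      qed
    qed (use L' in auto)
  qed
qed (rule Y)

lemma noeth_surj:
  assumes Y: "noeth_module R Y" and Z: "module R Z" and h: "h \<in> mod_hom R Y Z"
    and surj: "h ` carrier Y = carrier Z"
  shows "noeth_module R Z"
proof (rule noeth_moduleI)
  have Ym: "module R Y" using Y unfolding noeth_module_def by blast
  interpret Y: module R Y by fact
  interpret Z: module R Z by fact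
  fix S assume S: "S \<noteq> {}" "\<forall>L\<in>S. submodule L R Z"
  let ?v = "\<lambda>L. {y \<in> carrier Y. h y \<in> L}"
  have im: "h ` ?v L = L" if "L \<in> S" for L
  proof -
    have "L \<subseteq> carrier Z" using S(2) that Z.submoduleE(1) by auto
    then show ?thesis using surj by (auto simp: image_iff)
  qed
  from S(1) obtain L0 where mem: "?v L0 \<in> ?v ` S" by auto
  have vim: "submodule W R Y" if "W \<in> ?v ` S" for W
    using that S(2) submodule_hom_vimage[OF Ym Z h] by auto
  obtain W where W: "W \<in> ?v ` S" "\<forall>W'\<in>?v ` S. W \<subseteq> W' \<longrightarrow> W' = W"
    by (rule noeth_moduleD[OF Y mem vim])
  from W(1) obtain L where L: "L \<in> S" "W = ?v L" by blast
  show "\<exists>K\<in>S. \<forall>L\<in>S. K \<subseteq> L \<longrightarrow> L = K"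
  proof (intro bexI[OF _ L(1)] ballI impI)
    fix L' assume L': "L' \<in> S" "L \<subseteq> L'"
    then have "?v L' = W" using L by (intro W(2)[rule_format]) auto
    then show "L' = L" using im[OF L(1)] im[OF L'(1)] L(2) by metis
  qed
qed (rule Z)

lemma noeth_trivial:
  assumes "module R Y" "carrier Y \<subseteq> {\<zero>\<^bsub>Y\<^esub>}"
  shows "noeth_module R Y"
proof (rule noeth_moduleI)
  interpret Y: module R Y by fact
  fix S assume S: "S \<noteq> {}" "\<forall>L\<in>S. submodule L R Y"
  have "L = {\<zero>\<^bsub>Y\<^esub>}" if "L \<in> S" for L
  proof -
    have "submodule L R Y" using S(2) that by auto
    then have "L \<subseteq> carrier Y" "\<zero>\<^bsub>Y\<^esub> \<in> L" by (simp_all add: Y.submodule_iff)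
    then show ?thesis using assms(2) by auto
  qed
  then show "\<exists>K\<in>S. \<forall>L\<in>S. K \<subseteq> L \<longrightarrow> L = K" using S(1) by auto
qed (rule assms(1))

text \<open>Peel off one map \<open>h i\<close> at a time: on its kernel the remaining maps are jointly injective. In the
  applications the maps are coordinates, or evaluations at the elements of a basis.\<close>

lemma noeth_jointly_injective:
  fixes h :: "nat \<Rightarrow> 'b \<Rightarrow> 'c" and Y :: "('a, 'b, 'n) module_scheme"
  assumes Y: "module R Y" and Z: "noeth_module R Z"
    and h: "\<And>i. i < n \<Longrightarrow> h i \<in> mod_hom R Y Z"
    and inj: "\<And>y. y \<in> carrier Y \<Longrightarrow> (\<And>i. i < n \<Longrightarrow> h i y = \<zero>\<^bsub>Z\<^esub>) \<Longrightarrow> y = \<zero>\<^bsub>Y\<^esub>"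
  shows "noeth_module R Y"
  using Y h inj
proof (induction n arbitrary: Y)
  case 0
  then show ?case by (intro noeth_trivial) auto
next
  case (Suc n)
  have Zm: "module R Z" using Z unfolding noeth_module_def by blast
  interpret Y: module R Y by fact
  interpret Z: module R Z by fact
  let ?K = "{y \<in> carrier Y. h n y = \<zero>\<^bsub>Z\<^esub>}"
  have hn: "h n \<in> mod_hom R Y Z" using Suc.prems by auto
  have K: "submodule ?K R Y"
    using submodule_hom_vimage[OF Suc.prems(1) Zm hn, of "{\<zero>\<^bsub>Z\<^esub>}"] by (simp add: Z.submodule_iff)
  have "noeth_module R (Y\<lparr>carrier := ?K\<rparr>)"
  proof (rule Suc.IH)
    show "module R (Y\<lparr>carrier := ?K\<rparr>)"
      using submodule.submodule_is_module[OF K Suc.prems(1)] .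
    show "h i \<in> mod_hom R (Y\<lparr>carrier := ?K\<rparr>) Z" if "i < n" for i
      using Suc.prems(2)[of i] that unfolding mod_hom_def hom_def by auto
    show "y = \<zero>\<^bsub>Y\<lparr>carrier := ?K\<rparr>\<^esub>"
      if "y \<in> carrier (Y\<lparr>carrier := ?K\<rparr>)" "\<And>i. i < n \<Longrightarrow> h i y = \<zero>\<^bsub>Z\<^esub>" for y
      using Suc.prems(3)[of y] that less_Suc_eq by auto
  qed
  then show ?case by (rule noeth_extension[OF Suc.prems(1) Z hn])
qed

lemma noeth_rpow:
  assumes "cring R" "noetherian_ring R" shows "noeth_module R (rpow R n)"
proof (rule noeth_jointly_injective[where h = "\<lambda>i v. v i" and n = n])
  show "module R (rpow R n)" using free_on_module[OF assms(1)] .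
  show "noeth_module R (self_module R)" using noeth_self_module[OF assms] .
  show "(\<lambda>v. v i) \<in> mod_hom R (rpow R n) (self_module R)" if "i < n" for i
    using coordinate_hom[OF assms(1), of i "{..<n}"] that by simp
  show "v = \<zero>\<^bsub>rpow R n\<^esub>" if "v \<in> carrier (rpow R n)" "\<And>i. i < n \<Longrightarrow> v i = \<zero>\<^bsub>self_module R\<^esub>" for v
    using that by (auto simp: rpow_carrier_iff free_on_simps extensional_def fun_eq_iff)
qed

lemma hom_module_simps:
  "f \<in> carrier (hom_module R M N) \<longleftrightarrow> f \<in> mod_hom R M N \<and> f \<in> extensional (carrier M)"
  "\<zero>\<^bsub>hom_module R M N\<^esub> = (\<lambda>x\<in>carrier M. \<zero>\<^bsub>N\<^esub>)"
  "f \<oplus>\<^bsub>hom_module R M N\<^esub> g = (\<lambda>x\<in>carrier M. f x \<oplus>\<^bsub>N\<^esub> g x)"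
  "a \<odot>\<^bsub>hom_module R M N\<^esub> f = (\<lambda>x\<in>carrier M. a \<odot>\<^bsub>N\<^esub> f x)"
  by (simp_all add: hom_module_def)

lemma restrict_mod_hom:
  "module R M \<Longrightarrow> f \<in> mod_hom R M N \<Longrightarrow> restrict f (carrier M) \<in> carrier (hom_module R M N)"
  by (auto simp: hom_module_simps intro: mod_hom_cong)

lemma hom_module_module:
  assumes M: "module R M" and N: "module R N" shows "module R (hom_module R M N)"
proof -
  interpret M: module R M by fact
  interpret N: module R N by fact
  let ?H = "hom_module R M N"
  have c: "f x \<in> carrier N" if "f \<in> carrier ?H" "x \<in> carrier M" for f x
    using that by (auto simp: hom_module_simps mod_hom_closed)
  have ext: "f \<in> carrier ?H \<Longrightarrow> f \<in> extensional (carrier M)" for f by (simp add: hom_module_simps)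
  have add: "f \<oplus>\<^bsub>?H\<^esub> g \<in> carrier ?H" if "f \<in> carrier ?H" "g \<in> carrier ?H" for f g
    unfolding hom_module_simps(3)
    by (rule restrict_mod_hom[OF M mod_hom_plus[OF N]]) (use that in \<open>auto simp: hom_module_simps\<close>)
  have smult: "a \<odot>\<^bsub>?H\<^esub> f \<in> carrier ?H" if "a \<in> carrier R" "f \<in> carrier ?H" for a f
    unfolding hom_module_simps(4)
    by (rule restrict_mod_hom[OF M mod_hom_scale[OF N]]) (use that in \<open>auto simp: hom_module_simps\<close>)
  have zero: "\<zero>\<^bsub>?H\<^esub> \<in> carrier ?H"
    unfolding hom_module_simps(2) by (rule restrict_mod_hom[OF M mod_hom_zero_fun[OF N]])
  have "abelian_group ?H"
  proof (rule abelian_groupI)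
    fix f assume f: "f \<in> carrier ?H"
    have "(\<ominus>\<^bsub>R\<^esub> \<one>\<^bsub>R\<^esub>) \<odot>\<^bsub>?H\<^esub> f \<oplus>\<^bsub>?H\<^esub> f = \<zero>\<^bsub>?H\<^esub>"
      using c[OF f] by (auto simp: hom_module_simps N.smult_l_minus N.M.l_neg fun_eq_iff)
    then show "\<exists>g\<in>carrier ?H. g \<oplus>\<^bsub>?H\<^esub> f = \<zero>\<^bsub>?H\<^esub>"
      using smult[of "\<ominus>\<^bsub>R\<^esub> \<one>\<^bsub>R\<^esub>" f] f by blast
    show "\<zero>\<^bsub>?H\<^esub> \<oplus>\<^bsub>?H\<^esub> f = f"
      using c[OF f] ext[OF f] by (auto simp: hom_module_simps extensional_def fun_eq_iff)
  next
    fix f g h assume f: "f \<in> carrier ?H" and g: "g \<in> carrier ?H" and h: "h \<in> carrier ?H"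
    show "f \<oplus>\<^bsub>?H\<^esub> g \<oplus>\<^bsub>?H\<^esub> h = f \<oplus>\<^bsub>?H\<^esub> (g \<oplus>\<^bsub>?H\<^esub> h)"
      using c[OF f] c[OF g] c[OF h] by (auto simp: hom_module_simps N.M.a_assoc fun_eq_iff)
    show "f \<oplus>\<^bsub>?H\<^esub> g = g \<oplus>\<^bsub>?H\<^esub> f"
      using c[OF f] c[OF g] by (auto simp: hom_module_simps N.M.a_comm fun_eq_iff)
  qed (use add zero in auto)
  then show ?thesis
  proof (rule moduleI[OF M.R.cring_axioms])
    fix a b f g assume a: "a \<in> carrier R" and b: "b \<in> carrier R"
      and f: "f \<in> carrier ?H" and g: "g \<in> carrier ?H"
    show "(a \<oplus>\<^bsub>R\<^esub> b) \<odot>\<^bsub>?H\<^esub> f = a \<odot>\<^bsub>?H\<^esub> f \<oplus>\<^bsub>?H\<^esub> b \<odot>\<^bsub>?H\<^esub> f"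
      using c[OF f] a b by (auto simp: hom_module_simps N.smult_l_distr fun_eq_iff)
    show "a \<odot>\<^bsub>?H\<^esub> (f \<oplus>\<^bsub>?H\<^esub> g) = a \<odot>\<^bsub>?H\<^esub> f \<oplus>\<^bsub>?H\<^esub> a \<odot>\<^bsub>?H\<^esub> g"
      using c[OF f] c[OF g] a by (auto simp: hom_module_simps N.smult_r_distr fun_eq_iff)
    show "(a \<otimes>\<^bsub>R\<^esub> b) \<odot>\<^bsub>?H\<^esub> f = a \<odot>\<^bsub>?H\<^esub> (b \<odot>\<^bsub>?H\<^esub> f)"
      using c[OF f] a b by (auto simp: hom_module_simps N.smult_assoc1 fun_eq_iff)
  next
    fix f assume f: "f \<in> carrier ?H"
    show "\<one>\<^bsub>R\<^esub> \<odot>\<^bsub>?H\<^esub> f = f"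
      using c[OF f] ext[OF f] by (auto simp: hom_module_simps extensional_def fun_eq_iff)
  qed (use smult in auto)
qed

lemma noeth_hom_rpow:
  assumes X: "noeth_module R X"
  shows "noeth_module R (hom_module R (rpow R n) X)"
proof -
  have Xm: "module R X" using X unfolding noeth_module_def by blast
  interpret X: module R X by fact
  note Fm = free_on_module[OF X.R.cring_axioms]
  note e = basis_elt_closed[OF X.R.cring_axioms]
  interpret F: module R "rpow R n" using Fm .
  show ?thesis
  proof (rule noeth_jointly_injective[where h = "\<lambda>i f. f (basis_elt R {..<n} i)" and n = n])
    show "module R (hom_module R (rpow R n) X)" by (rule hom_module_module[OF Fm Xm])
    show "noeth_module R X" by fact
    show "(\<lambda>f. f (basis_elt R {..<n} i)) \<in> mod_hom R (hom_module R (rpow R n) X) X" if "i < n" for i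
    proof -
      have ei: "basis_elt R {..<n} i \<in> carrier (rpow R n)" using that by (intro e) simp
      show ?thesis using ei by (intro mod_homI) (auto simp: hom_module_simps ei intro: mod_hom_closed[OF _ ei])
    qed
    fix f assume f: "f \<in> carrier (hom_module R (rpow R n) X)"
      and z: "\<And>i. i < n \<Longrightarrow> f (basis_elt R {..<n} i) = \<zero>\<^bsub>X\<^esub>"
    have "f v = \<zero>\<^bsub>X\<^esub>" if "v \<in> carrier (rpow R n)" for v
      by (rule free_on_hom_eqI[OF Xm _ mod_hom_zero_fun[OF Xm] _ that])
        (use f z in \<open>auto simp: hom_module_simps\<close>)
    then show "f = \<zero>\<^bsub>hom_module R (rpow R n) X\<^esub>"
      using f by (auto simp: hom_module_simps extensional_def fun_eq_iff)
  qed
qed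

lemma (in module) colon_ideal:
  assumes K: "submodule K R M" and x: "x \<in> carrier M"
  shows "ideal {a \<in> carrier R. a \<odot>\<^bsub>M\<^esub> x \<in> K} R"
proof -
  interpret S: module R "self_module R" using self_module_module[OF R.cring_axioms] .
  show ?thesis
    unfolding ideal_iff_submodule[OF R.cring_axioms] S.submodule_iff
    using K x unfolding submodule_iff by (auto simp: smult_l_distr smult_assoc1)
qed

text \<open>A maximal one among the ideals \<open>(K : x)\<close> with \<open>x \<in> L - K\<close> is prime: if \<open>abx \<in> K\<close> but \<open>bx \<notin>
  K\<close>, then \<open>(K : x) \<subseteq> (K : bx)\<close>, so that these ideals are equal, and the second one contains
  \<open>a\<close>. Applied to \<open>K = 0\<close> it yields associated primes, and in general the steps of a prime
  filtration.\<close>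

lemma prime_colon_exists:
  assumes R: "noetherian_ring R" and M: "module R M"
    and K: "submodule K R M" and L: "submodule L R M" and KL: "K \<subseteq> L"
    and x0: "x0 \<in> L" "x0 \<notin> K"
  obtains x where "x \<in> L" "x \<notin> K" "primeideal {a \<in> carrier R. a \<odot>\<^bsub>M\<^esub> x \<in> K} R"
    "\<And>y. y \<in> L \<Longrightarrow> y \<notin> K \<Longrightarrow> {a \<in> carrier R. a \<odot>\<^bsub>M\<^esub> x \<in> K} \<subseteq> {a \<in> carrier R. a \<odot>\<^bsub>M\<^esub> y \<in> K}
       \<Longrightarrow> {a \<in> carrier R. a \<odot>\<^bsub>M\<^esub> y \<in> K} = {a \<in> carrier R. a \<odot>\<^bsub>M\<^esub> x \<in> K}"
    "{a \<in> carrier R. a \<odot>\<^bsub>M\<^esub> x0 \<in> K} \<subseteq> {a \<in> carrier R. a \<odot>\<^bsub>M\<^esub> x \<in> K}"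
proof -
  interpret M: module R M by fact
  let ?c = "\<lambda>x. {a \<in> carrier R. a \<odot>\<^bsub>M\<^esub> x \<in> K}"
  let ?S = "{?c x | x. x \<in> L - K \<and> ?c x0 \<subseteq> ?c x}"
  have Lc: "L \<subseteq> carrier M" by (rule M.submoduleE(1)[OF L])
  have sub: "submodule I R (self_module R)" if "I \<in> ?S" for I
    using that M.colon_ideal[OF K] Lc by (auto simp flip: ideal_iff_submodule[OF M.R.cring_axioms])
  have mem: "?c x0 \<in> ?S" using x0 by blast
  obtain I where I: "I \<in> ?S" "\<forall>J\<in>?S. I \<subseteq> J \<longrightarrow> J = I"
    by (rule noeth_moduleD[OF noeth_self_module[OF M.R.cring_axioms R] mem sub])
  from I(1) obtain x where x: "x \<in> L" "x \<notin> K" "I = ?c x" "?c x0 \<subseteq> ?c x" by blast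
  have xc: "x \<in> carrier M" using x Lc by auto
  have max: "?c y = ?c x" if "y \<in> L" "y \<notin> K" "?c x \<subseteq> ?c y" for y
    proof -
    have "?c y \<in> ?S" using that x(4) by blast
    moreover have "I \<subseteq> ?c y" using that x(3) by simp
    ultimately have "?c y = I" by (rule I(2)[rule_format])
    then show ?thesis using x(3) by simp
  qed
  have "primeideal (?c x) R"
  proof (rule primeidealI[OF M.colon_ideal[OF K xc] M.R.cring_axioms])
    have "\<one>\<^bsub>R\<^esub> \<notin> ?c x" using x xc by simp
    then show "carrier R \<noteq> ?c x" by (metis M.R.one_closed)
    fix a b assume a: "a \<in> carrier R" and b: "b \<in> carrier R" and ab: "a \<otimes>\<^bsub>R\<^esub> b \<in> ?c x"
    show "a \<in> ?c x \<or> b \<in> ?c x"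
    proof (cases "b \<odot>\<^bsub>M\<^esub> x \<in> K")
      case False
      have "?c x \<subseteq> ?c (b \<odot>\<^bsub>M\<^esub> x)"
      proof clarify
        fix r assume r: "r \<in> carrier R" "r \<odot>\<^bsub>M\<^esub> x \<in> K"
        then have "b \<odot>\<^bsub>M\<^esub> (r \<odot>\<^bsub>M\<^esub> x) \<in> K" using M.submoduleE(4)[OF K b] by simp
        then show "r \<odot>\<^bsub>M\<^esub> (b \<odot>\<^bsub>M\<^esub> x) \<in> K"
          using b r xc M.R.m_comm[of r b] by (simp flip: M.smult_assoc1)
      qed
      moreover have "b \<odot>\<^bsub>M\<^esub> x \<in> L" by (rule M.submoduleE(4)[OF L b x(1)])
      ultimately have "?c (b \<odot>\<^bsub>M\<^esub> x) = ?c x" by (intro max False)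
      moreover have "a \<in> ?c (b \<odot>\<^bsub>M\<^esub> x)" using a b ab xc by (simp add: M.smult_assoc1)
      ultimately show ?thesis by blast
    qed (use b in auto)
  qed
  then show ?thesis by (rule that[OF x(1,2) _ max x(4)])
qed

section \<open>Length at a prime\<close>

lemma (in module) add_diff_cancel_left:
  "x \<in> carrier M \<Longrightarrow> y \<in> carrier M \<Longrightarrow> (x \<oplus>\<^bsub>M\<^esub> y) \<ominus>\<^bsub>M\<^esub> x = y"
  by (simp add: M.a_comm[of x y] a_minus_def M.a_assoc M.r_neg)

lemma (in module) diff_add_cancel:
  "x \<in> carrier M \<Longrightarrow> y \<in> carrier M \<Longrightarrow> (x \<ominus>\<^bsub>M\<^esub> y) \<oplus>\<^bsub>M\<^esub> y = x"
  by (simp add: a_minus_def M.a_assoc M.l_neg)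

lemma (in module) diff_eq_zero_iff:
  "x \<in> carrier M \<Longrightarrow> y \<in> carrier M \<Longrightarrow> x \<ominus>\<^bsub>M\<^esub> y = \<zero>\<^bsub>M\<^esub> \<longleftrightarrow> x = y"
  using diff_add_cancel[of x y] by (auto simp: a_minus_def M.r_neg)

text \<open>\<open>N \<subseteq> L\<close> with \<open>(L/N)\<^sub>p \<noteq> 0\<close>.\<close>

definition pstrict ::
    "('a, 'm) ring_scheme \<Rightarrow> 'a set \<Rightarrow> ('a, 'b, 'n) module_scheme \<Rightarrow> 'b set \<Rightarrow> 'b set \<Rightarrow> bool"
  where "pstrict R p Y N L \<longleftrightarrow> N \<subseteq> L \<and> (\<exists>x\<in>L. \<forall>s\<in>carrier R - p. s \<odot>\<^bsub>Y\<^esub> x \<notin> N)"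

primrec pchain ::
    "('a, 'm) ring_scheme \<Rightarrow> 'a set \<Rightarrow> ('a, 'b, 'n) module_scheme \<Rightarrow> 'b set \<Rightarrow> nat \<Rightarrow> 'b set \<Rightarrow> bool"
  where
    "pchain R p Y K 0 L \<longleftrightarrow> submodule K R Y \<and> submodule L R Y \<and> K \<subseteq> L"
  | "pchain R p Y K (Suc n) L \<longleftrightarrow>
      submodule L R Y \<and> (\<exists>N. pchain R p Y K n N \<and> pstrict R p Y N L)"

definition pfinite ::
    "('a, 'm) ring_scheme \<Rightarrow> 'a set \<Rightarrow> ('a, 'b, 'n) module_scheme \<Rightarrow> 'b set \<Rightarrow> 'b set \<Rightarrow> bool"
  where "pfinite R p Y K L \<longleftrightarrow> (\<exists>b. \<forall>n. pchain R p Y K n L \<longrightarrow> n \<le> b)"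

text \<open>The length of \<open>(L/K)\<^sub>p\<close>; meaningful if \<open>pfinite R p Y K L\<close>.\<close>

definition plen ::
    "('a, 'm) ring_scheme \<Rightarrow> 'a set \<Rightarrow> ('a, 'b, 'n) module_scheme \<Rightarrow> 'b set \<Rightarrow> 'b set \<Rightarrow> nat"
  where "plen R p Y K L = Max {n. pchain R p Y K n L}"

lemma pstrict_mono: "pstrict R p Y N L \<Longrightarrow> L \<subseteq> L' \<Longrightarrow> pstrict R p Y N L'"
  unfolding pstrict_def by auto

lemma pchain_submodules: "pchain R p Y K n L \<Longrightarrow> submodule K R Y \<and> submodule L R Y \<and> K \<subseteq> L"
  by (induction n arbitrary: L) (auto simp: pstrict_def)

lemma pchain_mono:
  "pchain R p Y K n L \<Longrightarrow> submodule L' R Y \<Longrightarrow> L \<subseteq> L' \<Longrightarrow> pchain R p Y K n L'"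
  by (cases n) (auto intro: pstrict_mono)

lemma pchain_append:
  "pchain R p Y N n L \<Longrightarrow> pchain R p Y K m N \<Longrightarrow> pchain R p Y K (n + m) L"
proof (induction n arbitrary: L)
  case 0 then show ?case by (auto intro: pchain_mono)
next
  case (Suc n) then show ?case by auto
qed

definition sub_sum :: "('a, 'b, 'n) module_scheme \<Rightarrow> 'b set \<Rightarrow> 'b set \<Rightarrow> 'b set"
  where "sub_sum Y L N = {x \<oplus>\<^bsub>Y\<^esub> y | x y. x \<in> L \<and> y \<in> N}"

lemma (in module) sub_sum_submodule:
  assumes L: "submodule L R M" and N: "submodule N R M"
  shows "submodule (sub_sum M L N) R M"
proof -
  have c: "L \<subseteq> carrier M" "N \<subseteq> carrier M" using submoduleE(1) L N by auto
  have z: "\<zero>\<^bsub>M\<^esub> \<in> L" "\<zero>\<^bsub>M\<^esub> \<in> N" using L N by (simp_all add: submodule_iff)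
  show ?thesis unfolding submodule_iff
  proof (intro conjI ballI)
    show "sub_sum M L N \<subseteq> carrier M" using c by (auto simp: sub_sum_def)
    have "\<zero>\<^bsub>M\<^esub> \<oplus>\<^bsub>M\<^esub> \<zero>\<^bsub>M\<^esub> \<in> sub_sum M L N"
      unfolding sub_sum_def using z by (intro CollectI exI[of _ "\<zero>\<^bsub>M\<^esub>"]) simp
    then show "\<zero>\<^bsub>M\<^esub> \<in> sub_sum M L N" by simp
    fix u v assume "u \<in> sub_sum M L N" "v \<in> sub_sum M L N"
    then obtain x y x' y' where *: "x \<in> L" "y \<in> N" "x' \<in> L" "y' \<in> N"
      "u = x \<oplus>\<^bsub>M\<^esub> y" "v = x' \<oplus>\<^bsub>M\<^esub> y'" unfolding sub_sum_def by auto
    then have "x \<in> carrier M" "y \<in> carrier M" "x' \<in> carrier M" "y' \<in> carrier M" using c by auto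
    then have "u \<oplus>\<^bsub>M\<^esub> v = (x \<oplus>\<^bsub>M\<^esub> x') \<oplus>\<^bsub>M\<^esub> (y \<oplus>\<^bsub>M\<^esub> y')" using * by (simp add: M.add.m_ac)
    moreover have "x \<oplus>\<^bsub>M\<^esub> x' \<in> L" "y \<oplus>\<^bsub>M\<^esub> y' \<in> N" using * submoduleE(5)[OF L] submoduleE(5)[OF N] by auto
    ultimately show "u \<oplus>\<^bsub>M\<^esub> v \<in> sub_sum M L N" unfolding sub_sum_def by auto
  next
    fix a u assume a: "a \<in> carrier R" and "u \<in> sub_sum M L N"
    then obtain x y where *: "x \<in> L" "y \<in> N" "u = x \<oplus>\<^bsub>M\<^esub> y" unfolding sub_sum_def by auto
    then have "a \<odot>\<^bsub>M\<^esub> u = a \<odot>\<^bsub>M\<^esub> x \<oplus>\<^bsub>M\<^esub> a \<odot>\<^bsub>M\<^esub> y" using c a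
      by (simp add: smult_r_distr subset_iff)
    moreover have "a \<odot>\<^bsub>M\<^esub> x \<in> L" "a \<odot>\<^bsub>M\<^esub> y \<in> N" using * a submoduleE(4)[OF L] submoduleE(4)[OF N] by auto
    ultimately show "a \<odot>\<^bsub>M\<^esub> u \<in> sub_sum M L N" unfolding sub_sum_def by auto
  qed
qed

lemma (in module) sub_sum_upper:
  assumes L: "submodule L R M" and N: "submodule N R M"
  shows "L \<subseteq> sub_sum M L N" "N \<subseteq> sub_sum M L N"
proof -
  have c: "L \<subseteq> carrier M" "N \<subseteq> carrier M" using submoduleE(1) L N by auto
  have z: "\<zero>\<^bsub>M\<^esub> \<in> L" "\<zero>\<^bsub>M\<^esub> \<in> N" using L N by (simp_all add: submodule_iff)
  show "L \<subseteq> sub_sum M L N"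
  proof
    fix x assume x: "x \<in> L"
    then have "x = x \<oplus>\<^bsub>M\<^esub> \<zero>\<^bsub>M\<^esub>" using c by auto
    then show "x \<in> sub_sum M L N" unfolding sub_sum_def using x z by blast
  qed
  show "N \<subseteq> sub_sum M L N"
  proof
    fix x assume x: "x \<in> N"
    then have "x = \<zero>\<^bsub>M\<^esub> \<oplus>\<^bsub>M\<^esub> x" using c by auto
    then show "x \<in> sub_sum M L N" unfolding sub_sum_def using x z by blast
  qed
qed

lemma (in module) sub_sum_absorb:
  assumes L: "submodule L R M" and N: "N \<subseteq> L" "submodule N R M"
  shows "sub_sum M L N = L"
proof
  show "sub_sum M L N \<subseteq> L" unfolding sub_sum_def using N submoduleE(5)[OF L] by auto
qed (rule sub_sum_upper(1)[OF L N(2)])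

lemma prime_compl_mult:
  assumes "primeideal p R" "s \<in> carrier R - p" "t \<in> carrier R - p"
  shows "s \<otimes>\<^bsub>R\<^esub> t \<in> carrier R - p"
proof -
  interpret primeideal p R by fact
  show ?thesis using assms I_prime by auto
qed

lemma prime_compl_one:
  assumes "primeideal p R"
  shows "\<one>\<^bsub>R\<^esub> \<in> carrier R - p"
proof -
  interpret primeideal p R by fact
  show ?thesis using one_imp_carrier I_notcarr by auto
qed

text \<open>Suppose that neither alternative holds, and let \<open>x \<in> L\<close>. Then \<open>sx = y + z\<close> for some \<open>s \<notin>
  p\<close>, \<open>y \<in> L1\<close> and \<open>z \<in> N\<close>. Here \<open>z \<in> L \<inter> N\<close>, so \<open>tz \<in> L1\<close> for some \<open>t \<notin> p\<close>, and then \<open>tsx \<in>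
  L1\<close>.\<close>

lemma pstrict_split:
  assumes M: "module R Y" and p: "primeideal p R"
    and N: "submodule N R Y" and L: "submodule L R Y" and L1: "submodule L1 R Y"
    and st: "pstrict R p Y L1 L"
  shows "pstrict R p Y (L1 \<inter> N) (L \<inter> N) \<or> pstrict R p Y (sub_sum Y L1 N) (sub_sum Y L N)"
proof (rule ccontr)
  interpret M: module R Y by fact
  assume neg: "\<not> ?thesis"
  have c: "L \<subseteq> carrier Y" "N \<subseteq> carrier Y" "L1 \<subseteq> carrier Y" using M.submoduleE(1) L N L1 by auto
  have sub: "L1 \<subseteq> L" using st unfolding pstrict_def by simp
  have subs: "L1 \<inter> N \<subseteq> L \<inter> N" "sub_sum Y L1 N \<subseteq> sub_sum Y L N"
    using sub by (auto simp: sub_sum_def)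
  obtain x where x: "x \<in> L" "\<forall>s\<in>carrier R - p. s \<odot>\<^bsub>Y\<^esub> x \<notin> L1" using st unfolding pstrict_def by auto
  have "x \<in> sub_sum Y L N" using x M.sub_sum_upper(1)[OF L N] by auto
  then obtain s where s: "s \<in> carrier R - p" "s \<odot>\<^bsub>Y\<^esub> x \<in> sub_sum Y L1 N"
    using neg subs unfolding pstrict_def by auto
  then obtain y z where yz: "y \<in> L1" "z \<in> N" "s \<odot>\<^bsub>Y\<^esub> x = y \<oplus>\<^bsub>Y\<^esub> z" unfolding sub_sum_def by auto
  have cc: "x \<in> carrier Y" "y \<in> carrier Y" "z \<in> carrier Y" "s \<in> carrier R" using x yz s c by auto
  have "z = s \<odot>\<^bsub>Y\<^esub> x \<ominus>\<^bsub>Y\<^esub> y" using yz(3) cc by (simp add: M.add_diff_cancel_left)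
  moreover have "s \<odot>\<^bsub>Y\<^esub> x \<ominus>\<^bsub>Y\<^esub> y \<in> L"
    using yz(1) sub x(1) M.submoduleE(4)[OF L cc(4) x(1)] by (intro M.submodule_diff[OF L]) auto
  ultimately have "z \<in> L \<inter> N" using yz by simp
  moreover have "\<not> pstrict R p Y (L1 \<inter> N) (L \<inter> N)" using neg by simp
  ultimately obtain t where t: "t \<in> carrier R - p" "t \<odot>\<^bsub>Y\<^esub> z \<in> L1 \<inter> N"
    using subs(1) unfolding pstrict_def by meson
  have tc: "t \<in> carrier R" using t by simp
  have "(t \<otimes>\<^bsub>R\<^esub> s) \<odot>\<^bsub>Y\<^esub> x = t \<odot>\<^bsub>Y\<^esub> y \<oplus>\<^bsub>Y\<^esub> t \<odot>\<^bsub>Y\<^esub> z"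
    using cc tc yz(3) by (simp add: M.smult_assoc1 M.smult_r_distr)
  moreover have "t \<odot>\<^bsub>Y\<^esub> y \<oplus>\<^bsub>Y\<^esub> t \<odot>\<^bsub>Y\<^esub> z \<in> L1"
    using t yz M.submoduleE(4)[OF L1 tc yz(1)] by (intro M.submoduleE(5)[OF L1]) auto
  ultimately have "(t \<otimes>\<^bsub>R\<^esub> s) \<odot>\<^bsub>Y\<^esub> x \<in> L1" by simp
  with bspec[OF x(2) prime_compl_mult[OF p t(1) s(1)]] show False ..
qed

lemma pchain_split:
  assumes M: "module R Y" and p: "primeideal p R" and N: "submodule N R Y" and KN: "K \<subseteq> N"
  shows "pchain R p Y K n L \<Longrightarrow>
    \<exists>a b. n \<le> a + b \<and> pchain R p Y K a (L \<inter> N) \<and> pchain R p Y N b (sub_sum Y L N)"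
proof (induction n arbitrary: L)
  case 0
  interpret M: module R Y by fact
  have "submodule K R Y" "submodule L R Y" "K \<subseteq> L" using 0 by auto
  then have "pchain R p Y K 0 (L \<inter> N)" "pchain R p Y N 0 (sub_sum Y L N)"
    using M.submodule_Int[OF _ N] M.sub_sum_submodule[OF _ N] M.sub_sum_upper(2)[OF _ N] KN N by auto
  then show ?case by blast
next
  case (Suc n)
  interpret M: module R Y by fact
  obtain L1 where L1: "pchain R p Y K n L1" "pstrict R p Y L1 L" and L: "submodule L R Y"
    using Suc.prems by auto
  have sL1: "submodule L1 R Y" using pchain_submodules[OF L1(1)] by simp
  obtain a b where ab: "n \<le> a + b" "pchain R p Y K a (L1 \<inter> N)" "pchain R p Y N b (sub_sum Y L1 N)"
    using Suc.IH[OF L1(1)] by auto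
  have s: "submodule (L \<inter> N) R Y" "submodule (sub_sum Y L N) R Y"
    using M.submodule_Int[OF L N] M.sub_sum_submodule[OF L N] by auto
  have sub: "L1 \<inter> N \<subseteq> L \<inter> N" "sub_sum Y L1 N \<subseteq> sub_sum Y L N"
    using L1(2) by (auto simp: sub_sum_def pstrict_def)
  from pstrict_split[OF M p N L sL1 L1(2)] show ?case
  proof
    assume "pstrict R p Y (L1 \<inter> N) (L \<inter> N)"
    then have "pchain R p Y K (Suc a) (L \<inter> N)" using ab(2) s by auto
    then show ?thesis using pchain_mono[OF ab(3) s(2) sub(2)] ab(1)
      by (intro exI[of _ "Suc a"] exI[of _ b]) auto
  next
    assume "pstrict R p Y (sub_sum Y L1 N) (sub_sum Y L N)"
    then have "pchain R p Y N (Suc b) (sub_sum Y L N)" using ab(3) s by auto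
    then show ?thesis using pchain_mono[OF ab(2) s(1) sub(1)] ab(1)
      by (intro exI[of _ a] exI[of _ "Suc b"]) auto
  qed
qed

lemma pfinite_set: "pfinite R p Y K L \<Longrightarrow> finite {n. pchain R p Y K n L}"
  unfolding pfinite_def by (metis (mono_tags, lifting) finite_nat_set_iff_bounded_le mem_Collect_eq)

lemma pchain_le_plen: "pfinite R p Y K L \<Longrightarrow> pchain R p Y K n L \<Longrightarrow> n \<le> plen R p Y K L"
  unfolding plen_def using pfinite_set[of R p Y K L] by (intro Max_ge) auto

lemma pchain_plen:
  assumes "pfinite R p Y K L" "submodule K R Y" "submodule L R Y" "K \<subseteq> L"
  shows "pchain R p Y K (plen R p Y K L) L"
proof -
  have "pchain R p Y K 0 L" using assms by simp
  then have "{n. pchain R p Y K n L} \<noteq> {}" by blast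
  from Max_in[OF pfinite_set[OF assms(1)] this] show ?thesis unfolding plen_def by simp
qed

lemma pfinite_sub:
  assumes "pfinite R p Y K L" "submodule K R Y" "submodule N R Y" "submodule L R Y" "K \<subseteq> N" "N \<subseteq> L"
  shows "pfinite R p Y K N" "pfinite R p Y N L"
proof -
  obtain b where b: "\<And>n. pchain R p Y K n L \<Longrightarrow> n \<le> b" using assms(1) unfolding pfinite_def by auto
  show "pfinite R p Y K N"
    unfolding pfinite_def by (intro exI[of _ b] allI impI b pchain_mono[OF _ assms(4,6)])
  have "n \<le> b" if "pchain R p Y N n L" for n
  proof -
    have "pchain R p Y K 0 N" using assms by simp
    from pchain_append[OF that this] show ?thesis using b by simp
  qed
  then show "pfinite R p Y N L" unfolding pfinite_def by blast
qed

text \<open>A chain from \<open>K\<close> to \<open>N\<close> and one from \<open>N\<close> to \<open>L\<close> can be concatenated. Conversely, each step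
  of a chain from \<open>K\<close> to \<open>L\<close> survives in the intersections with \<open>N\<close> or in the sums with \<open>N\<close>.\<close>

lemma plen_add:
  assumes M: "module R Y" and p: "primeideal p R" and fin: "pfinite R p Y K L"
    and s: "submodule K R Y" "submodule N R Y" "submodule L R Y" and KN: "K \<subseteq> N" and NL: "N \<subseteq> L"
  shows "plen R p Y K L = plen R p Y K N + plen R p Y N L"
proof (rule antisym)
  interpret M: module R Y by fact
  note f = pfinite_sub[OF fin s KN NL]
  have KL: "K \<subseteq> L" using KN NL by simp
  obtain a b where ab: "plen R p Y K L \<le> a + b" "pchain R p Y K a (L \<inter> N)"
    "pchain R p Y N b (sub_sum Y L N)"
    using pchain_split[OF M p s(2) KN pchain_plen[OF fin s(1,3) KL]] by auto
  have "L \<inter> N = N" "sub_sum Y L N = L" using NL M.sub_sum_absorb[OF s(3) NL s(2)] by auto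
  then show "plen R p Y K L \<le> plen R p Y K N + plen R p Y N L"
    using ab pchain_le_plen[OF f(1), of a] pchain_le_plen[OF f(2), of b] by simp
  have "pchain R p Y K (plen R p Y N L + plen R p Y K N) L"
    by (rule pchain_append[OF pchain_plen[OF f(2) s(2,3) NL] pchain_plen[OF f(1) s(1,2) KN]])
  then show "plen R p Y K N + plen R p Y N L \<le> plen R p Y K L"
    using pchain_le_plen[OF fin] by (simp add: add.commute)
qed

lemma plen_zero_imp:
  assumes "pfinite R p Y K L" "submodule K R Y" "submodule L R Y" "K \<subseteq> L" "plen R p Y K L = 0" "x \<in> L"
  shows "\<exists>s\<in>carrier R - p. s \<odot>\<^bsub>Y\<^esub> x \<in> K"
proof (rule ccontr)
  assume "\<not> ?thesis"
  then have "pchain R p Y K (Suc 0) L" using assms unfolding pchain.simps pstrict_def by blast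
  from pchain_le_plen[OF assms(1) this] show False using assms(5) by simp
qed

lemma plen_self:
  assumes "module R Y" "submodule K R Y" "primeideal p R"
  shows "plen R p Y K K = 0" "pfinite R p Y K K"
proof -
  interpret module R Y by fact
  have *: "n = 0" if n: "pchain R p Y K n K" for n
  proof (cases n)
    case (Suc m)
    then obtain N where N: "pchain R p Y K m N" "pstrict R p Y N K" using n by auto
    have "K \<subseteq> N" using pchain_submodules[OF N(1)] by simp
    then show ?thesis using N(2) prime_compl_one[OF assms(3)] submoduleE(4)[OF assms(2)]
      unfolding pstrict_def by blast
  qed simp
  then show f: "pfinite R p Y K K" unfolding pfinite_def by auto
  have "pchain R p Y K (plen R p Y K K) K" using pchain_plen[OF f assms(2,2)] by simp
  then show "plen R p Y K K = 0" using * by simp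
qed

text \<open>A linear relation between \<open>L\<close> and \<open>L'\<close> that induces an isomorphism \<open>L/K \<cong> L'/K'\<close>. The
  isomorphisms of cohomology needed below are multivalued on cocycles, as is the connecting
  homomorphism; relations describe them without choices.\<close>

definition subquot_rel ::
    "('a, 'm) ring_scheme \<Rightarrow> ('a, 'b, 'n) module_scheme \<Rightarrow> ('a, 'c, 'k) module_scheme
      \<Rightarrow> ('b \<times> 'c) set \<Rightarrow> 'b set \<Rightarrow> 'b set \<Rightarrow> 'c set \<Rightarrow> 'c set \<Rightarrow> bool"
  where "subquot_rel R Y Y' r K L K' L' \<longleftrightarrow>
    r \<subseteq> L \<times> L' \<and> L \<subseteq> fst ` r \<and> L' \<subseteq> snd ` r \<and>
    (\<forall>x x' y y'. (x, x') \<in> r \<longrightarrow> (y, y') \<in> r \<longrightarrow> (x \<oplus>\<^bsub>Y\<^esub> y, x' \<oplus>\<^bsub>Y'\<^esub> y') \<in> r) \<and>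
    (\<forall>a x x'. a \<in> carrier R \<longrightarrow> (x, x') \<in> r \<longrightarrow> (a \<odot>\<^bsub>Y\<^esub> x, a \<odot>\<^bsub>Y'\<^esub> x') \<in> r) \<and>
    (\<forall>x x'. (x, x') \<in> r \<longrightarrow> (x \<in> K \<longleftrightarrow> x' \<in> K'))"

lemma subquot_relD:
  assumes "subquot_rel R Y Y' r K L K' L'"
  shows "r \<subseteq> L \<times> L'" "L \<subseteq> fst ` r" "L' \<subseteq> snd ` r"
    and "\<And>x x' y y'. (x, x') \<in> r \<Longrightarrow> (y, y') \<in> r \<Longrightarrow> (x \<oplus>\<^bsub>Y\<^esub> y, x' \<oplus>\<^bsub>Y'\<^esub> y') \<in> r"
    and "\<And>a x x'. a \<in> carrier R \<Longrightarrow> (x, x') \<in> r \<Longrightarrow> (a \<odot>\<^bsub>Y\<^esub> x, a \<odot>\<^bsub>Y'\<^esub> x') \<in> r"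
    and "\<And>x x'. (x, x') \<in> r \<Longrightarrow> x \<in> K \<longleftrightarrow> x' \<in> K'"
  using assms unfolding subquot_rel_def by simp_all

lemma subquot_rel_converse:
  assumes "subquot_rel R Y Y' r K L K' L'"
  shows "subquot_rel R Y' Y (r\<inverse>) K' L' K L"
proof -
  have "fst ` (r\<inverse>) = snd ` r" "snd ` (r\<inverse>) = fst ` r" by force+
  moreover have "r\<inverse> \<subseteq> L' \<times> L" using subquot_relD(1)[OF assms] by auto
  ultimately show ?thesis
    using subquot_relD(2-)[OF assms] unfolding subquot_rel_def by simp
qed

lemma subquot_rel_Image_submodule:
  assumes Y: "module R Y" and Y': "module R Y'" and r: "subquot_rel R Y Y' r K L K' L'"
    and s: "submodule K' R Y'" "submodule L' R Y'" "K' \<subseteq> L'"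
    and N: "submodule N R Y" "K \<subseteq> N"
  shows "submodule (r `` N) R Y'" "K' \<subseteq> r `` N"
proof -
  interpret Y: module R Y by fact
  interpret Y': module R Y' by fact
  have rs: "r \<subseteq> L \<times> L'" "L' \<subseteq> snd ` r" using subquot_relD(1-3)[OF r] by auto
  note radd = subquot_relD(4)[OF r] and rsm = subquot_relD(5)[OF r] and rK = subquot_relD(6)[OF r]
  show K'N: "K' \<subseteq> r `` N"
  proof
    fix x' assume x': "x' \<in> K'"
    then have "x' \<in> snd ` r" using s(3) rs(2) by auto
    then obtain x where "(x, x') \<in> r" by auto
    then show "x' \<in> r `` N" using rK x' N(2) by auto
  qed
  show "submodule (r `` N) R Y'"
    unfolding Y'.submodule_iff
  proof (intro conjI ballI)
    show "r `` N \<subseteq> carrier Y'" using rs(1) Y'.submoduleE(1)[OF s(2)] by auto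
    show "\<zero>\<^bsub>Y'\<^esub> \<in> r `` N" using K'N s(1) by (auto simp: Y'.submodule_iff)
    fix u v assume "u \<in> r `` N" "v \<in> r `` N"
    then obtain x y where *: "x \<in> N" "y \<in> N" "(x, u) \<in> r" "(y, v) \<in> r" by auto
    show "u \<oplus>\<^bsub>Y'\<^esub> v \<in> r `` N"
      by (rule ImageI[OF radd[OF *(3,4)] Y.submoduleE(5)[OF N(1) *(1,2)]])
  next
    fix a u assume a: "a \<in> carrier R" and "u \<in> r `` N"
    then obtain x where *: "x \<in> N" "(x, u) \<in> r" by auto
    show "a \<odot>\<^bsub>Y'\<^esub> u \<in> r `` N"
      by (rule ImageI[OF rsm[OF a *(2)] Y.submoduleE(4)[OF N(1) a *(1)]])
  qed
qed

lemma subquot_rel_pchain_image: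
  assumes Y: "module R Y" and Y': "module R Y'" and r: "subquot_rel R Y Y' r K L K' L'"
    and s: "submodule K' R Y'" "submodule L' R Y'" "K' \<subseteq> L'"
  shows "pchain R p Y K n N \<Longrightarrow> N \<subseteq> L \<Longrightarrow> pchain R p Y' K' n (r `` N)"
proof (induction n arbitrary: N)
  case 0
  then show ?case using subquot_rel_Image_submodule[OF Y Y' r s, of N] s(1) by auto
next
  case (Suc n)
  interpret Y: module R Y by fact
  interpret Y': module R Y' by fact
  obtain N1 where N1: "pchain R p Y K n N1" "pstrict R p Y N1 N" and sN: "submodule N R Y"
    using Suc.prems by auto
  have sN1: "submodule N1 R Y" "K \<subseteq> N1" using pchain_submodules[OF N1(1)] by auto
  have sub: "N1 \<subseteq> N" using N1(2) unfolding pstrict_def by simp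
  have IH: "pchain R p Y' K' n (r `` N1)" using Suc.IH[OF N1(1)] sub Suc.prems(2) by auto
  have rs: "r \<subseteq> L \<times> L'" "L \<subseteq> fst ` r" using subquot_relD(1-3)[OF r] by auto
  note radd = subquot_relD(4)[OF r] and rsm = subquot_relD(5)[OF r]
  obtain x where x: "x \<in> N" "\<forall>t\<in>carrier R - p. t \<odot>\<^bsub>Y\<^esub> x \<notin> N1" using N1(2) unfolding pstrict_def by auto
  have "x \<in> fst ` r" using x(1) Suc.prems(2) rs(2) by auto
  then obtain x' where x': "(x, x') \<in> r" by auto
  have "t \<odot>\<^bsub>Y'\<^esub> x' \<notin> r `` N1" if t: "t \<in> carrier R - p" for t
  proof
    assume "t \<odot>\<^bsub>Y'\<^esub> x' \<in> r `` N1"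
    then obtain y where y: "y \<in> N1" "(y, t \<odot>\<^bsub>Y'\<^esub> x') \<in> r" by auto
    have tc: "t \<in> carrier R" using t by simp
    have xc: "x \<in> carrier Y" "y \<in> carrier Y" "x' \<in> carrier Y'"
      using x y sub x' rs(1) Y.submoduleE(1)[OF sN] Y'.submoduleE(1)[OF s(2)] by auto
    have "(t \<odot>\<^bsub>Y\<^esub> x \<oplus>\<^bsub>Y\<^esub> (\<ominus>\<^bsub>R\<^esub> \<one>\<^bsub>R\<^esub>) \<odot>\<^bsub>Y\<^esub> y, t \<odot>\<^bsub>Y'\<^esub> x' \<oplus>\<^bsub>Y'\<^esub> (\<ominus>\<^bsub>R\<^esub> \<one>\<^bsub>R\<^esub>) \<odot>\<^bsub>Y'\<^esub> (t \<odot>\<^bsub>Y'\<^esub> x')) \<in> r"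
      using rsm[OF tc x'] rsm[OF _ y(2), of "\<ominus>\<^bsub>R\<^esub> \<one>\<^bsub>R\<^esub>"] by (intro radd) auto
    then have "(t \<odot>\<^bsub>Y\<^esub> x \<ominus>\<^bsub>Y\<^esub> y, \<zero>\<^bsub>Y'\<^esub>) \<in> r"
      using xc tc by (simp add: Y.smult_l_minus Y'.smult_l_minus a_minus_def Y'.M.r_neg)
    moreover have "\<zero>\<^bsub>Y'\<^esub> \<in> K'" using s(1) by (simp add: Y'.submodule_iff)
    ultimately have "t \<odot>\<^bsub>Y\<^esub> x \<ominus>\<^bsub>Y\<^esub> y \<in> N1" using subquot_relD(6)[OF r] sN1(2) by auto
    then have "(t \<odot>\<^bsub>Y\<^esub> x \<ominus>\<^bsub>Y\<^esub> y) \<oplus>\<^bsub>Y\<^esub> y \<in> N1" by (rule Y.submoduleE(5)[OF sN1(1) _ y(1)])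
    then have "t \<odot>\<^bsub>Y\<^esub> x \<in> N1" using xc tc by (simp add: a_minus_def Y.M.a_assoc Y.M.l_neg)
    then show False using x(2) t by auto
  qed
  then have "pstrict R p Y' (r `` N1) (r `` N)"
    unfolding pstrict_def using ImageI[OF x' x(1)] sub by auto
  moreover have "submodule (r `` N) R Y'"
    by (rule subquot_rel_Image_submodule(1)[OF Y Y' r s sN]) (use sN1(2) sub in simp)
  ultimately show ?case using IH by auto
qed

lemma subquot_rel_pchain_iff:
  assumes Y: "module R Y" and Y': "module R Y'" and r: "subquot_rel R Y Y' r K L K' L'"
    and s: "submodule K R Y" "submodule L R Y" "K \<subseteq> L"
    and s': "submodule K' R Y'" "submodule L' R Y'" "K' \<subseteq> L'"
  shows "pchain R p Y K n L \<longleftrightarrow> pchain R p Y' K' n L'"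
proof -
  have "r `` L = L'" "r\<inverse> `` L' = L" using subquot_relD(1-3)[OF r] by (auto; force)+
  then show ?thesis
    using subquot_rel_pchain_image[OF Y Y' r s', of p n L]
      subquot_rel_pchain_image[OF Y' Y subquot_rel_converse[OF r] s, of p n L'] by auto
qed

lemma subquot_rel_plen:
  assumes Y: "module R Y" and Y': "module R Y'" and r: "subquot_rel R Y Y' r K L K' L'"
    and s: "submodule K R Y" "submodule L R Y" "K \<subseteq> L"
    and s': "submodule K' R Y'" "submodule L' R Y'" "K' \<subseteq> L'"
  shows "plen R p Y K L = plen R p Y' K' L'"
  unfolding plen_def using subquot_rel_pchain_iff[OF assms] by auto


lemma submodule_hom_vimage_in:
  assumes Y: "module R Y" and Y': "module R Y'" and f: "f \<in> mod_hom R Y Y'"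
    and L: "submodule L R Y" and K: "submodule K R Y'"
  shows "submodule {x \<in> L. f x \<in> K} R Y"
proof -
  interpret Y: module R Y by fact
  have "{x \<in> L. f x \<in> K} = L \<inter> {x \<in> carrier Y. f x \<in> K}" using Y.submoduleE(1)[OF L] by auto
  then show ?thesis using Y.submodule_Int[OF L submodule_hom_vimage[OF Y Y' f K]] by simp
qed

text \<open>By the second isomorphism theorem \<open>f\<close> induces \<open>L / (L \<inter> f\<^sup>-\<^sup>1K) \<cong> (f(L) + K) / K\<close>.\<close>

lemma plen_hom_image:
  assumes Y: "module R Y" and Y': "module R Y'" and f: "f \<in> mod_hom R Y Y'"
    and L: "submodule L R Y" and K: "submodule K R Y'"
  shows "plen R p Y {x \<in> L. f x \<in> K} L = plen R p Y' K (sub_sum Y' (f ` L) K)"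
proof -
  interpret Y: module R Y by fact
  interpret Y': module R Y' by fact
  note fL = submodule_hom_image[OF Y Y' f L]
  have Lc: "x \<in> carrier Y" if "x \<in> L" for x using Y.submoduleE(1)[OF L] that by auto
  have Kc: "k \<in> carrier Y'" if "k \<in> K" for k using Y'.submoduleE(1)[OF K] that by auto
  have z: "\<zero>\<^bsub>Y'\<^esub> \<in> K" using K by (simp add: Y'.submodule_iff)
  let ?r = "{(x, f x \<oplus>\<^bsub>Y'\<^esub> k) | x k. x \<in> L \<and> k \<in> K}"
  have "subquot_rel R Y Y' ?r {x \<in> L. f x \<in> K} L K (sub_sum Y' (f ` L) K)"
    unfolding subquot_rel_def
  proof (intro conjI allI impI)
    show "?r \<subseteq> L \<times> sub_sum Y' (f ` L) K" "sub_sum Y' (f ` L) K \<subseteq> snd ` ?r"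
      by (force simp: sub_sum_def)+
    show "L \<subseteq> fst ` ?r" using z by force
    fix x x' y y' assume "(x, x') \<in> ?r" "(y, y') \<in> ?r"
    then obtain k l where *: "x \<in> L" "k \<in> K" "x' = f x \<oplus>\<^bsub>Y'\<^esub> k" "y \<in> L" "l \<in> K" "y' = f y \<oplus>\<^bsub>Y'\<^esub> l"
      by auto
    have "x' \<oplus>\<^bsub>Y'\<^esub> y' = f (x \<oplus>\<^bsub>Y\<^esub> y) \<oplus>\<^bsub>Y'\<^esub> (k \<oplus>\<^bsub>Y'\<^esub> l)"
      using * Lc Kc mod_hom_closed[OF f] by (simp add: mod_hom_add[OF f] Y'.M.add.m_ac)
    then show "(x \<oplus>\<^bsub>Y\<^esub> y, x' \<oplus>\<^bsub>Y'\<^esub> y') \<in> ?r"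
      using * Y.submoduleE(5)[OF L] Y'.submoduleE(5)[OF K] by auto
  next
    fix a x x' assume a: "a \<in> carrier R" and "(x, x') \<in> ?r"
    then obtain k where *: "x \<in> L" "k \<in> K" "x' = f x \<oplus>\<^bsub>Y'\<^esub> k" by auto
    have "a \<odot>\<^bsub>Y'\<^esub> x' = f (a \<odot>\<^bsub>Y\<^esub> x) \<oplus>\<^bsub>Y'\<^esub> a \<odot>\<^bsub>Y'\<^esub> k"
      using * a Lc Kc mod_hom_closed[OF f] by (simp add: mod_hom_smult[OF f] Y'.smult_r_distr)
    then show "(a \<odot>\<^bsub>Y\<^esub> x, a \<odot>\<^bsub>Y'\<^esub> x') \<in> ?r"
      using * Y.submoduleE(4)[OF L a] Y'.submoduleE(4)[OF K a] by auto
  next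
    fix x x' assume "(x, x') \<in> ?r"
    then obtain k where *: "x \<in> L" "k \<in> K" "x' = f x \<oplus>\<^bsub>Y'\<^esub> k" by auto
    have c: "f x \<in> carrier Y'" "k \<in> carrier Y'" using * Lc Kc mod_hom_closed[OF f] by auto
    have "f x = x' \<ominus>\<^bsub>Y'\<^esub> k" using *(3) c by (simp add: a_minus_def Y'.M.a_assoc Y'.M.r_neg)
    then show "x \<in> {x \<in> L. f x \<in> K} \<longleftrightarrow> x' \<in> K"
      using * Y'.submodule_diff[OF K, of x' k] Y'.submoduleE(5)[OF K, of "f x" k] by auto
  qed
  then show ?thesis
    by (rule subquot_rel_plen[OF Y Y' _ submodule_hom_vimage_in[OF Y Y' f L K] L _ K
          Y'.sub_sum_submodule[OF fL K] Y'.sub_sum_upper(2)[OF fL K]]) auto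
qed

section \<open>Primes and local rings\<close>

lemma prime_above:
  assumes R: "noetherian_ring R" "cring R" and I: "ideal I R" "I \<noteq> carrier R"
  obtains q where "primeideal q R" "I \<subseteq> q"
proof -
  interpret cring R by fact
  interpret S: module R "self_module R" using self_module_module[OF R(2)] .
  have sI: "submodule I R (self_module R)" using I(1) ideal_iff_submodule[OF R(2)] by simp
  have sub: "I \<subseteq> carrier R" using S.submoduleE(1)[OF sI] by simp
  have one: "\<one>\<^bsub>R\<^esub> \<notin> I" using ideal.one_imp_carrier[OF I(1)] I(2) by auto
  obtain x where x: "primeideal {a \<in> carrier R. a \<odot>\<^bsub>self_module R\<^esub> x \<in> I} R"
    "{a \<in> carrier R. a \<odot>\<^bsub>self_module R\<^esub> \<one>\<^bsub>R\<^esub> \<in> I} \<subseteq> {a \<in> carrier R. a \<odot>\<^bsub>self_module R\<^esub> x \<in> I}"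
    by (rule prime_colon_exists[OF R(1) S.module_axioms sI S.carrier_is_submodule, of "\<one>\<^bsub>R\<^esub>"])
      (use sub one in auto)
  have "I \<subseteq> {a \<in> carrier R. a \<odot>\<^bsub>self_module R\<^esub> \<one>\<^bsub>R\<^esub> \<in> I}" using sub by auto
  then show ?thesis using that[OF x(1)] x(2) by simp
qed

text \<open>The intersection of a chain of primes is prime: if neither \<open>a\<close> nor \<open>b\<close> lies in all of
  them, then some member of the chain contains neither. So Zorn's lemma applies, for the order
  by inclusion of complements.\<close>

lemma minimal_prime_exists:
  assumes R: "noetherian_ring R" "cring R" and I: "ideal I R" "I \<noteq> carrier R"
  obtains p where "primeideal p R" "I \<subseteq> p"
    "\<forall>q. primeideal q R \<longrightarrow> I \<subseteq> q \<longrightarrow> q \<subseteq> p \<longrightarrow> q = p"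
proof -
  interpret cring R by fact
  interpret S: module R "self_module R" using self_module_module[OF R(2)] .
  define Q where "Q = {q. primeideal q R \<and> I \<subseteq> q}"
  have Qc: "q \<subseteq> carrier R" if "q \<in> Q" for q
  proof -
    have "primeideal q R" using that by (simp add: Q_def)
    then interpret primeideal q R .
    show ?thesis using a_subset .
  qed
  let ?S = "(\<lambda>q. carrier R - q) ` Q"
  obtain q0 where "q0 \<in> Q" using prime_above[OF R I] unfolding Q_def by auto
  then have ne: "?S \<noteq> {}" by auto
  have "\<Union>C \<in> ?S" if C: "C \<noteq> {}" "subset.chain ?S C" for C
  proof -
    define D where "D = {q \<in> Q. carrier R - q \<in> C}"
    have CD: "C = (\<lambda>q. carrier R - q) ` D" using C(2) unfolding D_def pred_on.chain_def by auto
    have Dne: "D \<noteq> {}" using C(1) CD by auto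
    have Dp: "primeideal q R" if "q \<in> D" for q using that by (simp add: D_def Q_def)
    have Dchain: "q \<subseteq> q' \<or> q' \<subseteq> q" if q: "q \<in> D" "q' \<in> D" for q q'
    proof -
      have "carrier R - q \<subseteq> carrier R - q' \<or> carrier R - q' \<subseteq> carrier R - q"
      proof -
        have *: "\<forall>x\<in>C. \<forall>y\<in>C. x \<subseteq> y \<or> y \<subseteq> x" using C(2) unfolding pred_on.chain_def by blast
        have "carrier R - q \<in> C" "carrier R - q' \<in> C" using q by (auto simp: D_def)
        from bspec[OF bspec[OF * this(1)] this(2)] show ?thesis .
      qed
      moreover have "q \<subseteq> carrier R" "q' \<subseteq> carrier R" using Qc q by (auto simp: D_def)
      ultimately show ?thesis by auto
    qed
    have sub: "submodule q R (self_module R)" if "q \<in> D" for q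
    proof -
      interpret primeideal q R using Dp[OF that] .
      show ?thesis using is_ideal ideal_iff_submodule[OF R(2)] by simp
    qed
    have "ideal (\<Inter>D) R"
    proof -
      have "\<Inter>D \<subseteq> carrier R" using Dne S.submoduleE(1)[OF sub] by auto
      then have "submodule (\<Inter>D) R (self_module R)"
        using sub unfolding S.submodule_iff by auto
      then show ?thesis using ideal_iff_submodule[OF R(2)] by simp
    qed
    then have "primeideal (\<Inter>D) R"
    proof (rule primeidealI[OF _ R(2)])
      obtain q where q: "q \<in> D" using Dne by auto
      have "\<one>\<^bsub>R\<^esub> \<notin> q" using prime_compl_one[OF Dp[OF q]] by simp
      then show "carrier R \<noteq> \<Inter>D" using q one_closed by auto
      fix a b assume a: "a \<in> carrier R" and b: "b \<in> carrier R" and ab: "a \<otimes>\<^bsub>R\<^esub> b \<in> \<Inter>D"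
      show "a \<in> \<Inter>D \<or> b \<in> \<Inter>D"
      proof (rule ccontr)
        assume "\<not> ?thesis"
        then obtain q q' where q: "q \<in> D" "q' \<in> D" "a \<notin> q" "b \<notin> q'" by auto
        then obtain q'' where q'': "q'' \<in> D" "a \<notin> q''" "b \<notin> q''" using Dchain[OF q(1,2)] by auto
        have "a \<otimes>\<^bsub>R\<^esub> b \<in> carrier R - q''" using a b q'' by (intro prime_compl_mult[OF Dp]) auto
        then show False using ab q'' by auto
      qed
    qed
    moreover have "I \<subseteq> \<Inter>D" unfolding D_def Q_def by auto
    ultimately have "\<Inter>D \<in> Q" by (simp add: Q_def)
    moreover have "\<Union>C = carrier R - \<Inter>D" unfolding CD by auto
    ultimately show ?thesis by auto
  qed
  from subset_Zorn_nonempty[OF ne this] obtain T where T: "T \<in> ?S" "\<forall>X\<in>?S. T \<subseteq> X \<longrightarrow> X = T" by auto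
  then obtain p where p: "p \<in> Q" "T = carrier R - p" by auto
  have "q = p" if q: "primeideal q R" "I \<subseteq> q" "q \<subseteq> p" for q
  proof -
    have qQ: "q \<in> Q" using q by (simp add: Q_def)
    then have "carrier R - q = T" using T(2) p(2) q(3) by auto
    then show ?thesis using p Qc[OF qQ] Qc[OF p(1)] by auto
  qed
  then show ?thesis using that[of p] p(1) by (simp add: Q_def)
qed

lemma (in module) cyclic_submodule:
  assumes x: "x \<in> carrier M" shows "submodule {a \<odot>\<^bsub>M\<^esub> x | a. a \<in> carrier R} R M"
  unfolding submodule_iff
proof (intro conjI ballI)
  show "{a \<odot>\<^bsub>M\<^esub> x | a. a \<in> carrier R} \<subseteq> carrier M" using x by auto
  show "\<zero>\<^bsub>M\<^esub> \<in> {a \<odot>\<^bsub>M\<^esub> x | a. a \<in> carrier R}" using smult_l_null[OF x] R.zero_closed by force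
next
  fix u v assume "u \<in> {a \<odot>\<^bsub>M\<^esub> x | a. a \<in> carrier R}" "v \<in> {a \<odot>\<^bsub>M\<^esub> x | a. a \<in> carrier R}"
  then obtain a b where *: "a \<in> carrier R" "b \<in> carrier R" "u = a \<odot>\<^bsub>M\<^esub> x" "v = b \<odot>\<^bsub>M\<^esub> x" by auto
  then have "u \<oplus>\<^bsub>M\<^esub> v = (a \<oplus> b) \<odot>\<^bsub>M\<^esub> x" using x by (simp add: smult_l_distr)
  then show "u \<oplus>\<^bsub>M\<^esub> v \<in> {a \<odot>\<^bsub>M\<^esub> x | a. a \<in> carrier R}" using * by auto
next
  fix c u assume c: "c \<in> carrier R" and "u \<in> {a \<odot>\<^bsub>M\<^esub> x | a. a \<in> carrier R}"
  then obtain a where *: "a \<in> carrier R" "u = a \<odot>\<^bsub>M\<^esub> x" by auto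
  then have "c \<odot>\<^bsub>M\<^esub> u = (c \<otimes> a) \<odot>\<^bsub>M\<^esub> x" using x c by (simp add: smult_assoc1)
  then show "c \<odot>\<^bsub>M\<^esub> u \<in> {a \<odot>\<^bsub>M\<^esub> x | a. a \<in> carrier R}" using * c by auto
qed

definition add_cyclic ::
    "('a, 'm) ring_scheme \<Rightarrow> ('a, 'b, 'n) module_scheme \<Rightarrow> 'b set \<Rightarrow> 'b \<Rightarrow> 'b set"
  where "add_cyclic R M K x = sub_sum M K {a \<odot>\<^bsub>M\<^esub> x | a. a \<in> carrier R}"

lemma (in module) add_cyclic:
  assumes K: "submodule K R M" and x: "x \<in> carrier M"
  shows "submodule (add_cyclic R M K x) R M" "K \<subseteq> add_cyclic R M K x" "x \<in> add_cyclic R M K x"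
    and "z \<in> add_cyclic R M K x \<Longrightarrow> \<exists>k\<in>K. \<exists>a\<in>carrier R. z = k \<oplus>\<^bsub>M\<^esub> a \<odot>\<^bsub>M\<^esub> x"
    and "submodule L R M \<Longrightarrow> K \<subseteq> L \<Longrightarrow> x \<in> L \<Longrightarrow> add_cyclic R M K x \<subseteq> L"
proof -
  note c = cyclic_submodule[OF x]
  show "submodule (add_cyclic R M K x) R M" "K \<subseteq> add_cyclic R M K x"
    unfolding add_cyclic_def using sub_sum_submodule[OF K c] sub_sum_upper[OF K c] by auto
  have "x \<in> {a \<odot>\<^bsub>M\<^esub> x | a. a \<in> carrier R}" using smult_one[OF x] R.one_closed by force
  then show "x \<in> add_cyclic R M K x"
    unfolding add_cyclic_def using sub_sum_upper(2)[OF K c] by auto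
  show "z \<in> add_cyclic R M K x \<Longrightarrow> \<exists>k\<in>K. \<exists>a\<in>carrier R. z = k \<oplus>\<^bsub>M\<^esub> a \<odot>\<^bsub>M\<^esub> x"
    unfolding add_cyclic_def sub_sum_def by auto
  assume L: "submodule L R M" "K \<subseteq> L" "x \<in> L"
  show "add_cyclic R M K x \<subseteq> L"
    unfolding add_cyclic_def sub_sum_def
    using submoduleE(5)[OF L(1)] submoduleE(4)[OF L(1) _ L(3)] L(2) by auto
qed

text \<open>The subquotient is \<open>R/q\<close> with \<open>q\<close> a prime that contains \<open>I\<close>. As \<open>p\<close> is minimal over \<open>I\<close>,
  either \<open>q\<close> is not contained in \<open>p\<close> and \<open>R/q\<close> vanishes at \<open>p\<close>, or \<open>q = p\<close> and \<open>R/q\<close> becomes the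
  residue field of \<open>p\<close>.\<close>

lemma pchain_cyclic_le_one:
  assumes M: "module R Y" and p: "primeideal p R"
    and min: "\<forall>q. primeideal q R \<longrightarrow> I \<subseteq> q \<longrightarrow> q \<subseteq> p \<longrightarrow> q = p"
    and K: "submodule K R Y" and x: "x \<in> carrier Y"
    and q: "primeideal {a \<in> carrier R. a \<odot>\<^bsub>Y\<^esub> x \<in> K} R" "I \<subseteq> {a \<in> carrier R. a \<odot>\<^bsub>Y\<^esub> x \<in> K}"
    and ch: "pchain R p Y K n (add_cyclic R Y K x)"
  shows "n \<le> 1"
proof (rule ccontr)
  interpret M: module R Y by fact
  let ?q = "{a \<in> carrier R. a \<odot>\<^bsub>Y\<^esub> x \<in> K}"
  assume "\<not> n \<le> 1"
  then obtain m where m: "n = Suc (Suc m)" by (metis One_nat_def Suc_le_mono le0 not0_implies_Suc)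
  then obtain N1 where N1: "pchain R p Y K (Suc m) N1" "pstrict R p Y N1 (add_cyclic R Y K x)"
    using ch by auto
  then obtain N0 where N0: "pchain R p Y K m N0" "pstrict R p Y N0 N1" by auto
  have s1: "submodule N1 R Y" "K \<subseteq> N1" using pchain_submodules[OF N1(1)] by auto
  have s0: "K \<subseteq> N0" using pchain_submodules[OF N0(1)] by auto
  have Kc: "K \<subseteq> carrier Y" using M.submoduleE(1)[OF K] .
  have "\<exists>s\<in>carrier R - p. s \<odot>\<^bsub>Y\<^esub> x \<in> N1"
  proof (cases "?q \<subseteq> p")
    case False
    then obtain s where "s \<in> carrier R - p" "s \<odot>\<^bsub>Y\<^esub> x \<in> K" by auto
    then show ?thesis using s1(2) by auto
  next
    case True
    then have qp: "?q = p" using min q by simp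
    obtain y where y: "y \<in> N1" "\<forall>s\<in>carrier R - p. s \<odot>\<^bsub>Y\<^esub> y \<notin> N0" using N0(2) unfolding pstrict_def by auto
    have "y \<in> add_cyclic R Y K x" using N1(2) y(1) unfolding pstrict_def by auto
    from M.add_cyclic(4)[OF K x this]
    obtain k a where ka: "k \<in> K" "a \<in> carrier R" "y = k \<oplus>\<^bsub>Y\<^esub> a \<odot>\<^bsub>Y\<^esub> x"
      by (elim bexE)
    have kc: "k \<in> carrier Y" using ka Kc by auto
    have yc: "y \<in> carrier Y" using ka kc x by simp
    have "\<one>\<^bsub>R\<^esub> \<odot>\<^bsub>Y\<^esub> y \<notin> N0" using y(2) prime_compl_one[OF p] by auto
    then have "y \<notin> K" using s0 yc by auto
    then have "a \<odot>\<^bsub>Y\<^esub> x \<notin> K" using ka M.submoduleE(5)[OF K] by auto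
    then have "a \<in> carrier R - p" using ka(2) qp by auto
    moreover have "y \<ominus>\<^bsub>Y\<^esub> k \<in> N1" using y(1) ka(1) s1(2) by (intro M.submodule_diff[OF s1(1)]) auto
    moreover have "y \<ominus>\<^bsub>Y\<^esub> k = a \<odot>\<^bsub>Y\<^esub> x" using ka kc x by (simp add: M.add_diff_cancel_left)
    ultimately show ?thesis by auto
  qed
  then obtain s where s: "s \<in> carrier R - p" "s \<odot>\<^bsub>Y\<^esub> x \<in> N1" by auto
  obtain z where z: "z \<in> add_cyclic R Y K x" "\<forall>s\<in>carrier R - p. s \<odot>\<^bsub>Y\<^esub> z \<notin> N1"
    using N1(2) unfolding pstrict_def by auto
  obtain k b where kb: "k \<in> K" "b \<in> carrier R" "z = k \<oplus>\<^bsub>Y\<^esub> b \<odot>\<^bsub>Y\<^esub> x"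
    using M.add_cyclic(4)[OF K x z(1)] by (elim bexE)
  have sc: "s \<in> carrier R" "k \<in> carrier Y" using s kb Kc by auto
  have "s \<odot>\<^bsub>Y\<^esub> z = s \<odot>\<^bsub>Y\<^esub> k \<oplus>\<^bsub>Y\<^esub> b \<odot>\<^bsub>Y\<^esub> (s \<odot>\<^bsub>Y\<^esub> x)"
    using sc kb x M.R.m_comm[of s b] by (simp add: M.smult_r_distr flip: M.smult_assoc1)
  moreover have "s \<odot>\<^bsub>Y\<^esub> k \<in> N1" "b \<odot>\<^bsub>Y\<^esub> (s \<odot>\<^bsub>Y\<^esub> x) \<in> N1"
    using M.submoduleE(4)[OF s1(1)] sc kb s s1(2) by auto
  ultimately have "s \<odot>\<^bsub>Y\<^esub> z \<in> N1" using M.submoduleE(5)[OF s1(1)] by simp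
  then show False using z(2) s(1) by auto
qed

text \<open>Noetherian induction: let \<open>K1\<close> be maximal among the submodules between \<open>K\<close> and \<open>L\<close> for
  which \<open>L/K1\<close> has infinite length at \<open>p\<close>. Some \<open>(K1 : x)\<close> is a prime, and it contains \<open>I\<close>;
  adding \<open>x\<close> to \<open>K1\<close> makes the length finite, but lowers it by at most one.\<close>

lemma pfinite_if_killed:
  assumes R: "noetherian_ring R" and Y: "noeth_module R Y" and p: "primeideal p R"
    and min: "\<forall>q. primeideal q R \<longrightarrow> I \<subseteq> q \<longrightarrow> q \<subseteq> p \<longrightarrow> q = p"
    and K: "submodule K R Y" and L: "submodule L R Y" and KL: "K \<subseteq> L"
    and I: "I \<subseteq> carrier R" and kill: "\<And>a x. a \<in> I \<Longrightarrow> x \<in> L \<Longrightarrow> a \<odot>\<^bsub>Y\<^esub> x \<in> K"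
  shows "pfinite R p Y K L"
proof (rule ccontr)
  assume nf: "\<not> pfinite R p Y K L"
  have Ym: "module R Y" using Y unfolding noeth_module_def by simp
  interpret M: module R Y by fact
  let ?S = "{K'. submodule K' R Y \<and> K \<subseteq> K' \<and> K' \<subseteq> L \<and> \<not> pfinite R p Y K' L}"
  have mem: "K \<in> ?S" using K KL nf by simp
  obtain K1 where K1: "K1 \<in> ?S" "\<forall>L'\<in>?S. K1 \<subseteq> L' \<longrightarrow> L' = K1"
    by (rule noeth_moduleD[OF Y mem]) simp
  have sK1: "submodule K1 R Y" "K \<subseteq> K1" "K1 \<subseteq> L" "\<not> pfinite R p Y K1 L" using K1(1) by auto
  have "K1 \<noteq> L" using plen_self(2)[OF Ym L p] sK1(4) by auto
  then obtain x0 where x0: "x0 \<in> L" "x0 \<notin> K1" using sK1(3) by auto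
  obtain x where x: "x \<in> L" "x \<notin> K1" and q: "primeideal {a \<in> carrier R. a \<odot>\<^bsub>Y\<^esub> x \<in> K1} R"
    by (rule prime_colon_exists[OF R Ym sK1(1) L sK1(3) x0])
  have xc: "x \<in> carrier Y" using x M.submoduleE(1)[OF L] by auto
  let ?K2 = "add_cyclic R Y K1 x"
  note K2 = M.add_cyclic(1-3)[OF sK1(1) xc] M.add_cyclic(5)[OF sK1(1) xc L sK1(3) x(1)]
  have "?K2 \<notin> ?S" using K1(2) K2 x(2) by auto
  then have "pfinite R p Y ?K2 L" using K2 sK1(2) by auto
  then obtain b where b: "\<And>n. pchain R p Y ?K2 n L \<Longrightarrow> n \<le> b" unfolding pfinite_def by auto
  have "n \<le> Suc b" if n: "pchain R p Y K1 n L" for n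
  proof -
    obtain c d where cd: "n \<le> c + d" "pchain R p Y K1 c (L \<inter> ?K2)" "pchain R p Y ?K2 d (sub_sum Y L ?K2)"
      using pchain_split[OF Ym p K2(1,2) n] by auto
    have "L \<inter> ?K2 = ?K2" "sub_sum Y L ?K2 = L" using K2 M.sub_sum_absorb[OF L K2(4,1)] by auto
    then have cd': "pchain R p Y K1 c ?K2" "pchain R p Y ?K2 d L" using cd by auto
    have "I \<subseteq> {a \<in> carrier R. a \<odot>\<^bsub>Y\<^esub> x \<in> K1}" using I kill[OF _ x(1)] sK1(2) by auto
    from pchain_cyclic_le_one[OF Ym p min sK1(1) xc q this cd'(1)] b[OF cd'(2)] cd(1)
    show ?thesis by simp
  qed
  then have "pfinite R p Y K1 L" unfolding pfinite_def by auto
  then show False using sK1(4) by simp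
qed

lemma prime_contains_Int:
  assumes p: "primeideal p R" and "finite F" and "\<And>q. q \<in> F \<Longrightarrow> ideal q R"
    and "{a \<in> carrier R. \<forall>q\<in>F. a \<in> q} \<subseteq> p"
  shows "\<exists>q\<in>F. q \<subseteq> p"
  using assms(2-)
proof (induction rule: finite_induct)
  case empty
  then show ?case using prime_compl_one[OF p] by auto
next
  case (insert q F)
  interpret p: primeideal p R by fact
  show ?case
  proof (cases "q \<subseteq> p")
    case False
    then obtain b where b: "b \<in> q" "b \<notin> p" by auto
    interpret q: ideal q R using insert.prems by simp
    have bc: "b \<in> carrier R" using b(1) q.a_subset by auto
    have "a \<in> p" if a: "a \<in> carrier R" "\<forall>q\<in>F. a \<in> q" for a
    proof -
      have "a \<otimes>\<^bsub>R\<^esub> b \<in> r" if "r \<in> F" for r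
      proof -
        interpret r: ideal r R using insert.prems that by simp
        show ?thesis using a(2) that bc by (intro r.I_r_closed) auto
      qed
      moreover have "a \<otimes>\<^bsub>R\<^esub> b \<in> q" using a(1) b(1) by (rule q.I_l_closed[rotated])
      ultimately have "a \<otimes>\<^bsub>R\<^esub> b \<in> p" using insert.prems(2) a(1) bc by auto
      then show ?thesis using p.I_prime[OF a(1) bc] b(2) by simp
    qed
    then have "{a \<in> carrier R. \<forall>q\<in>F. a \<in> q} \<subseteq> p" by auto
    then show ?thesis using insert.IH insert.prems(1) by auto
  qed auto
qed

text \<open>Induction on \<open>F\<close>. If the element \<open>a\<close> found for \<open>F\<close> lies in the next prime \<open>p\<close>, add to it a
  product \<open>jc\<close> with \<open>j \<in> J - p\<close> and with \<open>c\<close> in all members of \<open>F\<close> but not in \<open>p\<close>; such a \<open>c\<close>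
  exists as the primes are incomparable.\<close>

lemma prime_avoidance:
  assumes J: "ideal J R" and "finite F" and "\<And>q. q \<in> F \<Longrightarrow> primeideal q R"
    and "\<And>q q'. q \<in> F \<Longrightarrow> q' \<in> F \<Longrightarrow> q \<subseteq> q' \<Longrightarrow> q = q'"
    and "\<And>q. q \<in> F \<Longrightarrow> \<not> J \<subseteq> q"
  shows "\<exists>a\<in>J. \<forall>q\<in>F. a \<notin> q"
  using assms(2-)
proof (induction rule: finite_induct)
  case empty
  interpret ideal J R by fact
  have "\<zero>\<^bsub>R\<^esub> \<in> J" by (rule additive_subgroup.zero_closed[OF ideal.axioms(1)[OF J]])
  then show ?case by (intro bexI[of _ "\<zero>\<^bsub>R\<^esub>"]) simp_all
next
  case (insert p F)
  interpret J: ideal J R by fact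
  interpret p: primeideal p R using insert.prems by simp
  obtain a where a: "a \<in> J" "\<forall>q\<in>F. a \<notin> q" using insert by auto
  show ?case
  proof (cases "a \<in> p")
    case True
    obtain j where j: "j \<in> J" "j \<notin> p" using insert.prems(3)[of p] by auto
    have id: "ideal q R" if "q \<in> F" for q
      using insert.prems(1)[of q] that by (simp add: primeideal_def)
    have "\<not> {a \<in> carrier R. \<forall>q\<in>F. a \<in> q} \<subseteq> p"
    proof
      assume "{a \<in> carrier R. \<forall>q\<in>F. a \<in> q} \<subseteq> p"
      from prime_contains_Int[OF p.primeideal insert.hyps(1) id this]
      obtain q where "q \<in> F" "q \<subseteq> p" by auto
      then show False using insert.prems(2)[of q p] insert.hyps(2) by auto
    qed
    then obtain c where c: "c \<in> carrier R" "\<forall>q\<in>F. c \<in> q" "c \<notin> p" by auto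
    have jc: "j \<in> carrier R" "a \<in> carrier R" using j(1) a(1) J.a_subset by auto
    let ?b = "j \<otimes>\<^bsub>R\<^esub> c"
    have b: "?b \<in> J" using j(1) c(1) by (rule J.I_r_closed)
    have "?b \<notin> p" using p.I_prime[OF jc(1) c(1)] j(2) c(3) by auto
    moreover have "?b = (a \<oplus>\<^bsub>R\<^esub> ?b) \<ominus>\<^bsub>R\<^esub> a"
      using jc c(1) by (simp add: J.a_comm[of a ?b] a_minus_def J.a_assoc J.r_neg)
    ultimately have np: "a \<oplus>\<^bsub>R\<^esub> ?b \<notin> p"
      using True p.a_closed[of "a \<oplus>\<^bsub>R\<^esub> ?b" "\<ominus>\<^bsub>R\<^esub> a"] p.a_inv_closed[of a] by (auto simp: a_minus_def)
    have nq: "a \<oplus>\<^bsub>R\<^esub> ?b \<notin> q" if q: "q \<in> F" for q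
    proof
      interpret q: primeideal q R using insert.prems q by simp
      assume 1: "a \<oplus>\<^bsub>R\<^esub> ?b \<in> q"
      have "?b \<in> q" using c(2) q jc(1) by (intro q.I_l_closed) auto
      from q.a_closed[OF 1 q.a_inv_closed[OF this]]
      have "(a \<oplus>\<^bsub>R\<^esub> ?b) \<oplus>\<^bsub>R\<^esub> (\<ominus>\<^bsub>R\<^esub> ?b) \<in> q" .
      then show False using a(2) q jc c(1) by (auto simp: J.a_assoc J.r_neg)
    qed
    have "a \<oplus>\<^bsub>R\<^esub> ?b \<in> J" using a(1) b by (rule additive_subgroup.a_closed[OF ideal.axioms(1)[OF J]])
    then show ?thesis using np nq by auto
  qed (use a in auto)
qed

definition nonzerodivisor :: "('a, 'm) ring_scheme \<Rightarrow> 'a \<Rightarrow> bool"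
  where "nonzerodivisor R a \<longleftrightarrow>
    a \<in> carrier R \<and> (\<forall>b\<in>carrier R. a \<otimes>\<^bsub>R\<^esub> b = \<zero>\<^bsub>R\<^esub> \<longrightarrow> b = \<zero>\<^bsub>R\<^esub>)"

text \<open>The maximal ones among the annihilators of nonzero elements are associated primes of \<open>R\<close>,
  and every zero divisor lies in one of them. They are finitely many by the ascending chain
  condition, so prime avoidance applies to \<open>J\<close>.\<close>

lemma nonzerodivisor_avoiding_Ass:
  assumes R: "noetherian_ring R" "cring R" and J: "ideal J R"
    and nA: "\<And>p. p \<in> Ass R (self_module R) \<Longrightarrow> \<not> J \<subseteq> p"
  shows "\<exists>a\<in>J. nonzerodivisor R a"
proof -
  interpret cring R by fact
  interpret S: module R "self_module R" using self_module_module[OF R(2)] .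
  define ann where "ann = (\<lambda>x. {a \<in> carrier R. a \<otimes>\<^bsub>R\<^esub> x = \<zero>\<^bsub>R\<^esub>})"
  define N where "N = carrier R - {\<zero>\<^bsub>R\<^esub>}"
  define X where "X = {x \<in> N. \<forall>y\<in>N. ann x \<subseteq> ann y \<longrightarrow> ann y = ann x}"
  have s0: "submodule {\<zero>\<^bsub>R\<^esub>} R (self_module R)" unfolding S.submodule_iff by auto
  have above: "\<exists>x\<in>X. primeideal (ann x) R \<and> ann x0 \<subseteq> ann x" if x0: "x0 \<in> N" for x0
  proof -
    have x0': "x0 \<in> carrier (self_module R)" "x0 \<notin> {\<zero>\<^bsub>R\<^esub>}" using x0 by (auto simp: N_def)
    have colon: "{a \<in> carrier R. a \<odot>\<^bsub>self_module R\<^esub> x \<in> {\<zero>\<^bsub>R\<^esub>}} = ann x" for x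
      by (simp add: ann_def)
    show ?thesis
    proof (rule prime_colon_exists[OF R(1) S.module_axioms s0 S.carrier_is_submodule _ x0',
          unfolded colon])
      show "{\<zero>\<^bsub>R\<^esub>} \<subseteq> carrier (self_module R)" by simp
      fix x
      assume x: "x \<in> carrier (self_module R)" "x \<notin> {\<zero>\<^bsub>R\<^esub>}" "primeideal (ann x) R"
        "\<And>y. y \<in> carrier (self_module R) \<Longrightarrow> y \<notin> {\<zero>\<^bsub>R\<^esub>} \<Longrightarrow> ann x \<subseteq> ann y \<Longrightarrow> ann y = ann x"
        "ann x0 \<subseteq> ann x"
      have "x \<in> X" using x(1,2) x(4) by (simp add: X_def N_def)
      then show ?thesis using x(3,5) by (intro bexI[of _ x]) simp_all
    qed
  qed
  have anti: "q = q'" if "q \<in> ann ` X" "q' \<in> ann ` X" "q \<subseteq> q'" for q q'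
    using that unfolding X_def by auto
  have prime: "primeideal q R" if "q \<in> ann ` X" for q
  proof -
    from that obtain x where x: "x \<in> X" "q = ann x" by auto
    then obtain y where y: "y \<in> X" "primeideal (ann y) R" "ann x \<subseteq> ann y"
      using above[of x] by (auto simp: X_def)
    then show ?thesis using anti[of "ann x" "ann y"] x by auto
  qed
  have Ass: "q \<in> Ass R (self_module R)" if "q \<in> ann ` X" for q
    using prime[OF that] that unfolding Ass_def by (auto simp: ann_def X_def N_def)
  have fin: "finite (ann ` X)"
  proof (rule ccontr)
    assume "infinite (ann ` X)"
    from infinite_countable_subset[OF this]
    obtain P :: "nat \<Rightarrow> 'a set" where P: "inj P" "range P \<subseteq> ann ` X" by (elim exE conjE)
    have PA: "P n \<in> ann ` X" for n using P(2) by auto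
    then have "\<forall>n. \<exists>x. x \<in> X \<and> P n = ann x" by blast
    from choice[OF this] obtain x where x: "\<And>n. x n \<in> X" "\<And>n. P n = ann (x n)" by auto
    \<comment> \<open>The annihilators of \<open>P 0 \<inter> \<dots> \<inter> P (n - 1)\<close> form an
      ascending chain. Where it becomes stationary, \<open>x k\<close> kills this intersection
      for \<open>n = k\<close>, which is therefore contained in \<open>P k = ann (x
      k)\<close>.\<close>
    let ?D = "\<lambda>n. {y \<in> carrier R. \<forall>a\<in>carrier R. (\<forall>i<n. a \<in> P i) \<longrightarrow> a \<otimes>\<^bsub>R\<^esub> y = \<zero>\<^bsub>R\<^esub>}"
    have sub: "submodule K R (self_module R)" if "K \<in> range ?D" for K
    proof -
      have "submodule (?D n) R (self_module R)" for n
        unfolding S.submodule_iff by (auto simp: r_distr m_lcomm)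
      then show ?thesis using that by auto
    qed
    have mem: "?D 0 \<in> range ?D" by (rule rangeI)
    obtain K where K: "K \<in> range ?D" "\<forall>L\<in>range ?D. K \<subseteq> L \<longrightarrow> L = K"
      by (rule noeth_moduleD[OF noeth_self_module[OF R(2,1)] mem sub])
    then obtain k where k: "K = ?D k" by auto
    have "?D k \<subseteq> ?D (Suc k)" by auto
    moreover have "?D (Suc k) \<in> range ?D" by (rule rangeI)
    ultimately have eq: "?D (Suc k) = ?D k" using K(2) k by simp
    have "x k \<in> carrier R" using x(1) by (simp add: X_def N_def)
    then have "x k \<in> ?D (Suc k)" using x(2)[of k] by (auto simp: ann_def)
    then have "x k \<in> ?D k" using eq by simp
    then have "{a \<in> carrier R. \<forall>q\<in>P ` {..<k}. a \<in> q} \<subseteq> P k" unfolding x(2)[of k] by (auto simp: ann_def)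
    moreover have "primeideal (P i) R" for i using prime[OF PA] .
    ultimately have "\<exists>q\<in>P ` {..<k}. q \<subseteq> P k"
      by (intro prime_contains_Int) (auto simp: primeideal_def)
    then obtain i where i: "i < k" "P i \<subseteq> P k" by auto
    have "P i = P k" by (rule anti[OF PA PA i(2)])
    then show False using P(1) i(1) by (auto simp: inj_def)
  qed
  have "\<exists>a\<in>J. \<forall>q\<in>ann ` X. a \<notin> q"
    by (rule prime_avoidance[OF J fin prime anti nA[OF Ass]])
  then obtain a where a: "a \<in> J" "\<forall>q\<in>ann ` X. a \<notin> q" by auto
  have ac: "a \<in> carrier R" using a(1) J ideal.Icarr by metis
  have "b = \<zero>\<^bsub>R\<^esub>" if b: "b \<in> carrier R" "a \<otimes>\<^bsub>R\<^esub> b = \<zero>\<^bsub>R\<^esub>" for b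
  proof (rule ccontr)
    assume "b \<noteq> \<zero>\<^bsub>R\<^esub>"
    then obtain x where "x \<in> X" "ann b \<subseteq> ann x" using above[of b] b(1) by (auto simp: N_def)
    moreover have "a \<in> ann b" using ac b(2) by (simp add: ann_def)
    ultimately show False using a(2) by auto
  qed
  then show ?thesis using a(1) ac by (auto simp: nonzerodivisor_def)
qed

lemma max_ideal:
  assumes "noetherian_local_ring R"
  shows "maximalideal (max_ideal R) R" "\<And>m. maximalideal m R \<Longrightarrow> m = max_ideal R"
proof -
  have *: "\<exists>!m. maximalideal m R" using assms unfolding noetherian_local_ring_def by simp
  show "maximalideal (max_ideal R) R" unfolding max_ideal_def using theI'[OF *] .
  then show "m = max_ideal R" if "maximalideal m R" for m using * that by auto
qed

text \<open>Otherwise the ideal of \<open>1 - a\<close> lies in a maximal ideal, which is the one that contains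
  \<open>a\<close>.\<close>

lemma one_minus_max_ideal_inverse:
  assumes R: "noetherian_local_ring R" and a: "a \<in> max_ideal R"
  obtains u where "u \<in> carrier R" "u \<otimes>\<^bsub>R\<^esub> (\<one>\<^bsub>R\<^esub> \<ominus>\<^bsub>R\<^esub> a) = \<one>\<^bsub>R\<^esub>"
proof (rule ccontr)
  assume no: "\<not> thesis"
  have R': "cring R" "noetherian_ring R" using R unfolding noetherian_local_ring_def by auto
  interpret cring R by fact
  interpret S: module R "self_module R" using self_module_module[OF R'(1)] .
  interpret m: maximalideal "max_ideal R" R using max_ideal(1)[OF R] .
  have ac: "a \<in> carrier R" using a m.Icarr by simp
  let ?J = "{u \<odot>\<^bsub>self_module R\<^esub> (\<one>\<^bsub>R\<^esub> \<ominus>\<^bsub>R\<^esub> a) | u. u \<in> carrier R}"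
  have J: "submodule ?J R (self_module R)" using ac by (intro S.cyclic_submodule) auto
  have "\<one>\<^bsub>R\<^esub> \<notin> ?J"
  proof
    assume "\<one>\<^bsub>R\<^esub> \<in> ?J"
    then obtain u where u: "u \<in> carrier R" "\<one>\<^bsub>R\<^esub> = u \<otimes>\<^bsub>R\<^esub> (\<one>\<^bsub>R\<^esub> \<ominus>\<^bsub>R\<^esub> a)" by auto
    show False using no that[OF u(1) u(2)[symmetric]] by simp
  qed
  let ?S = "{K. submodule K R (self_module R) \<and> ?J \<subseteq> K \<and> \<one>\<^bsub>R\<^esub> \<notin> K}"
  have mem: "?J \<in> ?S" using J \<open>\<one>\<^bsub>R\<^esub> \<notin> ?J\<close> by simp
  obtain K where K: "K \<in> ?S" "\<forall>L\<in>?S. K \<subseteq> L \<longrightarrow> L = K"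
    by (rule noeth_moduleD[OF noeth_self_module[OF R'] mem]) simp
  have "maximalideal K R"
  proof (rule maximalidealI)
    show "ideal K R" using K(1) ideal_iff_submodule[OF R'(1)] by simp
    show "carrier R \<noteq> K" using K(1) one_closed by auto
    fix L assume L: "ideal L R" "K \<subseteq> L" "L \<subseteq> carrier R"
    show "L = K \<or> L = carrier R"
    proof (cases "\<one>\<^bsub>R\<^esub> \<in> L")
      case True
      then show ?thesis using ideal.one_imp_carrier[OF L(1)] by simp
    next
      case False
      then have "L \<in> ?S" using L K(1) ideal_iff_submodule[OF R'(1)] by auto
      then show ?thesis using K(2) L(2) by auto
    qed
  qed
  then have "K = max_ideal R" by (rule max_ideal(2)[OF R])
  moreover have "\<one>\<^bsub>R\<^esub> \<ominus>\<^bsub>R\<^esub> a \<in> ?J"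
    using ac by (intro CollectI exI[of _ "\<one>\<^bsub>R\<^esub>"]) simp
  ultimately have "\<one>\<^bsub>R\<^esub> \<ominus>\<^bsub>R\<^esub> a \<in> max_ideal R" using K(1) by auto
  then have "(\<one>\<^bsub>R\<^esub> \<ominus>\<^bsub>R\<^esub> a) \<oplus>\<^bsub>R\<^esub> a \<in> max_ideal R" using a by (rule m.a_closed)
  then have "\<one>\<^bsub>R\<^esub> \<in> max_ideal R" using ac by (simp add: a_minus_def a_assoc l_neg)
  then show False using m.one_imp_carrier m.I_notcarr by simp
qed

text \<open>If \<open>K\<close> is not zero, it has a maximal proper submodule, and \<open>\<mm>K\<close> is contained in it.\<close>

lemma nakayama:
  assumes R: "noetherian_local_ring R" and Y: "noeth_module R Y" and K: "submodule K R Y"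
    and sub: "K \<subseteq> mod_span R Y {a \<odot>\<^bsub>Y\<^esub> x | a x. a \<in> max_ideal R \<and> x \<in> K}"
  shows "K = {\<zero>\<^bsub>Y\<^esub>}"
proof (rule ccontr)
  assume nz: "K \<noteq> {\<zero>\<^bsub>Y\<^esub>}"
  have Ym: "module R Y" using Y unfolding noeth_module_def by simp
  interpret M: module R Y by fact
  interpret m: maximalideal "max_ideal R" R using max_ideal(1)[OF R] .
  let ?S = "{L. submodule L R Y \<and> L \<subseteq> K \<and> L \<noteq> K}"
  have "submodule {\<zero>\<^bsub>Y\<^esub>} R Y" "\<zero>\<^bsub>Y\<^esub> \<in> K" using K by (auto simp: M.submodule_iff)
  then have mem: "{\<zero>\<^bsub>Y\<^esub>} \<in> ?S" using nz by auto
  obtain L where L: "L \<in> ?S" "\<forall>N\<in>?S. L \<subseteq> N \<longrightarrow> N = L"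
    by (rule noeth_moduleD[OF Y mem]) simp
  have sL: "submodule L R Y" "L \<subseteq> K" "L \<noteq> K" using L(1) by auto
  have Kc: "K \<subseteq> carrier Y" using M.submoduleE(1)[OF K] .
  have "a \<odot>\<^bsub>Y\<^esub> x \<in> L" if a: "a \<in> max_ideal R" and x: "x \<in> K" for a x
  proof (rule ccontr)
    assume n: "a \<odot>\<^bsub>Y\<^esub> x \<notin> L"
    have ac: "a \<in> carrier R" using a m.Icarr by simp
    have xc: "x \<in> carrier Y" using x Kc by auto
    have axK: "a \<odot>\<^bsub>Y\<^esub> x \<in> K" by (rule M.submoduleE(4)[OF K ac x])
    have axc: "a \<odot>\<^bsub>Y\<^esub> x \<in> carrier Y" using ac xc by simp
    let ?N = "add_cyclic R Y L (a \<odot>\<^bsub>Y\<^esub> x)"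
    note N = M.add_cyclic(1-3)[OF sL(1) axc] M.add_cyclic(5)[OF sL(1) axc K sL(2) axK]
    have "?N = K" using L(2) N n by auto
    then have "x \<in> ?N" using x by simp
    from M.add_cyclic(4)[OF sL(1) axc this]
    obtain k b where kb: "k \<in> L" "b \<in> carrier R" "x = k \<oplus>\<^bsub>Y\<^esub> b \<odot>\<^bsub>Y\<^esub> (a \<odot>\<^bsub>Y\<^esub> x)"
      by (elim bexE)
    have kc: "k \<in> carrier Y" using kb(1) sL(2) Kc by auto
    have ba: "b \<otimes>\<^bsub>R\<^esub> a \<in> max_ideal R" using a kb(2) by (rule m.I_l_closed)
    obtain u where u: "u \<in> carrier R" "u \<otimes>\<^bsub>R\<^esub> (\<one>\<^bsub>R\<^esub> \<ominus>\<^bsub>R\<^esub> b \<otimes>\<^bsub>R\<^esub> a) = \<one>\<^bsub>R\<^esub>"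
      by (rule one_minus_max_ideal_inverse[OF R ba])
    have bac: "b \<otimes>\<^bsub>R\<^esub> a \<in> carrier R" using kb(2) ac by simp
    have "(\<one>\<^bsub>R\<^esub> \<ominus>\<^bsub>R\<^esub> b \<otimes>\<^bsub>R\<^esub> a) \<odot>\<^bsub>Y\<^esub> x = x \<ominus>\<^bsub>Y\<^esub> b \<odot>\<^bsub>Y\<^esub> (a \<odot>\<^bsub>Y\<^esub> x)"
      using xc ac kb(2) bac
      by (simp add: a_minus_def M.smult_l_distr M.smult_l_minus M.smult_assoc1)
    also have "\<dots> = k"
    proof -
      have "b \<odot>\<^bsub>Y\<^esub> (a \<odot>\<^bsub>Y\<^esub> x) \<in> carrier Y" using axc kb(2) by simp
      then have "(k \<oplus>\<^bsub>Y\<^esub> b \<odot>\<^bsub>Y\<^esub> (a \<odot>\<^bsub>Y\<^esub> x)) \<ominus>\<^bsub>Y\<^esub> b \<odot>\<^bsub>Y\<^esub> (a \<odot>\<^bsub>Y\<^esub> x) = k"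
        using kc by (simp add: a_minus_def M.M.a_assoc M.M.r_neg)
      then show ?thesis by (simp flip: kb(3))
    qed
    finally have "u \<odot>\<^bsub>Y\<^esub> ((\<one>\<^bsub>R\<^esub> \<ominus>\<^bsub>R\<^esub> b \<otimes>\<^bsub>R\<^esub> a) \<odot>\<^bsub>Y\<^esub> x) = u \<odot>\<^bsub>Y\<^esub> k" by simp
    moreover have "u \<odot>\<^bsub>Y\<^esub> ((\<one>\<^bsub>R\<^esub> \<ominus>\<^bsub>R\<^esub> b \<otimes>\<^bsub>R\<^esub> a) \<odot>\<^bsub>Y\<^esub> x) = x"
      using u xc bac by (simp flip: M.smult_assoc1)
    ultimately have "x \<in> L" using M.submoduleE(4)[OF sL(1) u(1) kb(1)] by simp
    then have "a \<odot>\<^bsub>Y\<^esub> x \<in> L" by (rule M.submoduleE(4)[OF sL(1) ac])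
    then show False using n by simp
  qed
  then have "mod_span R Y {a \<odot>\<^bsub>Y\<^esub> x | a x. a \<in> max_ideal R \<and> x \<in> K} \<subseteq> L"
    by (intro mod_span_least[OF sL(1)]) auto
  then show False using sub sL by auto
qed

section \<open>Cohomology of a two-periodic complex of free modules\<close>

lemma rpow_module: "cring R \<Longrightarrow> module R (rpow R n)"
  by (rule free_on_module)

text \<open>The exact sequence \<open>\<dots> \<rightarrow> R\<^sup>n \<rightarrow> R\<^sup>m \<rightarrow> R\<^sup>n \<rightarrow> R\<^sup>m \<rightarrow> \<dots>\<close> with maps \<open>A\<close> and \<open>B\<close> in turn. Its symmetry
  under exchanging the two maps lets every statement about degree \<open>0\<close> be used in degree \<open>1\<close>.\<close>

locale exact_pair =
  fixes R :: "('a, 'm) ring_scheme" and m n :: nat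
    and A B :: "(nat \<Rightarrow> 'a) \<Rightarrow> (nat \<Rightarrow> 'a)"
  assumes cring: "cring R"
    and A: "A \<in> mod_hom R (rpow R n) (rpow R m)"
    and B: "B \<in> mod_hom R (rpow R m) (rpow R n)"
    and im_A: "A ` carrier (rpow R n) = a_kernel (rpow R m) (rpow R n) B"
    and im_B: "B ` carrier (rpow R m) = a_kernel (rpow R n) (rpow R m) A"

lemma exact_pair_swap: "exact_pair R m n A B \<Longrightarrow> exact_pair R n m B A"
  unfolding exact_pair_def by simp

context exact_pair
begin

lemma AB: "v \<in> carrier (rpow R m) \<Longrightarrow> A (B v) = \<zero>\<^bsub>rpow R m\<^esub>"
  using im_B by (auto simp: a_kernel_iff)

lemma BA: "v \<in> carrier (rpow R n) \<Longrightarrow> B (A v) = \<zero>\<^bsub>rpow R n\<^esub>"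
  using im_A by (auto simp: a_kernel_iff)

end

text \<open>Degree-\<open>0\<close> cocycles and coboundaries of the complex \<open>Hom(-, X)\<close>; for degree \<open>1\<close> exchange
  \<open>m\<close> with \<open>n\<close> and \<open>A\<close> with \<open>B\<close>.\<close>

definition cocycles ::
    "('a, 'm) ring_scheme \<Rightarrow> nat \<Rightarrow> nat \<Rightarrow> ((nat \<Rightarrow> 'a) \<Rightarrow> (nat \<Rightarrow> 'a)) \<Rightarrow> ('a, 'b, 'k) module_scheme
      \<Rightarrow> ((nat \<Rightarrow> 'a) \<Rightarrow> 'b) set"
  where "cocycles R m n A X =
    {f \<in> carrier (hom_module R (rpow R m) X). \<forall>v\<in>carrier (rpow R n). f (A v) = \<zero>\<^bsub>X\<^esub>}"

definition coboundaries ::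
    "('a, 'm) ring_scheme \<Rightarrow> nat \<Rightarrow> nat \<Rightarrow> ((nat \<Rightarrow> 'a) \<Rightarrow> (nat \<Rightarrow> 'a)) \<Rightarrow> ('a, 'b, 'k) module_scheme
      \<Rightarrow> ((nat \<Rightarrow> 'a) \<Rightarrow> 'b) set"
  where "coboundaries R m n B X =
    {f \<in> carrier (hom_module R (rpow R m) X).
      \<exists>g\<in>mod_hom R (rpow R n) X. \<forall>v\<in>carrier (rpow R m). f v = g (B v)}"

lemma hom_module_add_apply:
  "v \<in> carrier P \<Longrightarrow> (f \<oplus>\<^bsub>hom_module R P X\<^esub> g) v = f v \<oplus>\<^bsub>X\<^esub> g v"
  by (simp add: hom_module_simps)

lemma hom_module_smult_apply:
  "v \<in> carrier P \<Longrightarrow> (a \<odot>\<^bsub>hom_module R P X\<^esub> f) v = a \<odot>\<^bsub>X\<^esub> f v"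
  by (simp add: hom_module_simps)

lemma hom_module_zero_apply: "v \<in> carrier P \<Longrightarrow> \<zero>\<^bsub>hom_module R P X\<^esub> v = \<zero>\<^bsub>X\<^esub>"
  by (simp add: hom_module_simps)

lemmas hom_module_apply = hom_module_add_apply hom_module_smult_apply hom_module_zero_apply

lemma hom_module_hom: "f \<in> carrier (hom_module R P X) \<Longrightarrow> f \<in> mod_hom R P X"
  by (simp add: hom_module_simps)

lemma hom_module_closed:
  "f \<in> carrier (hom_module R P X) \<Longrightarrow> v \<in> carrier P \<Longrightarrow> f v \<in> carrier X"
  by (rule mod_hom_closed[OF hom_module_hom])

lemma cocycles_iff:
  "f \<in> cocycles R m n A X \<longleftrightarrow>
    f \<in> carrier (hom_module R (rpow R m) X) \<and> (\<forall>v\<in>carrier (rpow R n). f (A v) = \<zero>\<^bsub>X\<^esub>)"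
  by (simp add: cocycles_def)

lemma coboundaries_iff:
  "f \<in> coboundaries R m n B X \<longleftrightarrow> f \<in> carrier (hom_module R (rpow R m) X) \<and>
    (\<exists>g\<in>mod_hom R (rpow R n) X. \<forall>v\<in>carrier (rpow R m). f v = g (B v))"
  by (simp add: coboundaries_def)

text \<open>The map \<open>Hom(P, f)\<close>.\<close>

definition hom_push ::
    "('a, 'c, 'l) module_scheme \<Rightarrow> ('b \<Rightarrow> 'd) \<Rightarrow> ('c \<Rightarrow> 'b) \<Rightarrow> ('c \<Rightarrow> 'd)"
  where "hom_push P f z = (\<lambda>v\<in>carrier P. f (z v))"

lemma hom_push_hom:
  assumes P: "module R P" and f: "f \<in> mod_hom R X Y"
  shows "hom_push P f \<in> mod_hom R (hom_module R P X) (hom_module R P Y)"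
proof (rule mod_homI)
  show "hom_push P f z \<in> carrier (hom_module R P Y)" if "z \<in> carrier (hom_module R P X)" for z
    unfolding hom_push_def by (rule restrict_mod_hom[OF P mod_hom_comp[OF hom_module_hom[OF that] f]])
qed (auto simp: hom_push_def hom_module_simps(3,4) fun_eq_iff mod_hom_add[OF f] mod_hom_smult[OF f]
    hom_module_closed)

context exact_pair
begin

lemma mods: "module R (rpow R m)" "module R (rpow R n)"
  by (rule rpow_module[OF cring])+

lemma Ac: "v \<in> carrier (rpow R n) \<Longrightarrow> A v \<in> carrier (rpow R m)"
  by (rule mod_hom_closed[OF A])

lemma Bc: "v \<in> carrier (rpow R m) \<Longrightarrow> B v \<in> carrier (rpow R n)"
  by (rule mod_hom_closed[OF B])

lemma cocycles_submodule:
  assumes X: "module R X"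
  shows "submodule (cocycles R m n A X) R (hom_module R (rpow R m) X)"
proof -
  interpret X: module R X by fact
  interpret H: module R "hom_module R (rpow R m) X" by (rule hom_module_module[OF mods(1) X])
  show ?thesis
    unfolding H.submodule_iff cocycles_def
    by (auto simp: hom_module_apply Ac)
qed

lemma coboundaries_submodule:
  assumes X: "module R X"
  shows "submodule (coboundaries R m n B X) R (hom_module R (rpow R m) X)"
proof -
  interpret X: module R X by fact
  interpret H: module R "hom_module R (rpow R m) X" by (rule hom_module_module[OF mods(1) X])
  show ?thesis
    unfolding H.submodule_iff
  proof (intro conjI ballI)
    show "coboundaries R m n B X \<subseteq> carrier (hom_module R (rpow R m) X)"
      by (auto simp: coboundaries_def)
    show "\<zero>\<^bsub>hom_module R (rpow R m) X\<^esub> \<in> coboundaries R m n B X"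
      unfolding coboundaries_iff
      by (intro conjI bexI[OF _ mod_hom_zero_fun[OF X]]) (auto simp: hom_module_apply)
  next
    fix f f' assume f: "f \<in> coboundaries R m n B X" and f': "f' \<in> coboundaries R m n B X"
    obtain g where g: "g \<in> mod_hom R (rpow R n) X" "\<forall>v\<in>carrier (rpow R m). f v = g (B v)"
      using f by (auto simp: coboundaries_iff)
    obtain g' where g': "g' \<in> mod_hom R (rpow R n) X" "\<forall>v\<in>carrier (rpow R m). f' v = g' (B v)"
      using f' by (auto simp: coboundaries_iff)
    show "f \<oplus>\<^bsub>hom_module R (rpow R m) X\<^esub> f' \<in> coboundaries R m n B X"
      unfolding coboundaries_iff
      by (intro conjI bexI[OF _ mod_hom_plus[OF X g(1) g'(1)]])
        (use f f' g g' in \<open>auto simp: coboundaries_iff hom_module_apply\<close>)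
  next
    fix a f assume a: "a \<in> carrier R" and f: "f \<in> coboundaries R m n B X"
    obtain g where g: "g \<in> mod_hom R (rpow R n) X" "\<forall>v\<in>carrier (rpow R m). f v = g (B v)"
      using f by (auto simp: coboundaries_iff)
    show "a \<odot>\<^bsub>hom_module R (rpow R m) X\<^esub> f \<in> coboundaries R m n B X"
      unfolding coboundaries_iff
      by (intro conjI bexI[OF _ mod_hom_scale[OF X g(1) a]])
        (use f g a in \<open>auto simp: coboundaries_iff hom_module_apply\<close>)
  qed
qed

lemma coboundaries_le_cocycles:
  assumes X: "module R X"
  shows "coboundaries R m n B X \<subseteq> cocycles R m n A X"
proof
  fix f assume f: "f \<in> coboundaries R m n B X"
  then obtain g where g: "g \<in> mod_hom R (rpow R n) X" "\<forall>v\<in>carrier (rpow R m). f v = g (B v)"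
    by (auto simp: coboundaries_iff)
  have "f (A v) = \<zero>\<^bsub>X\<^esub>" if "v \<in> carrier (rpow R n)" for v
    using g(2) Ac[OF that] BA[OF that] mod_hom_zero[OF mods(2) X g(1)] by simp
  then show "f \<in> cocycles R m n A X" using f by (simp add: cocycles_iff coboundaries_iff)
qed

end

text \<open>The length at \<open>p\<close> of the degree-\<open>0\<close> cohomology with coefficients in \<open>X\<close>.\<close>

definition hlen ::
    "('a, 'm) ring_scheme \<Rightarrow> 'a set \<Rightarrow> nat \<Rightarrow> nat \<Rightarrow> ((nat \<Rightarrow> 'a) \<Rightarrow> (nat \<Rightarrow> 'a))
      \<Rightarrow> ((nat \<Rightarrow> 'a) \<Rightarrow> (nat \<Rightarrow> 'a)) \<Rightarrow> ('a, 'b, 'k) module_scheme \<Rightarrow> nat"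
  where "hlen R p m n A B X =
    plen R p (hom_module R (rpow R m) X) (coboundaries R m n B X) (cocycles R m n A X)"

definition hfinite ::
    "('a, 'm) ring_scheme \<Rightarrow> 'a set \<Rightarrow> nat \<Rightarrow> nat \<Rightarrow> ((nat \<Rightarrow> 'a) \<Rightarrow> (nat \<Rightarrow> 'a))
      \<Rightarrow> ((nat \<Rightarrow> 'a) \<Rightarrow> (nat \<Rightarrow> 'a)) \<Rightarrow> ('a, 'b, 'k) module_scheme \<Rightarrow> bool"
  where "hfinite R p m n A B X =
    pfinite R p (hom_module R (rpow R m) X) (coboundaries R m n B X) (cocycles R m n A X)"

locale exact_pair_ses = exact_pair R m n A B
  for R :: "('a, 'm) ring_scheme" and m n A B +
  fixes X' :: "('a, 'b, 'k) module_scheme" and X :: "('a, 'c, 'l) module_scheme"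
    and X'' :: "('a, 'd, 'h) module_scheme" and i :: "'b \<Rightarrow> 'c" and q :: "'c \<Rightarrow> 'd"
  assumes X': "module R X'" and X: "module R X" and X'': "module R X''"
    and i: "i \<in> mod_hom R X' X" and q: "q \<in> mod_hom R X X''"
    and inj: "inj_on i (carrier X')" and im_i: "i ` carrier X' = a_kernel X X'' q"
    and surj: "q ` carrier X = carrier X''"

lemma exact_pair_ses_swap:
  "exact_pair_ses R m n A B X' X X'' i q \<Longrightarrow> exact_pair_ses R n m B A X' X X'' i q"
  unfolding exact_pair_ses_def by (simp add: exact_pair_swap)

context exact_pair_ses
begin

abbreviation "H' \<equiv> hom_module R (rpow R m) X'"
abbreviation "H \<equiv> hom_module R (rpow R m) X"
abbreviation "H'' \<equiv> hom_module R (rpow R m) X''"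

abbreviation "push_i \<equiv> hom_push (rpow R m) i"
abbreviation "push_q \<equiv> hom_push (rpow R m) q"

text \<open>On cohomology, \<open>U\<close> represents the image of \<open>H(X') \<rightarrow> H(X)\<close>, \<open>V\<close> the image of \<open>H(X) \<rightarrow>
  H(X'')\<close>, and \<open>W\<close> the kernel of \<open>H(X') \<rightarrow> H(X)\<close>.\<close>

definition "U = sub_sum H (push_i ` cocycles R m n A X') (coboundaries R m n B X)"
definition "V = sub_sum H'' (push_q ` cocycles R m n A X) (coboundaries R m n B X'')"
definition "W = {z \<in> cocycles R m n A X'. push_i z \<in> coboundaries R m n B X}"

lemma Hm: "module R H'" "module R H" "module R H''"
  by (rule hom_module_module[OF mods(1) X'] hom_module_module[OF mods(1) X]
      hom_module_module[OF mods(1) X''])+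

lemma push: "push_i \<in> mod_hom R H' H" "push_q \<in> mod_hom R H H''"
  by (rule hom_push_hom[OF mods(1) i] hom_push_hom[OF mods(1) q])+

lemma X'm: "x \<in> carrier X' \<Longrightarrow> i x \<in> carrier X" by (rule mod_hom_closed[OF i])
lemma Xm: "x \<in> carrier X \<Longrightarrow> q x \<in> carrier X''" by (rule mod_hom_closed[OF q])

lemma qi: "x \<in> carrier X' \<Longrightarrow> q (i x) = \<zero>\<^bsub>X''\<^esub>"
  using im_i by (auto simp: a_kernel_iff)

lemma i_eq_zero: "x \<in> carrier X' \<Longrightarrow> i x = \<zero>\<^bsub>X\<^esub> \<Longrightarrow> x = \<zero>\<^bsub>X'\<^esub>"
proof -
  interpret X': module R X' by (rule X')
  assume "x \<in> carrier X'" "i x = \<zero>\<^bsub>X\<^esub>"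
  then show ?thesis using inj mod_hom_zero[OF X' X i] by (metis X'.zero_closed inj_onD)
qed

lemma lift_q:
  assumes "f \<in> mod_hom R (rpow R k) X''"
  obtains g where "g \<in> mod_hom R (rpow R k) X" "\<And>v. v \<in> carrier (rpow R k) \<Longrightarrow> q (g v) = f v"
  by (rule free_on_projective[OF X X'' q assms]) (use surj mod_hom_closed[OF assms] in auto)

lemma lift_i:
  assumes "f \<in> mod_hom R (rpow R k) X" "\<And>v. v \<in> carrier (rpow R k) \<Longrightarrow> q (f v) = \<zero>\<^bsub>X''\<^esub>"
  obtains g where "g \<in> mod_hom R (rpow R k) X'" "\<And>v. v \<in> carrier (rpow R k) \<Longrightarrow> i (g v) = f v"
  by (rule free_on_projective[OF X' X i assms(1)]) (use im_i assms mod_hom_closed[OF assms(1)] in \<open>auto simp: a_kernel_iff\<close>)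

lemma push_cocycles:
  "z \<in> cocycles R m n A X' \<Longrightarrow> push_i z \<in> cocycles R m n A X"
  "f \<in> cocycles R m n A X \<Longrightarrow> push_q f \<in> cocycles R m n A X''"
  using mod_hom_closed[OF push(1)] mod_hom_closed[OF push(2)]
  by (auto simp: cocycles_iff hom_push_def Ac mod_hom_zero[OF X' X i] mod_hom_zero[OF X X'' q])

lemma push_i_coboundaries:
  assumes "f \<in> coboundaries R m n B X'" shows "push_i f \<in> coboundaries R m n B X"
proof -
  obtain g where g: "g \<in> mod_hom R (rpow R n) X'" "\<forall>v\<in>carrier (rpow R m). f v = g (B v)"
    and f: "f \<in> carrier H'" using assms by (auto simp: coboundaries_iff)
  show ?thesis
    unfolding coboundaries_iff using mod_hom_closed[OF push(1) f] g(2)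
    by (intro conjI bexI[OF _ mod_hom_comp[OF g(1) i]]) (auto simp: hom_push_def)
qed

lemma mem_W:
  "z \<in> W \<longleftrightarrow> z \<in> cocycles R m n A X' \<and>
    (\<exists>g\<in>mod_hom R (rpow R n) X. \<forall>v\<in>carrier (rpow R m). i (z v) = g (B v))"
  using mod_hom_closed[OF push(1), of z]
  by (auto simp: W_def coboundaries_iff cocycles_iff hom_push_def)

lemma mem_V:
  "f \<in> V \<longleftrightarrow> f \<in> carrier H'' \<and> (\<exists>c\<in>cocycles R m n A X. \<exists>b\<in>mod_hom R (rpow R n) X''.
    \<forall>v\<in>carrier (rpow R m). f v = q (c v) \<oplus>\<^bsub>X''\<^esub> b (B v))"
proof
  interpret H'': module R H'' by (rule Hm(3))
  assume "f \<in> V"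
  then obtain c d where cd: "c \<in> cocycles R m n A X" "d \<in> coboundaries R m n B X''"
    "f = push_q c \<oplus>\<^bsub>H''\<^esub> d" unfolding V_def sub_sum_def by auto
  then show "f \<in> carrier H'' \<and> (\<exists>c\<in>cocycles R m n A X. \<exists>b\<in>mod_hom R (rpow R n) X''.
    \<forall>v\<in>carrier (rpow R m). f v = q (c v) \<oplus>\<^bsub>X''\<^esub> b (B v))"
    using push_cocycles(2)[OF cd(1)]
    by (fastforce simp: cocycles_iff coboundaries_iff hom_module_apply hom_push_def)
next
  interpret H'': module R H'' by (rule Hm(3))
  assume "f \<in> carrier H'' \<and> (\<exists>c\<in>cocycles R m n A X. \<exists>b\<in>mod_hom R (rpow R n) X''.
    \<forall>v\<in>carrier (rpow R m). f v = q (c v) \<oplus>\<^bsub>X''\<^esub> b (B v))"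
  then obtain c b where f: "f \<in> carrier H''" and c: "c \<in> cocycles R m n A X"
    and b: "b \<in> mod_hom R (rpow R n) X''" "\<forall>v\<in>carrier (rpow R m). f v = q (c v) \<oplus>\<^bsub>X''\<^esub> b (B v)"
    by auto
  let ?d = "\<lambda>v\<in>carrier (rpow R m). b (B v)"
  have d: "?d \<in> coboundaries R m n B X''"
    unfolding coboundaries_iff using restrict_mod_hom[OF mods(1) mod_hom_comp[OF B b(1)]] b(1) by auto
  have "f = push_q c \<oplus>\<^bsub>H''\<^esub> ?d"
    using f b(2) by (auto simp: hom_module_simps hom_push_def extensional_def fun_eq_iff)
  then show "f \<in> V" unfolding V_def sub_sum_def using c d by blast
qed

lemma V_submodule: "submodule V R H''" "coboundaries R m n B X'' \<subseteq> V" "V \<subseteq> cocycles R m n A X''"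
proof -
  interpret H'': module R H'' by (rule Hm(3))
  note s = submodule_hom_image[OF Hm(2,3) push(2) cocycles_submodule[OF X]] coboundaries_submodule[OF X'']
  show "submodule V R H''" "coboundaries R m n B X'' \<subseteq> V"
    unfolding V_def by (rule H''.sub_sum_submodule[OF s] H''.sub_sum_upper(2)[OF s])+
  show "V \<subseteq> cocycles R m n A X''"
    unfolding V_def sub_sum_def
    using H''.submoduleE(5)[OF cocycles_submodule[OF X'']] push_cocycles(2) coboundaries_le_cocycles[OF X'']
    by auto
qed

lemma U_submodule: "submodule U R H" "coboundaries R m n B X \<subseteq> U" "U \<subseteq> cocycles R m n A X"
proof -
  interpret H: module R H by (rule Hm(2))
  note s = submodule_hom_image[OF Hm(1,2) push(1) cocycles_submodule[OF X']] coboundaries_submodule[OF X]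
  show "submodule U R H" "coboundaries R m n B X \<subseteq> U"
    unfolding U_def by (rule H.sub_sum_submodule[OF s] H.sub_sum_upper(2)[OF s])+
  show "U \<subseteq> cocycles R m n A X"
    unfolding U_def sub_sum_def
    using H.submoduleE(5)[OF cocycles_submodule[OF X]] push_cocycles(1) coboundaries_le_cocycles[OF X]
    by auto
qed

lemma W_submodule: "submodule W R H'" "W \<subseteq> cocycles R m n A X'" "coboundaries R m n B X' \<subseteq> W"
proof -
  show "submodule W R H'"
    unfolding W_def
    by (rule submodule_hom_vimage_in[OF Hm(1,2) push(1) cocycles_submodule[OF X'] coboundaries_submodule[OF X]])
  show "W \<subseteq> cocycles R m n A X'" "coboundaries R m n B X' \<subseteq> W"
    using push_i_coboundaries coboundaries_le_cocycles[OF X'] by (auto simp: W_def)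
qed

end

section \<open>The exact hexagon of a short exact sequence\<close>

context exact_pair_ses
begin

lemma plen_U:
  "plen R p H (coboundaries R m n B X) U = plen R p H' W (cocycles R m n A X')"
  unfolding U_def W_def
  by (rule plen_hom_image[OF Hm(1,2) push(1) cocycles_submodule[OF X'] coboundaries_submodule[OF X], symmetric])

text \<open>Exactness of \<open>H(X') \<rightarrow> H(X) \<rightarrow> H(X'')\<close>: if \<open>qf = hB\<close>, lift \<open>h\<close> along \<open>q\<close> to \<open>k\<close>; then \<open>f -
  kB\<close> is a cocycle with values in the image of \<open>i\<close>.\<close>

lemma U_eq_kernel: "{f \<in> cocycles R m n A X. push_q f \<in> coboundaries R m n B X''} = U"
proof (rule subset_antisym; rule subsetI)
  interpret X'': module R X'' by (rule X'')
  interpret X: module R X by (rule X)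
  fix f assume "f \<in> {f \<in> cocycles R m n A X. push_q f \<in> coboundaries R m n B X''}"
  then obtain h where f: "f \<in> cocycles R m n A X" and h: "h \<in> mod_hom R (rpow R n) X''"
    "\<forall>v\<in>carrier (rpow R m). q (f v) = h (B v)"
    by (auto simp: coboundaries_iff hom_push_def)
  have fH: "f \<in> carrier H" using f by (simp add: cocycles_iff)
  have fc: "f v \<in> carrier X" if "v \<in> carrier (rpow R m)" for v using hom_module_closed[OF fH that] .
  obtain k where k: "k \<in> mod_hom R (rpow R n) X" "\<And>v. v \<in> carrier (rpow R n) \<Longrightarrow> q (k v) = h v"
    using lift_q[OF h(1)] by metis
  have kc: "k (B v) \<in> carrier X" if "v \<in> carrier (rpow R m)" for v
    using mod_hom_closed[OF k(1) Bc[OF that]] .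
  have dh: "(\<lambda>v. f v \<ominus>\<^bsub>X\<^esub> k (B v)) \<in> mod_hom R (rpow R m) X"
    by (rule mod_hom_minus[OF mods(1) X hom_module_hom[OF fH] mod_hom_comp[OF B k(1)]])
  have "q (f v \<ominus>\<^bsub>X\<^esub> k (B v)) = \<zero>\<^bsub>X''\<^esub>" if v: "v \<in> carrier (rpow R m)" for v
    using mod_hom_diff[OF X X'' q fc[OF v] kc[OF v]] h(2) v k(2)[OF Bc[OF v]] Xm[OF fc[OF v]]
    by (simp add: X''.diff_eq_zero_iff)
  from lift_i[OF dh this] obtain z where z: "z \<in> mod_hom R (rpow R m) X'"
    "\<And>v. v \<in> carrier (rpow R m) \<Longrightarrow> i (z v) = f v \<ominus>\<^bsub>X\<^esub> k (B v)" by metis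
  let ?z = "restrict z (carrier (rpow R m))" and ?k = "\<lambda>v\<in>carrier (rpow R m). k (B v)"
  have "?z (A v) = \<zero>\<^bsub>X'\<^esub>" if v: "v \<in> carrier (rpow R n)" for v
  proof -
    have "i (z (A v)) = \<zero>\<^bsub>X\<^esub>"
      using z(2)[OF Ac[OF v]] f v BA[OF v] mod_hom_zero[OF mods(2) X k(1)]
      by (simp add: cocycles_iff X.diff_eq_zero_iff)
    then show ?thesis using i_eq_zero[OF mod_hom_closed[OF z(1) Ac[OF v]]] Ac[OF v] by simp
  qed
  then have "?z \<in> cocycles R m n A X'"
    using restrict_mod_hom[OF mods(1) z(1)] by (simp add: cocycles_iff)
  moreover have "?k \<in> coboundaries R m n B X"
    unfolding coboundaries_iff using restrict_mod_hom[OF mods(1) mod_hom_comp[OF B k(1)]] k(1) by auto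
  moreover have "f = push_i ?z \<oplus>\<^bsub>H\<^esub> ?k"
    using fH z(2) fc kc
    by (auto simp: hom_module_simps hom_push_def extensional_def fun_eq_iff X.diff_add_cancel)
  ultimately show "f \<in> U" unfolding U_def sub_sum_def by blast
next
  interpret X'': module R X'' by (rule X'')
  interpret X: module R X by (rule X)
  fix f assume fU: "f \<in> U"
  then have f: "f \<in> cocycles R m n A X" using U_submodule(3) by auto
  obtain z c where z: "z \<in> cocycles R m n A X'" and c: "c \<in> coboundaries R m n B X"
    and eq: "f = push_i z \<oplus>\<^bsub>H\<^esub> c" using fU unfolding U_def sub_sum_def by auto
  obtain k where k: "k \<in> mod_hom R (rpow R n) X" "\<forall>v\<in>carrier (rpow R m). c v = k (B v)"
    using c by (auto simp: coboundaries_iff)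
  have "q (f v) = q (k (B v))" if v: "v \<in> carrier (rpow R m)" for v
  proof -
    have "z v \<in> carrier X'" "k (B v) \<in> carrier X"
      using z v mod_hom_closed[OF k(1) Bc[OF v]] by (auto simp: cocycles_iff hom_module_closed)
    then show ?thesis using k(2) v qi X'm Xm
      by (simp add: eq hom_module_apply hom_push_def mod_hom_add[OF q])
  qed
  then show "f \<in> {f \<in> cocycles R m n A X. push_q f \<in> coboundaries R m n B X''}"
    using f push_cocycles(2)[OF f] mod_hom_comp[OF k(1) q]
    by (auto simp: coboundaries_iff cocycles_iff hom_push_def)
qed

lemma plen_V:
  "plen R p H U (cocycles R m n A X) = plen R p H'' (coboundaries R m n B X'') V"
  unfolding V_def U_eq_kernel[symmetric]
  by (rule plen_hom_image[OF Hm(2,3) push(2) cocycles_submodule[OF X] coboundaries_submodule[OF X'']])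

text \<open>The connecting homomorphism: lift \<open>f''\<close> along \<open>q\<close> to \<open>f\<close>; then \<open>fA\<close> takes values in the
  image of \<open>i\<close>.\<close>

definition "rD = {(f'', z). f'' \<in> cocycles R m n A X'' \<and> z \<in> carrier (hom_module R (rpow R n) X') \<and>
    (\<exists>f\<in>mod_hom R (rpow R m) X. (\<forall>v\<in>carrier (rpow R m). q (f v) = f'' v) \<and>
       (\<forall>w\<in>carrier (rpow R n). f (A w) = i (z w)))}"

lemma mem_rD:
  "(f'', z) \<in> rD \<longleftrightarrow> f'' \<in> cocycles R m n A X'' \<and> z \<in> carrier (hom_module R (rpow R n) X') \<and>
    (\<exists>f\<in>mod_hom R (rpow R m) X. (\<forall>v\<in>carrier (rpow R m). q (f v) = f'' v) \<and>
       (\<forall>w\<in>carrier (rpow R n). f (A w) = i (z w)))"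
  by (simp add: rD_def)

text \<open>The cokernel of \<open>H(X) \<rightarrow> H(X'')\<close> is isomorphic to the kernel of \<open>H(X') \<rightarrow> H(X)\<close> in the other
  degree.\<close>

lemma plen_connecting:
  "plen R p H'' V (cocycles R m n A X'') =
   plen R p (hom_module R (rpow R n) X') (coboundaries R n m A X') (exact_pair_ses.W R n m B A X' X i)"
proof (rule subquot_rel_plen)
  interpret sw: exact_pair_ses R n m B A X' X X'' i q
    by (rule exact_pair_ses_swap[OF exact_pair_ses_axioms])
  interpret X': module R X' by (rule X')
  interpret X: module R X by (rule X)
  interpret X'': module R X'' by (rule X'')
  interpret H'': module R H'' by (rule hom_module_module[OF mods(1) X''])
  interpret H1: module R sw.H' by (rule hom_module_module[OF mods(2) X'])
  show "module R H''" by (rule hom_module_module[OF mods(1) X''])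
  show "module R sw.H'" by (rule hom_module_module[OF mods(2) X'])
  show "submodule V R H''" "V \<subseteq> cocycles R m n A X''" using V_submodule by auto
  show "submodule (cocycles R m n A X'') R H''" by (rule cocycles_submodule[OF X''])
  show "submodule (coboundaries R n m A X') R sw.H'" by (rule sw.coboundaries_submodule[OF X'])
  show "submodule sw.W R sw.H'" "coboundaries R n m A X' \<subseteq> sw.W" using sw.W_submodule by auto
  show "subquot_rel R H'' sw.H' rD V (cocycles R m n A X'') (coboundaries R n m A X') sw.W"
    unfolding subquot_rel_def
  proof (intro conjI allI impI)
    show "rD \<subseteq> cocycles R m n A X'' \<times> sw.W"
    proof clarify
      fix f'' z assume r: "(f'', z) \<in> rD"
      then obtain f where f: "f \<in> mod_hom R (rpow R m) X"
        "\<forall>w\<in>carrier (rpow R n). f (A w) = i (z w)"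
        and z: "z \<in> carrier sw.H'" and f'': "f'' \<in> cocycles R m n A X''" by (auto simp: mem_rD)
      have "z (B v) = \<zero>\<^bsub>X'\<^esub>" if v: "v \<in> carrier (rpow R m)" for v
      proof (rule i_eq_zero)
        show "z (B v) \<in> carrier X'" using hom_module_closed[OF z Bc[OF v]] .
        show "i (z (B v)) = \<zero>\<^bsub>X\<^esub>" using f(2) Bc[OF v] AB[OF v] mod_hom_zero[OF mods(1) X f(1)] by force
      qed
      then have "z \<in> cocycles R n m B X'" using z by (simp add: cocycles_iff)
      moreover have "\<forall>w\<in>carrier (rpow R n). i (z w) = f (A w)" using f(2) by simp
      ultimately have "z \<in> sw.W" unfolding sw.mem_W using f(1) by auto
      then show "f'' \<in> cocycles R m n A X'' \<and> z \<in> sw.W" using f'' by simp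
    qed
    show "cocycles R m n A X'' \<subseteq> fst ` rD"
    proof
      fix f'' assume f'': "f'' \<in> cocycles R m n A X''"
      then have fh: "f'' \<in> mod_hom R (rpow R m) X''" by (simp add: cocycles_iff hom_module_hom)
      obtain f where f: "f \<in> mod_hom R (rpow R m) X" "\<And>v. v \<in> carrier (rpow R m) \<Longrightarrow> q (f v) = f'' v"
        using lift_q[OF fh] by metis
      have "q (f (A v)) = \<zero>\<^bsub>X''\<^esub>" if "v \<in> carrier (rpow R n)" for v
        using f(2)[OF Ac[OF that]] f'' that by (simp add: cocycles_iff)
      from lift_i[OF mod_hom_comp[OF A f(1)] this] obtain z where z: "z \<in> mod_hom R (rpow R n) X'"
        "\<And>v. v \<in> carrier (rpow R n) \<Longrightarrow> i (z v) = f (A v)" by metis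
      have "(f'', restrict z (carrier (rpow R n))) \<in> rD"
        unfolding mem_rD using f'' restrict_mod_hom[OF mods(2) z(1)] f z(2) by auto
      then show "f'' \<in> fst ` rD" by force
    qed
    show "sw.W \<subseteq> snd ` rD"
    proof
      fix z assume z: "z \<in> sw.W"
      then obtain f where f: "f \<in> mod_hom R (rpow R m) X" "\<forall>w\<in>carrier (rpow R n). i (z w) = f (A w)"
        and zc: "z \<in> carrier sw.H'" by (auto simp: sw.mem_W cocycles_iff)
      let ?f = "restrict (\<lambda>v. q (f v)) (carrier (rpow R m))"
      have "q (f (A v)) = \<zero>\<^bsub>X''\<^esub>" if "v \<in> carrier (rpow R n)" for v
      proof -
        have "f (A v) = i (z v)" using f(2) that by simp
        then show ?thesis using qi[OF hom_module_closed[OF zc that]] by simp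
      qed
      then have "?f \<in> cocycles R m n A X''"
        using restrict_mod_hom[OF mods(1) mod_hom_comp[OF f(1) q]] by (simp add: cocycles_iff Ac)
      then have "(?f, z) \<in> rD" unfolding mem_rD using zc f by (intro conjI bexI[OF _ f(1)]) auto
      then show "z \<in> snd ` rD" by force
    qed
  next
    fix f'' z k'' y assume r: "(f'', z) \<in> rD" "(k'', y) \<in> rD"
    obtain f where f: "f \<in> mod_hom R (rpow R m) X" "\<forall>v\<in>carrier (rpow R m). q (f v) = f'' v"
      "\<forall>w\<in>carrier (rpow R n). f (A w) = i (z w)"
      and z: "z \<in> carrier sw.H'" and f'': "f'' \<in> cocycles R m n A X''" using r(1) by (auto simp: mem_rD)
    obtain k where k: "k \<in> mod_hom R (rpow R m) X" "\<forall>v\<in>carrier (rpow R m). q (k v) = k'' v"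
      "\<forall>w\<in>carrier (rpow R n). k (A w) = i (y w)"
      and y: "y \<in> carrier sw.H'" and k'': "k'' \<in> cocycles R m n A X''" using r(2) by (auto simp: mem_rD)
    have "f'' \<oplus>\<^bsub>H''\<^esub> k'' \<in> cocycles R m n A X''" by (rule H''.submoduleE(5)[OF cocycles_submodule[OF X''] f'' k''])
    moreover have "z \<oplus>\<^bsub>sw.H'\<^esub> y \<in> carrier sw.H'" using z y by simp
    moreover have "\<forall>v\<in>carrier (rpow R m). q (f v \<oplus>\<^bsub>X\<^esub> k v) = (f'' \<oplus>\<^bsub>H''\<^esub> k'') v"
      using f k by (simp add: hom_module_apply mod_hom_add[OF q] mod_hom_closed[OF f(1)] mod_hom_closed[OF k(1)])
    moreover have "\<forall>w\<in>carrier (rpow R n). f (A w) \<oplus>\<^bsub>X\<^esub> k (A w) = i ((z \<oplus>\<^bsub>sw.H'\<^esub> y) w)"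
      using f k by (simp add: hom_module_apply mod_hom_add[OF i] hom_module_closed[OF z] hom_module_closed[OF y])
    ultimately show "(f'' \<oplus>\<^bsub>H''\<^esub> k'', z \<oplus>\<^bsub>sw.H'\<^esub> y) \<in> rD"
      unfolding mem_rD by (intro conjI bexI[OF _ mod_hom_plus[OF X f(1) k(1)]])
  next
    fix a f'' z assume a: "a \<in> carrier R" and r: "(f'', z) \<in> rD"
    obtain f where f: "f \<in> mod_hom R (rpow R m) X" "\<forall>v\<in>carrier (rpow R m). q (f v) = f'' v"
      "\<forall>w\<in>carrier (rpow R n). f (A w) = i (z w)"
      and z: "z \<in> carrier sw.H'" and f'': "f'' \<in> cocycles R m n A X''" using r by (auto simp: mem_rD)
    have "a \<odot>\<^bsub>H''\<^esub> f'' \<in> cocycles R m n A X''" by (rule H''.submoduleE(4)[OF cocycles_submodule[OF X''] a f''])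
    moreover have "a \<odot>\<^bsub>sw.H'\<^esub> z \<in> carrier sw.H'" using z a by simp
    moreover have "\<forall>v\<in>carrier (rpow R m). q (a \<odot>\<^bsub>X\<^esub> f v) = (a \<odot>\<^bsub>H''\<^esub> f'') v"
      using f a by (simp add: hom_module_apply mod_hom_smult[OF q] mod_hom_closed[OF f(1)])
    moreover have "\<forall>w\<in>carrier (rpow R n). a \<odot>\<^bsub>X\<^esub> f (A w) = i ((a \<odot>\<^bsub>sw.H'\<^esub> z) w)"
      using f a by (simp add: hom_module_apply mod_hom_smult[OF i] hom_module_closed[OF z])
    ultimately show "(a \<odot>\<^bsub>H''\<^esub> f'', a \<odot>\<^bsub>sw.H'\<^esub> z) \<in> rD"
      unfolding mem_rD by (intro conjI bexI[OF _ mod_hom_scale[OF X f(1) a]])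
  next
    fix f'' z assume r: "(f'', z) \<in> rD"
    obtain f where f: "f \<in> mod_hom R (rpow R m) X" "\<forall>v\<in>carrier (rpow R m). q (f v) = f'' v"
      "\<forall>w\<in>carrier (rpow R n). f (A w) = i (z w)"
      and z: "z \<in> carrier sw.H'" and f'': "f'' \<in> cocycles R m n A X''" using r by (auto simp: mem_rD)
    have fc: "f v \<in> carrier X" if "v \<in> carrier (rpow R m)" for v using mod_hom_closed[OF f(1) that] .
    have zc: "z w \<in> carrier X'" if "w \<in> carrier (rpow R n)" for w using hom_module_closed[OF z that] .
    show "f'' \<in> V \<longleftrightarrow> z \<in> coboundaries R n m A X'"
    proof
      assume "z \<in> coboundaries R n m A X'"
      then obtain h where h: "h \<in> mod_hom R (rpow R m) X'" "\<forall>w\<in>carrier (rpow R n). z w = h (A w)"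
        by (auto simp: coboundaries_iff)
      have hc: "h v \<in> carrier X'" if "v \<in> carrier (rpow R m)" for v using mod_hom_closed[OF h(1) that] .
      let ?k = "restrict (\<lambda>v. f v \<ominus>\<^bsub>X\<^esub> i (h v)) (carrier (rpow R m))"
      have "f (A w) \<ominus>\<^bsub>X\<^esub> i (h (A w)) = \<zero>\<^bsub>X\<^esub>" if w: "w \<in> carrier (rpow R n)" for w
        using f(3) h(2) w X'm[OF hc[OF Ac[OF w]]] by (simp add: X.diff_eq_zero_iff)
      then have k: "?k \<in> cocycles R m n A X"
        using restrict_mod_hom[OF mods(1) mod_hom_minus[OF mods(1) X f(1) mod_hom_comp[OF h(1) i]]]
        by (simp add: cocycles_iff Ac)
      have "f'' v = q (?k v) \<oplus>\<^bsub>X''\<^esub> \<zero>\<^bsub>X''\<^esub>" if v: "v \<in> carrier (rpow R m)" for v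
        using f(2) v mod_hom_diff[OF X X'' q fc[OF v] X'm[OF hc[OF v]]] qi[OF hc[OF v]] Xm[OF fc[OF v]]
        by (auto simp: a_minus_def)
      then show "f'' \<in> V"
        unfolding mem_V
        by (intro conjI bexI[OF _ k] bexI[OF _ mod_hom_zero_fun[OF X'']]) (use f'' in \<open>auto simp: cocycles_iff\<close>)
    next
      assume "f'' \<in> V"
      then obtain c b where b: "b \<in> mod_hom R (rpow R n) X''"
        "\<forall>v\<in>carrier (rpow R m). f'' v = q (c v) \<oplus>\<^bsub>X''\<^esub> b (B v)" and c: "c \<in> cocycles R m n A X"
        by (auto simp: mem_V)
      have ch: "c \<in> mod_hom R (rpow R m) X" using c by (simp add: cocycles_iff hom_module_hom)
      obtain b' where b': "b' \<in> mod_hom R (rpow R n) X" "\<And>v. v \<in> carrier (rpow R n) \<Longrightarrow> q (b' v) = b v"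
        using lift_q[OF b(1)] by metis
      let ?s = "\<lambda>v. c v \<oplus>\<^bsub>X\<^esub> b' (B v)"
      have sh: "?s \<in> mod_hom R (rpow R m) X" by (rule mod_hom_plus[OF X ch mod_hom_comp[OF B b'(1)]])
      have sc: "?s v \<in> carrier X" if "v \<in> carrier (rpow R m)" for v using mod_hom_closed[OF sh that] .
      have "q (f v \<ominus>\<^bsub>X\<^esub> ?s v) = \<zero>\<^bsub>X''\<^esub>" if v: "v \<in> carrier (rpow R m)" for v
      proof -
        have "q (?s v) = q (c v) \<oplus>\<^bsub>X''\<^esub> b (B v)"
          using mod_hom_add[OF q mod_hom_closed[OF ch v] mod_hom_closed[OF b'(1) Bc[OF v]]] b'(2)[OF Bc[OF v]] by simp
        then have "q (?s v) = q (f v)" using b(2) f(2) v by simp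
        then show ?thesis
          using mod_hom_diff[OF X X'' q fc[OF v] sc[OF v]] Xm[OF fc[OF v]] by (simp add: X''.diff_eq_zero_iff)
      qed
      from lift_i[OF mod_hom_minus[OF mods(1) X f(1) sh] this]
      obtain h where h: "h \<in> mod_hom R (rpow R m) X'"
        "\<And>v. v \<in> carrier (rpow R m) \<Longrightarrow> i (h v) = f v \<ominus>\<^bsub>X\<^esub> ?s v" by metis
      have "z w = h (A w)" if w: "w \<in> carrier (rpow R n)" for w
      proof -
        have "?s (A w) = \<zero>\<^bsub>X\<^esub>"
          using c w BA[OF w] mod_hom_zero[OF mods(2) X b'(1)] by (simp add: cocycles_iff)
        then have "i (h (A w)) = f (A w)" using h(2)[OF Ac[OF w]] fc[OF Ac[OF w]] by (simp add: a_minus_def)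
        then have "i (h (A w)) = i (z w)" using f(3) w by simp
        then show ?thesis using inj zc[OF w] mod_hom_closed[OF h(1) Ac[OF w]] by (metis inj_onD)
      qed
      then show "z \<in> coboundaries R n m A X'" using z h(1) by (auto simp: coboundaries_iff)
    qed
  qed
qed

end

text \<open>The analogue of the Herbrand quotient, for lengths at \<open>p\<close>.\<close>

definition htheta ::
    "('a, 'm) ring_scheme \<Rightarrow> 'a set \<Rightarrow> nat \<Rightarrow> nat \<Rightarrow> ((nat \<Rightarrow> 'a) \<Rightarrow> (nat \<Rightarrow> 'a))
      \<Rightarrow> ((nat \<Rightarrow> 'a) \<Rightarrow> (nat \<Rightarrow> 'a)) \<Rightarrow> ('a, 'b, 'k) module_scheme \<Rightarrow> int"
  where "htheta R p m n A B X = int (hlen R p n m B A X) - int (hlen R p m n A B X)"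

lemma (in exact_pair_ses) hlen_parts:
  assumes p: "primeideal p R" and fin: "hfinite R p m n A B X'" "hfinite R p m n A B X" "hfinite R p m n A B X''"
  shows "hlen R p m n A B X' = plen R p H' (coboundaries R m n B X') W + plen R p H' W (cocycles R m n A X')"
    and "hlen R p m n A B X = plen R p H' W (cocycles R m n A X') + plen R p H'' (coboundaries R m n B X'') V"
    and "hlen R p m n A B X'' = plen R p H'' (coboundaries R m n B X'') V +
      plen R p (hom_module R (rpow R n) X') (coboundaries R n m A X') (exact_pair_ses.W R n m B A X' X i)"
proof -
  note f = fin[unfolded hfinite_def]
  show "hlen R p m n A B X' = plen R p H' (coboundaries R m n B X') W + plen R p H' W (cocycles R m n A X')"
    unfolding hlen_def
    by (rule plen_add[OF hom_module_module[OF mods(1) X'] p f(1) coboundaries_submodule[OF X']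
          W_submodule(1) cocycles_submodule[OF X'] W_submodule(3,2)])
  show "hlen R p m n A B X = plen R p H' W (cocycles R m n A X') + plen R p H'' (coboundaries R m n B X'') V"
    unfolding hlen_def plen_U[symmetric] plen_V[symmetric]
    by (rule plen_add[OF hom_module_module[OF mods(1) X] p f(2) coboundaries_submodule[OF X]
          U_submodule(1) cocycles_submodule[OF X] U_submodule(2,3)])
  show "hlen R p m n A B X'' = plen R p H'' (coboundaries R m n B X'') V +
      plen R p (hom_module R (rpow R n) X') (coboundaries R n m A X') (exact_pair_ses.W R n m B A X' X i)"
    unfolding hlen_def plen_connecting[symmetric]
    by (rule plen_add[OF hom_module_module[OF mods(1) X''] p f(3) coboundaries_submodule[OF X'']
          V_submodule(1) cocycles_submodule[OF X''] V_submodule(2,3)])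
qed

text \<open>In the exact hexagon each of the six cohomology lengths is the sum of the lengths of the
  images of two consecutive maps. Each of these six image lengths occurs in two neighbouring
  terms, which carry opposite signs in \<open>htheta X' - htheta X + htheta X''\<close>.\<close>

lemma (in exact_pair_ses) htheta_additive:
  assumes p: "primeideal p R" and fin: "hfinite R p m n A B X'" "hfinite R p m n A B X" "hfinite R p m n A B X''"
    and fin': "hfinite R p n m B A X'" "hfinite R p n m B A X" "hfinite R p n m B A X''"
  shows "htheta R p m n A B X = htheta R p m n A B X' + htheta R p m n A B X''"
proof -
  interpret sw: exact_pair_ses R n m B A X' X X'' i q
    by (rule exact_pair_ses_swap[OF exact_pair_ses_axioms])
  show ?thesis
    unfolding htheta_def hlen_parts[OF p fin] sw.hlen_parts[OF p fin'] by simp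
qed

section \<open>Transport of structure\<close>

lemma module_of_surj:
  assumes M: "module R M" and c: "carrier Q = \<pi> ` carrier M"
    and add: "\<And>x y. x \<in> carrier M \<Longrightarrow> y \<in> carrier M \<Longrightarrow> \<pi> x \<oplus>\<^bsub>Q\<^esub> \<pi> y = \<pi> (x \<oplus>\<^bsub>M\<^esub> y)"
    and smult: "\<And>a x. a \<in> carrier R \<Longrightarrow> x \<in> carrier M \<Longrightarrow> a \<odot>\<^bsub>Q\<^esub> \<pi> x = \<pi> (a \<odot>\<^bsub>M\<^esub> x)"
    and zero: "\<zero>\<^bsub>Q\<^esub> = \<pi> \<zero>\<^bsub>M\<^esub>"
  shows "module R Q"
proof -
  interpret M: module R M by fact
  have "abelian_group Q"
  proof (rule abelian_groupI)
    fix X assume "X \<in> carrier Q"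
    then obtain x where x: "x \<in> carrier M" "X = \<pi> x" by (auto simp: c)
    then have "\<pi> (\<ominus>\<^bsub>M\<^esub> x) \<oplus>\<^bsub>Q\<^esub> X = \<zero>\<^bsub>Q\<^esub>" by (simp add: add zero M.M.l_neg)
    then show "\<exists>Y\<in>carrier Q. Y \<oplus>\<^bsub>Q\<^esub> X = \<zero>\<^bsub>Q\<^esub>"
      using x(1) by (intro bexI[of _ "\<pi> (\<ominus>\<^bsub>M\<^esub> x)"]) (auto simp: c)
  qed (auto simp: c add zero M.M.add.m_ac)
  then show ?thesis
    by (rule moduleI[OF M.R.cring_axioms])
      (auto simp: c add smult M.smult_l_distr M.smult_r_distr M.smult_assoc1)
qed

definition copy_module ::
    "('b \<Rightarrow> 'c) \<Rightarrow> ('a, 'b, 'n) module_scheme \<Rightarrow> ('a, 'c) module"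
  where "copy_module \<phi> M =
    \<lparr>carrier = \<phi> ` carrier M, monoid.mult = undefined, one = undefined,
     ring.zero = \<phi> \<zero>\<^bsub>M\<^esub>,
     add = (\<lambda>x y. \<phi> (inv_into (carrier M) \<phi> x \<oplus>\<^bsub>M\<^esub> inv_into (carrier M) \<phi> y)),
     smult = (\<lambda>a x. \<phi> (a \<odot>\<^bsub>M\<^esub> inv_into (carrier M) \<phi> x))\<rparr>"

lemma copy_module_simps:
  assumes "inj_on \<phi> (carrier M)"
  shows "carrier (copy_module \<phi> M) = \<phi> ` carrier M" "\<zero>\<^bsub>copy_module \<phi> M\<^esub> = \<phi> \<zero>\<^bsub>M\<^esub>"
    "x \<in> carrier M \<Longrightarrow> y \<in> carrier M \<Longrightarrow> \<phi> x \<oplus>\<^bsub>copy_module \<phi> M\<^esub> \<phi> y = \<phi> (x \<oplus>\<^bsub>M\<^esub> y)"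
    "x \<in> carrier M \<Longrightarrow> a \<odot>\<^bsub>copy_module \<phi> M\<^esub> \<phi> x = \<phi> (a \<odot>\<^bsub>M\<^esub> x)"
  using assms by (simp_all add: copy_module_def inv_into_f_f)

lemma copy_module_module:
  assumes M: "module R M" and inj: "inj_on \<phi> (carrier M)"
  shows "module R (copy_module \<phi> M)"
  by (rule module_of_surj[OF M copy_module_simps(1,3,4,2)[OF inj]])

lemma copy_module_hom:
  assumes "module R M" "inj_on \<phi> (carrier M)"
  shows "\<phi> \<in> mod_hom R M (copy_module \<phi> M)"
  by (rule mod_homI) (simp_all add: copy_module_simps[OF assms(2)])

lemma copy_module_inv_hom:
  assumes M: "module R M" and inj: "inj_on \<phi> (carrier M)"
  shows "inv_into (carrier M) \<phi> \<in> mod_hom R (copy_module \<phi> M) M"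
proof -
  interpret M: module R M by fact
  note s = copy_module_simps[OF inj]
  show ?thesis
    by (rule mod_homI) (auto simp: s inv_into_f_f[OF inj])
qed


section \<open>Vanishing of cohomology over a Gorenstein ring\<close>

text \<open>Vanishing of the degree-\<open>0\<close> cohomology with coefficients in a submodule \<open>K\<close> of \<open>E\<close>.
  Keeping the ambient \<open>E\<close> suits the cosyzygies of an injective resolution, which occur both as
  kernels and as images.\<close>

definition hvanish ::
    "('a, 'm) ring_scheme \<Rightarrow> nat \<Rightarrow> nat \<Rightarrow> ((nat \<Rightarrow> 'a) \<Rightarrow> (nat \<Rightarrow> 'a))
      \<Rightarrow> ((nat \<Rightarrow> 'a) \<Rightarrow> (nat \<Rightarrow> 'a)) \<Rightarrow> ('a, 'b, 'k) module_scheme \<Rightarrow> 'b set \<Rightarrow> bool"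
  where "hvanish R m n A B E K \<longleftrightarrow>
    (\<forall>f\<in>mod_hom R (rpow R m) E. f ` carrier (rpow R m) \<subseteq> K \<longrightarrow>
       (\<forall>w\<in>carrier (rpow R n). f (A w) = \<zero>\<^bsub>E\<^esub>) \<longrightarrow>
       (\<exists>g\<in>mod_hom R (rpow R n) E. g ` carrier (rpow R n) \<subseteq> K \<and>
          (\<forall>v\<in>carrier (rpow R m). f v = g (B v))))"

lemma hvanishD:
  assumes "hvanish R m n A B E K" "f \<in> mod_hom R (rpow R m) E"
    "\<And>v. v \<in> carrier (rpow R m) \<Longrightarrow> f v \<in> K" "\<And>w. w \<in> carrier (rpow R n) \<Longrightarrow> f (A w) = \<zero>\<^bsub>E\<^esub>"
  obtains g where "g \<in> mod_hom R (rpow R n) E" "\<And>v. v \<in> carrier (rpow R n) \<Longrightarrow> g v \<in> K"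
    "\<And>v. v \<in> carrier (rpow R m) \<Longrightarrow> f v = g (B v)"
proof -
  have "f ` carrier (rpow R m) \<subseteq> K" using assms(3) by auto
  then obtain g where g: "g \<in> mod_hom R (rpow R n) E" "g ` carrier (rpow R n) \<subseteq> K"
     "\<forall>v\<in>carrier (rpow R m). f v = g (B v)"
    using bspec[OF assms(1)[unfolded hvanish_def] assms(2)] assms(4) by (elim impE) auto
  then show ?thesis by (intro that[OF g(1)]) auto
qed

lemma injective_module_extend:
  fixes A B :: "'a umodule"
  assumes "injective_module R E" "module R A" "module R B"
    and "i \<in> mod_hom R A B" "g \<in> mod_hom R A E" "inj_on i (carrier A)"
  shows "\<exists>h\<in>mod_hom R B E. \<forall>x\<in>carrier A. h (i x) = g x"
  using assms unfolding injective_module_def by auto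

text \<open>A homomorphism that vanishes on \<open>im A = ker B\<close> factors through \<open>im B\<close>, and an injective
  module allows extending from \<open>im B\<close> to \<open>R\<^sup>n\<close>.\<close>

lemma (in exact_pair) injective_hvanish:
  assumes E: "injective_module R E"
  shows "hvanish R m n A B E (carrier E)"
  unfolding hvanish_def
proof (intro ballI impI)
  fix f assume f: "f \<in> mod_hom R (rpow R m) E" and fA: "\<forall>w\<in>carrier (rpow R n). f (A w) = \<zero>\<^bsub>E\<^esub>"
  have Em: "module R E" using E unfolding injective_module_def by simp
  interpret E: module R E by fact
  interpret P: module R "rpow R m" by (rule mods(1))
  let ?N = "(rpow R n)\<lparr>carrier := B ` carrier (rpow R m)\<rparr>"
  \<comment> \<open>Singletons carry \<open>R\<^sup>n\<close> and \<open>im B\<close> over to the type of the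
    test modules of injectivity.\<close>
  let ?s = "\<lambda>v :: nat \<Rightarrow> 'a. {v}"
  have sN: "submodule (B ` carrier (rpow R m)) R (rpow R n)"
    by (rule submodule_hom_image[OF mods B P.carrier_is_submodule])
  have N: "module R ?N" by (rule submodule.submodule_is_module[OF sN mods(2)])
  have inj: "inj_on ?s S" for S by (simp add: inj_on_def)
  define fb where "fb u = f (SOME v. v \<in> carrier (rpow R m) \<and> B v = u)" for u
  have fb: "fb (B v) = f v" if v: "v \<in> carrier (rpow R m)" for v
  proof -
    let ?v = "SOME u. u \<in> carrier (rpow R m) \<and> B u = B v"
    have *: "?v \<in> carrier (rpow R m) \<and> B ?v = B v" using v by (rule someI[of _ v, OF conjI]) simp
    then have "B (?v \<ominus>\<^bsub>rpow R m\<^esub> v) = \<zero>\<^bsub>rpow R n\<^esub>"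
      using mod_hom_diff[OF mods B _ v, of ?v] Bc[OF v] module.diff_eq_zero_iff[OF mods(2)] by simp
    then have "?v \<ominus>\<^bsub>rpow R m\<^esub> v \<in> A ` carrier (rpow R n)"
      using im_A * v by (simp add: a_kernel_iff)
    then have "f (?v \<ominus>\<^bsub>rpow R m\<^esub> v) = \<zero>\<^bsub>E\<^esub>" using fA by auto
    then show ?thesis
      using mod_hom_diff[OF mods(1) Em f _ v, of ?v] * v mod_hom_closed[OF f]
      by (simp add: fb_def E.diff_eq_zero_iff)
  qed
  have fbh: "fb \<in> mod_hom R ?N E"
  proof (rule mod_homI)
    fix x assume "x \<in> carrier ?N"
    then obtain u where u: "u \<in> carrier (rpow R m)" "x = B u" by auto
    show "fb x \<in> carrier E" using u mod_hom_closed[OF f u(1)] by (simp add: fb)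
    fix y assume "y \<in> carrier ?N"
    then obtain v where v: "v \<in> carrier (rpow R m)" "y = B v" by auto
    have "x \<oplus>\<^bsub>?N\<^esub> y = B (u \<oplus>\<^bsub>rpow R m\<^esub> v)" using u v by (simp add: mod_hom_add[OF B])
    then show "fb (x \<oplus>\<^bsub>?N\<^esub> y) = fb x \<oplus>\<^bsub>E\<^esub> fb y"
      using u v by (simp only: fb P.M.a_closed mod_hom_add[OF f])
  next
    fix a x assume a: "a \<in> carrier R" and "x \<in> carrier ?N"
    then obtain u where u: "u \<in> carrier (rpow R m)" "x = B u" by auto
    have "a \<odot>\<^bsub>?N\<^esub> x = B (a \<odot>\<^bsub>rpow R m\<^esub> u)" using u a by (simp add: mod_hom_smult[OF B])
    then show "fb (a \<odot>\<^bsub>?N\<^esub> x) = a \<odot>\<^bsub>E\<^esub> fb x"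
      using u a by (simp only: fb P.smult_closed mod_hom_smult[OF f])
  qed
  let ?cN = "copy_module ?s ?N" and ?cP = "copy_module ?s (rpow R n)"
  have g: "(\<lambda>x. fb (inv_into (carrier ?N) ?s x)) \<in> mod_hom R ?cN E"
    by (rule mod_hom_comp[OF copy_module_inv_hom[OF N inj] fbh])
  have incl: "(\<lambda>x. x) \<in> mod_hom R ?N (rpow R n)"
    using sN by (intro mod_homI) (auto dest: module.submoduleE(1)[OF mods(2)])
  have i: "(\<lambda>x. ?s (inv_into (carrier ?N) ?s x)) \<in> mod_hom R ?cN ?cP"
    by (rule mod_hom_comp[OF copy_module_inv_hom[OF N inj]
          mod_hom_comp[OF incl copy_module_hom[OF mods(2) inj]]])
  have "inj_on (\<lambda>x. ?s (inv_into (carrier ?N) ?s x)) (carrier ?cN)"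
    by (auto simp: copy_module_simps(1)[OF inj] inj_on_def inv_into_f_f[OF inj])
  from injective_module_extend[OF E copy_module_module[OF N inj] copy_module_module[OF mods(2) inj] i g this]
  obtain h where h: "h \<in> mod_hom R ?cP E"
    "\<forall>x\<in>carrier ?cN. h (?s (inv_into (carrier ?N) ?s x)) = fb (inv_into (carrier ?N) ?s x)"
    by (elim bexE)
  have hB: "f v = h (?s (B v))" if v: "v \<in> carrier (rpow R m)" for v
  proof -
    have "?s (B v) \<in> carrier ?cN" "inv_into (carrier ?N) ?s (?s (B v)) = B v"
      using v inv_into_f_f[OF inj, of "B v" "carrier ?N"] by (simp_all add: copy_module_simps(1)[OF inj])
    then show ?thesis using h(2) fb[OF v] by metis
  qed
  have gh: "(\<lambda>v. h (?s v)) \<in> mod_hom R (rpow R n) E"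
    by (rule mod_hom_comp[OF copy_module_hom[OF mods(2) inj] h(1)])
  show "\<exists>g\<in>mod_hom R (rpow R n) E. g ` carrier (rpow R n) \<subseteq> carrier E \<and>
     (\<forall>v\<in>carrier (rpow R m). f v = g (B v))"
    by (intro bexI[OF _ gh] conjI ballI hB) (use mod_hom_closed[OF gh] in auto)
qed

text \<open>The connecting homomorphism places the cohomology of the kernel of \<open>d\<close> between the
  cohomology of the image of \<open>d\<close> in the other degree and that of \<open>E\<close>. As there are only two
  degrees, vanishing for images thus passes back along a resolution.\<close>

lemma (in exact_pair) hvanish_kernel:
  assumes E: "module R E" and E': "module R E'" and d: "d \<in> mod_hom R E E'"
    and vE: "hvanish R m n A B E (carrier E)"
    and vK': "hvanish R n m B A E' (d ` carrier E)"
  shows "hvanish R m n A B E (a_kernel E E' d)"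
  unfolding hvanish_def
proof (intro ballI impI)
  interpret E: module R E by fact
  interpret E': module R E' by fact
  fix f assume f: "f \<in> mod_hom R (rpow R m) E" and fK: "f ` carrier (rpow R m) \<subseteq> a_kernel E E' d"
    and fA: "\<forall>w\<in>carrier (rpow R n). f (A w) = \<zero>\<^bsub>E\<^esub>"
  obtain g where g: "g \<in> mod_hom R (rpow R n) E" "\<And>v. v \<in> carrier (rpow R m) \<Longrightarrow> f v = g (B v)"
    by (rule hvanishD[OF vE f]) (use fA mod_hom_closed[OF f] in auto)
  have gc: "g w \<in> carrier E" if "w \<in> carrier (rpow R n)" for w using mod_hom_closed[OF g(1) that] .
  have dgB: "d (g (B v)) = \<zero>\<^bsub>E'\<^esub>" if "v \<in> carrier (rpow R m)" for v
  proof -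
    have "f v \<in> a_kernel E E' d" using fK that by auto
    then show ?thesis using g(2)[OF that] by (simp add: a_kernel_iff)
  qed
  obtain h where h: "h \<in> mod_hom R (rpow R m) E'" "\<And>v. v \<in> carrier (rpow R m) \<Longrightarrow> h v \<in> d ` carrier E"
    "\<And>w. w \<in> carrier (rpow R n) \<Longrightarrow> d (g w) = h (A w)"
    by (rule hvanishD[OF vK' mod_hom_comp[OF g(1) d]]) (use dgB gc in auto)
  obtain k where k: "k \<in> mod_hom R (rpow R m) E" "\<And>v. v \<in> carrier (rpow R m) \<Longrightarrow> d (k v) = h v"
    using free_on_projective[OF E E' d h(1,2)] by metis
  have kc: "k v \<in> carrier E" if "v \<in> carrier (rpow R m)" for v using mod_hom_closed[OF k(1) that] .
  let ?g = "\<lambda>w. g w \<ominus>\<^bsub>E\<^esub> k (A w)"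
  have gh: "?g \<in> mod_hom R (rpow R n) E"
    by (rule mod_hom_minus[OF mods(2) E g(1) mod_hom_comp[OF A k(1)]])
  have "?g w \<in> a_kernel E E' d" if w: "w \<in> carrier (rpow R n)" for w
  proof -
    have "d (?g w) = d (g w) \<ominus>\<^bsub>E'\<^esub> d (k (A w))"
      by (rule mod_hom_diff[OF E E' d gc[OF w] kc[OF Ac[OF w]]])
    also have "\<dots> = \<zero>\<^bsub>E'\<^esub>"
      using h(3)[OF w] k(2)[OF Ac[OF w]] mod_hom_closed[OF d gc[OF w]] by (simp add: E'.diff_eq_zero_iff)
    finally show ?thesis using mod_hom_closed[OF gh w] by (simp add: a_kernel_iff)
  qed
  moreover have "f v = ?g (B v)" if v: "v \<in> carrier (rpow R m)" for v
    using g(2)[OF v] AB[OF v] mod_hom_zero[OF mods(1) E k(1)] gc[OF Bc[OF v]] by (simp add: a_minus_def)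
  ultimately show "\<exists>g\<in>mod_hom R (rpow R n) E. g ` carrier (rpow R n) \<subseteq> a_kernel E E' d \<and>
    (\<forall>v\<in>carrier (rpow R m). f v = g (B v))"
    by (intro bexI[OF _ gh]) auto
qed

lemma (in exact_pair) hvanish_trivial:
  assumes E: "module R E" and c: "carrier E = {\<zero>\<^bsub>E\<^esub>}" and K: "\<zero>\<^bsub>E\<^esub> \<in> K"
  shows "hvanish R m n A B E K"
  unfolding hvanish_def
proof (intro ballI impI)
  fix f assume f: "f \<in> mod_hom R (rpow R m) E"
  have "f v = \<zero>\<^bsub>E\<^esub>" if "v \<in> carrier (rpow R m)" for v using mod_hom_closed[OF f that] c by simp
  then show "\<exists>g\<in>mod_hom R (rpow R n) E. g ` carrier (rpow R n) \<subseteq> K \<and>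
    (\<forall>v\<in>carrier (rpow R m). f v = g (B v))"
    using K by (intro bexI[OF _ mod_hom_zero_fun[OF E]]) auto
qed

text \<open>The cosyzygies of a finite injective resolution vanish from some point on; from there
  vanishing descends to \<open>N\<close>.\<close>

lemma (in exact_pair) finite_injdim_hvanish:
  assumes fin: "finite_injdim R N" and N: "module R N"
  shows "hvanish R m n A B N (carrier N)"
proof -
  obtain E :: "nat \<Rightarrow> 'a umodule" and \<eta> d c where
    inj: "\<And>i. injective_module R (E i)" and eta: "\<eta> \<in> mod_hom R N (E 0)" "inj_on \<eta> (carrier N)"
    and d: "\<And>i. d i \<in> mod_hom R (E i) (E (Suc i))"
    and im0: "\<eta> ` carrier N = a_kernel (E 0) (E 1) (d 0)"
    and im: "\<And>i. d i ` carrier (E i) = a_kernel (E (Suc i)) (E (Suc (Suc i))) (d (Suc i))"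
    and triv: "\<And>i. i > c \<Longrightarrow> carrier (E i) = {\<zero>\<^bsub>E i\<^esub>}"
    using fin unfolding finite_injdim_def injective_resolution_def by metis
  interpret sw: exact_pair R n m B A by (rule exact_pair_swap[OF exact_pair_axioms])
  have Em: "module R (E i)" for i using inj unfolding injective_module_def by simp
  let ?K = "\<lambda>i. a_kernel (E i) (E (Suc i)) (d i)"
  have "hvanish R m n A B (E i) (?K i) \<and> hvanish R n m B A (E i) (?K i)" if "i \<le> Suc c" for i
    using that
  proof (induction i rule: inc_induct)
    case base
    have "\<zero>\<^bsub>E (Suc c)\<^esub> \<in> ?K (Suc c)"
      using mod_hom_zero[OF Em Em d] triv[of "Suc c"] by (simp add: a_kernel_iff)
    then show ?case using hvanish_trivial[OF Em triv] sw.hvanish_trivial[OF Em triv] by simp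
  next
    case (step i)
    have "hvanish R m n A B (E (Suc i)) (d i ` carrier (E i))"
      "hvanish R n m B A (E (Suc i)) (d i ` carrier (E i))"
      using step by (simp_all add: im)
    then show ?case
      using hvanish_kernel[OF Em Em d injective_hvanish[OF inj]]
        sw.hvanish_kernel[OF Em Em d sw.injective_hvanish[OF inj]] by simp
  qed
  from this[of 0] have v0: "hvanish R m n A B (E 0) (\<eta> ` carrier N)" using im0 by simp
  show ?thesis
    unfolding hvanish_def
  proof (intro ballI impI)
    fix f assume f: "f \<in> mod_hom R (rpow R m) N" and fA: "\<forall>w\<in>carrier (rpow R n). f (A w) = \<zero>\<^bsub>N\<^esub>"
    obtain g where g: "g \<in> mod_hom R (rpow R n) (E 0)" "\<And>v. v \<in> carrier (rpow R n) \<Longrightarrow> g v \<in> \<eta> ` carrier N"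
      "\<And>v. v \<in> carrier (rpow R m) \<Longrightarrow> \<eta> (f v) = g (B v)"
      by (rule hvanishD[OF v0 mod_hom_comp[OF f eta(1)]])
        (use fA mod_hom_closed[OF f] mod_hom_zero[OF N Em eta(1)] in auto)
    obtain h where h: "h \<in> mod_hom R (rpow R n) N" "\<And>v. v \<in> carrier (rpow R n) \<Longrightarrow> \<eta> (h v) = g v"
      using free_on_projective[OF N Em eta(1) g(1,2)] by metis
    have "f v = h (B v)" if v: "v \<in> carrier (rpow R m)" for v
    proof -
      have "\<eta> (f v) = \<eta> (h (B v))" using g(3)[OF v] h(2)[OF Bc[OF v]] by simp
      then show ?thesis
        using eta(2) mod_hom_closed[OF f v] mod_hom_closed[OF h(1) Bc[OF v]] by (metis inj_onD)
    qed
    then show "\<exists>g\<in>mod_hom R (rpow R n) N. g ` carrier (rpow R n) \<subseteq> carrier N \<and>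
      (\<forall>v\<in>carrier (rpow R m). f v = g (B v))"
      using h(1) mod_hom_closed[OF h(1)] by auto
  qed
qed

section \<open>The periodic complex of a two-periodic module\<close>

text \<open>The decomposition \<open>R\<^bsup>k + l\<^esup> = R\<^sup>k \<oplus> R\<^sup>l\<close>.\<close>

definition rfst :: "nat \<Rightarrow> (nat \<Rightarrow> 'a) \<Rightarrow> (nat \<Rightarrow> 'a)"
  where "rfst k v = (\<lambda>i\<in>{..<k}. v i)"

definition rsnd :: "nat \<Rightarrow> nat \<Rightarrow> (nat \<Rightarrow> 'a) \<Rightarrow> (nat \<Rightarrow> 'a)"
  where "rsnd k l v = (\<lambda>i\<in>{..<l}. v (k + i))"

definition rpair :: "nat \<Rightarrow> nat \<Rightarrow> (nat \<Rightarrow> 'a) \<Rightarrow> (nat \<Rightarrow> 'a) \<Rightarrow> (nat \<Rightarrow> 'a)"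
  where "rpair k l u w = (\<lambda>i\<in>{..<k + l}. if i < k then u i else w (i - k))"

lemma rfst_hom: "rfst k \<in> mod_hom R (rpow R (k + l)) (rpow R k)"
  by (rule mod_homI) (auto simp: rpow_carrier_iff free_on_simps rfst_def)

lemma rsnd_hom: "rsnd k l \<in> mod_hom R (rpow R (k + l)) (rpow R l)"
  by (rule mod_homI) (auto simp: rpow_carrier_iff free_on_simps rsnd_def)

lemma rpair_closed:
  "u \<in> carrier (rpow R k) \<Longrightarrow> w \<in> carrier (rpow R l) \<Longrightarrow> rpair k l u w \<in> carrier (rpow R (k + l))"
  by (auto simp: rpow_carrier_iff rpair_def)

lemma rpair_add:
  "rpair k l (u \<oplus>\<^bsub>rpow R k\<^esub> u') (w \<oplus>\<^bsub>rpow R l\<^esub> w') =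
   rpair k l u w \<oplus>\<^bsub>rpow R (k + l)\<^esub> rpair k l u' w'"
  by (auto simp: rpair_def free_on_simps fun_eq_iff)

lemma rpair_smult:
  "rpair k l (a \<odot>\<^bsub>rpow R k\<^esub> u) (a \<odot>\<^bsub>rpow R l\<^esub> w) = a \<odot>\<^bsub>rpow R (k + l)\<^esub> rpair k l u w"
  by (auto simp: rpair_def free_on_simps fun_eq_iff)

lemma rfst_rpair: "u \<in> carrier (rpow R k) \<Longrightarrow> rfst k (rpair k l u w) = u"
  by (auto simp: rfst_def rpair_def rpow_carrier_iff extensional_def fun_eq_iff)

lemma rsnd_rpair: "w \<in> carrier (rpow R l) \<Longrightarrow> rsnd k l (rpair k l u w) = w"
  by (auto simp: rsnd_def rpair_def rpow_carrier_iff extensional_def fun_eq_iff)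

lemma rpair_rfst_rsnd: "v \<in> carrier (rpow R (k + l)) \<Longrightarrow> rpair k l (rfst k v) (rsnd k l v) = v"
  by (auto simp: rsnd_def rfst_def rpair_def rpow_carrier_iff extensional_def fun_eq_iff)

lemma rpair_zero: "rpair k l \<zero>\<^bsub>rpow R k\<^esub> \<zero>\<^bsub>rpow R l\<^esub> = \<zero>\<^bsub>rpow R (k + l)\<^esub>"
  by (auto simp: rpair_def free_on_simps fun_eq_iff)

text \<open>A complex \<open>(A, B)\<close> whose cokernel of \<open>A\<close> is \<open>M \<oplus> R\<^sup>r\<close>, via \<open>(q, l)\<close>, and whose kernel of
  \<open>A\<close> is again \<open>M \<oplus> R\<^sup>r\<close>, via \<open>(j, k)\<close>.\<close>

locale periodic_presentation = exact_pair R m n A B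
  for R :: "('a, 'm) ring_scheme" and m n A B +
  fixes M :: "('a, 'b, 'k) module_scheme" and r :: nat
    and q :: "(nat \<Rightarrow> 'a) \<Rightarrow> 'b" and l :: "(nat \<Rightarrow> 'a) \<Rightarrow> (nat \<Rightarrow> 'a)"
    and j :: "'b \<Rightarrow> (nat \<Rightarrow> 'a)" and k :: "(nat \<Rightarrow> 'a) \<Rightarrow> (nat \<Rightarrow> 'a)"
  assumes M: "module R M"
    and q: "q \<in> mod_hom R (rpow R m) M" and l: "l \<in> mod_hom R (rpow R m) (rpow R r)"
    and j: "j \<in> mod_hom R M (rpow R n)" and k: "k \<in> mod_hom R (rpow R r) (rpow R n)"
    and B_eq: "\<And>v. v \<in> carrier (rpow R m) \<Longrightarrow> B v = j (q v) \<oplus>\<^bsub>rpow R n\<^esub> k (l v)"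
    and ker_ql: "\<And>v. v \<in> carrier (rpow R m) \<Longrightarrow>
      q v = \<zero>\<^bsub>M\<^esub> \<and> l v = \<zero>\<^bsub>rpow R r\<^esub> \<longleftrightarrow> v \<in> A ` carrier (rpow R n)"
    and surj_ql: "\<And>x y. x \<in> carrier M \<Longrightarrow> y \<in> carrier (rpow R r) \<Longrightarrow>
      \<exists>v\<in>carrier (rpow R m). q v = x \<and> l v = y"

lemma direct_sum_simps:
  "carrier (direct_sum M N) = carrier M \<times> carrier N"
  "\<zero>\<^bsub>direct_sum M N\<^esub> = (\<zero>\<^bsub>M\<^esub>, \<zero>\<^bsub>N\<^esub>)"
  "(x, y) \<oplus>\<^bsub>direct_sum M N\<^esub> (x', y') = (x \<oplus>\<^bsub>M\<^esub> x', y \<oplus>\<^bsub>N\<^esub> y')"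
  "a \<odot>\<^bsub>direct_sum M N\<^esub> (x, y) = (a \<odot>\<^bsub>M\<^esub> x, a \<odot>\<^bsub>N\<^esub> y)"
  by (simp_all add: direct_sum_def)

text \<open>With the first map \<open>d\<^sub>0 : R\<^bsup>b 1\<^esup> \<rightarrow> R\<^bsup>b 0\<^esup>\<close> of a minimal resolution, \<open>A = (d\<^sub>0, 0) : R\<^bsup>b 1 + s\<^esup> \<rightarrow>
  R\<^bsup>b 0 + r\<^esup>\<close> has cokernel \<open>M \<oplus> R\<^sup>r\<close> and kernel \<open>\<Omega>\<^sup>2M \<oplus> R\<^sup>s\<close>. Periodicity says that the two are
  isomorphic, and \<open>B\<close> is the isomorphism from the cokernel to the kernel.\<close>

lemma periodic_presentation_exists:
  fixes R :: "('a, 'm) ring_scheme" and M :: "('a, 'b, 'k) module_scheme"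
  assumes cring: "cring R" and M: "module R M" and per: "periodic_module R 2 M"
  obtains b \<epsilon> m n A B r q l j k where
    "periodic_presentation R m n A B M r q l j k"
    "\<epsilon> \<in> mod_hom R (rpow R b) M" "\<epsilon> ` carrier (rpow R b) = carrier M"
    "a_kernel (rpow R b) M \<epsilon> \<subseteq> ideal_smult R (max_ideal R) (rpow R b)"
proof -
  obtain b \<epsilon> d r s where res: "minimal_free_resolution R M b \<epsilon> d"
    and iso: "mod_iso R (direct_sum M (rpow R r)) (direct_sum (syzygy R b d 2) (rpow R s))"
    using per unfolding periodic_module_def by auto
  have eps: "\<epsilon> \<in> mod_hom R (rpow R (b 0)) M" "\<epsilon> ` carrier (rpow R (b 0)) = carrier M"
    and d: "\<And>i. d i \<in> mod_hom R (rpow R (b (Suc i))) (rpow R (b i))"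
    and ex0: "d 0 ` carrier (rpow R (b 1)) = a_kernel (rpow R (b 0)) M \<epsilon>"
    and ex1: "d 1 ` carrier (rpow R (b 2)) = a_kernel (rpow R (b 1)) (rpow R (b 0)) (d 0)"
    using res unfolding minimal_free_resolution_def by (simp_all add: numeral_2_eq_2)
  have "\<forall>i. d i ` carrier (rpow R (b (Suc i))) \<subseteq> ideal_smult R (max_ideal R) (rpow R (b i))"
    using res unfolding minimal_free_resolution_def by (elim conjE)
  from this[rule_format, of 0]
  have min: "d 0 ` carrier (rpow R (b 1)) \<subseteq> ideal_smult R (max_ideal R) (rpow R (b 0))"
    by simp
  have d0: "d 0 \<in> mod_hom R (rpow R (b 1)) (rpow R (b 0))" using d[of 0] by simp
  note Fm = rpow_module[OF cring]
  note One_nat_def [simp del]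
  interpret M: module R M by fact
  let ?S = "syzygy R b d 2"
  have S: "carrier ?S = a_kernel (rpow R (b 1)) (rpow R (b 0)) (d 0)"
    "add ?S = add (rpow R (b 1))" "smult ?S = smult (rpow R (b 1))" "\<zero>\<^bsub>?S\<^esub> = \<zero>\<^bsub>rpow R (b 1)\<^esub>"
    using ex1 by (simp_all add: syzygy_def One_nat_def)
  have Sc: "x \<in> carrier (rpow R (b 1))" if "x \<in> carrier ?S" for x using that by (simp add: S a_kernel_iff)
  let ?D = "direct_sum M (rpow R r)" and ?D' = "direct_sum ?S (rpow R s)"
  obtain \<Phi> where Ph: "\<Phi> \<in> mod_hom R ?D ?D'" "bij_betw \<Phi> (carrier ?D) (carrier ?D')"
    using iso unfolding mod_iso_def by auto
  define m where "m = b 0 + r"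
  define n where "n = b 1 + s"
  define \<Psi> :: "(nat \<Rightarrow> 'a) \<times> (nat \<Rightarrow> 'a) \<Rightarrow> (nat \<Rightarrow> 'a)"
    where "\<Psi> = (\<lambda>z. rpair (b 1) s (fst z) (snd z))"
  have Psc: "\<Psi> z \<in> carrier (rpow R n)" if "z \<in> carrier ?D'" for z
    using that Sc unfolding \<Psi>_def n_def by (auto simp: direct_sum_simps intro: rpair_closed)
  have Ps: "\<Psi> \<in> mod_hom R ?D' (rpow R n)"
  proof (rule mod_homI)
    fix x y assume "x \<in> carrier ?D'" "y \<in> carrier ?D'"
    show "\<Psi> (x \<oplus>\<^bsub>?D'\<^esub> y) = \<Psi> x \<oplus>\<^bsub>rpow R n\<^esub> \<Psi> y"
      by (cases x; cases y) (simp add: \<Psi>_def n_def direct_sum_simps S rpair_add)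
  next
    fix a x assume "a \<in> carrier R" "x \<in> carrier ?D'"
    show "\<Psi> (a \<odot>\<^bsub>?D'\<^esub> x) = a \<odot>\<^bsub>rpow R n\<^esub> \<Psi> x"
      by (cases x) (simp add: \<Psi>_def n_def direct_sum_simps S rpair_smult)
  qed (rule Psc)
  define J where "J = (\<lambda>z. \<Psi> (\<Phi> z))"
  have J: "J \<in> mod_hom R ?D (rpow R n)" unfolding J_def by (rule mod_hom_comp[OF Ph(1) Ps])
  have z: "\<zero>\<^bsub>rpow R i\<^esub> \<in> carrier (rpow R i)" for i
  proof -
    interpret module R "rpow R i" by (rule Fm)
    show ?thesis by simp
  qed
  have addz: "x \<oplus>\<^bsub>rpow R i\<^esub> \<zero>\<^bsub>rpow R i\<^esub> = x" "\<zero>\<^bsub>rpow R i\<^esub> \<oplus>\<^bsub>rpow R i\<^esub> x = x"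
    "a \<in> carrier R \<Longrightarrow> a \<odot>\<^bsub>rpow R i\<^esub> \<zero>\<^bsub>rpow R i\<^esub> = \<zero>\<^bsub>rpow R i\<^esub>"
    if "x \<in> carrier (rpow R i)" for x i a
  proof -
    interpret module R "rpow R i" by (rule Fm)
    show "x \<oplus>\<^bsub>rpow R i\<^esub> \<zero>\<^bsub>rpow R i\<^esub> = x" "\<zero>\<^bsub>rpow R i\<^esub> \<oplus>\<^bsub>rpow R i\<^esub> x = x"
      "a \<in> carrier R \<Longrightarrow> a \<odot>\<^bsub>rpow R i\<^esub> \<zero>\<^bsub>rpow R i\<^esub> = \<zero>\<^bsub>rpow R i\<^esub>" using that by simp_all
  qed
  have inl: "(\<lambda>x. (x, \<zero>\<^bsub>rpow R r\<^esub>)) \<in> mod_hom R M ?D"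
    by (rule mod_homI) (simp_all add: direct_sum_simps z addz[OF z])
  have inr: "(\<lambda>y. (\<zero>\<^bsub>M\<^esub>, y)) \<in> mod_hom R (rpow R r) ?D"
    by (rule mod_homI) (simp_all add: direct_sum_simps)
  define q where "q = (\<lambda>v :: nat \<Rightarrow> 'a. \<epsilon> (rfst (b 0) v))"
  define l where "l = (rsnd (b 0) r :: (nat \<Rightarrow> 'a) \<Rightarrow> _)"
  define j where "j = (\<lambda>x. J (x, \<zero>\<^bsub>rpow R r\<^esub>))"
  define k where "k = (\<lambda>y. J (\<zero>\<^bsub>M\<^esub>, y))"
  define A where "A = (\<lambda>w. rpair (b 0) r (d 0 (rfst (b 1) w)) \<zero>\<^bsub>rpow R r\<^esub>)"
  define B where "B = (\<lambda>v. J (q v, l v))"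
  have fst1: "rfst (b 1) \<in> mod_hom R (rpow R n) (rpow R (b 1))" unfolding n_def by (rule rfst_hom)
  have fst0: "rfst (b 0) \<in> mod_hom R (rpow R m) (rpow R (b 0))" unfolding m_def by (rule rfst_hom)
  have snd0: "rsnd (b 0) r \<in> mod_hom R (rpow R m) (rpow R r)" unfolding m_def by (rule rsnd_hom)
  have q: "q \<in> mod_hom R (rpow R m) M" unfolding q_def by (rule mod_hom_comp[OF fst0 eps(1)])
  have l: "l \<in> mod_hom R (rpow R m) (rpow R r)" unfolding l_def by (rule snd0)
  have j: "j \<in> mod_hom R M (rpow R n)" unfolding j_def by (rule mod_hom_comp[OF inl J])
  have k: "k \<in> mod_hom R (rpow R r) (rpow R n)" unfolding k_def by (rule mod_hom_comp[OF inr J])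
  have df: "(\<lambda>w. d 0 (rfst (b 1) w)) \<in> mod_hom R (rpow R n) (rpow R (b 0))"
    by (rule mod_hom_comp[OF fst1 d0])
  have in0: "(\<lambda>u. rpair (b 0) r u \<zero>\<^bsub>rpow R r\<^esub>) \<in> mod_hom R (rpow R (b 0)) (rpow R m)"
    unfolding m_def
  proof (rule mod_homI)
    fix x y
    show "rpair (b 0) r (x \<oplus>\<^bsub>rpow R (b 0)\<^esub> y) \<zero>\<^bsub>rpow R r\<^esub> =
      rpair (b 0) r x \<zero>\<^bsub>rpow R r\<^esub> \<oplus>\<^bsub>rpow R (b 0 + r)\<^esub> rpair (b 0) r y \<zero>\<^bsub>rpow R r\<^esub>"
      using rpair_add[of "b 0" r R x y "\<zero>\<^bsub>rpow R r\<^esub>" "\<zero>\<^bsub>rpow R r\<^esub>"] by (simp add: addz[OF z])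
  next
    fix a x assume "a \<in> carrier R"
    then show "rpair (b 0) r (a \<odot>\<^bsub>rpow R (b 0)\<^esub> x) \<zero>\<^bsub>rpow R r\<^esub> =
      a \<odot>\<^bsub>rpow R (b 0 + r)\<^esub> rpair (b 0) r x \<zero>\<^bsub>rpow R r\<^esub>"
      using rpair_smult[of "b 0" r R a x "\<zero>\<^bsub>rpow R r\<^esub>"] by (simp add: addz[OF z])
  qed (rule rpair_closed[OF _ z])
  have A: "A \<in> mod_hom R (rpow R n) (rpow R m)" unfolding A_def by (rule mod_hom_comp[OF df in0])
  have qlc: "(q v, l v) \<in> carrier ?D" if "v \<in> carrier (rpow R m)" for v
    using mod_hom_closed[OF q that] mod_hom_closed[OF l that] by (simp add: direct_sum_simps)
  have Jadd: "J (x, y) = j x \<oplus>\<^bsub>rpow R n\<^esub> k y" if "x \<in> carrier M" "y \<in> carrier (rpow R r)" for x y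
  proof -
    have "(x, \<zero>\<^bsub>rpow R r\<^esub>) \<oplus>\<^bsub>?D\<^esub> (\<zero>\<^bsub>M\<^esub>, y) = (x, y)" using that by (simp add: direct_sum_simps addz)
    moreover have "J ((x, \<zero>\<^bsub>rpow R r\<^esub>) \<oplus>\<^bsub>?D\<^esub> (\<zero>\<^bsub>M\<^esub>, y)) = j x \<oplus>\<^bsub>rpow R n\<^esub> k y"
      unfolding j_def k_def using that z by (intro mod_hom_add[OF J]) (simp_all add: direct_sum_simps)
    ultimately show ?thesis by simp
  qed
  have B_eq: "B v = j (q v) \<oplus>\<^bsub>rpow R n\<^esub> k (l v)" if "v \<in> carrier (rpow R m)" for v
    unfolding B_def using Jadd[OF mod_hom_closed[OF q that] mod_hom_closed[OF l that]] .
  have B: "B \<in> mod_hom R (rpow R m) (rpow R n)"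
    using mod_hom_plus[OF Fm mod_hom_comp[OF q j] mod_hom_comp[OF l k]]
    by (rule mod_hom_cong[OF Fm]) (rule B_eq)
  have surj: "\<exists>v\<in>carrier (rpow R m). q v = x \<and> l v = y"
    if x: "x \<in> carrier M" and y: "y \<in> carrier (rpow R r)" for x y
  proof -
    have "x \<in> \<epsilon> ` carrier (rpow R (b 0))" unfolding eps(2) by (rule x)
    then obtain u where u: "u \<in> carrier (rpow R (b 0))" "\<epsilon> u = x" by (auto elim!: imageE)
    show ?thesis
      using u y rpair_closed[OF u(1) y]
      by (intro bexI[of _ "rpair (b 0) r u y"])
        (simp_all add: q_def l_def m_def rfst_rpair[OF u(1)] rsnd_rpair[OF y])
  qed
  have Jinj: "z = \<zero>\<^bsub>?D\<^esub>" if zc: "z \<in> carrier ?D" and z0: "J z = \<zero>\<^bsub>rpow R n\<^esub>" for z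
  proof -
    have Dz: "\<zero>\<^bsub>?D\<^esub> \<in> carrier ?D" using z by (simp add: direct_sum_simps)
    have "J \<zero>\<^bsub>?D\<^esub> = j \<zero>\<^bsub>M\<^esub> \<oplus>\<^bsub>rpow R n\<^esub> k \<zero>\<^bsub>rpow R r\<^esub>"
      using Jadd[OF M.M.zero_closed z] by (simp add: direct_sum_simps)
    then have "J \<zero>\<^bsub>?D\<^esub> = \<zero>\<^bsub>rpow R n\<^esub>"
      using mod_hom_zero[OF M Fm j] mod_hom_zero[OF Fm Fm k] by (simp add: addz[OF z])
    then have eq: "\<Psi> (\<Phi> z) = \<Psi> (\<Phi> \<zero>\<^bsub>?D\<^esub>)" using z0 by (simp add: J_def)
    have c: "\<Phi> z \<in> carrier ?D'" "\<Phi> \<zero>\<^bsub>?D\<^esub> \<in> carrier ?D'" using mod_hom_closed[OF Ph(1)] zc Dz by auto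
    have Psinj: "x = y" if "x \<in> carrier ?D'" "y \<in> carrier ?D'" "\<Psi> x = \<Psi> y" for x y
    proof -
      have cx: "fst x \<in> carrier (rpow R (b 1))" "snd x \<in> carrier (rpow R s)"
        "fst y \<in> carrier (rpow R (b 1))" "snd y \<in> carrier (rpow R s)"
        using that Sc by (auto simp: direct_sum_simps)
      have "rfst (b 1) (\<Psi> x) = rfst (b 1) (\<Psi> y)" "rsnd (b 1) s (\<Psi> x) = rsnd (b 1) s (\<Psi> y)"
        using that by simp_all
      then show ?thesis
        unfolding \<Psi>_def rfst_rpair[OF cx(1)] rfst_rpair[OF cx(3)] rsnd_rpair[OF cx(2)] rsnd_rpair[OF cx(4)]
        by (rule prod_eqI)
    qed
    have "\<Phi> z = \<Phi> \<zero>\<^bsub>?D\<^esub>" by (rule Psinj[OF c eq])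
    then show ?thesis using Ph(2) zc Dz by (metis bij_betw_inv_into_left)
  qed
  have imA: "q v = \<zero>\<^bsub>M\<^esub> \<and> l v = \<zero>\<^bsub>rpow R r\<^esub> \<longleftrightarrow> v \<in> A ` carrier (rpow R n)"
    if v: "v \<in> carrier (rpow R m)" for v
  proof
    assume 0: "q v = \<zero>\<^bsub>M\<^esub> \<and> l v = \<zero>\<^bsub>rpow R r\<^esub>"
    then have "rfst (b 0) v \<in> a_kernel (rpow R (b 0)) M \<epsilon>"
      using mod_hom_closed[OF fst0 v] by (simp add: a_kernel_iff q_def)
    then obtain u where u: "u \<in> carrier (rpow R (b 1))" "d 0 u = rfst (b 0) v" using ex0 by force
    have "A (rpair (b 1) s u \<zero>\<^bsub>rpow R s\<^esub>) = rpair (b 0) r (rfst (b 0) v) (rsnd (b 0) r v)"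
      using 0 u by (simp add: A_def rfst_rpair[OF u(1)] l_def)
    then have "A (rpair (b 1) s u \<zero>\<^bsub>rpow R s\<^esub>) = v" using rpair_rfst_rsnd[OF v[unfolded m_def]] by simp
    moreover have "rpair (b 1) s u \<zero>\<^bsub>rpow R s\<^esub> \<in> carrier (rpow R n)"
      unfolding n_def by (rule rpair_closed[OF u(1) z])
    ultimately show "v \<in> A ` carrier (rpow R n)" by force
  next
    assume "v \<in> A ` carrier (rpow R n)"
    then obtain w where w: "w \<in> carrier (rpow R n)" "v = A w" by auto
    have "d 0 (rfst (b 1) w) \<in> a_kernel (rpow R (b 0)) M \<epsilon>"
      using ex0 mod_hom_closed[OF fst1 w(1)] by auto
    then show "q v = \<zero>\<^bsub>M\<^esub> \<and> l v = \<zero>\<^bsub>rpow R r\<^esub>"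
      using w by (simp add: q_def l_def A_def a_kernel_iff rfst_rpair[OF mod_hom_closed[OF df w(1)]] rsnd_rpair[OF z])
  qed
  have ep: "exact_pair R m n A B"
  proof (rule exact_pair.intro)
    show "cring R" "A \<in> mod_hom R (rpow R n) (rpow R m)" "B \<in> mod_hom R (rpow R m) (rpow R n)" by fact+
    show "A ` carrier (rpow R n) = a_kernel (rpow R m) (rpow R n) B"
    proof (rule subset_antisym; rule subsetI)
      fix v assume vA: "v \<in> A ` carrier (rpow R n)"
      then have v: "v \<in> carrier (rpow R m)" using mod_hom_closed[OF A] by auto
      have "q v = \<zero>\<^bsub>M\<^esub>" "l v = \<zero>\<^bsub>rpow R r\<^esub>" using imA[OF v] vA by auto
      then have "B v = \<zero>\<^bsub>rpow R n\<^esub>"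
        using B_eq[OF v] mod_hom_zero[OF M Fm j] mod_hom_zero[OF Fm Fm k] by (simp add: addz[OF z])
      then show "v \<in> a_kernel (rpow R m) (rpow R n) B" using v by (simp add: a_kernel_iff)
    next
      fix v assume "v \<in> a_kernel (rpow R m) (rpow R n) B"
      then have v: "v \<in> carrier (rpow R m)" "J (q v, l v) = \<zero>\<^bsub>rpow R n\<^esub>" by (simp_all add: a_kernel_iff B_def)
      then have "(q v, l v) = \<zero>\<^bsub>?D\<^esub>" using Jinj qlc by simp
      then show "v \<in> A ` carrier (rpow R n)" using imA[OF v(1)] by (simp add: direct_sum_simps)
    qed
    show "B ` carrier (rpow R m) = a_kernel (rpow R n) (rpow R m) A"
    proof (rule subset_antisym; rule subsetI)
      fix w assume "w \<in> B ` carrier (rpow R m)"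
      then obtain v where v: "v \<in> carrier (rpow R m)" "w = \<Psi> (\<Phi> (q v, l v))" by (auto simp: B_def J_def)
      have c: "\<Phi> (q v, l v) \<in> carrier ?D'" by (rule mod_hom_closed[OF Ph(1) qlc[OF v(1)]])
      then have f: "fst (\<Phi> (q v, l v)) \<in> carrier ?S" by (auto simp: direct_sum_simps)
      have "rfst (b 1) w = fst (\<Phi> (q v, l v))" unfolding v(2) \<Psi>_def by (rule rfst_rpair[OF Sc[OF f]])
      then have "d 0 (rfst (b 1) w) = \<zero>\<^bsub>rpow R (b 0)\<^esub>" using f by (simp add: S a_kernel_iff)
      then have "A w = \<zero>\<^bsub>rpow R m\<^esub>" unfolding A_def m_def using rpair_zero by simp
      then show "w \<in> a_kernel (rpow R n) (rpow R m) A" using Psc[OF c] v(2) by (simp add: a_kernel_iff)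
    next
      fix w assume "w \<in> a_kernel (rpow R n) (rpow R m) A"
      then have w: "w \<in> carrier (rpow R n)" "A w = \<zero>\<^bsub>rpow R m\<^esub>" by (simp_all add: a_kernel_iff)
      have "rfst (b 0) (A w) = \<zero>\<^bsub>rpow R (b 0)\<^esub>" using w(2) mod_hom_zero[OF Fm Fm fst0] by simp
      then have "d 0 (rfst (b 1) w) = \<zero>\<^bsub>rpow R (b 0)\<^esub>"
        unfolding A_def rfst_rpair[OF mod_hom_closed[OF df w(1)]] .
      then have c: "(rfst (b 1) w, rsnd (b 1) s w) \<in> carrier ?D'"
        using mod_hom_closed[OF fst1 w(1)] mod_hom_closed[OF rsnd_hom w(1)[unfolded n_def]]
        by (simp add: direct_sum_simps S a_kernel_iff)
      then have "(rfst (b 1) w, rsnd (b 1) s w) \<in> \<Phi> ` carrier ?D" using Ph(2) by (simp add: bij_betw_def)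
      then obtain x y where xy: "x \<in> carrier M" "y \<in> carrier (rpow R r)"
        "\<Phi> (x, y) = (rfst (b 1) w, rsnd (b 1) s w)" by (auto simp: direct_sum_simps)
      obtain v where v: "v \<in> carrier (rpow R m)" "q v = x" "l v = y" using surj[OF xy(1,2)] by auto
      have "B v = w"
        using v xy(3) rpair_rfst_rsnd[OF w(1)[unfolded n_def]] by (simp add: B_def J_def \<Psi>_def)
      then show "w \<in> B ` carrier (rpow R m)" using v(1) by auto
    qed
  qed
  have "periodic_presentation R m n A B M r q l j k"
    by (rule periodic_presentation.intro[OF ep periodic_presentation_axioms.intro[OF M q l j k B_eq imA surj]])
  then show ?thesis by (rule that[OF _ eps]) (use min ex0 in simp)
qed

context exact_pair
begin

lemma homotopy_kills:
  assumes X: "module R X" and a: "a \<in> carrier R"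
    and s: "s \<in> mod_hom R (rpow R m) (rpow R n)" and t: "t \<in> mod_hom R (rpow R n) (rpow R m)"
    and eq: "\<And>v. v \<in> carrier (rpow R m) \<Longrightarrow> a \<odot>\<^bsub>rpow R m\<^esub> v = A (s v) \<oplus>\<^bsub>rpow R m\<^esub> t (B v)"
    and f: "f \<in> cocycles R m n A X"
  shows "a \<odot>\<^bsub>hom_module R (rpow R m) X\<^esub> f \<in> coboundaries R m n B X"
proof -
  interpret X: module R X by fact
  interpret H: module R "hom_module R (rpow R m) X" by (rule hom_module_module[OF mods(1) X])
  have fc: "f \<in> carrier (hom_module R (rpow R m) X)" using f by (simp add: cocycles_iff)
  then have fh: "f \<in> mod_hom R (rpow R m) X" by (rule hom_module_hom)
  have "a \<odot>\<^bsub>X\<^esub> f v = f (t (B v))" if v: "v \<in> carrier (rpow R m)" for v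
  proof -
    have c: "s v \<in> carrier (rpow R n)" "t (B v) \<in> carrier (rpow R m)"
      using mod_hom_closed[OF s v] mod_hom_closed[OF t Bc[OF v]] .
    have "a \<odot>\<^bsub>X\<^esub> f v = f (A (s v) \<oplus>\<^bsub>rpow R m\<^esub> t (B v))"
      using mod_hom_smult[OF fh a v] eq[OF v] by simp
    also have "\<dots> = f (A (s v)) \<oplus>\<^bsub>X\<^esub> f (t (B v))" by (rule mod_hom_add[OF fh Ac[OF c(1)] c(2)])
    also have "\<dots> = f (t (B v))"
      using f c mod_hom_closed[OF fh c(2)] by (simp add: cocycles_iff)
    finally show ?thesis .
  qed
  then show ?thesis
    unfolding coboundaries_iff using H.smult_closed[OF a fc]
    by (intro conjI bexI[OF _ mod_hom_comp[OF t fh]]) (auto simp: hom_module_apply)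
qed

end

context periodic_presentation
begin

lemma qA: "w \<in> carrier (rpow R n) \<Longrightarrow> q (A w) = \<zero>\<^bsub>M\<^esub>"
  and lA: "w \<in> carrier (rpow R n) \<Longrightarrow> l (A w) = \<zero>\<^bsub>rpow R r\<^esub>"
  using ker_ql[OF Ac] by auto

text \<open>Each coordinate of \<open>l\<close> is a cocycle with coefficients in \<open>R\<close>.\<close>

lemma extend_l:
  assumes "hvanish R m n A B (self_module R) (carrier R)"
  obtains u where "u \<in> mod_hom R (rpow R n) (rpow R r)"
    "\<And>v. v \<in> carrier (rpow R m) \<Longrightarrow> l v = u (B v)"
proof -
  have "\<exists>g\<in>mod_hom R (rpow R n) (self_module R). \<forall>v\<in>carrier (rpow R m). l v i = g (B v)"
    if i: "i < r" for i
  proof -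
    have h: "(\<lambda>v. l v i) \<in> mod_hom R (rpow R m) (self_module R)"
      by (rule mod_hom_comp[OF l coordinate_hom[OF cring]]) (use i in simp)
    obtain g where "g \<in> mod_hom R (rpow R n) (self_module R)"
      "\<And>v. v \<in> carrier (rpow R m) \<Longrightarrow> l v i = g (B v)"
      by (rule hvanishD[OF assms h]) (use mod_hom_closed[OF h] lA i in \<open>auto simp: free_on_simps\<close>)
    then show ?thesis by auto
  qed
  then obtain g where g: "\<And>i. i < r \<Longrightarrow> g i \<in> mod_hom R (rpow R n) (self_module R)"
    "\<And>i v. i < r \<Longrightarrow> v \<in> carrier (rpow R m) \<Longrightarrow> l v i = g i (B v)" by metis
  let ?g = "\<lambda>w. \<lambda>i\<in>{..<r}. g i w"
  have "?g \<in> mod_hom R (rpow R n) (rpow R r)"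
  proof (rule mod_homI)
    show "?g w \<in> carrier (rpow R r)" if "w \<in> carrier (rpow R n)" for w
      using mod_hom_closed[OF g(1) that] by (auto simp: rpow_carrier_iff)
    show "?g (w \<oplus>\<^bsub>rpow R n\<^esub> w') = ?g w \<oplus>\<^bsub>rpow R r\<^esub> ?g w'"
      if "w \<in> carrier (rpow R n)" "w' \<in> carrier (rpow R n)" for w w'
      using mod_hom_add[OF g(1) that] by (auto simp: free_on_simps)
    show "?g (a \<odot>\<^bsub>rpow R n\<^esub> w) = a \<odot>\<^bsub>rpow R r\<^esub> ?g w"
      if "a \<in> carrier R" "w \<in> carrier (rpow R n)" for a w
      using mod_hom_smult[OF g(1) that] by (auto simp: free_on_simps)
  qed
  moreover have "l v = ?g (B v)" if v: "v \<in> carrier (rpow R m)" for v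
    using mod_hom_closed[OF l v] g(2)[OF _ v] by (auto simp: rpow_carrier_iff extensional_def fun_eq_iff)
  ultimately show ?thesis using that by auto
qed

text \<open>The homotopy equation propagates around the complex. First lift \<open>(g, al')\<close>, where \<open>l =
  l'B\<close>, along the surjection \<open>(q, l)\<close> to \<open>t\<close>. Then \<open>a - tB\<close> is killed by \<open>q\<close> and \<open>l\<close>, so it
  takes values in \<open>im A\<close> and lifts along \<open>A\<close> to \<open>s\<close>. Finally \<open>a - sA\<close> is killed by \<open>A\<close>, so it
  takes values in \<open>im B\<close> and lifts along \<open>B\<close> to \<open>t'\<close>.\<close>

lemma homotopy_from_factorization:
  assumes v: "hvanish R m n A B (self_module R) (carrier R)"
    and a: "a \<in> carrier R" and g: "g \<in> mod_hom R (rpow R n) M"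
    and ag: "\<And>v. v \<in> carrier (rpow R m) \<Longrightarrow> a \<odot>\<^bsub>M\<^esub> q v = g (B v)"
  obtains s t t' where "s \<in> mod_hom R (rpow R m) (rpow R n)" "t \<in> mod_hom R (rpow R n) (rpow R m)"
    "t' \<in> mod_hom R (rpow R n) (rpow R m)"
    "\<And>v. v \<in> carrier (rpow R m) \<Longrightarrow> a \<odot>\<^bsub>rpow R m\<^esub> v = A (s v) \<oplus>\<^bsub>rpow R m\<^esub> t (B v)"
    "\<And>w. w \<in> carrier (rpow R n) \<Longrightarrow> a \<odot>\<^bsub>rpow R n\<^esub> w = B (t' w) \<oplus>\<^bsub>rpow R n\<^esub> s (A w)"
proof -
  interpret M: module R M by (rule M)
  interpret P0: module R "rpow R m" by (rule mods(1))
  interpret P1: module R "rpow R n" by (rule mods(2))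
  have Fr: "module R (rpow R r)" by (rule rpow_module[OF cring])
  interpret Fr: module R "rpow R r" by (rule Fr)
  obtain ll where la: "ll \<in> mod_hom R (rpow R n) (rpow R r)"
    "\<And>v. v \<in> carrier (rpow R m) \<Longrightarrow> l v = ll (B v)" using extend_l[OF v] by metis
  have ala: "(\<lambda>w. a \<odot>\<^bsub>rpow R r\<^esub> ll w) \<in> mod_hom R (rpow R n) (rpow R r)"
    by (rule mod_hom_scale[OF Fr la(1) a])
  let ?e = "basis_elt R {..<n}"
  have e: "?e i \<in> carrier (rpow R n)" if "i \<in> {..<n}" for i using basis_elt_closed[OF cring that] .
  have "\<exists>u\<in>carrier (rpow R m). q u = g (?e i) \<and> l u = a \<odot>\<^bsub>rpow R r\<^esub> ll (?e i)" if "i \<in> {..<n}" for i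
    by (rule surj_ql[OF mod_hom_closed[OF g e[OF that]] mod_hom_closed[OF ala e[OF that]]])
  then obtain u where u: "\<And>i. i \<in> {..<n} \<Longrightarrow> u i \<in> carrier (rpow R m)"
    "\<And>i. i \<in> {..<n} \<Longrightarrow> q (u i) = g (?e i)"
    "\<And>i. i \<in> {..<n} \<Longrightarrow> l (u i) = a \<odot>\<^bsub>rpow R r\<^esub> ll (?e i)" by metis
  have uc: "u \<in> {..<n} \<rightarrow> carrier (rpow R m)" using u(1) by auto
  define t where "t = free_lift R {..<n} (rpow R m) u"
  have t: "t \<in> mod_hom R (rpow R n) (rpow R m)" unfolding t_def by (rule free_lift_hom[OF mods(1) uc])
  have te: "t (?e i) = u i" if "i \<in> {..<n}" for i
    unfolding t_def by (rule free_lift_basis[OF mods(1) uc that])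
  have qt: "q (t w) = g w" if "w \<in> carrier (rpow R n)" for w
    by (rule free_on_hom_eqI[OF M mod_hom_comp[OF t q] g _ that]) (simp add: te u)
  have lt: "l (t w) = a \<odot>\<^bsub>rpow R r\<^esub> ll w" if "w \<in> carrier (rpow R n)" for w
    by (rule free_on_hom_eqI[OF Fr mod_hom_comp[OF t l] ala _ that]) (simp add: te u)
  let ?f = "\<lambda>v. a \<odot>\<^bsub>rpow R m\<^esub> v \<ominus>\<^bsub>rpow R m\<^esub> t (B v)"
  have av: "(\<lambda>v. a \<odot>\<^bsub>rpow R m\<^esub> v) \<in> mod_hom R (rpow R m) (rpow R m)"
    by (rule mod_hom_scale[OF mods(1) mod_hom_id a])
  have aw: "(\<lambda>v. a \<odot>\<^bsub>rpow R n\<^esub> v) \<in> mod_hom R (rpow R n) (rpow R n)"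
    by (rule mod_hom_scale[OF mods(2) mod_hom_id a])
  have f: "?f \<in> mod_hom R (rpow R m) (rpow R m)"
    by (rule mod_hom_minus[OF mods(1) mods(1) av mod_hom_comp[OF B t]])
  have fA: "?f v \<in> A ` carrier (rpow R n)" if v: "v \<in> carrier (rpow R m)" for v
  proof -
    have c: "a \<odot>\<^bsub>rpow R m\<^esub> v \<in> carrier (rpow R m)" "t (B v) \<in> carrier (rpow R m)"
      using a v mod_hom_closed[OF t Bc[OF v]] by auto
    have "q (?f v) = \<zero>\<^bsub>M\<^esub>"
      using mod_hom_diff[OF mods(1) M q c] mod_hom_smult[OF q a v] ag[OF v] qt[OF Bc[OF v]]
        mod_hom_closed[OF g Bc[OF v]] by (simp add: M.diff_eq_zero_iff)
    moreover have "l (?f v) = \<zero>\<^bsub>rpow R r\<^esub>"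
      using mod_hom_diff[OF mods(1) Fr l c] mod_hom_smult[OF l a v] la(2)[OF v] lt[OF Bc[OF v]]
        mod_hom_closed[OF ala Bc[OF v]] by (simp add: Fr.diff_eq_zero_iff)
    ultimately show ?thesis using ker_ql[OF mod_hom_closed[OF f v]] by simp
  qed
  obtain s where s: "s \<in> mod_hom R (rpow R m) (rpow R n)"
    "\<And>v. v \<in> carrier (rpow R m) \<Longrightarrow> A (s v) = ?f v"
    using free_on_projective[OF mods(2) mods(1) A f fA] by metis
  have eq: "a \<odot>\<^bsub>rpow R m\<^esub> v = A (s v) \<oplus>\<^bsub>rpow R m\<^esub> t (B v)" if v: "v \<in> carrier (rpow R m)" for v
    using s(2)[OF v] a v mod_hom_closed[OF t Bc[OF v]] by (simp add: P0.diff_add_cancel)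
  let ?h = "\<lambda>w. a \<odot>\<^bsub>rpow R n\<^esub> w \<ominus>\<^bsub>rpow R n\<^esub> s (A w)"
  have h: "?h \<in> mod_hom R (rpow R n) (rpow R n)"
    by (rule mod_hom_minus[OF mods(2) mods(2) aw mod_hom_comp[OF A s(1)]])
  have hB: "?h w \<in> B ` carrier (rpow R m)" if w: "w \<in> carrier (rpow R n)" for w
  proof -
    have c: "a \<odot>\<^bsub>rpow R n\<^esub> w \<in> carrier (rpow R n)" "s (A w) \<in> carrier (rpow R n)"
      using a w mod_hom_closed[OF s(1) Ac[OF w]] by auto
    have "t (B (A w)) = \<zero>\<^bsub>rpow R m\<^esub>" using BA[OF w] mod_hom_zero[OF mods(2,1) t] by simp
    then have "a \<odot>\<^bsub>rpow R m\<^esub> A w = A (s (A w))"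
      using eq[OF Ac[OF w]] Ac[OF c(2)] by simp
    then have "A (?h w) = \<zero>\<^bsub>rpow R m\<^esub>"
      using mod_hom_diff[OF mods(2,1) A c] mod_hom_smult[OF A a w] Ac[OF c(2)]
      by (simp add: P0.diff_eq_zero_iff)
    then show ?thesis using im_B mod_hom_closed[OF h w] by (simp add: a_kernel_iff)
  qed
  obtain t' where t': "t' \<in> mod_hom R (rpow R n) (rpow R m)"
    "\<And>w. w \<in> carrier (rpow R n) \<Longrightarrow> B (t' w) = ?h w"
    using free_on_projective[OF mods(1) mods(2) B h hB] by metis
  have "a \<odot>\<^bsub>rpow R n\<^esub> w = B (t' w) \<oplus>\<^bsub>rpow R n\<^esub> s (A w)" if w: "w \<in> carrier (rpow R n)" for w
    using t'(2)[OF w] a w mod_hom_closed[OF s(1) Ac[OF w]] by (simp add: P1.diff_add_cancel)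
  then show ?thesis using that[OF s(1) t t'(1)] eq by blast
qed

end

section \<open>Quotients and tensor products\<close>

lemma (in module) coset_eq_iff:
  assumes N: "submodule N R M" and x: "x \<in> carrier M" and y: "y \<in> carrier M"
  shows "N +>\<^bsub>M\<^esub> x = N +>\<^bsub>M\<^esub> y \<longleftrightarrow> x \<ominus>\<^bsub>M\<^esub> y \<in> N"
proof
  have Nc: "N \<subseteq> carrier M" by (rule submoduleE(1)[OF N])
  have z: "\<zero>\<^bsub>M\<^esub> \<in> N" using N by (simp add: submodule_iff)
  {
    assume "N +>\<^bsub>M\<^esub> x = N +>\<^bsub>M\<^esub> y"
    moreover have "x \<in> N +>\<^bsub>M\<^esub> x" using x z by (force simp: a_r_coset_def')
    ultimately obtain h where h: "h \<in> N" "x = h \<oplus>\<^bsub>M\<^esub> y" by (auto simp: a_r_coset_def')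
    have "h \<in> carrier M" using h(1) Nc by auto
    then have "x \<ominus>\<^bsub>M\<^esub> y = h" using h(2) y by (simp add: a_minus_def M.a_assoc M.r_neg)
    then show "x \<ominus>\<^bsub>M\<^esub> y \<in> N" using h(1) by simp
  next
    have sub: "N +>\<^bsub>M\<^esub> u \<subseteq> N +>\<^bsub>M\<^esub> v"
      if "u \<ominus>\<^bsub>M\<^esub> v \<in> N" "u \<in> carrier M" "v \<in> carrier M" for u v
    proof
      fix w assume "w \<in> N +>\<^bsub>M\<^esub> u"
      then obtain h where h: "h \<in> N" "w = h \<oplus>\<^bsub>M\<^esub> u" by (auto simp: a_r_coset_def')
      have hc: "h \<in> carrier M" using h(1) Nc by auto
      have "w = (h \<oplus>\<^bsub>M\<^esub> (u \<ominus>\<^bsub>M\<^esub> v)) \<oplus>\<^bsub>M\<^esub> v"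
        using h(2) hc that by (simp add: a_minus_def M.a_assoc M.l_neg)
      moreover have "h \<oplus>\<^bsub>M\<^esub> (u \<ominus>\<^bsub>M\<^esub> v) \<in> N" by (rule submoduleE(5)[OF N h(1) that(1)])
      ultimately show "w \<in> N +>\<^bsub>M\<^esub> v" by (auto simp: a_r_coset_def')
    qed
    assume d: "x \<ominus>\<^bsub>M\<^esub> y \<in> N"
    have "y \<ominus>\<^bsub>M\<^esub> x = \<ominus>\<^bsub>M\<^esub> (x \<ominus>\<^bsub>M\<^esub> y)" using x y by (simp add: a_minus_def M.minus_add M.a_comm)
    then have d': "y \<ominus>\<^bsub>M\<^esub> x \<in> N" using submoduleE(3)[OF N d] by simp
    show "N +>\<^bsub>M\<^esub> x = N +>\<^bsub>M\<^esub> y" using sub[OF d x y] sub[OF d' y x] by (rule subset_antisym)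
  }
qed

lemma (in module) coset_mem:
  assumes N: "submodule N R M" and x: "x \<in> carrier M"
  shows "x \<in> N +>\<^bsub>M\<^esub> x"
  using x N by (force simp: a_r_coset_def' submodule_iff)

lemma (in module) coset_zero:
  assumes N: "submodule N R M"
  shows "N +>\<^bsub>M\<^esub> \<zero>\<^bsub>M\<^esub> = N"
proof -
  have "h \<oplus>\<^bsub>M\<^esub> \<zero>\<^bsub>M\<^esub> = h" if "h \<in> N" for h using submoduleE(1)[OF N] that by auto
  then show ?thesis by (force simp: a_r_coset_def')
qed

lemma quot_module_ops:
  assumes M: "module R M" and N: "submodule N R M"
  shows "carrier (quot_module M N) = (\<lambda>x. N +>\<^bsub>M\<^esub> x) ` carrier M"
    "\<zero>\<^bsub>quot_module M N\<^esub> = N +>\<^bsub>M\<^esub> \<zero>\<^bsub>M\<^esub>"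
    "\<And>x y. x \<in> carrier M \<Longrightarrow> y \<in> carrier M \<Longrightarrow>
      (N +>\<^bsub>M\<^esub> x) \<oplus>\<^bsub>quot_module M N\<^esub> (N +>\<^bsub>M\<^esub> y) = N +>\<^bsub>M\<^esub> (x \<oplus>\<^bsub>M\<^esub> y)"
    "\<And>a x. a \<in> carrier R \<Longrightarrow> x \<in> carrier M \<Longrightarrow>
      a \<odot>\<^bsub>quot_module M N\<^esub> (N +>\<^bsub>M\<^esub> x) = N +>\<^bsub>M\<^esub> (a \<odot>\<^bsub>M\<^esub> x)"
proof -
  interpret M: module R M by fact
  have Nc: "N \<subseteq> carrier M" by (rule M.submoduleE(1)[OF N])
  show "carrier (quot_module M N) = (\<lambda>x. N +>\<^bsub>M\<^esub> x) ` carrier M"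
    by (auto simp: quot_module_def A_RCOSETS_def RCOSETS_def a_r_coset_def)
  show "\<zero>\<^bsub>quot_module M N\<^esub> = N +>\<^bsub>M\<^esub> \<zero>\<^bsub>M\<^esub>"
    using M.coset_zero[OF N] by (simp add: quot_module_def)
  fix x y assume x: "x \<in> carrier M" and y: "y \<in> carrier M"
  have "additive_subgroup N M"
    using N by (simp add: additive_subgroup_def submodule_def)
  then interpret N: abelian_subgroup N M by (rule abelian_subgroupI3[OF _ M.abelian_group_axioms])
  show "(N +>\<^bsub>M\<^esub> x) \<oplus>\<^bsub>quot_module M N\<^esub> (N +>\<^bsub>M\<^esub> y) = N +>\<^bsub>M\<^esub> (x \<oplus>\<^bsub>M\<^esub> y)"
    using N.a_rcos_sum[OF x y] by (simp add: quot_module_def)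
next
  interpret M: module R M by fact
  have Nc: "N \<subseteq> carrier M" by (rule M.submoduleE(1)[OF N])
  fix a x assume a: "a \<in> carrier R" and x: "x \<in> carrier M"
  have "N +>\<^bsub>M\<^esub> (a \<odot>\<^bsub>M\<^esub> z) = N +>\<^bsub>M\<^esub> (a \<odot>\<^bsub>M\<^esub> x)" if z: "z \<in> N +>\<^bsub>M\<^esub> x" for z
  proof -
    obtain h where h: "h \<in> N" "z = h \<oplus>\<^bsub>M\<^esub> x" using z by (auto simp: a_r_coset_def')
    have hc: "h \<in> carrier M" using h(1) Nc by auto
    have "a \<odot>\<^bsub>M\<^esub> z \<ominus>\<^bsub>M\<^esub> a \<odot>\<^bsub>M\<^esub> x = a \<odot>\<^bsub>M\<^esub> h"
      using h(2) hc a x by (simp add: M.smult_r_distr a_minus_def M.M.a_assoc M.M.r_neg)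
    then have "a \<odot>\<^bsub>M\<^esub> z \<ominus>\<^bsub>M\<^esub> a \<odot>\<^bsub>M\<^esub> x \<in> N" using M.submoduleE(4)[OF N a h(1)] by simp
    then show ?thesis using M.coset_eq_iff[OF N] h(2) hc a x by simp
  qed
  then have "(\<Union>z\<in>N +>\<^bsub>M\<^esub> x. N +>\<^bsub>M\<^esub> (a \<odot>\<^bsub>M\<^esub> z)) = (\<Union>z\<in>N +>\<^bsub>M\<^esub> x. N +>\<^bsub>M\<^esub> (a \<odot>\<^bsub>M\<^esub> x))"
    by (rule SUP_cong[OF refl])
  moreover have "N +>\<^bsub>M\<^esub> x \<noteq> {}" using M.coset_mem[OF N x] by (metis empty_iff)
  ultimately show "a \<odot>\<^bsub>quot_module M N\<^esub> (N +>\<^bsub>M\<^esub> x) = N +>\<^bsub>M\<^esub> (a \<odot>\<^bsub>M\<^esub> x)"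
    by (simp add: quot_module_def)
qed

lemma quot_module_module:
  assumes M: "module R M" and N: "submodule N R M"
  shows "module R (quot_module M N)" "(\<lambda>x. N +>\<^bsub>M\<^esub> x) \<in> mod_hom R M (quot_module M N)"
proof -
  note ops = quot_module_ops[OF M N]
  show "module R (quot_module M N)" by (rule module_of_surj[OF M ops(1,3,4,2)])
  show "(\<lambda>x. N +>\<^bsub>M\<^esub> x) \<in> mod_hom R M (quot_module M N)"
    by (rule mod_homI) (simp_all add: ops(1,3,4))
qed

lemma quot_module_eq_zero_iff:
  assumes M: "module R M" and N: "submodule N R M" and x: "x \<in> carrier M"
  shows "N +>\<^bsub>M\<^esub> x = \<zero>\<^bsub>quot_module M N\<^esub> \<longleftrightarrow> x \<in> N"
proof -
  interpret M: module R M by fact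
  show ?thesis
    unfolding quot_module_ops(2)[OF M N] M.coset_eq_iff[OF N x M.M.zero_closed]
    using M.add_diff_cancel_left[OF M.M.zero_closed x] x by simp
qed

lemma tensor_rels_closed:
  assumes M: "module R M" and N: "module R N"
  shows "tensor_rels R M N \<subseteq> carrier (free_on R (carrier M \<times> carrier N))"
proof -
  interpret M: module R M by fact
  interpret N: module R N by fact
  interpret F: module R "free_on R (carrier M \<times> carrier N)" by (rule free_on_module[OF M.R.cring_axioms])
  show ?thesis
    unfolding tensor_rels_def Let_def
    by (auto intro!: F.M.minus_closed F.M.a_closed F.smult_closed basis_elt_closed[OF M.R.cring_axioms])
qed

lemma tensor_sub_submodule:
  assumes M: "module R M" and N: "module R N"
  shows "submodule (tensor_sub R M N) R (free_on R (carrier M \<times> carrier N))"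
    "tensor_rels R M N \<subseteq> tensor_sub R M N"
proof -
  interpret M: module R M by fact
  interpret F: module R "free_on R (carrier M \<times> carrier N)" by (rule free_on_module[OF M.R.cring_axioms])
  show "submodule (tensor_sub R M N) R (free_on R (carrier M \<times> carrier N))"
    "tensor_rels R M N \<subseteq> tensor_sub R M N"
    unfolding tensor_sub_def by (rule F.mod_span_submodule[OF tensor_rels_closed[OF M N]])+
qed

lemma tensor_module:
  assumes M: "module R M" and N: "module R N"
  shows "module R (tensor R M N)"
  unfolding tensor_def
  by (rule quot_module_module(1)[OF free_on_module tensor_sub_submodule(1)[OF M N]])
    (rule module.axioms(1)[OF M])

text \<open>The universal property of the tensor product, for maps that are bilinear only modulo a
  submodule \<open>K\<close>; in the main application \<open>K\<close> consists of coboundaries.\<close>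

lemma tensor_sub_lift:
  assumes M: "module R M" and N: "module R N" and Y: "module R Y" and K: "submodule K R Y"
    and \<beta>: "\<And>x y. x \<in> carrier M \<Longrightarrow> y \<in> carrier N \<Longrightarrow> \<beta> x y \<in> carrier Y"
    and add1: "\<And>x x' y. x \<in> carrier M \<Longrightarrow> x' \<in> carrier M \<Longrightarrow> y \<in> carrier N \<Longrightarrow>
      \<beta> (x \<oplus>\<^bsub>M\<^esub> x') y \<ominus>\<^bsub>Y\<^esub> (\<beta> x y \<oplus>\<^bsub>Y\<^esub> \<beta> x' y) \<in> K"
    and add2: "\<And>x y y'. x \<in> carrier M \<Longrightarrow> y \<in> carrier N \<Longrightarrow> y' \<in> carrier N \<Longrightarrow>
      \<beta> x (y \<oplus>\<^bsub>N\<^esub> y') \<ominus>\<^bsub>Y\<^esub> (\<beta> x y \<oplus>\<^bsub>Y\<^esub> \<beta> x y') \<in> K"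
    and smult1: "\<And>a x y. a \<in> carrier R \<Longrightarrow> x \<in> carrier M \<Longrightarrow> y \<in> carrier N \<Longrightarrow>
      \<beta> (a \<odot>\<^bsub>M\<^esub> x) y \<ominus>\<^bsub>Y\<^esub> a \<odot>\<^bsub>Y\<^esub> \<beta> x y \<in> K"
    and smult2: "\<And>a x y. a \<in> carrier R \<Longrightarrow> x \<in> carrier M \<Longrightarrow> y \<in> carrier N \<Longrightarrow>
      \<beta> x (a \<odot>\<^bsub>N\<^esub> y) \<ominus>\<^bsub>Y\<^esub> a \<odot>\<^bsub>Y\<^esub> \<beta> x y \<in> K"
    and t: "t \<in> tensor_sub R M N"
  shows "free_lift R (carrier M \<times> carrier N) Y (\<lambda>(x, y). \<beta> x y) t \<in> K"
proof -
  interpret M: module R M by fact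
  interpret N: module R N by fact
  interpret Y: module R Y by fact
  let ?S = "carrier M \<times> carrier N"
  let ?F = "free_on R ?S"
  have Fm: "module R ?F" by (rule free_on_module[OF M.R.cring_axioms])
  interpret F: module R ?F by (rule Fm)
  let ?h = "free_lift R ?S Y (\<lambda>(x, y). \<beta> x y)"
  have \<beta>c: "(\<lambda>(x, y). \<beta> x y) \<in> ?S \<rightarrow> carrier Y" using \<beta> by auto
  have h: "?h \<in> mod_hom R ?F Y" by (rule free_lift_hom[OF Y \<beta>c])
  have he: "?h (basis_elt R ?S (x, y)) = \<beta> x y" if "x \<in> carrier M" "y \<in> carrier N" for x y
    using free_lift_basis[OF Y \<beta>c, of "(x, y)"] that by simp
  have e: "basis_elt R ?S (x, y) \<in> carrier ?F" if "x \<in> carrier M" "y \<in> carrier N" for x y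
    using basis_elt_closed[OF M.R.cring_axioms, of "(x, y)" ?S] that by simp
  have sub: "submodule {v \<in> carrier ?F. ?h v \<in> K} R ?F" by (rule submodule_hom_vimage[OF Fm Y h K])
  note hd = mod_hom_diff[OF Fm Y h] and ha = mod_hom_add[OF h] and hs = mod_hom_smult[OF h]
  have "tensor_rels R M N \<subseteq> {v \<in> carrier ?F. ?h v \<in> K}"
  proof
    fix v assume v: "v \<in> tensor_rels R M N"
    then have vc: "v \<in> carrier ?F" using tensor_rels_closed[OF M N] by auto
    have "?h v \<in> K"
      using v unfolding tensor_rels_def Let_def
      by (elim UnE CollectE exE conjE)
        (simp_all add: hd ha hs e he add1 add2 smult1 smult2)
    then show "v \<in> {v \<in> carrier ?F. ?h v \<in> K}" using vc by simp
  qed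
  then have "tensor_sub R M N \<subseteq> {v \<in> carrier ?F. ?h v \<in> K}"
    unfolding tensor_sub_def by (rule mod_span_least[OF sub])
  then show ?thesis using t by auto
qed

lemma pure_tensor_bilinear:
  assumes M: "module R M" and N: "module R N"
  shows "x \<in> carrier M \<Longrightarrow> y \<in> carrier N \<Longrightarrow> pure_tensor R M N x y \<in> carrier (tensor R M N)"
    "y \<in> carrier N \<Longrightarrow> (\<lambda>x. pure_tensor R M N x y) \<in> mod_hom R M (tensor R M N)"
    "x \<in> carrier M \<Longrightarrow> (\<lambda>y. pure_tensor R M N x y) \<in> mod_hom R N (tensor R M N)"
proof -
  interpret M: module R M by fact
  interpret N: module R N by fact
  let ?S = "carrier M \<times> carrier N"
  let ?F = "free_on R ?S"
  have Fm: "module R ?F" by (rule free_on_module[OF M.R.cring_axioms])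
  interpret F: module R ?F by (rule Fm)
  let ?T = "tensor_sub R M N"
  let ?e = "\<lambda>x y. basis_elt R ?S (x, y)"
  note T = tensor_sub_submodule[OF M N]
  note ops = quot_module_ops[OF Fm T(1)]
  note ceq = F.coset_eq_iff[OF T(1)]
  have e: "?e x y \<in> carrier ?F" if "x \<in> carrier M" "y \<in> carrier N" for x y
    using basis_elt_closed[OF M.R.cring_axioms, of "(x, y)" ?S] that by simp
  show cl: "pure_tensor R M N x y \<in> carrier (tensor R M N)" if "x \<in> carrier M" "y \<in> carrier N" for x y
    unfolding pure_tensor_def tensor_def ops(1) using e[OF that] by simp
  have rel: "u \<in> ?T" if "u \<in> tensor_rels R M N" for u using T(2) that by auto
  show "(\<lambda>x. pure_tensor R M N x y) \<in> mod_hom R M (tensor R M N)" if y: "y \<in> carrier N"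
  proof (rule mod_homI)
    fix x x' assume x: "x \<in> carrier M" "x' \<in> carrier M"
    have "?e (x \<oplus>\<^bsub>M\<^esub> x') y \<ominus>\<^bsub>?F\<^esub> (?e x y \<oplus>\<^bsub>?F\<^esub> ?e x' y) \<in> ?T"
      by (rule rel) (use x y in \<open>auto simp: tensor_rels_def Let_def\<close>)
    then show "pure_tensor R M N (x \<oplus>\<^bsub>M\<^esub> x') y =
        pure_tensor R M N x y \<oplus>\<^bsub>tensor R M N\<^esub> pure_tensor R M N x' y"
      unfolding pure_tensor_def tensor_def using x y by (simp add: ops ceq e)
  next
    fix a x assume a: "a \<in> carrier R" and x: "x \<in> carrier M"
    have "?e (a \<odot>\<^bsub>M\<^esub> x) y \<ominus>\<^bsub>?F\<^esub> a \<odot>\<^bsub>?F\<^esub> ?e x y \<in> ?T"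
      by (rule rel) (use a x y in \<open>auto simp: tensor_rels_def Let_def\<close>)
    then show "pure_tensor R M N (a \<odot>\<^bsub>M\<^esub> x) y = a \<odot>\<^bsub>tensor R M N\<^esub> pure_tensor R M N x y"
      unfolding pure_tensor_def tensor_def using a x y by (simp add: ops ceq e)
  qed (use cl y in auto)
  show "(\<lambda>y. pure_tensor R M N x y) \<in> mod_hom R N (tensor R M N)" if x: "x \<in> carrier M"
  proof (rule mod_homI)
    fix y y' assume y: "y \<in> carrier N" "y' \<in> carrier N"
    have "?e x (y \<oplus>\<^bsub>N\<^esub> y') \<ominus>\<^bsub>?F\<^esub> (?e x y \<oplus>\<^bsub>?F\<^esub> ?e x y') \<in> ?T"
      by (rule rel) (use x y in \<open>auto simp: tensor_rels_def Let_def\<close>)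
    then show "pure_tensor R M N x (y \<oplus>\<^bsub>N\<^esub> y') =
        pure_tensor R M N x y \<oplus>\<^bsub>tensor R M N\<^esub> pure_tensor R M N x y'"
      unfolding pure_tensor_def tensor_def using x y by (simp add: ops ceq e)
  next
    fix a y assume a: "a \<in> carrier R" and y: "y \<in> carrier N"
    have "?e x (a \<odot>\<^bsub>N\<^esub> y) \<ominus>\<^bsub>?F\<^esub> a \<odot>\<^bsub>?F\<^esub> ?e x y \<in> ?T"
      by (rule rel) (use a x y in \<open>auto simp: tensor_rels_def Let_def\<close>)
    then show "pure_tensor R M N x (a \<odot>\<^bsub>N\<^esub> y) = a \<odot>\<^bsub>tensor R M N\<^esub> pure_tensor R M N x y"
      unfolding pure_tensor_def tensor_def using a x y by (simp add: ops ceq e)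
  qed (use cl x in auto)
qed

lemma sum_pure_tensors_zero_iff:
  assumes M: "module R M" and N: "module R N" and fin: "finite I"
    and x: "x \<in> I \<rightarrow> carrier M" and y: "y \<in> I \<rightarrow> carrier N"
  shows "(\<Oplus>\<^bsub>tensor R M N\<^esub>i\<in>I. pure_tensor R M N (x i) (y i)) = \<zero>\<^bsub>tensor R M N\<^esub> \<longleftrightarrow>
    (\<Oplus>\<^bsub>free_on R (carrier M \<times> carrier N)\<^esub>i\<in>I. basis_elt R (carrier M \<times> carrier N) (x i, y i))
      \<in> tensor_sub R M N"
proof -
  interpret M: module R M by fact
  let ?S = "carrier M \<times> carrier N"
  let ?F = "free_on R ?S"
  have Fm: "module R ?F" by (rule free_on_module[OF M.R.cring_axioms])
  interpret F: module R ?F by (rule Fm)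
  note T = tensor_sub_submodule[OF M N]
  have e: "(\<lambda>i. basis_elt R ?S (x i, y i)) \<in> I \<rightarrow> carrier ?F"
    using x y by (auto intro!: basis_elt_closed[OF M.R.cring_axioms])
  have "(\<Oplus>\<^bsub>tensor R M N\<^esub>i\<in>I. pure_tensor R M N (x i) (y i)) =
    tensor_sub R M N +>\<^bsub>?F\<^esub> (\<Oplus>\<^bsub>?F\<^esub>i\<in>I. basis_elt R ?S (x i, y i))"
    unfolding tensor_def pure_tensor_def
    by (rule mod_hom_finsum[OF Fm quot_module_module[OF Fm T(1)] fin e, symmetric])
  then show ?thesis
    unfolding tensor_def using quot_module_eq_zero_iff[OF Fm T(1) F.M.finsum_closed[OF e]] by simp
qed

lemma (in module) finsum_swap:
  assumes "finite I" "finite J" "\<And>i j. i \<in> I \<Longrightarrow> j \<in> J \<Longrightarrow> f i j \<in> carrier M"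
  shows "(\<Oplus>\<^bsub>M\<^esub>i\<in>I. \<Oplus>\<^bsub>M\<^esub>j\<in>J. f i j) = (\<Oplus>\<^bsub>M\<^esub>j\<in>J. \<Oplus>\<^bsub>M\<^esub>i\<in>I. f i j)"
  using assms(1,3)
proof (induction rule: finite_induct)
  case empty
  then show ?case using assms(2) by simp
next
  case (insert i I)
  have c: "(\<lambda>j. f i j) \<in> J \<rightarrow> carrier M" "\<And>j. j \<in> J \<Longrightarrow> (\<lambda>i. f i j) \<in> I \<rightarrow> carrier M"
    "(\<lambda>j. \<Oplus>\<^bsub>M\<^esub>i\<in>I. f i j) \<in> J \<rightarrow> carrier M"
    using insert.prems by (auto intro!: finsum_closed)
  have "(\<Oplus>\<^bsub>M\<^esub>i\<in>insert i I. \<Oplus>\<^bsub>M\<^esub>j\<in>J. f i j) =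
    (\<Oplus>\<^bsub>M\<^esub>j\<in>J. f i j) \<oplus>\<^bsub>M\<^esub> (\<Oplus>\<^bsub>M\<^esub>j\<in>J. \<Oplus>\<^bsub>M\<^esub>i\<in>I. f i j)"
    using insert by (subst finsum_insert) (auto intro!: finsum_closed)
  also have "\<dots> = (\<Oplus>\<^bsub>M\<^esub>j\<in>J. f i j \<oplus>\<^bsub>M\<^esub> (\<Oplus>\<^bsub>M\<^esub>i\<in>I. f i j))"
    by (rule finsum_addf[OF c(1,3), symmetric])
  also have "\<dots> = (\<Oplus>\<^bsub>M\<^esub>j\<in>J. \<Oplus>\<^bsub>M\<^esub>i\<in>insert i I. f i j)"
    using insert by (intro finsum_cong') (auto intro!: finsum_closed simp: Pi_iff)
  finally show ?case .
qed

section \<open>Fractions\<close>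

locale fractions = module R M for R (structure) and M (structure) +
  fixes S :: "'a set"
  assumes S_sub: "S \<subseteq> carrier R" and S_one: "\<one> \<in> S"
    and S_mult: "\<And>s t. s \<in> S \<Longrightarrow> t \<in> S \<Longrightarrow> s \<otimes> t \<in> S"
begin

lemma Sc [simp]: "s \<in> S \<Longrightarrow> s \<in> carrier R"
  using S_sub by auto

lemma fraction_mem:
  assumes "x \<in> carrier M" "s \<in> S" shows "(x, s) \<in> fraction R S M x s"
  using assms S_one by (auto simp: fraction_def)

lemma fraction_subset:
  assumes x: "x \<in> carrier M" "s \<in> S" and y: "y \<in> carrier M" "t \<in> S"
    and u: "u \<in> S" "u \<odot>\<^bsub>M\<^esub> (t \<odot>\<^bsub>M\<^esub> x) = u \<odot>\<^bsub>M\<^esub> (s \<odot>\<^bsub>M\<^esub> y)"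
  shows "fraction R S M y t \<subseteq> fraction R S M x s"
proof (rule subrelI)
  fix z w assume "(z, w) \<in> fraction R S M y t"
  then obtain v where z: "z \<in> carrier M" "w \<in> S" and v: "v \<in> S"
    "v \<odot>\<^bsub>M\<^esub> (w \<odot>\<^bsub>M\<^esub> y) = v \<odot>\<^bsub>M\<^esub> (t \<odot>\<^bsub>M\<^esub> z)" by (auto simp: fraction_def)
  let ?k = "u \<otimes> v \<otimes> t"
  have k: "?k \<in> S" using u v y by (intro S_mult)
  have "?k \<odot>\<^bsub>M\<^esub> (w \<odot>\<^bsub>M\<^esub> x) = (v \<otimes> w) \<odot>\<^bsub>M\<^esub> (u \<odot>\<^bsub>M\<^esub> (t \<odot>\<^bsub>M\<^esub> x))"
    using x y z u(1) v(1) by (simp flip: smult_assoc1 add: m_ac)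
  also have "\<dots> = (u \<otimes> s) \<odot>\<^bsub>M\<^esub> (v \<odot>\<^bsub>M\<^esub> (w \<odot>\<^bsub>M\<^esub> y))"
    unfolding u(2) using x y z u(1) v(1) by (simp flip: smult_assoc1 add: m_ac)
  also have "\<dots> = ?k \<odot>\<^bsub>M\<^esub> (s \<odot>\<^bsub>M\<^esub> z)"
    unfolding v(2) using x y z u(1) v(1) by (simp flip: smult_assoc1 add: m_ac)
  finally show "(z, w) \<in> fraction R S M x s" using z k by (auto simp: fraction_def)
qed

lemma fraction_eq_iff:
  assumes x: "x \<in> carrier M" "s \<in> S" and y: "y \<in> carrier M" "t \<in> S"
  shows "fraction R S M x s = fraction R S M y t \<longleftrightarrow>
    (\<exists>u\<in>S. u \<odot>\<^bsub>M\<^esub> (t \<odot>\<^bsub>M\<^esub> x) = u \<odot>\<^bsub>M\<^esub> (s \<odot>\<^bsub>M\<^esub> y))"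
proof
  assume "fraction R S M x s = fraction R S M y t"
  then have "(y, t) \<in> fraction R S M x s" using fraction_mem[OF y] by simp
  then show "\<exists>u\<in>S. u \<odot>\<^bsub>M\<^esub> (t \<odot>\<^bsub>M\<^esub> x) = u \<odot>\<^bsub>M\<^esub> (s \<odot>\<^bsub>M\<^esub> y)" by (auto simp: fraction_def)
next
  assume "\<exists>u\<in>S. u \<odot>\<^bsub>M\<^esub> (t \<odot>\<^bsub>M\<^esub> x) = u \<odot>\<^bsub>M\<^esub> (s \<odot>\<^bsub>M\<^esub> y)"
  then obtain u where u: "u \<in> S" "u \<odot>\<^bsub>M\<^esub> (t \<odot>\<^bsub>M\<^esub> x) = u \<odot>\<^bsub>M\<^esub> (s \<odot>\<^bsub>M\<^esub> y)" by auto
  show "fraction R S M x s = fraction R S M y t"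
    using fraction_subset[OF x y u] fraction_subset[OF y x u(1) u(2)[symmetric]] by (rule equalityI[rotated])
qed

lemma fraction_eqI:
  assumes "x \<in> carrier M" "s \<in> S" "y \<in> carrier M" "t \<in> S" "t \<odot>\<^bsub>M\<^esub> x = s \<odot>\<^bsub>M\<^esub> y"
  shows "fraction R S M x s = fraction R S M y t"
  unfolding fraction_eq_iff[OF assms(1-4)] using assms(5) S_one by (auto intro!: bexI[of _ \<one>])

lemma fraction_memD:
  assumes "(x', s') \<in> fraction R S M x s"
  obtains u where "x' \<in> carrier M" "s' \<in> S" "u \<in> S" "u \<odot>\<^bsub>M\<^esub> (s' \<odot>\<^bsub>M\<^esub> x) = u \<odot>\<^bsub>M\<^esub> (s \<odot>\<^bsub>M\<^esub> x')"
  using assms by (auto simp: fraction_def)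

lemma fraction_add_cong:
  assumes x: "x \<in> carrier M" "s \<in> S" and y: "y \<in> carrier M" "t \<in> S"
    and x': "(x', s') \<in> fraction R S M x s" and y': "(y', t') \<in> fraction R S M y t"
  shows "fraction R S M (t' \<odot>\<^bsub>M\<^esub> x' \<oplus>\<^bsub>M\<^esub> s' \<odot>\<^bsub>M\<^esub> y') (s' \<otimes> t') =
    fraction R S M (t \<odot>\<^bsub>M\<^esub> x \<oplus>\<^bsub>M\<^esub> s \<odot>\<^bsub>M\<^esub> y) (s \<otimes> t)"
proof -
  obtain u where u: "x' \<in> carrier M" "s' \<in> S" "u \<in> S" "u \<odot>\<^bsub>M\<^esub> (s' \<odot>\<^bsub>M\<^esub> x) = u \<odot>\<^bsub>M\<^esub> (s \<odot>\<^bsub>M\<^esub> x')"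
    using fraction_memD[OF x'] .
  obtain v where v: "y' \<in> carrier M" "t' \<in> S" "v \<in> S" "v \<odot>\<^bsub>M\<^esub> (t' \<odot>\<^bsub>M\<^esub> y) = v \<odot>\<^bsub>M\<^esub> (t \<odot>\<^bsub>M\<^esub> y')"
    using fraction_memD[OF y'] .
  let ?k = "u \<otimes> v"
  have k: "?k \<in> S" using u(3) v(3) by (rule S_mult)
  have 1: "?k \<odot>\<^bsub>M\<^esub> ((s \<otimes> t) \<odot>\<^bsub>M\<^esub> (t' \<odot>\<^bsub>M\<^esub> x')) = ?k \<odot>\<^bsub>M\<^esub> ((s' \<otimes> t') \<odot>\<^bsub>M\<^esub> (t \<odot>\<^bsub>M\<^esub> x))"
  proof -
    have "?k \<odot>\<^bsub>M\<^esub> ((s \<otimes> t) \<odot>\<^bsub>M\<^esub> (t' \<odot>\<^bsub>M\<^esub> x')) = (v \<otimes> t \<otimes> t') \<odot>\<^bsub>M\<^esub> (u \<odot>\<^bsub>M\<^esub> (s \<odot>\<^bsub>M\<^esub> x'))"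
      using x y u(1-3) v(1-3) by (simp flip: smult_assoc1 add: m_ac)
    also have "\<dots> = ?k \<odot>\<^bsub>M\<^esub> ((s' \<otimes> t') \<odot>\<^bsub>M\<^esub> (t \<odot>\<^bsub>M\<^esub> x))"
      unfolding u(4)[symmetric] using x y u(1-3) v(1-3) by (simp flip: smult_assoc1 add: m_ac)
    finally show ?thesis .
  qed
  have 2: "?k \<odot>\<^bsub>M\<^esub> ((s \<otimes> t) \<odot>\<^bsub>M\<^esub> (s' \<odot>\<^bsub>M\<^esub> y')) = ?k \<odot>\<^bsub>M\<^esub> ((s' \<otimes> t') \<odot>\<^bsub>M\<^esub> (s \<odot>\<^bsub>M\<^esub> y))"
  proof -
    have "?k \<odot>\<^bsub>M\<^esub> ((s \<otimes> t) \<odot>\<^bsub>M\<^esub> (s' \<odot>\<^bsub>M\<^esub> y')) = (u \<otimes> s \<otimes> s') \<odot>\<^bsub>M\<^esub> (v \<odot>\<^bsub>M\<^esub> (t \<odot>\<^bsub>M\<^esub> y'))"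
      using x y u(1-3) v(1-3) by (simp flip: smult_assoc1 add: m_ac)
    also have "\<dots> = ?k \<odot>\<^bsub>M\<^esub> ((s' \<otimes> t') \<odot>\<^bsub>M\<^esub> (s \<odot>\<^bsub>M\<^esub> y))"
      unfolding v(4)[symmetric] using x y u(1-3) v(1-3) by (simp flip: smult_assoc1 add: m_ac)
    finally show ?thesis .
  qed
  have st: "s \<otimes> t \<in> S" "s' \<otimes> t' \<in> S" using x y u v S_mult by auto
  have c: "t' \<odot>\<^bsub>M\<^esub> x' \<oplus>\<^bsub>M\<^esub> s' \<odot>\<^bsub>M\<^esub> y' \<in> carrier M" "t \<odot>\<^bsub>M\<^esub> x \<oplus>\<^bsub>M\<^esub> s \<odot>\<^bsub>M\<^esub> y \<in> carrier M"
    using x y u(1-3) v(1-3) by auto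
  have "?k \<odot>\<^bsub>M\<^esub> ((s \<otimes> t) \<odot>\<^bsub>M\<^esub> (t' \<odot>\<^bsub>M\<^esub> x' \<oplus>\<^bsub>M\<^esub> s' \<odot>\<^bsub>M\<^esub> y')) =
    ?k \<odot>\<^bsub>M\<^esub> ((s' \<otimes> t') \<odot>\<^bsub>M\<^esub> (t \<odot>\<^bsub>M\<^esub> x \<oplus>\<^bsub>M\<^esub> s \<odot>\<^bsub>M\<^esub> y))"
    using 1 2 x y u(1-3) v(1-3) st k by (simp add: smult_r_distr)
  then show ?thesis unfolding fraction_eq_iff[OF c(1) st(2) c(2) st(1)] using k by auto
qed

lemma loc_add:
  assumes x: "x \<in> carrier M" "s \<in> S" and y: "y \<in> carrier M" "t \<in> S"
  shows "fraction R S M x s \<oplus>\<^bsub>loc_module R S M\<^esub> fraction R S M y t =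
    fraction R S M (t \<odot>\<^bsub>M\<^esub> x \<oplus>\<^bsub>M\<^esub> s \<odot>\<^bsub>M\<^esub> y) (s \<otimes> t)"
proof -
  have "fraction R S M x s \<oplus>\<^bsub>loc_module R S M\<^esub> fraction R S M y t =
    (\<Union>(x', s')\<in>fraction R S M x s. \<Union>(y', t')\<in>fraction R S M y t.
      fraction R S M (t' \<odot>\<^bsub>M\<^esub> x' \<oplus>\<^bsub>M\<^esub> s' \<odot>\<^bsub>M\<^esub> y') (s' \<otimes> t'))"
    by (simp add: loc_module_def)
  also have "\<dots> = (\<Union>a\<in>fraction R S M x s. \<Union>b\<in>fraction R S M y t.
      fraction R S M (t \<odot>\<^bsub>M\<^esub> x \<oplus>\<^bsub>M\<^esub> s \<odot>\<^bsub>M\<^esub> y) (s \<otimes> t))"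
    by (intro SUP_cong refl) (auto simp: fraction_add_cong[OF x y])
  also have "\<dots> = fraction R S M (t \<odot>\<^bsub>M\<^esub> x \<oplus>\<^bsub>M\<^esub> s \<odot>\<^bsub>M\<^esub> y) (s \<otimes> t)"
    using fraction_mem[OF x] fraction_mem[OF y] by auto
  finally show ?thesis .
qed

lemma loc_add_same:
  assumes x: "x \<in> carrier M" and y: "y \<in> carrier M" and s: "s \<in> S"
  shows "fraction R S M x s \<oplus>\<^bsub>loc_module R S M\<^esub> fraction R S M y s = fraction R S M (x \<oplus>\<^bsub>M\<^esub> y) s"
  unfolding loc_add[OF x s y s]
  using x y s S_mult by (intro fraction_eqI) (auto simp: smult_r_distr smult_assoc1)

lemma self_fractions: "fractions R (self_module R) S"
  using S_sub S_one S_mult self_module_module[OF R.cring_axioms]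
  by (simp add: fractions_def fractions_axioms_def)

lemma fraction_smult_cong:
  assumes a: "a \<in> carrier R" "s \<in> S" and x: "x \<in> carrier M" "t \<in> S"
    and a': "(a', s') \<in> fraction R S (self_module R) a s" and x': "(x', t') \<in> fraction R S M x t"
  shows "fraction R S M (a' \<odot>\<^bsub>M\<^esub> x') (s' \<otimes> t') = fraction R S M (a \<odot>\<^bsub>M\<^esub> x) (s \<otimes> t)"
proof -
  obtain u where u: "a' \<in> carrier R" "s' \<in> S" "u \<in> S" "u \<otimes> (s' \<otimes> a) = u \<otimes> (s \<otimes> a')"
    using fractions.fraction_memD[OF self_fractions a'] by auto
  obtain v where v: "x' \<in> carrier M" "t' \<in> S" "v \<in> S" "v \<odot>\<^bsub>M\<^esub> (t' \<odot>\<^bsub>M\<^esub> x) = v \<odot>\<^bsub>M\<^esub> (t \<odot>\<^bsub>M\<^esub> x')"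
    using fraction_memD[OF x'] .
  let ?k = "u \<otimes> v"
  have k: "?k \<in> S" using u(3) v(3) by (rule S_mult)
  have st: "s \<otimes> t \<in> S" "s' \<otimes> t' \<in> S" using a x u v S_mult by auto
  have c: "a' \<odot>\<^bsub>M\<^esub> x' \<in> carrier M" "a \<odot>\<^bsub>M\<^esub> x \<in> carrier M" using a x u(1-3) v(1-3) by auto
  have "?k \<odot>\<^bsub>M\<^esub> ((s \<otimes> t) \<odot>\<^bsub>M\<^esub> (a' \<odot>\<^bsub>M\<^esub> x')) = (u \<otimes> (s \<otimes> a')) \<odot>\<^bsub>M\<^esub> (v \<odot>\<^bsub>M\<^esub> (t \<odot>\<^bsub>M\<^esub> x'))"
    using a x u(1-3) v(1-3) by (simp flip: smult_assoc1 add: m_ac)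
  also have "\<dots> = ?k \<odot>\<^bsub>M\<^esub> ((s' \<otimes> t') \<odot>\<^bsub>M\<^esub> (a \<odot>\<^bsub>M\<^esub> x))"
    unfolding u(4)[symmetric] v(4)[symmetric] using a x u(1-3) v(1-3)
    by (simp flip: smult_assoc1 add: m_ac)
  finally show ?thesis unfolding fraction_eq_iff[OF c(1) st(2) c(2) st(1)] using k by auto
qed

lemma loc_smult:
  assumes a: "a \<in> carrier R" "s \<in> S" and x: "x \<in> carrier M" "t \<in> S"
  shows "fraction R S (self_module R) a s \<odot>\<^bsub>loc_module R S M\<^esub> fraction R S M x t =
    fraction R S M (a \<odot>\<^bsub>M\<^esub> x) (s \<otimes> t)"
proof -
  have "fraction R S (self_module R) a s \<odot>\<^bsub>loc_module R S M\<^esub> fraction R S M x t =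
    (\<Union>(a', s')\<in>fraction R S (self_module R) a s. \<Union>(x', t')\<in>fraction R S M x t.
      fraction R S M (a' \<odot>\<^bsub>M\<^esub> x') (s' \<otimes> t'))"
    by (simp add: loc_module_def)
  also have "\<dots> = (\<Union>p\<in>fraction R S (self_module R) a s. \<Union>b\<in>fraction R S M x t.
      fraction R S M (a \<odot>\<^bsub>M\<^esub> x) (s \<otimes> t))"
    by (intro SUP_cong refl) (auto simp: fraction_smult_cong[OF a x])
  also have "\<dots> = fraction R S M (a \<odot>\<^bsub>M\<^esub> x) (s \<otimes> t)"
    using fraction_mem[OF x] fractions.fraction_mem[OF self_fractions, of a s] a by auto
  finally show ?thesis .
qed

lemma loc_zero: "s \<in> S \<Longrightarrow> fraction R S M \<zero>\<^bsub>M\<^esub> s = \<zero>\<^bsub>loc_module R S M\<^esub>"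
proof -
  assume "s \<in> S"
  then have "fraction R S M \<zero>\<^bsub>M\<^esub> s = fraction R S M \<zero>\<^bsub>M\<^esub> \<one>"
    using S_one by (intro fraction_eqI) auto
  then show ?thesis by (simp add: loc_module_def)
qed

lemma loc_carrier: "X \<in> carrier (loc_module R S M) \<longleftrightarrow> (\<exists>x\<in>carrier M. \<exists>s\<in>S. X = fraction R S M x s)"
  by (auto simp: loc_module_def)

lemma loc_ring_simps:
  "carrier (loc_ring R S) = carrier (loc_module R S (self_module R))"
  "\<zero>\<^bsub>loc_ring R S\<^esub> = \<zero>\<^bsub>loc_module R S (self_module R)\<^esub>"
  "x \<oplus>\<^bsub>loc_ring R S\<^esub> y = x \<oplus>\<^bsub>loc_module R S (self_module R)\<^esub> y"
  "x \<otimes>\<^bsub>loc_ring R S\<^esub> y = x \<odot>\<^bsub>loc_module R S (self_module R)\<^esub> y"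
  "\<one>\<^bsub>loc_ring R S\<^esub> = fraction R S (self_module R) \<one> \<one>"
  by (simp_all add: loc_ring_def Let_def)

text \<open>A vector with common denominator \<open>u\<close> is a sum of multiples of basis elements, and \<open>(c i s
  i / u) (x i / s i) = (c i x i) / u\<close>; the factors \<open>s i\<close> cancel the denominators in the values
  of \<open>\<phi>\<close>. The induction is on the number of leading coordinates that are taken into account.\<close>

lemma loc_hom_eval:
  assumes phi: "\<phi> \<in> mod_hom (loc_ring R S) (rpow (loc_ring R S) N) (loc_module R S M)"
    and x: "\<And>i. i < N \<Longrightarrow> x i \<in> carrier M" "\<And>i. i < N \<Longrightarrow> s i \<in> S"
    and phi_e: "\<And>i. i < N \<Longrightarrow> \<phi> (basis_elt (loc_ring R S) {..<N} i) = fraction R S M (x i) (s i)"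
    and c: "\<And>i. i < N \<Longrightarrow> c i \<in> carrier R" and u: "u \<in> S"
  shows "(\<lambda>i\<in>{..<N}. fraction R S (self_module R) (c i \<otimes> s i) u) \<in> carrier (rpow (loc_ring R S) N)"
    and "\<phi> (\<lambda>i\<in>{..<N}. fraction R S (self_module R) (c i \<otimes> s i) u) =
      fraction R S M (\<Oplus>\<^bsub>M\<^esub>i\<in>{..<N}. c i \<odot>\<^bsub>M\<^esub> x i) u"
proof -
  interpret Rf: fractions R "self_module R" S by (rule self_fractions)
  let ?L = "loc_ring R S" and ?fr = "fraction R S (self_module R)"
  let ?w = "\<lambda>K. \<lambda>i\<in>{..<N}. if i < K then ?fr (c i \<otimes> s i) u else ?fr \<zero> u"
  have Rl: "?fr a t \<in> carrier ?L" if "a \<in> carrier R" "t \<in> S" for a t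
    unfolding loc_ring_simps Rf.loc_carrier using that by auto
  have wc: "?w K \<in> carrier (rpow ?L N)" for K
    using x(2) c u by (auto simp: rpow_carrier_iff intro!: Rl)
  have fz: "?fr \<zero> t = \<zero>\<^bsub>?L\<^esub>" if "t \<in> S" for t
    using Rf.loc_zero[OF that] by (simp add: loc_ring_simps)
  have add: "?fr a t \<oplus>\<^bsub>?L\<^esub> ?fr b t = ?fr (a \<oplus> b) t" if "a \<in> carrier R" "b \<in> carrier R" "t \<in> S" for a b t
    using Rf.loc_add_same[of a b t] that by (simp add: loc_ring_simps)
  have mult: "?fr a t \<otimes>\<^bsub>?L\<^esub> ?fr b t' = ?fr (a \<otimes> b) (t \<otimes> t')"
    if "a \<in> carrier R" "b \<in> carrier R" "t \<in> S" "t' \<in> S" for a b t t'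
    using Rf.loc_smult[of a t b t'] that by (simp add: loc_ring_simps)
  have one: "\<one>\<^bsub>?L\<^esub> = ?fr \<one> \<one>" by (simp add: loc_ring_simps)
  have ec: "basis_elt ?L {..<N} K \<in> carrier (rpow ?L N)" for K
    using Rl[OF R.one_closed S_one] Rl[OF R.zero_closed S_one]
    by (auto simp: rpow_carrier_iff basis_elt_def one fz[OF S_one, symmetric])
  have eval: "K \<le> N \<Longrightarrow> \<phi> (?w K) = fraction R S M (\<Oplus>\<^bsub>M\<^esub>i\<in>{..<K}. c i \<odot>\<^bsub>M\<^esub> x i) u" for K
  proof (induction K)
    case 0
    have "?fr \<zero> u \<otimes>\<^bsub>?L\<^esub> ?fr \<zero> u = ?fr \<zero> u"
      using mult[of \<zero> \<zero> u u] fz[OF u] fz[OF S_mult[OF u u]] u by simp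
    then have "?fr \<zero> u \<odot>\<^bsub>rpow ?L N\<^esub> ?w 0 = ?w 0"
      by (simp add: free_on_simps fun_eq_iff)
    then have "\<phi> (?w 0) = ?fr \<zero> u \<odot>\<^bsub>loc_module R S M\<^esub> \<phi> (?w 0)"
      using mod_hom_smult[OF phi Rl[OF R.zero_closed u] wc[of 0]] by simp
    moreover obtain y t where "y \<in> carrier M" "t \<in> S" "\<phi> (?w 0) = fraction R S M y t"
      using mod_hom_closed[OF phi wc[of 0]] by (auto simp: loc_carrier)
    ultimately have "\<phi> (?w 0) = fraction R S M \<zero>\<^bsub>M\<^esub> (u \<otimes> t)" using u by (simp add: loc_smult)
    also have "\<dots> = fraction R S M \<zero>\<^bsub>M\<^esub> u"
      using u \<open>t \<in> S\<close> S_mult by (simp add: loc_zero)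
    finally show ?case by (simp only: lessThan_0 finsum_empty)
  next
    case (Suc K)
    then have K: "K < N" by simp
    let ?a = "?fr (c K \<otimes> s K) u"
    have ac: "?a \<in> carrier ?L" using c[OF K] x(2)[OF K] u by (auto intro: Rl)
    have "?w (Suc K) = ?w K \<oplus>\<^bsub>rpow ?L N\<^esub> ?a \<odot>\<^bsub>rpow ?L N\<^esub> basis_elt ?L {..<N} K"
    proof
      fix i
      show "?w (Suc K) i = (?w K \<oplus>\<^bsub>rpow ?L N\<^esub> ?a \<odot>\<^bsub>rpow ?L N\<^esub> basis_elt ?L {..<N} K) i"
      proof (cases "i < N")
        case True
        have e: "basis_elt ?L {..<N} K i = (if i = K then ?fr \<one> \<one> else ?fr \<zero> \<one>)"
          using True by (simp add: basis_elt_def one fz[OF S_one])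
        show ?thesis
          using True K c x(2) u S_one less_Suc_eq
          by (auto simp: free_on_simps e mult add)
      qed (simp add: free_on_simps)
    qed
    then have "\<phi> (?w (Suc K)) = \<phi> (?w K) \<oplus>\<^bsub>loc_module R S M\<^esub> ?a \<odot>\<^bsub>loc_module R S M\<^esub> fraction R S M (x K) (s K)"
    proof -
      assume eq: "?w (Suc K) = ?w K \<oplus>\<^bsub>rpow ?L N\<^esub> ?a \<odot>\<^bsub>rpow ?L N\<^esub> basis_elt ?L {..<N} K"
      have aec: "?a \<odot>\<^bsub>rpow ?L N\<^esub> basis_elt ?L {..<N} K \<in> carrier (rpow ?L N)"
      proof -
        have "?a \<otimes>\<^bsub>?L\<^esub> basis_elt ?L {..<N} K i \<in> carrier ?L" if "i < N" for i
          using that K c x(2) u S_one S_mult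
          by (auto simp: basis_elt_def one fz[OF S_one, symmetric] mult intro!: Rl)
        then show ?thesis by (auto simp: rpow_carrier_iff free_on_simps)
      qed
      show ?thesis unfolding eq
        using mod_hom_add[OF phi wc aec] mod_hom_smult[OF phi ac ec] phi_e[OF K] by simp
    qed
    also have "?a \<odot>\<^bsub>loc_module R S M\<^esub> fraction R S M (x K) (s K) = fraction R S M (c K \<odot>\<^bsub>M\<^esub> x K) u"
    proof -
      have "fraction R S M ((c K \<otimes> s K) \<odot>\<^bsub>M\<^esub> x K) (u \<otimes> s K) = fraction R S M (c K \<odot>\<^bsub>M\<^esub> x K) u"
        using c[OF K] x(1,2)[OF K] u S_mult
        by (intro fraction_eqI) (auto simp flip: smult_assoc1 simp: m_ac)
      then show ?thesis using loc_smult[of "c K \<otimes> s K" u "x K" "s K"] c[OF K] x(1,2)[OF K] u by simp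
    qed
    also have "\<phi> (?w K) = fraction R S M (\<Oplus>\<^bsub>M\<^esub>i\<in>{..<K}. c i \<odot>\<^bsub>M\<^esub> x i) u"
      by (rule Suc.IH) (use K in simp)
    also have "fraction R S M (\<Oplus>\<^bsub>M\<^esub>i\<in>{..<K}. c i \<odot>\<^bsub>M\<^esub> x i) u \<oplus>\<^bsub>loc_module R S M\<^esub>
        fraction R S M (c K \<odot>\<^bsub>M\<^esub> x K) u =
      fraction R S M ((\<Oplus>\<^bsub>M\<^esub>i\<in>{..<K}. c i \<odot>\<^bsub>M\<^esub> x i) \<oplus>\<^bsub>M\<^esub> c K \<odot>\<^bsub>M\<^esub> x K) u"
      using K c x u by (intro loc_add_same finsum_closed) auto
    also have "(\<Oplus>\<^bsub>M\<^esub>i\<in>{..<K}. c i \<odot>\<^bsub>M\<^esub> x i) \<oplus>\<^bsub>M\<^esub> c K \<odot>\<^bsub>M\<^esub> x K = (\<Oplus>\<^bsub>M\<^esub>i\<in>{..<Suc K}. c i \<odot>\<^bsub>M\<^esub> x i)"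
      using K c x by (simp add: lessThan_Suc finsum_insert Pi_iff M.a_comm finsum_closed)
    finally show ?case .
  qed
  have "?w N = (\<lambda>i\<in>{..<N}. ?fr (c i \<otimes> s i) u)" by (rule restrict_ext) simp
  then show "(\<lambda>i\<in>{..<N}. ?fr (c i \<otimes> s i) u) \<in> carrier (rpow ?L N)"
    and "\<phi> (\<lambda>i\<in>{..<N}. ?fr (c i \<otimes> s i) u) = fraction R S M (\<Oplus>\<^bsub>M\<^esub>i\<in>{..<N}. c i \<odot>\<^bsub>M\<^esub> x i) u"
    using wc[of N] eval[of N] by simp_all
qed

lemma common_multiple:
  fixes N :: nat
  assumes Q: "\<And>i u v. i < N \<Longrightarrow> u \<in> S \<Longrightarrow> v \<in> S \<Longrightarrow> Q i u \<Longrightarrow> Q i (u \<otimes> v)"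
  shows "(\<And>i. i < N \<Longrightarrow> \<exists>u\<in>S. Q i u) \<Longrightarrow> \<exists>u\<in>S. \<forall>i<N. Q i u"
  using Q
proof (induction N)
  case 0
  then show ?case using S_one by auto
next
  case (Suc N)
  then obtain u where u: "u \<in> S" "\<forall>i<N. Q i u" by (metis less_SucI)
  obtain v where v: "v \<in> S" "Q N v" using Suc.prems(1)[of N] by auto
  have "Q i (u \<otimes> v)" if "i < Suc N" for i
  proof (cases "i = N")
    case True
    then show ?thesis using Suc.prems(2)[of N v u] u v m_comm[of u v] by simp
  next
    case False
    then show ?thesis using Suc.prems(2)[of i u v] u v that by simp
  qed
  then show ?case using S_mult[OF u(1) v(1)] by auto
qed

text \<open>The numerators \<open>x\<close> of the images of a basis under \<open>(S\<^sup>-\<^sup>1R)\<^sup>N \<cong> S\<^sup>-\<^sup>1M\<close> generate \<open>M\<close> and are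
  independent, both up to factors from \<open>S\<close>.\<close>

lemma locally_free_basis:
  assumes free: "free_module (loc_ring R S) (loc_module R S M)"
  obtains N x where "\<And>i. i < (N::nat) \<Longrightarrow> x i \<in> carrier M"
    "\<And>y. y \<in> carrier M \<Longrightarrow> \<exists>u\<in>S. \<exists>c. (\<forall>i<N. c i \<in> carrier R) \<and> u \<odot>\<^bsub>M\<^esub> y = (\<Oplus>\<^bsub>M\<^esub>i\<in>{..<N}. c i \<odot>\<^bsub>M\<^esub> x i)"
    "\<And>c. (\<And>i. i < N \<Longrightarrow> c i \<in> carrier R) \<Longrightarrow> (\<Oplus>\<^bsub>M\<^esub>i\<in>{..<N}. c i \<odot>\<^bsub>M\<^esub> x i) = \<zero>\<^bsub>M\<^esub> \<Longrightarrow>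
      \<exists>t\<in>S. \<forall>i<N. t \<otimes> c i = \<zero>"
proof -
  interpret Rf: fractions R "self_module R" S by (rule self_fractions)
  let ?L = "loc_ring R S" and ?fr = "fraction R S (self_module R)"
  obtain N \<phi> where phi: "\<phi> \<in> mod_hom ?L (rpow ?L N) (loc_module R S M)"
    and bij: "bij_betw \<phi> (carrier (rpow ?L N)) (carrier (loc_module R S M))"
    using free unfolding free_module_def mod_iso_def by auto
  have Rl: "?fr a t \<in> carrier ?L" if "a \<in> carrier R" "t \<in> S" for a t
    unfolding loc_ring_simps Rf.loc_carrier using that by auto
  have fz: "?fr \<zero> \<one> = \<zero>\<^bsub>?L\<^esub>"
    using Rf.loc_zero[OF S_one] by (simp add: loc_ring_simps)
  have one: "\<one>\<^bsub>?L\<^esub> = ?fr \<one> \<one>" by (simp add: loc_ring_simps)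
  have ec: "basis_elt ?L {..<N} K \<in> carrier (rpow ?L N)" for K
    using Rl[OF R.one_closed S_one] Rl[OF R.zero_closed S_one]
    by (auto simp: rpow_carrier_iff basis_elt_def one fz[symmetric])
  have "\<exists>y t. y \<in> carrier M \<and> t \<in> S \<and> \<phi> (basis_elt ?L {..<N} i) = fraction R S M y t" for i
    using mod_hom_closed[OF phi ec[of i]] by (auto simp: loc_carrier)
  then obtain x s where x: "\<And>i. x i \<in> carrier M" "\<And>i. s i \<in> S"
    "\<And>i. \<phi> (basis_elt ?L {..<N} i) = fraction R S M (x i) (s i)" by metis
  note ev = loc_hom_eval[OF phi x]
  show ?thesis
  proof (rule that[of N x])
    show "x i \<in> carrier M" for i by (rule x(1))
    fix y assume y: "y \<in> carrier M"
    have "fraction R S M y \<one> \<in> carrier (loc_module R S M)" using y S_one by (auto simp: loc_carrier)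
    then have "fraction R S M y \<one> \<in> \<phi> ` carrier (rpow ?L N)"
      using bij unfolding bij_betw_def by simp
    then obtain v where v: "\<phi> v = fraction R S M y \<one>" "v \<in> carrier (rpow ?L N)"
      by (rule imageE) (rule that, simp_all)
    have "\<exists>u\<in>S. \<forall>i<N. \<exists>c\<in>carrier R. v i = ?fr (c \<otimes> s i) u"
    proof (rule common_multiple)
      fix i assume "i < N"
      then have "v i \<in> carrier ?L" using v(2) by (simp add: rpow_carrier_iff)
      then obtain a t where a: "a \<in> carrier R" "t \<in> S" "v i = ?fr a t"
        by (auto simp: loc_ring_simps Rf.loc_carrier)
      have "?fr a t = ?fr (a \<otimes> s i) (t \<otimes> s i)"
        using a(1,2) x(2)[of i] S_mult by (intro Rf.fraction_eqI) (auto simp: m_ac)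
      then show "\<exists>u\<in>S. \<exists>c\<in>carrier R. v i = ?fr (c \<otimes> s i) u"
        using a S_mult[OF a(2) x(2)] by auto
    next
      fix i u w assume uw: "u \<in> S" "w \<in> S" and "\<exists>c\<in>carrier R. v i = ?fr (c \<otimes> s i) u"
      then obtain c where c: "c \<in> carrier R" "v i = ?fr (c \<otimes> s i) u" by auto
      have "?fr (c \<otimes> s i) u = ?fr ((c \<otimes> w) \<otimes> s i) (u \<otimes> w)"
        using c(1) uw x(2)[of i] S_mult by (intro Rf.fraction_eqI) (auto simp: m_ac)
      then show "\<exists>c\<in>carrier R. v i = ?fr (c \<otimes> s i) (u \<otimes> w)" using c uw by auto
    qed
    then obtain u c where u: "u \<in> S" and c: "\<And>i. i < N \<Longrightarrow> c i \<in> carrier R"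
      "\<And>i. i < N \<Longrightarrow> v i = ?fr (c i \<otimes> s i) u" by metis
    have "v = (\<lambda>i\<in>{..<N}. ?fr (c i \<otimes> s i) u)"
      using v(2) c(2) by (auto simp: rpow_carrier_iff extensional_def fun_eq_iff)
    then have "\<phi> v = \<phi> (\<lambda>i\<in>{..<N}. ?fr (c i \<otimes> s i) u)" by (rule arg_cong)
    also have "\<dots> = fraction R S M (\<Oplus>\<^bsub>M\<^esub>i\<in>{..<N}. c i \<odot>\<^bsub>M\<^esub> x i) u" by (rule ev(2)[OF c(1) u])
    finally have eq: "fraction R S M y \<one> = fraction R S M (\<Oplus>\<^bsub>M\<^esub>i\<in>{..<N}. c i \<odot>\<^bsub>M\<^esub> x i) u"
      unfolding v(1) .
    have sc: "(\<Oplus>\<^bsub>M\<^esub>i\<in>{..<N}. c i \<odot>\<^bsub>M\<^esub> x i) \<in> carrier M"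
      using c(1) x(1) by (intro finsum_closed) auto
    from eq obtain w where w: "w \<in> S"
      "w \<odot>\<^bsub>M\<^esub> (u \<odot>\<^bsub>M\<^esub> y) = w \<odot>\<^bsub>M\<^esub> (\<one> \<odot>\<^bsub>M\<^esub> (\<Oplus>\<^bsub>M\<^esub>i\<in>{..<N}. c i \<odot>\<^bsub>M\<^esub> x i))"
      unfolding fraction_eq_iff[OF y S_one sc u] by auto
    have "(w \<otimes> u) \<odot>\<^bsub>M\<^esub> y = w \<odot>\<^bsub>M\<^esub> (\<Oplus>\<^bsub>M\<^esub>i\<in>{..<N}. c i \<odot>\<^bsub>M\<^esub> x i)"
      using w u y sc by (simp add: smult_assoc1)
    also have "\<dots> = (\<Oplus>\<^bsub>M\<^esub>i\<in>{..<N}. w \<odot>\<^bsub>M\<^esub> (c i \<odot>\<^bsub>M\<^esub> x i))"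
      using c(1) x(1) w(1) by (intro finsum_smult_ldistr) auto
    also have "\<dots> = (\<Oplus>\<^bsub>M\<^esub>i\<in>{..<N}. (w \<otimes> c i) \<odot>\<^bsub>M\<^esub> x i)"
      using c(1) x(1) w(1) by (intro finsum_cong') (auto simp: smult_assoc1)
    finally show "\<exists>u\<in>S. \<exists>c. (\<forall>i<N. c i \<in> carrier R) \<and> u \<odot>\<^bsub>M\<^esub> y = (\<Oplus>\<^bsub>M\<^esub>i\<in>{..<N}. c i \<odot>\<^bsub>M\<^esub> x i)"
      using S_mult[OF w(1) u] c(1) w(1)
      by (intro bexI[of _ "w \<otimes> u"] exI[of _ "\<lambda>i. w \<otimes> c i"]) auto
  next
    fix c assume c: "\<And>i. i < N \<Longrightarrow> c i \<in> carrier R" and z: "(\<Oplus>\<^bsub>M\<^esub>i\<in>{..<N}. c i \<odot>\<^bsub>M\<^esub> x i) = \<zero>\<^bsub>M\<^esub>"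
    let ?v = "\<lambda>i\<in>{..<N}. ?fr (c i \<otimes> s i) \<one>" and ?z = "\<lambda>i\<in>{..<N}. ?fr (\<zero> \<otimes> s i) \<one>"
    have v: "?v \<in> carrier (rpow ?L N)" "\<phi> ?v = fraction R S M \<zero>\<^bsub>M\<^esub> \<one>"
    proof -
      show "?v \<in> carrier (rpow ?L N)" by (rule ev(1)[OF _ S_one]) (rule c)
      have "\<phi> ?v = fraction R S M (\<Oplus>\<^bsub>M\<^esub>i\<in>{..<N}. c i \<odot>\<^bsub>M\<^esub> x i) \<one>"
        by (rule ev(2)[OF _ S_one]) (rule c)
      then show "\<phi> ?v = fraction R S M \<zero>\<^bsub>M\<^esub> \<one>" unfolding z .
    qed
    have zz: "(\<Oplus>\<^bsub>M\<^esub>i\<in>{..<N}. \<zero> \<odot>\<^bsub>M\<^esub> x i) = \<zero>\<^bsub>M\<^esub>"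
      using x(1) by (simp cong: finsum_cong add: finsum_zero)
    have z: "?z \<in> carrier (rpow ?L N)" "\<phi> ?z = fraction R S M \<zero>\<^bsub>M\<^esub> \<one>"
      by (rule ev(1)[OF R.zero_closed S_one]) (rule ev(2)[OF R.zero_closed S_one, unfolded zz])
    have "\<phi> ?v = \<phi> ?z" using v(2) z(2) by simp
    then have "?v = ?z" using inj_onD[OF bij_betw_imp_inj_on[OF bij] _ v(1) z(1)] by simp
    have "\<exists>t\<in>S. t \<otimes> c i = \<zero>" if i: "i < N" for i
    proof -
      have "?v i = ?z i" using \<open>?v = ?z\<close> by simp
      then have "?fr (c i \<otimes> s i) \<one> = ?fr \<zero> \<one>" using i x(2)[of i] by simp
      then obtain t where t: "t \<in> S" "t \<otimes> (c i \<otimes> s i) = \<zero>"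
        using Rf.fraction_eq_iff[of "c i \<otimes> s i" \<one> \<zero> \<one>] S_one c[OF i] x(2)[of i] by auto
      have "(t \<otimes> s i) \<otimes> c i = \<zero>" using t c[OF i] x(2)[of i] by (simp add: m_ac)
      then show ?thesis using S_mult[OF t(1) x(2)] by auto
    qed
    then show "\<exists>t\<in>S. \<forall>i<N. t \<otimes> c i = \<zero>"
    proof (rule common_multiple[rotated])
      fix i t t' assume "i < N" "t \<in> S" "t' \<in> S" "t \<otimes> c i = \<zero>"
      then have "t \<otimes> t' \<otimes> c i = t' \<otimes> (t \<otimes> c i)" using c by (simp add: m_ac)
      then show "t \<otimes> t' \<otimes> c i = \<zero>" using \<open>t \<otimes> c i = \<zero>\<close> \<open>t' \<in> S\<close> by simp
    qed
  qed
qed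

end

section \<open>Torsion in the tensor product with the dual\<close>

lemma (in module) diff_self: "x \<in> carrier M \<Longrightarrow> x \<ominus>\<^bsub>M\<^esub> x = \<zero>\<^bsub>M\<^esub>"
  by (simp add: diff_eq_zero_iff)

lemma hom_module_eval:
  "v \<in> carrier P \<Longrightarrow> (\<lambda>f. f v) \<in> mod_hom R (hom_module R P X) X"
  by (rule mod_homI) (auto simp: hom_module_apply hom_module_closed)

lemma hom_module_eqI:
  assumes "f \<in> carrier (hom_module R P X)" "g \<in> carrier (hom_module R P X)"
    "\<And>v. v \<in> carrier P \<Longrightarrow> f v = g v"
  shows "f = g"
  using assms by (auto simp: hom_module_simps intro: extensionalityI)

lemma scalar_hom:
  assumes M: "module R M" and c: "\<chi> \<in> mod_hom R P (self_module R)" and x: "x \<in> carrier M"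
  shows "(\<lambda>w. \<chi> w \<odot>\<^bsub>M\<^esub> x) \<in> mod_hom R P M"
proof -
  interpret M: module R M by fact
  have c': "\<chi> w \<in> carrier R" if "w \<in> carrier P" for w using mod_hom_closed[OF c that] by simp
  show ?thesis
    using x by (intro mod_homI)
      (simp_all add: c' mod_hom_add[OF c] mod_hom_smult[OF c] M.smult_l_distr M.smult_assoc1)
qed

lemma dual_module_module: "module R M \<Longrightarrow> module R (dual_module R M)"
  unfolding dual_module_def by (rule hom_module_module[OF _ self_module_module]) (auto dest: module.axioms(1))

lemma dual_module_hom: "\<phi> \<in> carrier (dual_module R M) \<Longrightarrow> \<phi> \<in> mod_hom R M (self_module R)"
  unfolding dual_module_def by (rule hom_module_hom)

lemma dual_module_closed: "\<phi> \<in> carrier (dual_module R M) \<Longrightarrow> x \<in> carrier M \<Longrightarrow> \<phi> x \<in> carrier R"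
  using mod_hom_closed[OF dual_module_hom] by fastforce

text \<open>Let \<open>x\<close> become a basis of \<open>S\<^sup>-\<^sup>1M\<close>. Up to denominators, \<open>\<Sum> y i \<otimes> \<phi> i\<close> is \<open>\<Sum> x a \<otimes> \<theta> a\<close> with
  \<open>\<theta> a = \<Sum> c i a \<phi> i\<close>, and the relation \<open>\<Sum> \<phi> i(z) y i = 0\<close> becomes \<open>\<Sum> \<theta> a(z) x a = 0\<close>, so that
  each \<open>\<theta> a(z)\<close> is killed by an element of \<open>S\<close>; finitely many \<open>z\<close> generate \<open>M\<close>, so one element
  of \<open>S\<close> kills all \<open>\<theta> a\<close>.\<close>

lemma sum_pure_tensors_locally_zero:
  fixes R :: "('a, 'm) ring_scheme" and M :: "('a, 'b, 'k) module_scheme"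
  assumes fg: "fg_module R M" and S: "fractions R M S"
    and free: "free_module (loc_ring R S) (loc_module R S M)"
    and y: "\<And>i. i < (n::nat) \<Longrightarrow> y i \<in> carrier M"
    and phi: "\<And>i. i < n \<Longrightarrow> \<phi> i \<in> carrier (dual_module R M)"
    and rel: "\<And>z. z \<in> carrier M \<Longrightarrow> (\<Oplus>\<^bsub>M\<^esub>i\<in>{..<n}. \<phi> i z \<odot>\<^bsub>M\<^esub> y i) = \<zero>\<^bsub>M\<^esub>"
  shows "\<exists>t\<in>S. t \<odot>\<^bsub>tensor R M (dual_module R M)\<^esub>
    (\<Oplus>\<^bsub>tensor R M (dual_module R M)\<^esub>i\<in>{..<n}. pure_tensor R M (dual_module R M) (y i) (\<phi> i)) =
    \<zero>\<^bsub>tensor R M (dual_module R M)\<^esub>"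
proof -
  let ?D = "dual_module R M"
  let ?T = "tensor R M ?D"
  let ?pt = "pure_tensor R M ?D"
  interpret S: fractions R M S by fact
  note M = S.module_axioms
  note D = dual_module_module[OF M]
  interpret D: module R ?D by (rule D)
  note T = tensor_module[OF M D]
  interpret T: module R ?T by (rule T)
  note ptc = pure_tensor_bilinear(1)[OF M D]
  note pt1 = pure_tensor_bilinear(2)[OF M D] and pt2 = pure_tensor_bilinear(3)[OF M D]
  obtain N x where x: "\<And>a. a < (N::nat) \<Longrightarrow> x a \<in> carrier M"
    and gen: "\<And>y. y \<in> carrier M \<Longrightarrow>
      \<exists>u\<in>S. \<exists>c. (\<forall>a<N. c a \<in> carrier R) \<and> u \<odot>\<^bsub>M\<^esub> y = (\<Oplus>\<^bsub>M\<^esub>a\<in>{..<N}. c a \<odot>\<^bsub>M\<^esub> x a)"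
    and indep: "\<And>c. (\<And>a. a < N \<Longrightarrow> c a \<in> carrier R) \<Longrightarrow>
      (\<Oplus>\<^bsub>M\<^esub>a\<in>{..<N}. c a \<odot>\<^bsub>M\<^esub> x a) = \<zero>\<^bsub>M\<^esub> \<Longrightarrow> \<exists>t\<in>S. \<forall>a<N. t \<otimes>\<^bsub>R\<^esub> c a = \<zero>\<^bsub>R\<^esub>"
  proof (rule S.locally_free_basis[OF free], goal_cases)
    case (1 N x)
    show ?case
    proof (rule 1(1)[of N x])
      show "x a \<in> carrier M" if "a < N" for a by (rule 1(2)[OF that])
      show "\<exists>u\<in>S. \<exists>c. (\<forall>a<N. c a \<in> carrier R) \<and> u \<odot>\<^bsub>M\<^esub> y = (\<Oplus>\<^bsub>M\<^esub>a\<in>{..<N}. c a \<odot>\<^bsub>M\<^esub> x a)"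
        if "y \<in> carrier M" for y by (rule 1(3)[OF that])
      show "\<exists>t\<in>S. \<forall>a<N. t \<otimes>\<^bsub>R\<^esub> c a = \<zero>\<^bsub>R\<^esub>"
        if "\<And>a. a < N \<Longrightarrow> c a \<in> carrier R" "(\<Oplus>\<^bsub>M\<^esub>a\<in>{..<N}. c a \<odot>\<^bsub>M\<^esub> x a) = \<zero>\<^bsub>M\<^esub>" for c
        by (rule 1(4)) (use that in auto)
    qed
  qed
  let ?Q = "\<lambda>i u. \<exists>c. (\<forall>a<N. c a \<in> carrier R) \<and> u \<odot>\<^bsub>M\<^esub> y i = (\<Oplus>\<^bsub>M\<^esub>a\<in>{..<N}. c a \<odot>\<^bsub>M\<^esub> x a)"
  have "\<exists>u\<in>S. \<forall>i<n. ?Q i u"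
  proof (rule S.common_multiple)
    show "\<exists>u\<in>S. ?Q i u" if "i < n" for i by (rule gen[OF y[OF that]])
    fix i u v assume i: "i < n" and u: "u \<in> S" and v: "v \<in> S" and "?Q i u"
    then obtain c where c: "\<forall>a<N. c a \<in> carrier R" "u \<odot>\<^bsub>M\<^esub> y i = (\<Oplus>\<^bsub>M\<^esub>a\<in>{..<N}. c a \<odot>\<^bsub>M\<^esub> x a)"
      by auto
    have "(u \<otimes>\<^bsub>R\<^esub> v) \<odot>\<^bsub>M\<^esub> y i = v \<odot>\<^bsub>M\<^esub> (u \<odot>\<^bsub>M\<^esub> y i)"
      using u v y[OF i] by (simp add: S.R.m_comm flip: S.smult_assoc1)
    also have "\<dots> = (\<Oplus>\<^bsub>M\<^esub>a\<in>{..<N}. v \<odot>\<^bsub>M\<^esub> (c a \<odot>\<^bsub>M\<^esub> x a))"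
      unfolding c(2) using c(1) x v by (intro S.finsum_smult_ldistr) auto
    also have "\<dots> = (\<Oplus>\<^bsub>M\<^esub>a\<in>{..<N}. (v \<otimes>\<^bsub>R\<^esub> c a) \<odot>\<^bsub>M\<^esub> x a)"
      using c(1) x v by (intro S.M.finsum_cong') (auto simp: S.smult_assoc1)
    finally show "?Q i (u \<otimes>\<^bsub>R\<^esub> v)" using c(1) v by (intro exI[of _ "\<lambda>a. v \<otimes>\<^bsub>R\<^esub> c a"]) auto
  qed
  then obtain u c where u: "u \<in> S" and c: "\<And>i a. i < n \<Longrightarrow> a < N \<Longrightarrow> c i a \<in> carrier R"
    and uy: "\<And>i. i < n \<Longrightarrow> u \<odot>\<^bsub>M\<^esub> y i = (\<Oplus>\<^bsub>M\<^esub>a\<in>{..<N}. c i a \<odot>\<^bsub>M\<^esub> x a)" by metis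
  have uc: "u \<in> carrier R" using u by simp
  define \<theta> where "\<theta> a = (\<Oplus>\<^bsub>?D\<^esub>i\<in>{..<n}. c i a \<odot>\<^bsub>?D\<^esub> \<phi> i)" for a
  have theta: "\<theta> a \<in> carrier ?D" if "a < N" for a
    unfolding \<theta>_def using c phi that by (intro D.M.finsum_closed) auto
  let ?\<tau> = "\<Oplus>\<^bsub>?T\<^esub>i\<in>{..<n}. ?pt (y i) (\<phi> i)"
  have utau: "u \<odot>\<^bsub>?T\<^esub> ?\<tau> = (\<Oplus>\<^bsub>?T\<^esub>a\<in>{..<N}. ?pt (x a) (\<theta> a))"
  proof -
    have "u \<odot>\<^bsub>?T\<^esub> ?\<tau> = (\<Oplus>\<^bsub>?T\<^esub>i\<in>{..<n}. u \<odot>\<^bsub>?T\<^esub> ?pt (y i) (\<phi> i))"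
      using uc ptc y phi by (intro T.finsum_smult_ldistr) auto
    also have "\<dots> = (\<Oplus>\<^bsub>?T\<^esub>i\<in>{..<n}. \<Oplus>\<^bsub>?T\<^esub>a\<in>{..<N}. c i a \<odot>\<^bsub>?T\<^esub> ?pt (x a) (\<phi> i))"
    proof (rule T.M.finsum_cong')
      show "(\<lambda>i. \<Oplus>\<^bsub>?T\<^esub>a\<in>{..<N}. c i a \<odot>\<^bsub>?T\<^esub> ?pt (x a) (\<phi> i)) \<in> {..<n} \<rightarrow> carrier ?T"
        using c ptc x phi by (auto intro!: T.M.finsum_closed)
      fix i assume "i \<in> {..<n}"
      then have i: "i < n" by simp
      have cx: "(\<lambda>a. c i a \<odot>\<^bsub>M\<^esub> x a) \<in> {..<N} \<rightarrow> carrier M" using c[OF i] x by auto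
      have "u \<odot>\<^bsub>?T\<^esub> ?pt (y i) (\<phi> i) = ?pt (u \<odot>\<^bsub>M\<^esub> y i) (\<phi> i)"
        using mod_hom_smult[OF pt1[OF phi[OF i]] uc y[OF i]] by simp
      also have "\<dots> = (\<Oplus>\<^bsub>?T\<^esub>a\<in>{..<N}. ?pt (c i a \<odot>\<^bsub>M\<^esub> x a) (\<phi> i))"
        unfolding uy[OF i] by (rule mod_hom_finsum[OF M T pt1[OF phi[OF i]] finite_lessThan cx])
      also have "\<dots> = (\<Oplus>\<^bsub>?T\<^esub>a\<in>{..<N}. c i a \<odot>\<^bsub>?T\<^esub> ?pt (x a) (\<phi> i))"
        using c[OF i] x ptc phi[OF i] mod_hom_smult[OF pt1[OF phi[OF i]]]
        by (intro T.M.finsum_cong') auto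
      finally show "u \<odot>\<^bsub>?T\<^esub> ?pt (y i) (\<phi> i) = (\<Oplus>\<^bsub>?T\<^esub>a\<in>{..<N}. c i a \<odot>\<^bsub>?T\<^esub> ?pt (x a) (\<phi> i))" .
    qed simp
    also have "\<dots> = (\<Oplus>\<^bsub>?T\<^esub>a\<in>{..<N}. \<Oplus>\<^bsub>?T\<^esub>i\<in>{..<n}. c i a \<odot>\<^bsub>?T\<^esub> ?pt (x a) (\<phi> i))"
      using c x phi ptc by (intro T.finsum_swap) auto
    also have "\<dots> = (\<Oplus>\<^bsub>?T\<^esub>a\<in>{..<N}. ?pt (x a) (\<theta> a))"
    proof (rule T.M.finsum_cong')
      show "(\<lambda>a. ?pt (x a) (\<theta> a)) \<in> {..<N} \<rightarrow> carrier ?T" using ptc x theta by auto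
      fix a assume "a \<in> {..<N}"
      then have a: "a < N" by simp
      have cp: "(\<lambda>i. c i a \<odot>\<^bsub>?D\<^esub> \<phi> i) \<in> {..<n} \<rightarrow> carrier ?D" using c a phi by auto
      have "?pt (x a) (\<theta> a) = (\<Oplus>\<^bsub>?T\<^esub>i\<in>{..<n}. ?pt (x a) (c i a \<odot>\<^bsub>?D\<^esub> \<phi> i))"
        unfolding \<theta>_def by (rule mod_hom_finsum[OF D T pt2[OF x[OF a]] finite_lessThan cp])
      also have "\<dots> = (\<Oplus>\<^bsub>?T\<^esub>i\<in>{..<n}. c i a \<odot>\<^bsub>?T\<^esub> ?pt (x a) (\<phi> i))"
        using c a x ptc phi mod_hom_smult[OF pt2[OF x[OF a]]]
        by (intro T.M.finsum_cong') auto
      finally show "(\<Oplus>\<^bsub>?T\<^esub>i\<in>{..<n}. c i a \<odot>\<^bsub>?T\<^esub> ?pt (x a) (\<phi> i)) = ?pt (x a) (\<theta> a)" ..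
    qed simp
    finally show ?thesis .
  qed
  have thz: "\<exists>t\<in>S. \<forall>a<N. t \<otimes>\<^bsub>R\<^esub> \<theta> a z = \<zero>\<^bsub>R\<^esub>" if z: "z \<in> carrier M" for z
  proof (rule indep)
    have pz: "\<phi> i z \<in> carrier R" if "i < n" for i using dual_module_closed[OF phi[OF that] z] .
    show tc: "\<theta> a z \<in> carrier R" if "a < N" for a using dual_module_closed[OF theta[OF that] z] .
    have ev: "(\<lambda>f. f z) \<in> mod_hom R ?D (self_module R)"
      unfolding dual_module_def by (rule hom_module_eval[OF z])
    have "(\<Oplus>\<^bsub>M\<^esub>a\<in>{..<N}. \<theta> a z \<odot>\<^bsub>M\<^esub> x a) =
      (\<Oplus>\<^bsub>M\<^esub>a\<in>{..<N}. \<Oplus>\<^bsub>M\<^esub>i\<in>{..<n}. \<phi> i z \<odot>\<^bsub>M\<^esub> (c i a \<odot>\<^bsub>M\<^esub> x a))"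
    proof (rule S.M.finsum_cong')
      show "(\<lambda>a. \<Oplus>\<^bsub>M\<^esub>i\<in>{..<n}. \<phi> i z \<odot>\<^bsub>M\<^esub> (c i a \<odot>\<^bsub>M\<^esub> x a)) \<in> {..<N} \<rightarrow> carrier M"
        using c x pz by (auto intro!: S.M.finsum_closed)
      fix a assume "a \<in> {..<N}"
      then have a: "a < N" by simp
      have ax: "(\<lambda>f. f z \<odot>\<^bsub>M\<^esub> x a) \<in> mod_hom R ?D M" by (rule scalar_hom[OF M ev x[OF a]])
      have cp: "(\<lambda>i. c i a \<odot>\<^bsub>?D\<^esub> \<phi> i) \<in> {..<n} \<rightarrow> carrier ?D" using c a phi by auto
      have "\<theta> a z \<odot>\<^bsub>M\<^esub> x a = (\<Oplus>\<^bsub>M\<^esub>i\<in>{..<n}. (c i a \<odot>\<^bsub>?D\<^esub> \<phi> i) z \<odot>\<^bsub>M\<^esub> x a)"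
        unfolding \<theta>_def by (rule mod_hom_finsum[OF D M ax finite_lessThan cp])
      also have "\<dots> = (\<Oplus>\<^bsub>M\<^esub>i\<in>{..<n}. \<phi> i z \<odot>\<^bsub>M\<^esub> (c i a \<odot>\<^bsub>M\<^esub> x a))"
      proof (rule S.M.finsum_cong')
        fix i assume "i \<in> {..<n}"
        then have i: "i < n" by simp
        have "(c i a \<odot>\<^bsub>?D\<^esub> \<phi> i) z = c i a \<otimes>\<^bsub>R\<^esub> \<phi> i z"
          unfolding dual_module_def using z by (simp add: hom_module_apply)
        then show "(c i a \<odot>\<^bsub>?D\<^esub> \<phi> i) z \<odot>\<^bsub>M\<^esub> x a = \<phi> i z \<odot>\<^bsub>M\<^esub> (c i a \<odot>\<^bsub>M\<^esub> x a)"
          using c[OF i a] pz[OF i] x[OF a] by (simp add: S.R.m_comm flip: S.smult_assoc1)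
      qed (use c a pz x in auto)
      finally show "\<theta> a z \<odot>\<^bsub>M\<^esub> x a = (\<Oplus>\<^bsub>M\<^esub>i\<in>{..<n}. \<phi> i z \<odot>\<^bsub>M\<^esub> (c i a \<odot>\<^bsub>M\<^esub> x a))" .
    qed simp
    also have "\<dots> = (\<Oplus>\<^bsub>M\<^esub>i\<in>{..<n}. \<Oplus>\<^bsub>M\<^esub>a\<in>{..<N}. \<phi> i z \<odot>\<^bsub>M\<^esub> (c i a \<odot>\<^bsub>M\<^esub> x a))"
      using c x pz by (intro S.finsum_swap) auto
    also have "\<dots> = (\<Oplus>\<^bsub>M\<^esub>i\<in>{..<n}. u \<odot>\<^bsub>M\<^esub> (\<phi> i z \<odot>\<^bsub>M\<^esub> y i))"
    proof (rule S.M.finsum_cong')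
      fix i assume "i \<in> {..<n}"
      then have i: "i < n" by simp
      have "(\<Oplus>\<^bsub>M\<^esub>a\<in>{..<N}. \<phi> i z \<odot>\<^bsub>M\<^esub> (c i a \<odot>\<^bsub>M\<^esub> x a)) = \<phi> i z \<odot>\<^bsub>M\<^esub> (u \<odot>\<^bsub>M\<^esub> y i)"
        unfolding uy[OF i] using c[OF i] x pz[OF i]
        by (intro S.finsum_smult_ldistr[symmetric]) auto
      then show "(\<Oplus>\<^bsub>M\<^esub>a\<in>{..<N}. \<phi> i z \<odot>\<^bsub>M\<^esub> (c i a \<odot>\<^bsub>M\<^esub> x a)) = u \<odot>\<^bsub>M\<^esub> (\<phi> i z \<odot>\<^bsub>M\<^esub> y i)"
        using uc pz[OF i] y[OF i] by (simp add: S.R.m_comm flip: S.smult_assoc1)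
    qed (use uc pz y in auto)
    also have "\<dots> = u \<odot>\<^bsub>M\<^esub> (\<Oplus>\<^bsub>M\<^esub>i\<in>{..<n}. \<phi> i z \<odot>\<^bsub>M\<^esub> y i)"
      using uc pz y by (intro S.finsum_smult_ldistr[symmetric]) auto
    also have "\<dots> = \<zero>\<^bsub>M\<^esub>" using rel[OF z] uc by simp
    finally show "(\<Oplus>\<^bsub>M\<^esub>a\<in>{..<N}. \<theta> a z \<odot>\<^bsub>M\<^esub> x a) = \<zero>\<^bsub>M\<^esub>" .
  qed
  obtain G where G: "finite G" "G \<subseteq> carrier M" "mod_span R M G = carrier M"
    using fg unfolding fg_module_def by auto
  obtain zs where zs: "set zs = G" using finite_list[OF G(1)] by auto
  have zsc: "zs ! i \<in> carrier M" if "i < length zs" for i using nth_mem[OF that] zs G(2) by auto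
  have "\<exists>t\<in>S. \<forall>i<length zs. \<forall>a<N. t \<otimes>\<^bsub>R\<^esub> \<theta> a (zs ! i) = \<zero>\<^bsub>R\<^esub>"
  proof (rule S.common_multiple)
    show "\<exists>t\<in>S. \<forall>a<N. t \<otimes>\<^bsub>R\<^esub> \<theta> a (zs ! i) = \<zero>\<^bsub>R\<^esub>" if "i < length zs" for i
      by (rule thz[OF zsc[OF that]])
    fix i t t' assume i: "i < length zs" and t: "t \<in> S" "t' \<in> S" and z: "\<forall>a<N. t \<otimes>\<^bsub>R\<^esub> \<theta> a (zs ! i) = \<zero>\<^bsub>R\<^esub>"
    show "\<forall>a<N. t \<otimes>\<^bsub>R\<^esub> t' \<otimes>\<^bsub>R\<^esub> \<theta> a (zs ! i) = \<zero>\<^bsub>R\<^esub>"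
    proof (intro allI impI)
      fix a assume a: "a < N"
      have "\<theta> a (zs ! i) \<in> carrier R" by (rule dual_module_closed[OF theta[OF a] zsc[OF i]])
      then have "t \<otimes>\<^bsub>R\<^esub> t' \<otimes>\<^bsub>R\<^esub> \<theta> a (zs ! i) = t' \<otimes>\<^bsub>R\<^esub> (t \<otimes>\<^bsub>R\<^esub> \<theta> a (zs ! i))"
        using t by (simp add: S.R.m_ac)
      then show "t \<otimes>\<^bsub>R\<^esub> t' \<otimes>\<^bsub>R\<^esub> \<theta> a (zs ! i) = \<zero>\<^bsub>R\<^esub>" using z a t by simp
    qed
  qed
  then obtain t where t: "t \<in> S" "\<And>i a. i < length zs \<Longrightarrow> a < N \<Longrightarrow> t \<otimes>\<^bsub>R\<^esub> \<theta> a (zs ! i) = \<zero>\<^bsub>R\<^esub>" by auto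
  have tc: "t \<in> carrier R" using t(1) by simp
  have tth: "t \<odot>\<^bsub>?D\<^esub> \<theta> a = \<zero>\<^bsub>?D\<^esub>" if a: "a < N" for a
  proof -
    have tD: "t \<odot>\<^bsub>?D\<^esub> \<theta> a \<in> carrier ?D" using tc theta[OF a] by simp
    have app: "(t \<odot>\<^bsub>?D\<^esub> \<theta> a) z = t \<otimes>\<^bsub>R\<^esub> \<theta> a z" if "z \<in> carrier M" for z
      unfolding dual_module_def using that by (simp add: hom_module_apply)
    interpret Sf: module R "self_module R" by (rule self_module_module[OF S.R.cring_axioms])
    have s0: "submodule {\<zero>\<^bsub>R\<^esub>} R (self_module R)" unfolding Sf.submodule_iff by auto
    have "submodule {z \<in> carrier M. (t \<odot>\<^bsub>?D\<^esub> \<theta> a) z \<in> {\<zero>\<^bsub>R\<^esub>}} R M"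
      by (rule submodule_hom_vimage[OF M Sf.module_axioms dual_module_hom[OF tD] s0])
    moreover have "G \<subseteq> {z \<in> carrier M. (t \<odot>\<^bsub>?D\<^esub> \<theta> a) z \<in> {\<zero>\<^bsub>R\<^esub>}}"
    proof
      fix z assume z: "z \<in> G"
      then obtain i where "i < length zs" "z = zs ! i" using zs by (metis in_set_conv_nth)
      then show "z \<in> {z \<in> carrier M. (t \<odot>\<^bsub>?D\<^esub> \<theta> a) z \<in> {\<zero>\<^bsub>R\<^esub>}}" using t(2) a z G(2) app zsc by auto
    qed
    ultimately have "carrier M \<subseteq> {z \<in> carrier M. (t \<odot>\<^bsub>?D\<^esub> \<theta> a) z \<in> {\<zero>\<^bsub>R\<^esub>}}"
      using mod_span_least[of _ R M G] G(3) by metis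
    then have z: "(t \<odot>\<^bsub>?D\<^esub> \<theta> a) z = \<zero>\<^bsub>?D\<^esub> z" if "z \<in> carrier M" for z
      using that unfolding dual_module_def by (auto simp: hom_module_zero_apply)
    show ?thesis
      using tD D.M.zero_closed z unfolding dual_module_def by (rule hom_module_eqI)
  qed
  have ztau: "?\<tau> \<in> carrier ?T" using ptc y phi by (intro T.M.finsum_closed) auto
  have "(t \<otimes>\<^bsub>R\<^esub> u) \<odot>\<^bsub>?T\<^esub> ?\<tau> = t \<odot>\<^bsub>?T\<^esub> (\<Oplus>\<^bsub>?T\<^esub>a\<in>{..<N}. ?pt (x a) (\<theta> a))"
    using tc uc ztau utau by (simp add: T.smult_assoc1)
  also have "\<dots> = (\<Oplus>\<^bsub>?T\<^esub>a\<in>{..<N}. t \<odot>\<^bsub>?T\<^esub> ?pt (x a) (\<theta> a))"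
    using tc ptc x theta by (intro T.finsum_smult_ldistr) auto
  also have "\<dots> = (\<Oplus>\<^bsub>?T\<^esub>a\<in>{..<N}. \<zero>\<^bsub>?T\<^esub>)"
  proof (rule T.M.finsum_cong')
    fix a assume "a \<in> {..<N}"
    then have a: "a < N" by simp
    show "t \<odot>\<^bsub>?T\<^esub> ?pt (x a) (\<theta> a) = \<zero>\<^bsub>?T\<^esub>"
      using mod_hom_smult[OF pt2[OF x[OF a]] tc theta[OF a]] tth[OF a] mod_hom_zero[OF D T pt2[OF x[OF a]]]
      by simp
  qed auto
  also have "\<dots> = \<zero>\<^bsub>?T\<^esub>" by (rule T.M.finsum_zero)
  finally show ?thesis using S.S_mult[OF t(1) u] by auto
qed

lemma prime_fractions:
  assumes "module R M" "primeideal p R" shows "fractions R M (carrier R - p)"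
  using assms prime_compl_mult[OF assms(2)] prime_compl_one[OF assms(2)]
  by (simp add: fractions_def fractions_axioms_def)

text \<open>The element is zero at every associated prime of \<open>R\<close>, where \<open>M\<close> is free. So its
  annihilator contains a non zero-divisor, and torsion-freeness applies.\<close>

lemma sum_pure_tensors_zero:
  fixes R :: "('a, 'm) ring_scheme" and M :: "('a, 'b, 'k) module_scheme"
  assumes R: "noetherian_ring R" "cring R" and fg: "fg_module R M" and gf: "generically_free R M"
    and tf: "torsion_free R (tensor R M (dual_module R M))"
    and y: "\<And>i. i < (n::nat) \<Longrightarrow> y i \<in> carrier M"
    and phi: "\<And>i. i < n \<Longrightarrow> \<phi> i \<in> carrier (dual_module R M)"
    and rel: "\<And>z. z \<in> carrier M \<Longrightarrow> (\<Oplus>\<^bsub>M\<^esub>i\<in>{..<n}. \<phi> i z \<odot>\<^bsub>M\<^esub> y i) = \<zero>\<^bsub>M\<^esub>"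
  shows "(\<Oplus>\<^bsub>tensor R M (dual_module R M)\<^esub>i\<in>{..<n}. pure_tensor R M (dual_module R M) (y i) (\<phi> i)) =
    \<zero>\<^bsub>tensor R M (dual_module R M)\<^esub>"
proof -
  let ?D = "dual_module R M"
  let ?T = "tensor R M ?D"
  have M: "module R M" using fg unfolding fg_module_def by simp
  note D = dual_module_module[OF M]
  interpret T: module R ?T by (rule tensor_module[OF M D])
  let ?\<tau> = "\<Oplus>\<^bsub>?T\<^esub>i\<in>{..<n}. pure_tensor R M ?D (y i) (\<phi> i)"
  have tau: "?\<tau> \<in> carrier ?T"
    using pure_tensor_bilinear(1)[OF M D] y phi by (intro T.M.finsum_closed) auto
  let ?J = "{a \<in> carrier R. a \<odot>\<^bsub>?T\<^esub> ?\<tau> \<in> {\<zero>\<^bsub>?T\<^esub>}}"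
  have s0: "submodule {\<zero>\<^bsub>?T\<^esub>} R ?T" unfolding T.submodule_iff by auto
  have "\<exists>a\<in>?J. nonzerodivisor R a"
  proof (rule nonzerodivisor_avoiding_Ass[OF R T.colon_ideal[OF s0 tau]])
    fix p assume p: "p \<in> Ass R (self_module R)"
    then have pp: "primeideal p R" unfolding Ass_def by simp
    have "free_module (loc_ring R (carrier R - p)) (loc_module R (carrier R - p) M)"
      using gf p unfolding generically_free_def by simp
    from sum_pure_tensors_locally_zero[OF fg prime_fractions[OF M pp] this y phi rel]
    obtain t where "t \<in> carrier R - p" "t \<odot>\<^bsub>?T\<^esub> ?\<tau> = \<zero>\<^bsub>?T\<^esub>" by auto
    then show "\<not> ?J \<subseteq> p" by auto
  qed
  then obtain a where a: "a \<in> carrier R" "a \<odot>\<^bsub>?T\<^esub> ?\<tau> = \<zero>\<^bsub>?T\<^esub>" "nonzerodivisor R a" by auto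
  show ?thesis
    using tf[unfolded torsion_free_def, rule_format, OF a(1) _ tau a(2)] a(3)
    unfolding nonzerodivisor_def by simp
qed

context periodic_presentation
begin

text \<open>A cocycle \<open>g\<close> of degree \<open>1\<close> with coefficients in \<open>M\<close> vanishes on \<open>im B\<close>, which contains
  the image of \<open>j\<close>. So \<open>\<Sum> g(e\<^sub>i) \<otimes> e\<^sub>i\<^sup>*j\<close> is zero in \<open>M \<otimes> M\<^sup>*\<close>. Extending functionals on \<open>M\<close>,
  composed with \<open>q\<close>, along \<open>B\<close> defines a map from \<open>M \<otimes> M\<^sup>*\<close> to cochains modulo coboundaries, and
  this map takes the above element to the class of \<open>g\<close>.\<close>

lemma cocycle_is_coboundary:
  assumes R: "noetherian_ring R" and fg: "fg_module R M" and gf: "generically_free R M"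
    and tf: "torsion_free R (tensor R M (dual_module R M))"
    and v0: "hvanish R m n A B (self_module R) (carrier R)"
    and v1: "hvanish R n m B A (self_module R) (carrier R)"
    and g: "g \<in> mod_hom R (rpow R n) M" and gB: "\<And>v. v \<in> carrier (rpow R m) \<Longrightarrow> g (B v) = \<zero>\<^bsub>M\<^esub>"
  shows "restrict g (carrier (rpow R n)) \<in> coboundaries R n m A M"
proof -
  interpret sw: exact_pair R n m B A by (rule exact_pair_swap[OF exact_pair_axioms])
  interpret M: module R M by (rule M)
  have Sf: "module R (self_module R)" by (rule self_module_module[OF cring])
  have Fr: "module R (rpow R r)" by (rule rpow_module[OF cring])
  interpret Fr: module R "rpow R r" by (rule Fr)
  interpret P1: module R "rpow R n" by (rule mods(2))
  let ?D = "dual_module R M"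
  note D = dual_module_module[OF M]
  interpret D: module R ?D by (rule D)
  let ?H = "hom_module R (rpow R n) M"
  have H: "module R ?H" by (rule hom_module_module[OF mods(2) M])
  interpret H: module R ?H by (rule H)
  let ?K = "coboundaries R n m A M"
  have K: "submodule ?K R ?H" by (rule sw.coboundaries_submodule[OF M])
  let ?e = "basis_elt R {..<n}"
  have e: "?e i \<in> carrier (rpow R n)" if "i < n" for i using basis_elt_closed[OF cring, of i "{..<n}"] that by simp
  have ge: "g (?e i) \<in> carrier M" if "i < n" for i using mod_hom_closed[OF g e[OF that]] .
  have gk: "g (k y) = \<zero>\<^bsub>M\<^esub>" if y: "y \<in> carrier (rpow R r)" for y
  proof -
    obtain v where v: "v \<in> carrier (rpow R m)" "q v = \<zero>\<^bsub>M\<^esub>" "l v = y" using surj_ql[OF M.M.zero_closed y] by auto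
    have "B v = k y" using B_eq[OF v(1)] v(2,3) mod_hom_zero[OF M mods(2) j] mod_hom_closed[OF k y] by simp
    then show ?thesis using gB[OF v(1)] by simp
  qed
  have gj: "g (j x) = \<zero>\<^bsub>M\<^esub>" if x: "x \<in> carrier M" for x
  proof -
    obtain v where v: "v \<in> carrier (rpow R m)" "q v = x" "l v = \<zero>\<^bsub>rpow R r\<^esub>" using surj_ql[OF x Fr.M.zero_closed] by auto
    have "B v = j x" using B_eq[OF v(1)] v(2,3) mod_hom_zero[OF Fr mods(2) k] mod_hom_closed[OF j x] by simp
    then show ?thesis using gB[OF v(1)] by simp
  qed
  have coord: "(\<lambda>w. w i) \<in> mod_hom R (rpow R n) (self_module R)" if "i < n" for i
    using coordinate_hom[OF cring, of i "{..<n}"] that by simp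
  define \<phi> where "\<phi> i = restrict (\<lambda>x. j x i) (carrier M)" for i
  have phi: "\<phi> i \<in> carrier ?D" if "i < n" for i
    unfolding \<phi>_def dual_module_def by (rule restrict_mod_hom[OF M mod_hom_comp[OF j coord[OF that]]])
  have "(\<Oplus>\<^bsub>tensor R M ?D\<^esub>i\<in>{..<n}. pure_tensor R M ?D (g (?e i)) (\<phi> i)) = \<zero>\<^bsub>tensor R M ?D\<^esub>"
  proof (rule sum_pure_tensors_zero[OF R cring fg gf tf ge phi])
    fix z assume z: "z \<in> carrier M"
    have jz: "j z \<in> carrier (rpow R n)" by (rule mod_hom_closed[OF j z])
    have "(\<Oplus>\<^bsub>M\<^esub>i\<in>{..<n}. \<phi> i z \<odot>\<^bsub>M\<^esub> g (?e i)) = (\<Oplus>\<^bsub>M\<^esub>i\<in>{..<n}. j z i \<odot>\<^bsub>M\<^esub> g (?e i))"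
      using z by (simp add: \<phi>_def)
    also have "\<dots> = g (j z)" by (rule rpow_hom_eq_sum[OF M g jz, symmetric])
    finally show "(\<Oplus>\<^bsub>M\<^esub>i\<in>{..<n}. \<phi> i z \<odot>\<^bsub>M\<^esub> g (?e i)) = \<zero>\<^bsub>M\<^esub>" using gj[OF z] by simp
  qed
  then have tsub: "(\<Oplus>\<^bsub>free_on R (carrier M \<times> carrier ?D)\<^esub>i\<in>{..<n}.
      basis_elt R (carrier M \<times> carrier ?D) (g (?e i), \<phi> i)) \<in> tensor_sub R M ?D"
    using sum_pure_tensors_zero_iff[OF M D finite_lessThan, of "\<lambda>i. g (?e i)" n \<phi>] ge phi by auto
  \<comment> \<open>The extension \<open>\<psi> f\<close> of \<open>f q\<close> along \<open>B\<close> is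
    unique up to functionals that vanish on \<open>im B\<close>. These have the form
    \<open>hA\<close>, so they contribute coboundaries (the fact \<open>SK\<close>).\<close>
  have ext: "\<exists>\<psi>\<in>mod_hom R (rpow R n) (self_module R). \<forall>v\<in>carrier (rpow R m). f (q v) = \<psi> (B v)"
    if f: "f \<in> carrier ?D" for f
  proof -
    have fh: "f \<in> mod_hom R M (self_module R)" by (rule dual_module_hom[OF f])
    obtain h where "h \<in> mod_hom R (rpow R n) (self_module R)" "\<And>v. v \<in> carrier (rpow R m) \<Longrightarrow> f (q v) = h (B v)"
      by (rule hvanishD[OF v0 mod_hom_comp[OF q fh]])
        (use mod_hom_closed[OF mod_hom_comp[OF q fh]] qA mod_hom_zero[OF M Sf fh] in auto)
    then show ?thesis by auto
  qed
  then obtain \<psi> where psi: "\<And>f. f \<in> carrier ?D \<Longrightarrow> \<psi> f \<in> mod_hom R (rpow R n) (self_module R)"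
    "\<And>f v. f \<in> carrier ?D \<Longrightarrow> v \<in> carrier (rpow R m) \<Longrightarrow> f (q v) = \<psi> f (B v)" by metis
  have psic: "\<psi> f w \<in> carrier R" if "f \<in> carrier ?D" "w \<in> carrier (rpow R n)" for f w
    using mod_hom_closed[OF psi(1)[OF that(1)] that(2)] by simp
  define S where "S \<chi> x = restrict (\<lambda>w. \<chi> w \<odot>\<^bsub>M\<^esub> x) (carrier (rpow R n))" for \<chi> x
  have Sc: "S \<chi> x \<in> carrier ?H" if "\<chi> \<in> mod_hom R (rpow R n) (self_module R)" "x \<in> carrier M" for \<chi> x
    unfolding S_def by (rule restrict_mod_hom[OF mods(2) scalar_hom[OF M that]])
  have Sapp: "S \<chi> x w = \<chi> w \<odot>\<^bsub>M\<^esub> x" if "w \<in> carrier (rpow R n)" for \<chi> x w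
    unfolding S_def using that by simp
  have SK: "S \<chi> x \<in> ?K"
    if chi: "\<chi> \<in> mod_hom R (rpow R n) (self_module R)" and chiB: "\<And>v. v \<in> carrier (rpow R m) \<Longrightarrow> \<chi> (B v) = \<zero>\<^bsub>R\<^esub>"
      and x: "x \<in> carrier M" for \<chi> x
  proof -
    obtain h where h: "h \<in> mod_hom R (rpow R m) (self_module R)" "\<And>w. w \<in> carrier (rpow R n) \<Longrightarrow> \<chi> w = h (A w)"
      by (rule hvanishD[OF v1 chi]) (use mod_hom_closed[OF chi] chiB in auto)
    show ?thesis
      unfolding coboundaries_iff
      by (intro conjI bexI[OF _ scalar_hom[OF M h(1) x]] Sc[OF chi x]) (simp add: Sapp h(2))
  qed
  have diffH: "(f \<ominus>\<^bsub>?H\<^esub> f') w = f w \<ominus>\<^bsub>M\<^esub> f' w"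
    if "f \<in> carrier ?H" "f' \<in> carrier ?H" "w \<in> carrier (rpow R n)" for f f' w
    by (rule mod_hom_diff[OF H M hom_module_eval[OF that(3)] that(1,2)])
  have zK: "\<zero>\<^bsub>?H\<^esub> \<in> ?K" using K by (simp add: H.submodule_iff)
  have Dadd: "(f \<oplus>\<^bsub>?D\<^esub> f') x = f x \<oplus>\<^bsub>R\<^esub> f' x" if "x \<in> carrier M" for f f' x
    unfolding dual_module_def using that by (simp add: hom_module_apply)
  have Dsm: "(a \<odot>\<^bsub>?D\<^esub> f) x = a \<otimes>\<^bsub>R\<^esub> f x" if "x \<in> carrier M" for a f x
    unfolding dual_module_def using that by (simp add: hom_module_apply)
  have "free_lift R (carrier M \<times> carrier ?D) ?H (\<lambda>(x, f). S (\<psi> f) x)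
    (\<Oplus>\<^bsub>free_on R (carrier M \<times> carrier ?D)\<^esub>i\<in>{..<n}.
      basis_elt R (carrier M \<times> carrier ?D) (g (?e i), \<phi> i)) \<in> ?K"
  proof (rule tensor_sub_lift[OF M D H K _ _ _ _ _ tsub])
    show "S (\<psi> f) x \<in> carrier ?H" if "x \<in> carrier M" "f \<in> carrier ?D" for x f
      by (rule Sc[OF psi(1)[OF that(2)] that(1)])
    fix x x' f assume x: "x \<in> carrier M" "x' \<in> carrier M" and f: "f \<in> carrier ?D"
    have "S (\<psi> f) (x \<oplus>\<^bsub>M\<^esub> x') = S (\<psi> f) x \<oplus>\<^bsub>?H\<^esub> S (\<psi> f) x'"
    proof (rule hom_module_eqI)
      show "S (\<psi> f) (x \<oplus>\<^bsub>M\<^esub> x') \<in> carrier ?H" "S (\<psi> f) x \<oplus>\<^bsub>?H\<^esub> S (\<psi> f) x' \<in> carrier ?H"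
        using Sc[OF psi(1)[OF f]] x by auto
      show "S (\<psi> f) (x \<oplus>\<^bsub>M\<^esub> x') w = (S (\<psi> f) x \<oplus>\<^bsub>?H\<^esub> S (\<psi> f) x') w" if "w \<in> carrier (rpow R n)" for w
        using that psic[OF f that] x by (simp add: Sapp hom_module_apply M.smult_r_distr)
    qed
    moreover have "S (\<psi> f) x \<oplus>\<^bsub>?H\<^esub> S (\<psi> f) x' \<in> carrier ?H" using Sc[OF psi(1)[OF f]] x by auto
    ultimately show "S (\<psi> f) (x \<oplus>\<^bsub>M\<^esub> x') \<ominus>\<^bsub>?H\<^esub> (S (\<psi> f) x \<oplus>\<^bsub>?H\<^esub> S (\<psi> f) x') \<in> ?K"
      using zK by (simp add: H.diff_self)
  next
    fix x f f' assume x: "x \<in> carrier M" and f: "f \<in> carrier ?D" "f' \<in> carrier ?D"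
    have ff: "f \<oplus>\<^bsub>?D\<^esub> f' \<in> carrier ?D" using f by simp
    let ?c = "\<lambda>w. \<psi> (f \<oplus>\<^bsub>?D\<^esub> f') w \<ominus>\<^bsub>self_module R\<^esub> (\<psi> f w \<oplus>\<^bsub>self_module R\<^esub> \<psi> f' w)"
    interpret Sf: module R "self_module R" by (rule Sf)
    have c: "?c \<in> mod_hom R (rpow R n) (self_module R)"
      by (rule mod_hom_minus[OF mods(2) Sf psi(1)[OF ff] mod_hom_plus[OF Sf psi(1)[OF f(1)] psi(1)[OF f(2)]]])
    have "?c (B v) = \<zero>\<^bsub>R\<^esub>" if v: "v \<in> carrier (rpow R m)" for v
      using psi(2)[OF ff v] psi(2)[OF f(1) v] psi(2)[OF f(2) v] Dadd[OF mod_hom_closed[OF q v]]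
        psic[OF f(1) Bc[OF v]] psic[OF f(2) Bc[OF v]]
        Sf.diff_eq_zero_iff[of "\<psi> (f \<oplus>\<^bsub>?D\<^esub> f') (B v)" "\<psi> f (B v) \<oplus>\<^bsub>R\<^esub> \<psi> f' (B v)"]
        psic[OF ff Bc[OF v]] by simp
    from SK[OF c this x] have "S ?c x \<in> ?K" .
    moreover have "S ?c x = S (\<psi> (f \<oplus>\<^bsub>?D\<^esub> f')) x \<ominus>\<^bsub>?H\<^esub> (S (\<psi> f) x \<oplus>\<^bsub>?H\<^esub> S (\<psi> f') x)"
    proof (rule hom_module_eqI)
      note cs = Sc[OF psi(1)[OF f(1)] x] Sc[OF psi(1)[OF f(2)] x] Sc[OF psi(1)[OF ff] x]
      show "S ?c x \<in> carrier ?H" by (rule Sc[OF c x])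
      show "S (\<psi> (f \<oplus>\<^bsub>?D\<^esub> f')) x \<ominus>\<^bsub>?H\<^esub> (S (\<psi> f) x \<oplus>\<^bsub>?H\<^esub> S (\<psi> f') x) \<in> carrier ?H" using cs by simp
      fix w assume w: "w \<in> carrier (rpow R n)"
      have "?c w \<odot>\<^bsub>M\<^esub> x = \<psi> (f \<oplus>\<^bsub>?D\<^esub> f') w \<odot>\<^bsub>M\<^esub> x \<ominus>\<^bsub>M\<^esub> (\<psi> f w \<oplus>\<^bsub>R\<^esub> \<psi> f' w) \<odot>\<^bsub>M\<^esub> x"
        using mod_hom_diff[OF Sf M scalar_hom[OF M mod_hom_id x]] psic w f ff by simp
      then show "S ?c x w = (S (\<psi> (f \<oplus>\<^bsub>?D\<^esub> f')) x \<ominus>\<^bsub>?H\<^esub> (S (\<psi> f) x \<oplus>\<^bsub>?H\<^esub> S (\<psi> f') x)) w"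
        using w cs psic[OF f(1) w] psic[OF f(2) w] x
        by (simp add: Sapp diffH hom_module_apply M.smult_l_distr)
    qed
    ultimately show "S (\<psi> (f \<oplus>\<^bsub>?D\<^esub> f')) x \<ominus>\<^bsub>?H\<^esub> (S (\<psi> f) x \<oplus>\<^bsub>?H\<^esub> S (\<psi> f') x) \<in> ?K" by simp
  next
    fix a x f assume a: "a \<in> carrier R" and x: "x \<in> carrier M" and f: "f \<in> carrier ?D"
    have "S (\<psi> f) (a \<odot>\<^bsub>M\<^esub> x) = a \<odot>\<^bsub>?H\<^esub> S (\<psi> f) x"
    proof (rule hom_module_eqI)
      show "S (\<psi> f) (a \<odot>\<^bsub>M\<^esub> x) \<in> carrier ?H" "a \<odot>\<^bsub>?H\<^esub> S (\<psi> f) x \<in> carrier ?H"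
        using Sc[OF psi(1)[OF f]] x a by auto
      show "S (\<psi> f) (a \<odot>\<^bsub>M\<^esub> x) w = (a \<odot>\<^bsub>?H\<^esub> S (\<psi> f) x) w" if "w \<in> carrier (rpow R n)" for w
        using that psic[OF f that] x a M.R.m_comm[of a "\<psi> f w"] by (simp add: Sapp hom_module_apply flip: M.smult_assoc1)
    qed
    moreover have "a \<odot>\<^bsub>?H\<^esub> S (\<psi> f) x \<in> carrier ?H" using Sc[OF psi(1)[OF f]] x a by auto
    ultimately show "S (\<psi> f) (a \<odot>\<^bsub>M\<^esub> x) \<ominus>\<^bsub>?H\<^esub> a \<odot>\<^bsub>?H\<^esub> S (\<psi> f) x \<in> ?K"
      using zK by (simp add: H.diff_self)
  next
    fix a x f assume a: "a \<in> carrier R" and x: "x \<in> carrier M" and f: "f \<in> carrier ?D"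
    have ff: "a \<odot>\<^bsub>?D\<^esub> f \<in> carrier ?D" using f a by simp
    let ?c = "\<lambda>w. \<psi> (a \<odot>\<^bsub>?D\<^esub> f) w \<ominus>\<^bsub>self_module R\<^esub> a \<odot>\<^bsub>self_module R\<^esub> \<psi> f w"
    interpret Sf: module R "self_module R" by (rule Sf)
    have c: "?c \<in> mod_hom R (rpow R n) (self_module R)"
      by (rule mod_hom_minus[OF mods(2) Sf psi(1)[OF ff] mod_hom_scale[OF Sf psi(1)[OF f] a]])
    have "?c (B v) = \<zero>\<^bsub>R\<^esub>" if v: "v \<in> carrier (rpow R m)" for v
      using psi(2)[OF ff v] psi(2)[OF f v] Dsm[OF mod_hom_closed[OF q v]]
        psic[OF f Bc[OF v]] a
        Sf.diff_eq_zero_iff[of "\<psi> (a \<odot>\<^bsub>?D\<^esub> f) (B v)" "a \<otimes>\<^bsub>R\<^esub> \<psi> f (B v)"]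
        psic[OF ff Bc[OF v]] by simp
    from SK[OF c this x] have "S ?c x \<in> ?K" .
    moreover have "S ?c x = S (\<psi> (a \<odot>\<^bsub>?D\<^esub> f)) x \<ominus>\<^bsub>?H\<^esub> a \<odot>\<^bsub>?H\<^esub> S (\<psi> f) x"
    proof (rule hom_module_eqI)
      note cs = Sc[OF psi(1)[OF f] x] Sc[OF psi(1)[OF ff] x]
      show "S ?c x \<in> carrier ?H" by (rule Sc[OF c x])
      show "S (\<psi> (a \<odot>\<^bsub>?D\<^esub> f)) x \<ominus>\<^bsub>?H\<^esub> a \<odot>\<^bsub>?H\<^esub> S (\<psi> f) x \<in> carrier ?H" using cs a by simp
      fix w assume w: "w \<in> carrier (rpow R n)"
      have "?c w \<odot>\<^bsub>M\<^esub> x = \<psi> (a \<odot>\<^bsub>?D\<^esub> f) w \<odot>\<^bsub>M\<^esub> x \<ominus>\<^bsub>M\<^esub> (a \<otimes>\<^bsub>R\<^esub> \<psi> f w) \<odot>\<^bsub>M\<^esub> x"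
        using mod_hom_diff[OF Sf M scalar_hom[OF M mod_hom_id x]] psic w f ff a by simp
      then show "S ?c x w = (S (\<psi> (a \<odot>\<^bsub>?D\<^esub> f)) x \<ominus>\<^bsub>?H\<^esub> a \<odot>\<^bsub>?H\<^esub> S (\<psi> f) x) w"
        using w cs a psic[OF f w] x
        by (simp add: Sapp diffH hom_module_apply M.smult_assoc1)
    qed
    ultimately show "S (\<psi> (a \<odot>\<^bsub>?D\<^esub> f)) x \<ominus>\<^bsub>?H\<^esub> a \<odot>\<^bsub>?H\<^esub> S (\<psi> f) x \<in> ?K" by simp
  qed
  moreover have "free_lift R (carrier M \<times> carrier ?D) ?H (\<lambda>(x, f). S (\<psi> f) x)
    (\<Oplus>\<^bsub>free_on R (carrier M \<times> carrier ?D)\<^esub>i\<in>{..<n}.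
      basis_elt R (carrier M \<times> carrier ?D) (g (?e i), \<phi> i)) = (\<Oplus>\<^bsub>?H\<^esub>i\<in>{..<n}. S (\<psi> (\<phi> i)) (g (?e i)))"
  proof -
    let ?SD = "carrier M \<times> carrier ?D"
    have bc: "(\<lambda>(x, f). S (\<psi> f) x) \<in> ?SD \<rightarrow> carrier ?H" using Sc psi(1) by auto
    have be: "(\<lambda>i. basis_elt R ?SD (g (?e i), \<phi> i)) \<in> {..<n} \<rightarrow> carrier (free_on R ?SD)"
      using ge phi by (auto intro!: basis_elt_closed[OF cring])
    show ?thesis
      unfolding mod_hom_finsum[OF free_on_module[OF cring] H free_lift_hom[OF H bc] finite_lessThan be]
      using ge phi Sc psi(1) free_lift_basis[OF H bc] by (intro H.M.finsum_cong') auto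
  qed
  ultimately have K1: "(\<Oplus>\<^bsub>?H\<^esub>i\<in>{..<n}. S (\<psi> (\<phi> i)) (g (?e i))) \<in> ?K" by simp
  obtain ll where ll: "ll \<in> mod_hom R (rpow R n) (rpow R r)"
    "\<And>v. v \<in> carrier (rpow R m) \<Longrightarrow> l v = ll (B v)" using extend_l[OF v0] by metis
  have kll: "k (ll w) \<in> carrier (rpow R n)" if "w \<in> carrier (rpow R n)" for w
    using mod_hom_closed[OF mod_hom_comp[OF ll(1) k] that] .
  \<comment> \<open>By \<open>B = jq + kl\<close>, the \<open>i\<close>-th coordinate function agrees on
    \<open>im B\<close> with \<open>\<psi> (\<phi> i)\<close> plus the \<open>i\<close>-th
    coordinate of \<open>k ll\<close>; and \<open>g\<close> vanishes on the image of
    \<open>k\<close>.\<close>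
  define \<rho> where "\<rho> i w = w i \<ominus>\<^bsub>self_module R\<^esub> (\<psi> (\<phi> i) w \<oplus>\<^bsub>self_module R\<^esub> k (ll w) i)" for i w
  interpret Sf: module R "self_module R" by (rule Sf)
  have rho: "\<rho> i \<in> mod_hom R (rpow R n) (self_module R)" if i: "i < n" for i
    unfolding \<rho>_def
    by (rule mod_hom_minus[OF mods(2) Sf coord[OF i] mod_hom_plus[OF Sf psi(1)[OF phi[OF i]]
          mod_hom_comp[OF mod_hom_comp[OF ll(1) k] coord[OF i]]]])
  have rhoB: "\<rho> i (B v) = \<zero>\<^bsub>R\<^esub>" if i: "i < n" and v: "v \<in> carrier (rpow R m)" for i v
  proof -
    have qv: "q v \<in> carrier M" by (rule mod_hom_closed[OF q v])
    have "B v i = j (q v) i \<oplus>\<^bsub>R\<^esub> k (l v) i" using B_eq[OF v] i by (simp add: free_on_simps)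
    moreover have "\<psi> (\<phi> i) (B v) = j (q v) i"
      using psi(2)[OF phi[OF i] v] qv by (simp add: \<phi>_def)
    moreover have "B v i \<in> carrier R" using Bc[OF v] i by (simp add: rpow_carrier_iff)
    ultimately show ?thesis
      unfolding \<rho>_def using ll(2)[OF v] Sf.diff_eq_zero_iff[of "B v i" "B v i"] by simp
  qed
  have K2: "(\<Oplus>\<^bsub>?H\<^esub>i\<in>{..<n}. S (\<rho> i) (g (?e i))) \<in> ?K"
    using SK[OF rho rhoB ge] by (intro H.submodule_finsum[OF K]) auto
  have "restrict g (carrier (rpow R n)) =
    (\<Oplus>\<^bsub>?H\<^esub>i\<in>{..<n}. S (\<psi> (\<phi> i)) (g (?e i))) \<oplus>\<^bsub>?H\<^esub> (\<Oplus>\<^bsub>?H\<^esub>i\<in>{..<n}. S (\<rho> i) (g (?e i)))"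
  proof (rule hom_module_eqI)
    have c1: "(\<lambda>i. S (\<psi> (\<phi> i)) (g (?e i))) \<in> {..<n} \<rightarrow> carrier ?H" using Sc[OF psi(1)] phi ge by auto
    have c2: "(\<lambda>i. S (\<rho> i) (g (?e i))) \<in> {..<n} \<rightarrow> carrier ?H" using Sc[OF rho] ge by auto
    show "restrict g (carrier (rpow R n)) \<in> carrier ?H" by (rule restrict_mod_hom[OF mods(2) g])
    show "(\<Oplus>\<^bsub>?H\<^esub>i\<in>{..<n}. S (\<psi> (\<phi> i)) (g (?e i))) \<oplus>\<^bsub>?H\<^esub> (\<Oplus>\<^bsub>?H\<^esub>i\<in>{..<n}. S (\<rho> i) (g (?e i))) \<in> carrier ?H"
      using c1 c2 by simp
    fix w assume w: "w \<in> carrier (rpow R n)"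
    have wc: "w i \<in> carrier R" if "i < n" for i using w that by (simp add: rpow_carrier_iff)
    have pw: "\<psi> (\<phi> i) w \<in> carrier R" if "i < n" for i by (rule psic[OF phi[OF that] w])
    have rw: "\<rho> i w \<in> carrier R" if "i < n" for i using mod_hom_closed[OF rho[OF that] w] by simp
    have kw: "k (ll w) i \<in> carrier R" if "i < n" for i using kll[OF w] that by (simp add: rpow_carrier_iff)
    have ev1: "(\<Oplus>\<^bsub>?H\<^esub>i\<in>{..<n}. S (\<psi> (\<phi> i)) (g (?e i))) w = (\<Oplus>\<^bsub>M\<^esub>i\<in>{..<n}. \<psi> (\<phi> i) w \<odot>\<^bsub>M\<^esub> g (?e i))"
      using mod_hom_finsum[OF H M hom_module_eval[OF w] finite_lessThan c1] by (simp add: Sapp w)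
    have ev2: "(\<Oplus>\<^bsub>?H\<^esub>i\<in>{..<n}. S (\<rho> i) (g (?e i))) w = (\<Oplus>\<^bsub>M\<^esub>i\<in>{..<n}. \<rho> i w \<odot>\<^bsub>M\<^esub> g (?e i))"
      using mod_hom_finsum[OF H M hom_module_eval[OF w] finite_lessThan c2] by (simp add: Sapp w)
    have ev3: "(\<Oplus>\<^bsub>M\<^esub>i\<in>{..<n}. k (ll w) i \<odot>\<^bsub>M\<^esub> g (?e i)) = \<zero>\<^bsub>M\<^esub>"
      using rpow_hom_eq_sum[OF M g kll[OF w]] gk[OF mod_hom_closed[OF ll(1) w]] by simp
    have "g w = (\<Oplus>\<^bsub>M\<^esub>i\<in>{..<n}. w i \<odot>\<^bsub>M\<^esub> g (?e i))" by (rule rpow_hom_eq_sum[OF M g w])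
    also have "\<dots> = (\<Oplus>\<^bsub>M\<^esub>i\<in>{..<n}. \<rho> i w \<odot>\<^bsub>M\<^esub> g (?e i) \<oplus>\<^bsub>M\<^esub>
        (\<psi> (\<phi> i) w \<odot>\<^bsub>M\<^esub> g (?e i) \<oplus>\<^bsub>M\<^esub> k (ll w) i \<odot>\<^bsub>M\<^esub> g (?e i)))"
    proof (rule M.M.finsum_cong')
      fix i assume "i \<in> {..<n}"
      then have i: "i < n" by simp
      have "w i = \<rho> i w \<oplus>\<^bsub>R\<^esub> (\<psi> (\<phi> i) w \<oplus>\<^bsub>R\<^esub> k (ll w) i)"
        unfolding \<rho>_def using Sf.diff_add_cancel[of "w i" "\<psi> (\<phi> i) w \<oplus>\<^bsub>R\<^esub> k (ll w) i"] wc[OF i] pw[OF i] kw[OF i] by simp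
      then have "w i \<odot>\<^bsub>M\<^esub> g (?e i) = (\<rho> i w \<oplus>\<^bsub>R\<^esub> (\<psi> (\<phi> i) w \<oplus>\<^bsub>R\<^esub> k (ll w) i)) \<odot>\<^bsub>M\<^esub> g (?e i)"
        by (rule arg_cong)
      then show "w i \<odot>\<^bsub>M\<^esub> g (?e i) = \<rho> i w \<odot>\<^bsub>M\<^esub> g (?e i) \<oplus>\<^bsub>M\<^esub>
        (\<psi> (\<phi> i) w \<odot>\<^bsub>M\<^esub> g (?e i) \<oplus>\<^bsub>M\<^esub> k (ll w) i \<odot>\<^bsub>M\<^esub> g (?e i))"
        using rw[OF i] pw[OF i] kw[OF i] ge[OF i] by (simp add: M.smult_l_distr)
    qed (use rw pw kw ge in auto)
    also have "\<dots> = (\<Oplus>\<^bsub>M\<^esub>i\<in>{..<n}. \<rho> i w \<odot>\<^bsub>M\<^esub> g (?e i)) \<oplus>\<^bsub>M\<^esub>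
        ((\<Oplus>\<^bsub>M\<^esub>i\<in>{..<n}. \<psi> (\<phi> i) w \<odot>\<^bsub>M\<^esub> g (?e i)) \<oplus>\<^bsub>M\<^esub> (\<Oplus>\<^bsub>M\<^esub>i\<in>{..<n}. k (ll w) i \<odot>\<^bsub>M\<^esub> g (?e i)))"
      using rw pw kw ge by (subst M.M.finsum_addf, force, force, subst M.M.finsum_addf) auto
    also have "\<dots> = (\<Oplus>\<^bsub>M\<^esub>i\<in>{..<n}. \<psi> (\<phi> i) w \<odot>\<^bsub>M\<^esub> g (?e i)) \<oplus>\<^bsub>M\<^esub> (\<Oplus>\<^bsub>M\<^esub>i\<in>{..<n}. \<rho> i w \<odot>\<^bsub>M\<^esub> g (?e i))"
    proof -
      have "(\<Oplus>\<^bsub>M\<^esub>i\<in>{..<n}. \<psi> (\<phi> i) w \<odot>\<^bsub>M\<^esub> g (?e i)) \<in> carrier M" "(\<Oplus>\<^bsub>M\<^esub>i\<in>{..<n}. \<rho> i w \<odot>\<^bsub>M\<^esub> g (?e i)) \<in> carrier M"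
        using pw rw ge by (auto intro!: M.M.finsum_closed)
      then show ?thesis unfolding ev3 by (simp add: M.M.a_comm)
    qed
    finally show "restrict g (carrier (rpow R n)) w =
      ((\<Oplus>\<^bsub>?H\<^esub>i\<in>{..<n}. S (\<psi> (\<phi> i)) (g (?e i))) \<oplus>\<^bsub>?H\<^esub> (\<Oplus>\<^bsub>?H\<^esub>i\<in>{..<n}. S (\<rho> i) (g (?e i)))) w"
      using w by (simp add: hom_module_apply ev1 ev2)
  qed
  then show ?thesis using H.submoduleE(5)[OF K K1 K2] by simp
qed

end

section \<open>Finitely generated modules and isomorphisms\<close>

lemma mod_iso_sym:
  assumes M: "module R M" and "mod_iso R M N" shows "mod_iso R N M"
proof -
  interpret M: module R M by fact
  obtain f where f: "f \<in> mod_hom R M N" "bij_betw f (carrier M) (carrier N)"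
    using assms unfolding mod_iso_def by auto
  let ?g = "inv_into (carrier M) f"
  have inj: "inj_on f (carrier M)" and im: "f ` carrier M = carrier N"
    using f(2) unfolding bij_betw_def by auto
  have "?g \<in> mod_hom R N M"
  proof (rule mod_homI)
    fix x assume "x \<in> carrier N"
    then obtain u where u: "u \<in> carrier M" "x = f u" using im by auto
    then show "?g x \<in> carrier M" by (simp add: inv_into_f_f[OF inj])
    fix y assume "y \<in> carrier N"
    then obtain v where v: "v \<in> carrier M" "y = f v" using im by auto
    have "x \<oplus>\<^bsub>N\<^esub> y = f (u \<oplus>\<^bsub>M\<^esub> v)" using u v mod_hom_add[OF f(1)] by simp
    then show "?g (x \<oplus>\<^bsub>N\<^esub> y) = ?g x \<oplus>\<^bsub>M\<^esub> ?g y" using u v by (simp add: inv_into_f_f[OF inj])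
  next
    fix a x assume a: "a \<in> carrier R" and "x \<in> carrier N"
    then obtain u where u: "u \<in> carrier M" "x = f u" using im by auto
    have "a \<odot>\<^bsub>N\<^esub> x = f (a \<odot>\<^bsub>M\<^esub> u)" using u a mod_hom_smult[OF f(1)] by simp
    then show "?g (a \<odot>\<^bsub>N\<^esub> x) = a \<odot>\<^bsub>M\<^esub> ?g x" using u a by (simp add: inv_into_f_f[OF inj])
  qed
  then show ?thesis unfolding mod_iso_def using bij_betw_inv_into[OF f(2)] by auto
qed

lemma mod_iso_trans:
  assumes "mod_iso R L M" "mod_iso R M N" shows "mod_iso R L N"
proof -
  obtain f g where "f \<in> mod_hom R L M" "bij_betw f (carrier L) (carrier M)"
    "g \<in> mod_hom R M N" "bij_betw g (carrier M) (carrier N)"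
    using assms unfolding mod_iso_def by auto
  then have "(\<lambda>x. g (f x)) \<in> mod_hom R L N" "bij_betw (g \<circ> f) (carrier L) (carrier N)"
    using mod_hom_comp bij_betw_trans by blast+
  then show ?thesis unfolding mod_iso_def by (auto simp: comp_def)
qed

lemma mod_iso_refl: "mod_iso R M M"
  unfolding mod_iso_def by (rule bexI[OF _ mod_hom_id]) (simp add: bij_betw_def inj_on_def)

lemma fg_module_surj:
  assumes X: "fg_module R X" and Y: "module R Y" and f: "f \<in> mod_hom R X Y"
    and surj: "f ` carrier X = carrier Y"
  shows "fg_module R Y"
proof -
  have Xm: "module R X" using X unfolding fg_module_def by simp
  interpret Y: module R Y by fact
  obtain A where A: "finite A" "A \<subseteq> carrier X" "mod_span R X A = carrier X"
    using X unfolding fg_module_def by auto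
  have fA: "f ` A \<subseteq> carrier Y" using A(2) surj by auto
  note sp = Y.mod_span_submodule[OF fA]
  have "submodule {x \<in> carrier X. f x \<in> mod_span R Y (f ` A)} R X"
    by (rule submodule_hom_vimage[OF Xm Y f sp(1)])
  moreover have "A \<subseteq> {x \<in> carrier X. f x \<in> mod_span R Y (f ` A)}" using A(2) sp(2) by auto
  ultimately have "mod_span R X A \<subseteq> {x \<in> carrier X. f x \<in> mod_span R Y (f ` A)}"
    by (rule mod_span_least)
  then have "carrier Y \<subseteq> mod_span R Y (f ` A)" unfolding A(3) surj[symmetric] by auto
  then have "mod_span R Y (f ` A) = carrier Y" using Y.submoduleE(1)[OF sp(1)] by (rule subset_antisym[rotated])
  then show ?thesis unfolding fg_module_def using Y A(1) fA by auto
qed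

lemma fg_module_presentation:
  assumes X: "fg_module R X"
  obtains n f where "f \<in> mod_hom R (rpow R n) X" "f ` carrier (rpow R n) = carrier X"
proof -
  have Xm: "module R X" using X unfolding fg_module_def by simp
  interpret X: module R X by fact
  have F: "module R (rpow R n)" for n by (rule rpow_module[OF X.R.cring_axioms])
  obtain A where A: "finite A" "A \<subseteq> carrier X" "mod_span R X A = carrier X"
    using X unfolding fg_module_def by auto
  obtain xs where xs: "set xs = A" using finite_list[OF A(1)] by auto
  let ?n = "length xs"
  interpret F: module R "rpow R ?n" by (rule F)
  have c: "(\<lambda>i. xs ! i) \<in> {..<?n} \<rightarrow> carrier X" using xs A(2) nth_mem by fastforce
  let ?f = "free_lift R {..<?n} X (\<lambda>i. xs ! i)"
  have f: "?f \<in> mod_hom R (rpow R ?n) X" by (rule free_lift_hom[OF Xm c])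
  have sub: "submodule (?f ` carrier (rpow R ?n)) R X"
    by (rule submodule_hom_image[OF F Xm f F.carrier_is_submodule])
  have "A \<subseteq> ?f ` carrier (rpow R ?n)"
  proof
    fix x assume "x \<in> A"
    then obtain i where i: "i < ?n" "x = xs ! i" using xs by (metis in_set_conv_nth)
    then have "?f (basis_elt R {..<?n} i) = x" using free_lift_basis[OF Xm c, of i] by simp
    moreover have "basis_elt R {..<?n} i \<in> carrier (rpow R ?n)"
      using basis_elt_closed[OF X.R.cring_axioms, of i "{..<?n}"] i by simp
    ultimately show "x \<in> ?f ` carrier (rpow R ?n)" by force
  qed
  from mod_span_least[OF sub this] have "carrier X \<subseteq> ?f ` carrier (rpow R ?n)" unfolding A(3) .
  then have "?f ` carrier (rpow R ?n) = carrier X" using X.submoduleE(1)[OF sub] by (rule subset_antisym[rotated])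
  then show ?thesis using that[OF f] by simp
qed

lemma fg_noeth:
  assumes R: "noetherian_ring R" and X: "fg_module R X" shows "noeth_module R X"
proof -
  have Xm: "module R X" using X unfolding fg_module_def by simp
  interpret X: module R X by fact
  obtain n f where "f \<in> mod_hom R (rpow R n) X" "f ` carrier (rpow R n) = carrier X"
    using fg_module_presentation[OF X] .
  then show ?thesis using noeth_surj[OF noeth_rpow[OF X.R.cring_axioms R] Xm] by auto
qed

text \<open>The copy of \<open>X\<close> consists of the fibres of a presentation \<open>R\<^sup>n \<rightarrow> X\<close>, which are sets of
  functions on natural numbers.\<close>

lemma umodule_copy:
  fixes R :: "('a, 'm) ring_scheme" and X :: "('a, 'b, 'k) module_scheme"
  assumes X: "fg_module R X"
  obtains Y :: "'a umodule" where "fg_module R Y" "mod_iso R X Y"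
proof -
  have Xm: "module R X" using X unfolding fg_module_def by simp
  obtain n f where f: "f \<in> mod_hom R (rpow R n) X" "f ` carrier (rpow R n) = carrier X"
    using fg_module_presentation[OF X] .
  let ?p = "\<lambda>x. {v \<in> carrier (rpow R n). f v = x}"
  have inj: "inj_on ?p (carrier X)"
  proof (rule inj_onI)
    fix x y assume x: "x \<in> carrier X" and eq: "?p x = ?p y"
    have "x \<in> f ` carrier (rpow R n)" using f(2) x by simp
    then obtain v where "v \<in> carrier (rpow R n)" "f v = x" by auto
    then have "v \<in> ?p x" by simp
    then show "x = y" using eq \<open>f v = x\<close> by simp
  qed
  let ?Y = "copy_module ?p X"
  have Y: "module R ?Y" by (rule copy_module_module[OF Xm inj])
  have p: "?p \<in> mod_hom R X ?Y" by (rule copy_module_hom[OF Xm inj])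
  have c: "carrier ?Y = ?p ` carrier X" by (rule copy_module_simps(1)[OF inj])
  have "fg_module R ?Y" by (rule fg_module_surj[OF X Y p c[symmetric]])
  moreover have "mod_iso R X ?Y" unfolding mod_iso_def using p inj c by (auto simp: bij_betw_def)
  ultimately show ?thesis by (rule that)
qed

lemma fg_self_module:
  assumes "cring R" shows "fg_module R (self_module R)"
proof -
  interpret cring R by fact
  interpret S: module R "self_module R" by (rule self_module_module[OF assms])
  have sub: "{\<one>\<^bsub>R\<^esub>} \<subseteq> carrier (self_module R)" by simp
  note sp = S.mod_span_submodule[OF sub]
  have "carrier R \<subseteq> mod_span R (self_module R) {\<one>\<^bsub>R\<^esub>}"
  proof
    fix a assume a: "a \<in> carrier R"
    have "a \<odot>\<^bsub>self_module R\<^esub> \<one>\<^bsub>R\<^esub> \<in> mod_span R (self_module R) {\<one>\<^bsub>R\<^esub>}"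
      by (rule S.submoduleE(4)[OF sp(1) a]) (use sp(2) in simp)
    then show "a \<in> mod_span R (self_module R) {\<one>\<^bsub>R\<^esub>}" using a by simp
  qed
  then have "mod_span R (self_module R) {\<one>\<^bsub>R\<^esub>} = carrier (self_module R)"
    using S.submoduleE(1)[OF sp(1)] by auto
  then show ?thesis unfolding fg_module_def using S.module_axioms sub by blast
qed

section \<open>Additive functions and the Grothendieck group\<close>

locale additive_function =
  fixes R :: "('a, 'm) ring_scheme" and th :: "'a umodule \<Rightarrow> int"
  assumes R: "cring R"
    and additive: "\<And>X' X X''. fg_module R X' \<Longrightarrow> fg_module R X \<Longrightarrow> fg_module R X'' \<Longrightarrow>
      short_exact R X' X X'' \<Longrightarrow> th X = th X' + th X''"
begin

text \<open>An isomorphism is a short exact sequence with kernel zero, and additivity for \<open>0 \<rightarrow> 0 \<rightarrow> 0 \<rightarrow>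
  0 \<rightarrow> 0\<close> gives the zero module the value \<open>0\<close>.\<close>

lemma th_iso:
  assumes Y: "fg_module R Y" and Y': "fg_module R Y'" and iso: "mod_iso R Y Y'"
  shows "th Y = th Y'"
proof -
  have Ym: "module R Y" and Ym': "module R Y'" using Y Y' unfolding fg_module_def by auto
  interpret Y: module R Y by fact
  interpret Y': module R Y' by fact
  obtain f where f: "f \<in> mod_hom R Y Y'" "bij_betw f (carrier Y) (carrier Y')"
    using iso unfolding mod_iso_def by auto
  have f0: "f \<zero>\<^bsub>Y\<^esub> = \<zero>\<^bsub>Y'\<^esub>" by (rule mod_hom_zero[OF Ym Ym' f(1)])
  have s0: "submodule {\<zero>\<^bsub>Y\<^esub>} R Y" unfolding Y.submodule_iff by simp
  let ?Z = "Y\<lparr>carrier := {\<zero>\<^bsub>Y\<^esub>}\<rparr>"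
  have Zm: "module R ?Z" by (rule submodule.submodule_is_module[OF s0 Ym])
  interpret Z: module R ?Z by (rule Zm)
  have "mod_span R ?Z {\<zero>\<^bsub>Y\<^esub>} = {\<zero>\<^bsub>Y\<^esub>}"
    using Z.mod_span_submodule[of "{\<zero>\<^bsub>Y\<^esub>}"] Z.submoduleE(1) by fastforce
  then have Z: "fg_module R ?Z" unfolding fg_module_def using Zm by (intro conjI exI[of _ "{\<zero>\<^bsub>Y\<^esub>}"]) auto
  have i: "(\<lambda>x. x) \<in> mod_hom R ?Z Y" by (rule mod_homI) auto
  have "short_exact R ?Z Y Y'"
    unfolding short_exact_def
  proof (intro bexI[OF _ i] bexI[OF _ f(1)] conjI)
    have "f x = \<zero>\<^bsub>Y'\<^esub> \<longleftrightarrow> x = \<zero>\<^bsub>Y\<^esub>" if "x \<in> carrier Y" for x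
      using f(2) f0 that inj_onD[OF bij_betw_imp_inj_on[OF f(2)], of x "\<zero>\<^bsub>Y\<^esub>"] by auto
    then show "(\<lambda>x. x) ` carrier ?Z = a_kernel Y Y' f" by (auto simp: a_kernel_iff)
    show "f ` carrier Y = carrier Y'" using f(2) by (simp add: bij_betw_def)
  qed simp
  from additive[OF Z Y Y' this] have 1: "th Y = th ?Z + th Y'" .
  have "short_exact R ?Z ?Z ?Z"
    unfolding short_exact_def
    by (intro bexI[OF _ mod_hom_id] conjI) (auto simp: a_kernel_iff)
  from additive[OF Z Z Z this] have "th ?Z = 0" by simp
  then show ?thesis using 1 by simp
qed

lemma iso_class_eq:
  assumes M: "fg_module R M" and Y: "mod_iso R M Y"
  shows "iso_class R M = iso_class R Y"
proof -
  have Mm: "module R M" using M unfolding fg_module_def by simp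
  show ?thesis
    unfolding iso_class_def
    using mod_iso_trans[OF mod_iso_sym[OF Mm Y]] mod_iso_trans[OF Y] by auto
qed

abbreviation "F \<equiv> free_Abelian_group (iso_classes R)"
abbreviation "G \<equiv> groth_group R"

lemma groth_rels_subgroup: "subgroup (groth_rels R) F"
proof -
  interpret F: comm_group F by (rule abelian_free_Abelian_group)
  have c: "iso_class R X \<in> iso_classes R" if "fg_module R X" for X :: "'a umodule"
    using that unfolding iso_classes_def by auto
  have "frag_of (iso_class R X) - frag_of (iso_class R X') - frag_of (iso_class R X'') \<in> carrier F"
    if "fg_module R X" "fg_module R X'" "fg_module R X''" for X X' X'' :: "'a umodule"
  proof -
    have "Poly_Mapping.keys (frag_of (iso_class R X) - frag_of (iso_class R X') - frag_of (iso_class R X''))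
      \<subseteq> Poly_Mapping.keys (frag_of (iso_class R X) - frag_of (iso_class R X')) \<union> Poly_Mapping.keys (frag_of (iso_class R X''))"
      by (rule keys_diff)
    also have "\<dots> \<subseteq> (Poly_Mapping.keys (frag_of (iso_class R X)) \<union> Poly_Mapping.keys (frag_of (iso_class R X')))
        \<union> Poly_Mapping.keys (frag_of (iso_class R X''))"
      by (intro Un_mono keys_diff subset_refl)
    also have "\<dots> \<subseteq> iso_classes R" using c that by simp
    finally show ?thesis by simp
  qed
  then show ?thesis unfolding groth_rels_def by (intro F.generate_is_subgroup) auto
qed

lemma class_mem_F:
  assumes M: "fg_module R M" shows "frag_of (iso_class R M) \<in> carrier F"
proof -
  obtain Y :: "'a umodule" where "fg_module R Y" "mod_iso R M Y" using umodule_copy[OF M] .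
  then have "iso_class R M \<in> iso_classes R" using iso_class_eq[OF M] unfolding iso_classes_def by auto
  then show ?thesis by simp
qed

lemma induced_hom_F:
  obtains h where "h \<in> hom F integer_group"
    "\<And>Y :: 'a umodule. fg_module R Y \<Longrightarrow> h (frag_of (iso_class R Y)) = th Y"
    "\<And>x. x \<in> groth_rels R \<Longrightarrow> h x = 0"
proof -
  interpret I: comm_group integer_group by (rule abelian_integer_group)
  obtain h where h: "h \<in> hom F integer_group"
    "\<And>c. c \<in> iso_classes R \<Longrightarrow> h (frag_of c) = th (SOME Y. Y \<in> c)"
    using I.free_Abelian_group_universal[of "\<lambda>c. th (SOME Y. Y \<in> c)" "iso_classes R"] by auto
  interpret h: group_hom F integer_group h
    using h(1) by (simp add: group_hom_def group_hom_axioms_def)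
  have hY: "h (frag_of (iso_class R Y)) = th Y" if Y: "fg_module R Y" for Y :: "'a umodule"
  proof -
    have "Y \<in> iso_class R Y" using Y mod_iso_refl unfolding iso_class_def by auto
    then have "(SOME Z. Z \<in> iso_class R Y) \<in> iso_class R Y" by (rule someI)
    then have "th (SOME Z. Z \<in> iso_class R Y) = th Y"
      using th_iso[OF Y] unfolding iso_class_def by auto
    moreover have "iso_class R Y \<in> iso_classes R" using Y unfolding iso_classes_def by auto
    ultimately show ?thesis using h(2) by simp
  qed
  have sub: "subgroup (kernel F integer_group h) F" by (rule h.subgroup_kernel)
  have hdiff: "h (x - y) = h x - h y" if "x \<in> carrier F" "y \<in> carrier F" for x y
  proof -
    have xy: "x - y \<in> carrier F" using that keys_diff[of x y] by auto
    have "h ((x - y) \<otimes>\<^bsub>F\<^esub> y) = h (x - y) + h y" using hom_mult[OF h(1) xy that(2)] by simp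
    then show ?thesis by simp
  qed
  have "groth_rels R \<subseteq> kernel F integer_group h"
    unfolding groth_rels_def
  proof (rule h.G.generate_subgroup_incl[OF _ sub], clarify)
    fix X X' X'' :: "'a umodule"
    assume X: "fg_module R X" "fg_module R X'" "fg_module R X''" and ses: "short_exact R X' X X''"
    note c = class_mem_F[OF X(1)] class_mem_F[OF X(2)] class_mem_F[OF X(3)]
    have c': "frag_of (iso_class R X) - frag_of (iso_class R X') \<in> carrier F"
      using c keys_diff[of "frag_of (iso_class R X)" "frag_of (iso_class R X')"] by auto
    have c'': "frag_of (iso_class R X) - frag_of (iso_class R X') - frag_of (iso_class R X'') \<in> carrier F"
      using c c' keys_diff[of "frag_of (iso_class R X) - frag_of (iso_class R X')" "frag_of (iso_class R X'')"] by auto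
    have "h (frag_of (iso_class R X) - frag_of (iso_class R X') - frag_of (iso_class R X'')) = 0"
      unfolding hdiff[OF c' c(3)] hdiff[OF c(1,2)] hY[OF X(1)] hY[OF X(2)] hY[OF X(3)]
      using additive[OF X(2,1,3) ses] by simp
    then show "frag_of (iso_class R X) - frag_of (iso_class R X') - frag_of (iso_class R X'')
      \<in> kernel F integer_group h"
      using c'' by (simp add: kernel_def)
  qed
  then have "h x = 0" if "x \<in> groth_rels R" for x using that by (auto simp: kernel_def)
  then show ?thesis using that[OF h(1) hY] by simp
qed

lemma groth_group_comm: "comm_group G"
  unfolding groth_group_def by (rule comm_group.abelian_FactGroup[OF abelian_free_Abelian_group groth_rels_subgroup])

lemma groth_class_mem: "fg_module R M \<Longrightarrow> groth_class R M \<in> carrier G"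
  unfolding groth_group_def groth_class_def carrier_FactGroup using class_mem_F by blast

lemma induced_hom_G:
  obtains g where "g \<in> hom G integer_group" "\<And>Y :: 'a umodule. fg_module R Y \<Longrightarrow> g (groth_class R Y) = th Y"
proof -
  obtain h where h: "h \<in> hom F integer_group"
    "\<And>Y :: 'a umodule. fg_module R Y \<Longrightarrow> h (frag_of (iso_class R Y)) = th Y"
    "\<And>x. x \<in> groth_rels R \<Longrightarrow> h x = 0" using induced_hom_F by metis
  interpret h: group_hom F integer_group h
    using h(1) by (simp add: group_hom_def group_hom_axioms_def)
  have N: "groth_rels R \<lhd> F"
    by (rule comm_group.subgroup_imp_normal[OF abelian_free_Abelian_group groth_rels_subgroup])
  have ker: "groth_rels R \<subseteq> kernel F integer_group h"
  proof
    fix x assume x: "x \<in> groth_rels R"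
    have "x \<in> carrier F" by (rule subsetD[OF subgroup.subset[OF groth_rels_subgroup] x])
    then show "x \<in> kernel F integer_group h" unfolding kernel_def using h(3)[OF x] by simp
  qed
  obtain g where g: "g \<in> hom (F Mod groth_rels R) integer_group"
    "\<And>x. x \<in> carrier F \<Longrightarrow> g (groth_rels R #>\<^bsub>F\<^esub> x) = h x"
    using h.FactGroup_universal_kernel[OF N ker] by metis
  show ?thesis
  proof (rule that[of g])
    show "g \<in> hom G integer_group" using g(1) unfolding groth_group_def .
    show "g (groth_class R Y) = th Y" if "fg_module R Y" for Y :: "'a umodule"
      unfolding groth_class_def g(2)[OF class_mem_F[OF that]] by (rule h(2)[OF that])
  qed
qed

lemma reduced_groth_sub_subgroup: "subgroup (reduced_groth_sub R) G"
proof -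
  interpret G: comm_group G by (rule groth_group_comm)
  show ?thesis
    unfolding reduced_groth_sub_def
    by (rule G.generate_is_subgroup) (simp add: groth_class_mem[OF fg_self_module[OF R]])
qed

lemma reduced_groth_class_mem:
  "fg_module R M \<Longrightarrow> reduced_groth_class R M \<in> carrier (reduced_groth_group R)"
  unfolding reduced_groth_group_def reduced_groth_class_def carrier_FactGroup using groth_class_mem by blast

lemma groth_class_iso: "fg_module R M \<Longrightarrow> mod_iso R M Y \<Longrightarrow> groth_class R M = groth_class R Y"
  unfolding groth_class_def by (drule (1) iso_class_eq) simp

lemma induced_hom_reduced:
  assumes free: "\<And>Y :: 'a umodule. fg_module R Y \<Longrightarrow> mod_iso R (self_module R) Y \<Longrightarrow> th Y = 0"
  obtains g where "g \<in> hom (reduced_groth_group R) integer_group"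
    "\<And>Y :: 'a umodule. fg_module R Y \<Longrightarrow> g (reduced_groth_class R Y) = th Y"
proof -
  obtain g where g: "g \<in> hom G integer_group" "\<And>Y :: 'a umodule. fg_module R Y \<Longrightarrow> g (groth_class R Y) = th Y"
    using induced_hom_G by metis
  interpret G: comm_group G by (rule groth_group_comm)
  interpret g: group_hom G integer_group g
    using g(1) G.is_group by (simp add: group_hom_def group_hom_axioms_def)
  have N: "reduced_groth_sub R \<lhd> G"
    by (rule G.subgroup_imp_normal[OF reduced_groth_sub_subgroup])
  obtain Y :: "'a umodule" where Y: "fg_module R Y" "mod_iso R (self_module R) Y"
    using umodule_copy[OF fg_self_module[OF R]] .
  have "g (groth_class R (self_module R)) = 0"
    using groth_class_iso[OF fg_self_module[OF R] Y(2)] g(2)[OF Y(1)] free[OF Y] by simp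
  then have "{groth_class R (self_module R)} \<subseteq> kernel G integer_group g"
    using groth_class_mem[OF fg_self_module[OF R]] by (simp add: kernel_def)
  then have ker: "reduced_groth_sub R \<subseteq> kernel G integer_group g"
    unfolding reduced_groth_sub_def by (rule G.generate_subgroup_incl[OF _ g.subgroup_kernel])
  obtain k where k: "k \<in> hom (G Mod reduced_groth_sub R) integer_group"
    "\<And>x. x \<in> carrier G \<Longrightarrow> k (reduced_groth_sub R #>\<^bsub>G\<^esub> x) = g x"
    using g.FactGroup_universal_kernel[OF N ker] by metis
  show ?thesis
  proof (rule that[of k])
    show "k \<in> hom (reduced_groth_group R) integer_group" using k(1) unfolding reduced_groth_group_def .
    show "k (reduced_groth_class R Y) = th Y" if "fg_module R Y" for Y :: "'a umodule"
      unfolding reduced_groth_class_def k(2)[OF groth_class_mem[OF that]] by (rule g(2)[OF that])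
  qed
qed

end

lemma int_module_module:
  assumes "comm_group G" shows "module \<Z> (int_module G)"
proof -
  interpret comm_group G by fact
  have "abelian_group (int_module G)"
    by (rule abelian_groupI)
      (auto simp: int_module_def m_ac intro: bexI[of _ "inv\<^bsub>G\<^esub> _"])
  then show ?thesis
    by (rule moduleI[OF int_is_cring])
      (auto simp: int_module_def int_pow_mult int_pow_distrib int_pow_pow mult.commute)
qed

lemma rat_module_module: "module \<Z> rat_module"
proof -
  have "abelian_group rat_module"
    by (rule abelian_groupI) (auto simp: rat_module_def intro: exI[of _ "- _"])
  then show ?thesis
    by (rule moduleI[OF int_is_cring]) (auto simp: rat_module_def algebra_simps)
qed

text \<open>A homomorphism \<open>g : G \<rightarrow> \<int>\<close> extends to \<open>G \<otimes> \<rat> \<rightarrow> \<rat>\<close>, which takes \<open>c \<otimes> 1\<close> to \<open>g c\<close>.\<close>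

lemma pure_tensor_rat_zero:
  assumes G: "comm_group G" and g: "g \<in> hom G integer_group" and c: "c \<in> carrier G"
    and zero: "pure_tensor \<Z> (int_module G) rat_module c 1 = \<zero>\<^bsub>tensor \<Z> (int_module G) rat_module\<^esub>"
  shows "g c = 0"
proof -
  note IM = int_module_module[OF G] and QM = rat_module_module
  interpret comm_group G by fact
  interpret g: group_hom G integer_group g
    using g is_group by (simp add: group_hom_def group_hom_axioms_def)
  interpret Q: module \<Z> rat_module by (rule QM)
  let ?S = "carrier (int_module G) \<times> carrier rat_module"
  have cS: "(c, 1) \<in> ?S" using c by (simp add: int_module_def rat_module_def)
  note T = tensor_sub_submodule[OF IM QM]
  have e: "basis_elt \<Z> ?S (c, 1) \<in> carrier (free_on \<Z> ?S)" by (rule basis_elt_closed[OF int_is_cring cS])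
  have mem: "basis_elt \<Z> ?S (c, 1) \<in> tensor_sub \<Z> (int_module G) rat_module"
    using zero quot_module_eq_zero_iff[OF free_on_module[OF int_is_cring] T(1) e]
    unfolding pure_tensor_def tensor_def by simp
  have minus: "x \<ominus>\<^bsub>rat_module\<^esub> x = 0" for x
    using Q.diff_self[of x] by (simp add: rat_module_def)
  have opsQ: "x \<oplus>\<^bsub>rat_module\<^esub> y = x + y" "k \<odot>\<^bsub>rat_module\<^esub> x = of_int k * x" for x y k
    by (simp_all add: rat_module_def)
  have opsI: "x \<oplus>\<^bsub>int_module G\<^esub> y = x \<otimes>\<^bsub>G\<^esub> y" "k \<odot>\<^bsub>int_module G\<^esub> x = x [^]\<^bsub>G\<^esub> k"
    "carrier (int_module G) = carrier G" for x y k
    by (simp_all add: int_module_def)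
  have "free_lift \<Z> ?S rat_module (\<lambda>(x, q). of_int (g x) * q) (basis_elt \<Z> ?S (c, 1)) \<in> {0}"
  proof (rule tensor_sub_lift[OF IM QM QM _ _ _ _ _ _ mem])
    show "submodule {0} \<Z> rat_module" unfolding Q.submodule_iff by (auto simp: rat_module_def)
    show "of_int (g x) * q \<in> carrier rat_module" for x and q :: rat by (simp add: rat_module_def)
  qed (simp_all add: opsI opsQ g.hom_int_pow minus algebra_simps)
  then have "of_int (g c) * (1 :: rat) = 0"
    using free_lift_basis[OF QM _ cS, of "\<lambda>(x, q). of_int (g x) * q"] by (simp add: rat_module_def Pi_iff split_beta)
  then show ?thesis by simp
qed

lemma (in additive_function) vanishes_on_zero_class:
  assumes free: "\<And>Y :: 'a umodule. fg_module R Y \<Longrightarrow> mod_iso R (self_module R) Y \<Longrightarrow> th Y = 0"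
    and M: "fg_module R M" and zero: "reduced_groth_Q_class R M = \<zero>\<^bsub>reduced_groth_Q R\<^esub>"
    and Y: "fg_module R Y" "mod_iso R M Y"
  shows "th Y = 0"
proof -
  obtain g where g: "g \<in> hom (reduced_groth_group R) integer_group"
    "\<And>Y :: 'a umodule. fg_module R Y \<Longrightarrow> g (reduced_groth_class R Y) = th Y"
    using induced_hom_reduced[OF free] by metis
  have cg: "comm_group (reduced_groth_group R)"
    unfolding reduced_groth_group_def
    by (rule comm_group.abelian_FactGroup[OF groth_group_comm reduced_groth_sub_subgroup])
  have "g (reduced_groth_class R M) = 0"
    using zero unfolding reduced_groth_Q_class_def reduced_groth_Q_def
    by (rule pure_tensor_rat_zero[OF cg g(1) reduced_groth_class_mem[OF M]])
  moreover have "reduced_groth_class R M = reduced_groth_class R Y"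
    unfolding reduced_groth_class_def using groth_class_iso[OF M Y(2)] by simp
  ultimately show ?thesis using g(2)[OF Y(1)] by simp
qed

section \<open>Split minimal presentations\<close>

text \<open>If a minimal presentation splits, its kernel \<open>K\<close> is a direct summand of \<open>R\<^sup>b\<close> inside \<open>\<mm>R\<^sup>b\<close>.
  The projection \<open>1 - s\<epsilon>\<close> onto \<open>K\<close> shows that \<open>K = \<mm>K\<close>, and \<open>K = 0\<close> by Nakayama.\<close>

lemma free_if_minimal_presentation_splits:
  assumes R: "noetherian_local_ring R" and M: "module R M"
    and eps: "\<epsilon> \<in> mod_hom R (rpow R b) M" and surj: "\<epsilon> ` carrier (rpow R b) = carrier M"
    and min: "a_kernel (rpow R b) M \<epsilon> \<subseteq> ideal_smult R (max_ideal R) (rpow R b)"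
    and s: "s \<in> mod_hom R M (rpow R b)" and sect: "\<And>x. x \<in> carrier M \<Longrightarrow> \<epsilon> (s x) = x"
  shows "free_module R M"
proof -
  have R': "cring R" "noetherian_ring R" using R unfolding noetherian_local_ring_def by auto
  interpret M: module R M by fact
  have P: "module R (rpow R b)" by (rule rpow_module[OF R'(1)])
  interpret P: module R "rpow R b" by (rule P)
  interpret m: maximalideal "max_ideal R" R by (rule max_ideal(1)[OF R])
  let ?K = "a_kernel (rpow R b) M \<epsilon>"
  have "submodule {\<zero>\<^bsub>M\<^esub>} R M" unfolding M.submodule_iff by auto
  from submodule_hom_vimage[OF P M eps this]
  have K: "submodule ?K R (rpow R b)" by (simp add: a_kernel_def kernel_def)
  let ?mK = "mod_span R (rpow R b) {a \<odot>\<^bsub>rpow R b\<^esub> x | a x. a \<in> max_ideal R \<and> x \<in> ?K}"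
  let ?N = "\<lambda>v. v \<ominus>\<^bsub>rpow R b\<^esub> s (\<epsilon> v)"
  have N: "?N \<in> mod_hom R (rpow R b) (rpow R b)"
    by (rule mod_hom_minus[OF P P mod_hom_id mod_hom_comp[OF eps s]])
  have NK: "?N v \<in> ?K" if v: "v \<in> carrier (rpow R b)" for v
  proof -
    have ev: "\<epsilon> v \<in> carrier M" by (rule mod_hom_closed[OF eps v])
    have "\<epsilon> (?N v) = \<epsilon> v \<ominus>\<^bsub>M\<^esub> \<epsilon> (s (\<epsilon> v))"
      by (rule mod_hom_diff[OF P M eps v mod_hom_closed[OF s ev]])
    then have "\<epsilon> (?N v) = \<zero>\<^bsub>M\<^esub>" using sect[OF ev] ev by (simp add: M.diff_self)
    then show ?thesis using mod_hom_closed[OF N v] by (simp add: a_kernel_iff)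
  qed
  have gens: "{a \<odot>\<^bsub>rpow R b\<^esub> x | a x. a \<in> max_ideal R \<and> x \<in> ?K} \<subseteq> carrier (rpow R b)"
    using m.Icarr by (auto simp: a_kernel_iff)
  note mK = P.mod_span_submodule[OF gens]
  have "ideal_smult R (max_ideal R) (rpow R b) \<subseteq> {v \<in> carrier (rpow R b). ?N v \<in> ?mK}"
    unfolding ideal_smult_def
  proof (rule mod_span_least[OF submodule_hom_vimage[OF P P N mK(1)]], clarify)
    fix a v assume a: "a \<in> max_ideal R" and v: "v \<in> carrier (rpow R b)"
    have ac: "a \<in> carrier R" using a m.Icarr by simp
    have "?N (a \<odot>\<^bsub>rpow R b\<^esub> v) = a \<odot>\<^bsub>rpow R b\<^esub> ?N v" by (rule mod_hom_smult[OF N ac v])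
    moreover have "a \<odot>\<^bsub>rpow R b\<^esub> ?N v \<in> ?mK"
      by (rule subsetD[OF mK(2)]) (use a NK[OF v] in blast)
    ultimately show "a \<odot>\<^bsub>rpow R b\<^esub> v \<in> carrier (rpow R b) \<and> ?N (a \<odot>\<^bsub>rpow R b\<^esub> v) \<in> ?mK"
      using ac v by simp
  qed
  then have "?K \<subseteq> {v \<in> carrier (rpow R b). ?N v \<in> ?mK}" using min by (rule subset_trans[rotated])
  moreover have "?N v = v" if "v \<in> ?K" for v
  proof -
    have v: "v \<in> carrier (rpow R b)" "\<epsilon> v = \<zero>\<^bsub>M\<^esub>" using that by (simp_all add: a_kernel_iff)
    then show ?thesis
      using mod_hom_zero[OF M P s] P.add_diff_cancel_left[OF P.M.zero_closed v(1)] by simp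
  qed
  ultimately have "?K \<subseteq> ?mK" by auto
  from nakayama[OF R noeth_rpow[OF R'] K this] have K0: "?K = {\<zero>\<^bsub>rpow R b\<^esub>}" .
  have "inj_on \<epsilon> (carrier (rpow R b))"
  proof (rule inj_onI)
    fix u v assume u: "u \<in> carrier (rpow R b)" and v: "v \<in> carrier (rpow R b)" and eq: "\<epsilon> u = \<epsilon> v"
    have "\<epsilon> (u \<ominus>\<^bsub>rpow R b\<^esub> v) = \<zero>\<^bsub>M\<^esub>"
      using mod_hom_diff[OF P M eps u v] eq mod_hom_closed[OF eps v] by (simp add: M.diff_self)
    then have "u \<ominus>\<^bsub>rpow R b\<^esub> v \<in> ?K" using u v by (simp add: a_kernel_iff)
    then show "u = v" using K0 u v by (simp add: P.diff_eq_zero_iff)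
  qed
  then show ?thesis
    unfolding free_module_def mod_iso_def using eps surj by (auto simp: bij_betw_def)
qed

section \<open>Freeness of two-periodic modules\<close>

lemma (in exact_pair) cocycles_eq_coboundaries:
  assumes X: "module R X" and v: "hvanish R m n A B X (carrier X)"
  shows "cocycles R m n A X = coboundaries R m n B X"
proof (rule subset_antisym)
  show "coboundaries R m n B X \<subseteq> cocycles R m n A X" by (rule coboundaries_le_cocycles[OF X])
  show "cocycles R m n A X \<subseteq> coboundaries R m n B X"
  proof
    fix f assume f: "f \<in> cocycles R m n A X"
    then have fc: "f \<in> carrier (hom_module R (rpow R m) X)" by (simp add: cocycles_iff)
    obtain g where "g \<in> mod_hom R (rpow R n) X" "\<And>v. v \<in> carrier (rpow R m) \<Longrightarrow> f v = g (B v)"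
      by (rule hvanishD[OF v hom_module_hom[OF fc]])
        (use f hom_module_closed[OF fc] in \<open>auto simp: cocycles_iff\<close>)
    then show "f \<in> coboundaries R m n B X" using fc by (auto simp: coboundaries_iff)
  qed
qed

lemma (in exact_pair) hlen_eq_zero:
  assumes X: "module R X" and p: "primeideal p R" and eq: "cocycles R m n A X = coboundaries R m n B X"
  shows "hlen R p m n A B X = 0"
  unfolding hlen_def eq
  by (rule plen_self(1)[OF hom_module_module[OF mods(1) X] coboundaries_submodule[OF X] p])

text \<open>Additivity for \<open>0 \<rightarrow> 0 \<rightarrow> X \<rightarrow> Y \<rightarrow> 0\<close>. The elements of \<open>X\<close> and \<open>Y\<close> may have different types,
  as they do when a module is compared with its copy in the Grothendieck group.\<close>

lemma (in exact_pair) htheta_iso: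
  assumes p: "primeideal p R" and X: "module R X" and Y: "module R Y" and iso: "mod_iso R X Y"
    and fin: "hfinite R p m n A B X" "hfinite R p m n A B Y" "hfinite R p n m B A X" "hfinite R p n m B A Y"
  shows "htheta R p m n A B X = htheta R p m n A B Y"
proof -
  interpret sw: exact_pair R n m B A by (rule exact_pair_swap[OF exact_pair_axioms])
  interpret X: module R X by fact
  interpret Y: module R Y by fact
  obtain f where f: "f \<in> mod_hom R X Y" "bij_betw f (carrier X) (carrier Y)"
    using iso unfolding mod_iso_def by auto
  have f0: "f \<zero>\<^bsub>X\<^esub> = \<zero>\<^bsub>Y\<^esub>" by (rule mod_hom_zero[OF X Y f(1)])
  have s0: "submodule {\<zero>\<^bsub>X\<^esub>} R X" unfolding X.submodule_iff by simp
  let ?Z = "X\<lparr>carrier := {\<zero>\<^bsub>X\<^esub>}\<rparr>"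
  have Zm: "module R ?Z" by (rule submodule.submodule_is_module[OF s0 X])
  have i: "(\<lambda>x. x) \<in> mod_hom R ?Z X" by (rule mod_homI) auto
  have "exact_pair_ses R m n A B ?Z X Y (\<lambda>x. x) f"
  proof (rule exact_pair_ses.intro[OF exact_pair_axioms exact_pair_ses_axioms.intro[OF Zm X Y i f(1)]])
    have "f x = \<zero>\<^bsub>Y\<^esub> \<longleftrightarrow> x = \<zero>\<^bsub>X\<^esub>" if "x \<in> carrier X" for x
      using f(2) f0 that inj_onD[OF bij_betw_imp_inj_on[OF f(2)], of x "\<zero>\<^bsub>X\<^esub>"] by auto
    then show "(\<lambda>x. x) ` carrier ?Z = a_kernel X Y f" by (auto simp: a_kernel_iff)
    show "f ` carrier X = carrier Y" using f(2) by (simp add: bij_betw_def)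
  qed simp
  then interpret ses: exact_pair_ses R m n A B ?Z X Y "\<lambda>x. x" f .
  have z: "carrier ?Z = {\<zero>\<^bsub>?Z\<^esub>}" by simp
  have eq: "cocycles R m n A ?Z = coboundaries R m n B ?Z" "cocycles R n m B ?Z = coboundaries R n m A ?Z"
    by (rule cocycles_eq_coboundaries[OF Zm hvanish_trivial[OF Zm z]], simp)
      (rule sw.cocycles_eq_coboundaries[OF Zm sw.hvanish_trivial[OF Zm z]], simp)
  have zf: "hfinite R p m n A B ?Z" "hfinite R p n m B A ?Z"
    unfolding hfinite_def eq
    by (rule plen_self(2)[OF hom_module_module[OF mods(1) Zm] coboundaries_submodule[OF Zm] p])
      (rule plen_self(2)[OF hom_module_module[OF mods(2) Zm] sw.coboundaries_submodule[OF Zm] p])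
  have "htheta R p m n A B ?Z = 0"
    unfolding htheta_def hlen_eq_zero[OF Zm p eq(1)] sw.hlen_eq_zero[OF Zm p eq(2)] by simp
  then show ?thesis
    using ses.htheta_additive[OF p zf(1) fin(1,2) zf(2) fin(3,4)] by simp
qed

text \<open>Each \<open>a \<in> I\<close> acts null-homotopically on the complex, so \<open>I\<close> kills its cohomology with any
  coefficients.\<close>

lemma (in periodic_presentation) killed_hfinite:
  assumes R: "noetherian_ring R" and p: "primeideal p R"
    and min: "\<forall>q. primeideal q R \<longrightarrow> I \<subseteq> q \<longrightarrow> q \<subseteq> p \<longrightarrow> q = p"
    and v0: "hvanish R m n A B (self_module R) (carrier R)"
    and I: "I \<subseteq> carrier R"
    and fac: "\<forall>a\<in>I. \<exists>g\<in>mod_hom R (rpow R n) M. \<forall>v\<in>carrier (rpow R m). a \<odot>\<^bsub>M\<^esub> q v = g (B v)"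
    and X: "noeth_module R X"
  shows "hfinite R p m n A B X" "hfinite R p n m B A X"
proof -
  interpret sw: exact_pair R n m B A by (rule exact_pair_swap[OF exact_pair_axioms])
  have Xm: "module R X" using X unfolding noeth_module_def by simp
  have h: "\<exists>s t t'. s \<in> mod_hom R (rpow R m) (rpow R n) \<and> t \<in> mod_hom R (rpow R n) (rpow R m) \<and>
    t' \<in> mod_hom R (rpow R n) (rpow R m) \<and>
    (\<forall>v\<in>carrier (rpow R m). a \<odot>\<^bsub>rpow R m\<^esub> v = A (s v) \<oplus>\<^bsub>rpow R m\<^esub> t (B v)) \<and>
    (\<forall>w\<in>carrier (rpow R n). a \<odot>\<^bsub>rpow R n\<^esub> w = B (t' w) \<oplus>\<^bsub>rpow R n\<^esub> s (A w))" if a: "a \<in> I" for a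
  proof -
    have ac: "a \<in> carrier R" using a I by auto
    obtain g where g: "g \<in> mod_hom R (rpow R n) M" "\<And>v. v \<in> carrier (rpow R m) \<Longrightarrow> a \<odot>\<^bsub>M\<^esub> q v = g (B v)"
      using fac a by auto
    show ?thesis using homotopy_from_factorization[OF v0 ac g] by metis
  qed
  have kill: "a \<odot>\<^bsub>hom_module R (rpow R m) X\<^esub> f \<in> coboundaries R m n B X"
    if a: "a \<in> I" and f: "f \<in> cocycles R m n A X" for a f
  proof -
    obtain s t where st: "s \<in> mod_hom R (rpow R m) (rpow R n)" "t \<in> mod_hom R (rpow R n) (rpow R m)"
      "\<And>v. v \<in> carrier (rpow R m) \<Longrightarrow> a \<odot>\<^bsub>rpow R m\<^esub> v = A (s v) \<oplus>\<^bsub>rpow R m\<^esub> t (B v)"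
      using h[OF a] by auto
    show ?thesis by (rule homotopy_kills[OF Xm subsetD[OF I a] st f])
  qed
  have kill': "a \<odot>\<^bsub>hom_module R (rpow R n) X\<^esub> f \<in> coboundaries R n m A X"
    if a: "a \<in> I" and f: "f \<in> cocycles R n m B X" for a f
  proof -
    obtain s t' where st: "t' \<in> mod_hom R (rpow R n) (rpow R m)" "s \<in> mod_hom R (rpow R m) (rpow R n)"
      "\<And>w. w \<in> carrier (rpow R n) \<Longrightarrow> a \<odot>\<^bsub>rpow R n\<^esub> w = B (t' w) \<oplus>\<^bsub>rpow R n\<^esub> s (A w)"
      using h[OF a] by auto
    show ?thesis by (rule sw.homotopy_kills[OF Xm subsetD[OF I a] st f])
  qed
  show "hfinite R p m n A B X"
    unfolding hfinite_def
    by (rule pfinite_if_killed[OF R noeth_hom_rpow[OF X] p min coboundaries_submodule[OF Xm]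
          cocycles_submodule[OF Xm] coboundaries_le_cocycles[OF Xm] I kill])
  show "hfinite R p n m B A X"
    unfolding hfinite_def
    by (rule pfinite_if_killed[OF R noeth_hom_rpow[OF X] p min sw.coboundaries_submodule[OF Xm]
          sw.cocycles_submodule[OF Xm] sw.coboundaries_le_cocycles[OF Xm] I kill'])
qed

theorem proposition5p7:
  fixes R :: "('a, 'm) ring_scheme" and M :: "('a, 'b, 'n) module_scheme"
  assumes "gorenstein_local_ring R"
    and "fg_module R M"
    and "periodic_module R 2 M"
    and "generically_free R M"
    and "reduced_groth_Q_class R M = \<zero>\<^bsub>reduced_groth_Q R\<^esub>"
    and "torsion_free R (tensor R M (dual_module R M))"
  shows "free_module R M"
proof -
  have Rl: "noetherian_local_ring R" and inj: "finite_injdim R (self_module R)"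
    using assms(1) unfolding gorenstein_local_ring_def by auto
  have R: "cring R" "noetherian_ring R" using Rl unfolding noetherian_local_ring_def by auto
  have M: "module R M" using assms(2) unfolding fg_module_def by simp
  obtain b \<epsilon> m n A B r q l j k where pp: "periodic_presentation R m n A B M r q l j k"
    and eps: "\<epsilon> \<in> mod_hom R (rpow R b) M" "\<epsilon> ` carrier (rpow R b) = carrier M"
    and min: "a_kernel (rpow R b) M \<epsilon> \<subseteq> ideal_smult R (max_ideal R) (rpow R b)"
    using periodic_presentation_exists[OF R(1) M assms(3)] .
  interpret pp: periodic_presentation R m n A B M r q l j k by (rule pp)
  interpret sw: exact_pair R n m B A by (rule exact_pair_swap[OF pp.exact_pair_axioms])
  interpret M: module R M by (rule M)
  have Sf: "module R (self_module R)" by (rule self_module_module[OF R(1)])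
  have v0: "hvanish R m n A B (self_module R) (carrier R)"
    and v1: "hvanish R n m B A (self_module R) (carrier R)"
    using pp.finite_injdim_hvanish[OF inj Sf] sw.finite_injdim_hvanish[OF inj Sf] by simp_all
  let ?H = "hom_module R (rpow R m) M"
  interpret H: module R ?H by (rule hom_module_module[OF pp.mods(1) M])
  let ?q = "restrict q (carrier (rpow R m))"
  have qH: "?q \<in> carrier ?H" by (rule restrict_mod_hom[OF pp.mods(1) pp.q])
  have qZ: "?q \<in> cocycles R m n A M" using qH pp.qA pp.Ac by (simp add: cocycles_iff)
  \<comment> \<open>The class of \<open>q\<close> is killed by \<open>a\<close> if and only if
    \<open>a\<close> times the identity of \<open>M\<close> factors through \<open>j\<close>.\<close>
  define I where "I = {a \<in> carrier R. a \<odot>\<^bsub>?H\<^esub> ?q \<in> coboundaries R m n B M}"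
  have Ideal: "ideal I R" unfolding I_def by (rule H.colon_ideal[OF pp.coboundaries_submodule[OF M] qH])
  have "I = carrier R"
  proof (rule ccontr)
    assume "I \<noteq> carrier R"
    then obtain p where p: "primeideal p R" "I \<subseteq> p"
      and minp: "\<forall>q. primeideal q R \<longrightarrow> I \<subseteq> q \<longrightarrow> q \<subseteq> p \<longrightarrow> q = p"
      using minimal_prime_exists[OF R(2,1) Ideal] by metis
    have Ic: "I \<subseteq> carrier R" by (auto simp: I_def)
    have fac: "\<forall>a\<in>I. \<exists>g\<in>mod_hom R (rpow R n) M. \<forall>v\<in>carrier (rpow R m). a \<odot>\<^bsub>M\<^esub> q v = g (B v)"
    proof
      fix a assume "a \<in> I"
      then have "a \<odot>\<^bsub>?H\<^esub> ?q \<in> coboundaries R m n B M" by (simp add: I_def)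
      then obtain g where "g \<in> mod_hom R (rpow R n) M" "\<forall>v\<in>carrier (rpow R m). (a \<odot>\<^bsub>?H\<^esub> ?q) v = g (B v)"
        by (auto simp: coboundaries_iff)
      then show "\<exists>g\<in>mod_hom R (rpow R n) M. \<forall>v\<in>carrier (rpow R m). a \<odot>\<^bsub>M\<^esub> q v = g (B v)"
        by (auto simp: hom_module_apply)
    qed
    note hf = pp.killed_hfinite[OF R(2) p(1) minp v0 Ic fac fg_noeth[OF R(2)]]
    interpret af: additive_function R "htheta R p m n A B"
    proof (rule additive_function.intro[OF R(1)])
      fix X' X X'' :: "'a umodule"
      assume X: "fg_module R X'" "fg_module R X" "fg_module R X''" and ses: "short_exact R X' X X''"
      have Xm: "module R X'" "module R X" "module R X''" using X unfolding fg_module_def by auto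
      obtain i f where "i \<in> mod_hom R X' X" "f \<in> mod_hom R X X''" "inj_on i (carrier X')"
        "i ` carrier X' = a_kernel X X'' f" "f ` carrier X = carrier X''"
        using ses unfolding short_exact_def by auto
      then interpret ses: exact_pair_ses R m n A B X' X X'' i f
        by (intro exact_pair_ses.intro exact_pair_ses_axioms.intro pp.exact_pair_axioms Xm)
      show "htheta R p m n A B X = htheta R p m n A B X' + htheta R p m n A B X''"
        by (rule ses.htheta_additive[OF p(1) hf(1)[OF X(1)] hf(1)[OF X(2)] hf(1)[OF X(3)]
              hf(2)[OF X(1)] hf(2)[OF X(2)] hf(2)[OF X(3)]])
    qed
    have "htheta R p m n A B (self_module R) = 0"
      using v0 v1 unfolding htheta_def
      by (simp add: pp.hlen_eq_zero[OF Sf p(1) pp.cocycles_eq_coboundaries[OF Sf]]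
          sw.hlen_eq_zero[OF Sf p(1) sw.cocycles_eq_coboundaries[OF Sf]])
    then have free: "htheta R p m n A B Y = 0"
      if "fg_module R Y" "mod_iso R (self_module R) Y" for Y :: "'a umodule"
      using pp.htheta_iso[OF p(1) Sf _ that(2) hf(1)[OF fg_self_module[OF R(1)]] hf(1)[OF that(1)]
          hf(2)[OF fg_self_module[OF R(1)]] hf(2)[OF that(1)]] that(1)
      unfolding fg_module_def by simp
    obtain Y :: "'a umodule" where Y: "fg_module R Y" "mod_iso R M Y" using umodule_copy[OF assms(2)] .
    have "htheta R p m n A B Y = 0" by (rule af.vanishes_on_zero_class[OF free assms(2,5) Y])
    moreover have "htheta R p m n A B M = htheta R p m n A B Y"
      using pp.htheta_iso[OF p(1) M _ Y(2) hf(1)[OF assms(2)] hf(1)[OF Y(1)] hf(2)[OF assms(2)] hf(2)[OF Y(1)]] Y(1)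
      unfolding fg_module_def by simp
    moreover have "cocycles R n m B M = coboundaries R n m A M"
    proof (rule subset_antisym[OF _ sw.coboundaries_le_cocycles[OF M]], rule subsetI)
      fix f assume f: "f \<in> cocycles R n m B M"
      then have fc: "f \<in> carrier (hom_module R (rpow R n) M)" by (simp add: cocycles_iff)
      have "restrict f (carrier (rpow R n)) \<in> coboundaries R n m A M"
        by (rule pp.cocycle_is_coboundary[OF R(2) assms(2,4,6) v0 v1 hom_module_hom[OF fc]])
          (use f in \<open>simp add: cocycles_iff\<close>)
      moreover have "restrict f (carrier (rpow R n)) = f"
        using fc by (simp add: hom_module_simps extensional_restrict)
      ultimately show "f \<in> coboundaries R n m A M" by simp
    qed
    then have "hlen R p n m B A M = 0" by (rule sw.hlen_eq_zero[OF M p(1)])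
    ultimately have "hlen R p m n A B M = 0" unfolding htheta_def by simp
    \<comment> \<open>The class of \<open>q\<close> vanishes at \<open>p\<close>, so an element of \<open>I\<close> lies outside \<open>p\<close>.\<close>
    then have "\<exists>a\<in>carrier R - p. a \<odot>\<^bsub>?H\<^esub> ?q \<in> coboundaries R m n B M"
      unfolding hlen_def
      by (intro plen_zero_imp[OF hf(1)[OF assms(2), unfolded hfinite_def] pp.coboundaries_submodule[OF M]
            pp.cocycles_submodule[OF M] pp.coboundaries_le_cocycles[OF M] _ qZ])
    then show False using p(2) by (auto simp: I_def)
  qed
  then have "\<one>\<^bsub>R\<^esub> \<in> I" by simp
  then have "\<one>\<^bsub>R\<^esub> \<odot>\<^bsub>?H\<^esub> ?q \<in> coboundaries R m n B M" by (simp add: I_def)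
  then have "?q \<in> coboundaries R m n B M" using H.smult_one[OF qH] by simp
  then obtain g where g: "g \<in> mod_hom R (rpow R n) M" "\<And>v. v \<in> carrier (rpow R m) \<Longrightarrow> q v = g (B v)"
    by (auto simp: coboundaries_iff)
  \<comment> \<open>Hence \<open>M\<close> is a direct summand of \<open>R\<^sup>n\<close>.\<close>
  have gj: "g (j x) = x" if x: "x \<in> carrier M" for x
  proof -
    interpret F: module R "rpow R r" by (rule rpow_module[OF R(1)])
    interpret P1: module R "rpow R n" by (rule pp.mods(2))
    obtain v where v: "v \<in> carrier (rpow R m)" "q v = x" "l v = \<zero>\<^bsub>rpow R r\<^esub>"
      using pp.surj_ql[OF x F.M.zero_closed] by auto
    have "B v = j x"
      using pp.B_eq[OF v(1)] v(2,3) mod_hom_zero[OF F.module_axioms pp.mods(2) pp.k]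
        mod_hom_closed[OF pp.j x] by simp
    then show ?thesis using g(2)[OF v(1)] v(2) by simp
  qed
  obtain h where h: "h \<in> mod_hom R (rpow R n) (rpow R b)" "\<And>w. w \<in> carrier (rpow R n) \<Longrightarrow> \<epsilon> (h w) = g w"
    using free_on_projective[OF rpow_module[OF R(1)] M eps(1) g(1)] eps(2) mod_hom_closed[OF g(1)] by metis
  show ?thesis
  proof (rule free_if_minimal_presentation_splits[OF Rl M eps min mod_hom_comp[OF pp.j h(1)]])
    fix x assume x: "x \<in> carrier M"
    show "\<epsilon> (h (j x)) = x" using h(2)[OF mod_hom_closed[OF pp.j x]] gj[OF x] by simp
  qed
qed

end
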